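(* Let $(X,d)$ be a metric space homeomorphic to $\mathbb{R}^2$ with locally finite Hausdorff $2$-measure, let $Q \subset X$ be a quadrilateral, and let $u: Q \to [0,1]$ be the associated harmonic function (as defined in the context). Then $u$ is continuous in $Q$.
   Context: Hausdorff measure: for $k\in\{1,2\}$, $\varepsilon>0$ and $E \subset X$, $\mathcal{H}^k_\varepsilon(E) = \inf\{\sum_j a_k \operatorname{diam}(A_j)^k : E \subset \bigcup_{j=1}^\infty A_j,\ \operatorname{diam} A_j < \varepsilon\}$ with $a_1 = 1$, $a_2 = \pi/4$, and $\mathcal{H}^k(E) = \lim_{\varepsilon\to 0}\mathcal{H}^k_\varepsilon(E)$. The space $(X,d)$ is equipped with the measure $\mathcal{H}^2$. Quadrilateral: a subset $Q \subset X$ homeomorphic to $[0,1]^2$, with four designated boundary arcs $\zeta_1,\zeta_2,\zeta_3,\zeta_4$ which are the images of $[0,1]\times\{0\}$, $\{1\}\times[0,1]$, $[0,1]\times\{1\}$, $\{0\}\times[0,1]$, respectively, under the parametrizing homeomorphism. $\Gamma_1$ is the family of curves in $Q$ connecting $\zeta_1$ and $\zeta_3$. All curves are assumed non-constant; $|\gamma|$ denotes the image of a curve $\gamma$. Modulus: for a family $\Gamma$ of curves in $X$, $\operatorname{mod}\Gamma = \inf \int_X \rho^2\, d\mathcal{H}^2$ over all Borel functions $\rho: X \to [0,\infty]$ with $\int_\gamma \rho\, ds \geq 1$ for all locally rectifiable $\gamma \in \Gamma$ (admissible functions). Construction of $\rho$ and $u$: there is a sequence $(\rho_k)$ of admissible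 functions for $\Gamma_1$ converging strongly in $L^2$ to a (Borel) function $\rho \in L^2(Q)$ with $\int_Q \rho^2\, d\mathcal{H}^2 = \operatorname{mod}\Gamma_1$, and such that $$( * )\qquad \int_\gamma \rho_k\, ds \to \int_\gamma \rho\, ds < \infty$$ for all curves $\gamma$ in $Q$ except for a family of modulus zero. Fix such $(\rho_k)$ and $\rho$, and extend $\rho$ by $0$ to $X \setminus Q$. Let $\Gamma_0$ be the family of curves in $Q$ having a subcurve on which $( * )$ does not hold (non-rectifiable curves are regarded as belonging to $\Gamma_0$); then $\operatorname{mod}\Gamma_0 = 0$. For $x \in Q$: if there is a curve $\gamma \in \Gamma_1 \setminus \Gamma_0$ with $x \in |\gamma|$, set $$u(x) = \inf \int_{\gamma_x} \rho\, ds,$$ the infimum over all such curves $\gamma$ and all subcurves $\gamma_x$ of $\gamma$ joining $\zeta_1$ and $x$. Otherwise set $u(x) = \liminf_{y \in E_u,\, y \to x} u(y)$, where $E_u$ is the set of those $y \in Q$ for which $u(y)$ is defined by the preceding formula. It is known that $u$ is well defined on $Q$ and $0 \leq u \leq 1$. *)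

theory Defs
  imports "HOL-Analysis.Analysis"
begin

section \<open>Hausdorff 2-measure\<close>

text \<open>The library's \<^const>\<open>diameter\<close> is only meaningful for bounded sets, so boundedness, which is
  implicit in \<open>diam (A j) < \<epsilon>\<close>, is spelled out.\<close>

definition hausdorff2_pre :: "real \<Rightarrow> 'a::metric_space set \<Rightarrow> ennreal" where
  "hausdorff2_pre \<epsilon> E =
     Inf {(\<Sum>j. ennreal (pi / 4 * diameter (A j) ^ 2)) | A :: nat \<Rightarrow> 'a set.
            E \<subseteq> (\<Union>j. A j) \<and> (\<forall>j. bounded (A j) \<and> diameter (A j) < \<epsilon>)}"

definition hausdorff2 :: "'a::metric_space set \<Rightarrow> ennreal" where
  "hausdorff2 E = Lim (at_right 0) (\<lambda>\<epsilon>. hausdorff2_pre \<epsilon> E)"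

text \<open>See \<open>emeasure_hausdorff2_measure\<close> below for the countable additivity on which this
  definition relies.\<close>

definition hausdorff2_measure :: "'a::metric_space measure" where
  "hausdorff2_measure = measure_of UNIV (sets borel) hausdorff2"

definition locally_finite_hausdorff2 :: "'a::metric_space itself \<Rightarrow> bool" where
  "locally_finite_hausdorff2 _ \<longleftrightarrow> (\<forall>x::'a. \<exists>U. open U \<and> x \<in> U \<and> hausdorff2 U < \<infinity>)"

lemma hausdorff2_pre_antimono:
  assumes "\<epsilon> \<le> \<epsilon>'"
  shows "hausdorff2_pre \<epsilon>' E \<le> hausdorff2_pre \<epsilon> E"
  unfolding hausdorff2_pre_def using assms
  by (intro Inf_superset_mono) (blast intro: less_le_trans)

lemma hausdorff2_pre_mono:
  assumes "E \<subseteq> F"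
  shows "hausdorff2_pre \<epsilon> E \<le> hausdorff2_pre \<epsilon> F"
  unfolding hausdorff2_pre_def using assms
  by (intro Inf_superset_mono) blast

lemma tendsto_hausdorff2_pre:
  "((\<lambda>\<epsilon>. hausdorff2_pre \<epsilon> E) \<longlongrightarrow> (SUP \<epsilon>\<in>{0<..}. hausdorff2_pre \<epsilon> E)) (at_right 0)"
proof (rule order_tendstoI)
  fix a assume "a < (SUP \<epsilon>\<in>{0<..}. hausdorff2_pre \<epsilon> E)"
  then obtain d :: real where d: "d > 0" "a < hausdorff2_pre d E"
    by (auto simp: less_SUP_iff)
  have "eventually (\<lambda>\<epsilon>. \<epsilon> \<in> {0<..<d}) (at_right (0::real))"
    using d(1) by (rule eventually_at_right_real)
  then show "eventually (\<lambda>\<epsilon>. a < hausdorff2_pre \<epsilon> E) (at_right 0)"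
  proof eventually_elim
    case (elim \<epsilon>)
    then have "hausdorff2_pre d E \<le> hausdorff2_pre \<epsilon> E" by (intro hausdorff2_pre_antimono) simp
    with d(2) show ?case by (rule less_le_trans)
  qed
next
  fix a assume a: "(SUP \<epsilon>\<in>{0<..}. hausdorff2_pre \<epsilon> E) < a"
  have "eventually (\<lambda>\<epsilon>. \<epsilon> > 0) (at_right (0::real))"
    by (rule eventually_at_right_less)
  then show "eventually (\<lambda>\<epsilon>. hausdorff2_pre \<epsilon> E < a) (at_right 0)"
  proof eventually_elim
    case (elim \<epsilon>)
    then have "hausdorff2_pre \<epsilon> E \<le> (SUP \<epsilon>\<in>{0<..}. hausdorff2_pre \<epsilon> E)"
      by (intro SUP_upper) simp
    then show ?case using a by (rule le_less_trans)
  qed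
qed

lemma hausdorff2_eq_SUP: "hausdorff2 E = (SUP \<epsilon>\<in>{0<..}. hausdorff2_pre \<epsilon> E)"
  unfolding hausdorff2_def by (rule tendsto_Lim[OF _ tendsto_hausdorff2_pre]) simp

lemma hausdorff2_mono: "E \<subseteq> F \<Longrightarrow> hausdorff2 E \<le> hausdorff2 F"
  unfolding hausdorff2_eq_SUP by (intro SUP_mono') (rule hausdorff2_pre_mono)

lemma hausdorff2_pre_le: "\<epsilon> > 0 \<Longrightarrow> hausdorff2_pre \<epsilon> E \<le> hausdorff2 E"
  unfolding hausdorff2_eq_SUP by (rule SUP_upper) simp

lemma hausdorff2_pre_le_cover:
  fixes E :: "'a::metric_space set"
  assumes "E \<subseteq> (\<Union>j. A j)" "\<And>j::nat. bounded (A j)" "\<And>j. diameter (A j) < \<epsilon>"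
  shows "hausdorff2_pre \<epsilon> E \<le> (\<Sum>j. ennreal (pi / 4 * diameter (A j) ^ 2))"
  unfolding hausdorff2_pre_def using assms by (intro Inf_lower) blast

lemma hausdorff2_pre_empty:
  assumes "\<epsilon> > 0"
  shows "hausdorff2_pre \<epsilon> ({}::'a::metric_space set) = 0"
proof -
  have "hausdorff2_pre \<epsilon> ({}::'a set) \<le> (\<Sum>j. ennreal (pi / 4 * diameter ({}::'a set) ^ 2))"
    by (rule hausdorff2_pre_le_cover[where A = "\<lambda>_. {}"]) (use assms in auto)
  then show ?thesis by simp
qed

lemma hausdorff2_empty: "hausdorff2 {} = 0"
  by (simp add: hausdorff2_eq_SUP hausdorff2_pre_empty)

lemma hausdorff2_pre_countably_subadditive:
  fixes E :: "nat \<Rightarrow> 'a::metric_space set"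
  shows "hausdorff2_pre \<epsilon> (\<Union>i. E i) \<le> (\<Sum>i. hausdorff2_pre \<epsilon> (E i))"
proof (rule ennreal_le_epsilon)
  fix e :: real assume e: "e > 0" and fin: "(\<Sum>i. hausdorff2_pre \<epsilon> (E i)) < top"
  have "\<exists>A. E i \<subseteq> (\<Union>j. A j) \<and> (\<forall>j. bounded (A j) \<and> diameter (A j) < \<epsilon>) \<and>
       (\<Sum>j. ennreal (pi / 4 * diameter (A j) ^ 2)) \<le> hausdorff2_pre \<epsilon> (E i) + ennreal (e * (1/2) ^ Suc i)" for i
  proof -
    have "hausdorff2_pre \<epsilon> (E i) \<le> (\<Sum>i. hausdorff2_pre \<epsilon> (E i))"
      using sum_le_suminf[OF summableI, of "{i}" "\<lambda>i. hausdorff2_pre \<epsilon> (E i)"] by simp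
    with fin have "hausdorff2_pre \<epsilon> (E i) < top" by (rule le_less_trans[rotated])
    then have "hausdorff2_pre \<epsilon> (E i) < hausdorff2_pre \<epsilon> (E i) + ennreal (e * (1/2) ^ Suc i)"
      using e by (auto simp: ennreal_add_left_cancel_less less_top)
    then show ?thesis
      unfolding hausdorff2_pre_def[of \<epsilon> "E i"] Inf_less_iff by (blast intro: less_imp_le)
  qed
  then obtain A where A: "\<And>i. E i \<subseteq> (\<Union>j. A i j)"
      "\<And>i j. bounded (A i j)" "\<And>i j. diameter (A i j) < \<epsilon>"
      "\<And>i. (\<Sum>j. ennreal (pi / 4 * diameter (A i j :: 'a set) ^ 2))
          \<le> hausdorff2_pre \<epsilon> (E i) + ennreal (e * (1/2) ^ Suc i)"
    by metis
  define B where "B n = case_prod A (prod_decode n)" for n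
  have "hausdorff2_pre \<epsilon> (\<Union>i. E i) \<le> (\<Sum>n. ennreal (pi / 4 * diameter (B n) ^ 2))"
  proof (rule hausdorff2_pre_le_cover)
    show "(\<Union>i. E i) \<subseteq> (\<Union>n. B n)"
    proof clarify
      fix x i assume "x \<in> E i"
      then obtain j where "x \<in> A i j" using A(1) by blast
      then have "x \<in> B (prod_encode (i, j))" by (simp add: B_def)
      then show "x \<in> (\<Union>n. B n)" by blast
    qed
  qed (auto simp: B_def A split: prod.split)
  also have "\<dots> = (\<Sum>i. \<Sum>j. ennreal (pi / 4 * diameter (A i j) ^ 2))"
    unfolding B_def
    by (rule suminf_ennreal_2dimen[where f = "\<lambda>p. ennreal (pi / 4 * diameter (case_prod A p) ^ 2)"]) simp
  also have "\<dots> \<le> (\<Sum>i. hausdorff2_pre \<epsilon> (E i) + ennreal (e * (1/2) ^ Suc i))"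
    by (intro suminf_le A) auto
  also have "\<dots> = (\<Sum>i. hausdorff2_pre \<epsilon> (E i)) + (\<Sum>i. ennreal (e * (1/2) ^ Suc i))"
    by (intro suminf_add[symmetric]) auto
  also have "(\<Sum>i. ennreal (e * (1/2) ^ Suc i)) = ennreal e"
  proof -
    have "(\<lambda>i. e * (1/2) ^ Suc i) sums (e * 1)"
      by (intro sums_mult power_half_series)
    then show ?thesis
      using e by (intro sums_unique[symmetric]) (simp add: sums_ennreal)
  qed
  finally show "hausdorff2_pre \<epsilon> (\<Union>i. E i) \<le> (\<Sum>i. hausdorff2_pre \<epsilon> (E i)) + ennreal e" .
qed

lemma hausdorff2_countably_subadditive:
  fixes E :: "nat \<Rightarrow> 'a::metric_space set"
  shows "hausdorff2 (\<Union>i. E i) \<le> (\<Sum>i. hausdorff2 (E i))"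
proof -
  have "hausdorff2_pre \<epsilon> (\<Union>i. E i) \<le> (\<Sum>i. hausdorff2 (E i))" if "\<epsilon> > 0" for \<epsilon>
    using hausdorff2_pre_countably_subadditive[of \<epsilon> E]
    by (rule order_trans) (auto intro!: suminf_le hausdorff2_pre_le that)
  then show ?thesis
    unfolding hausdorff2_eq_SUP[of "\<Union>i. E i"] by (auto intro: SUP_least)
qed

lemma outer_measure_space_hausdorff2: "outer_measure_space UNIV hausdorff2"
  unfolding outer_measure_space_def positive_def increasing_def countably_subadditive_def
  by (simp add: hausdorff2_empty hausdorff2_mono hausdorff2_countably_subadditive)

lemma hausdorff2_subadditive:
  fixes E F :: "'a::metric_space set"
  shows "hausdorff2 (E \<union> F) \<le> hausdorff2 E + hausdorff2 F"
proof -
  interpret P: sigma_algebra "UNIV :: 'a set" "UNIV :: 'a set set"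
    using sigma_algebra_Pow[of "UNIV :: 'a set"] by simp
  have "subadditive (UNIV :: 'a set set) hausdorff2"
    using outer_measure_space_hausdorff2[where ?'a = 'a]
    by (intro P.countably_subadditive_subadditive) (simp_all add: outer_measure_space_def)
  then have *: "hausdorff2 (E \<union> (F - E)) \<le> hausdorff2 E + hausdorff2 (F - E)"
    by (rule subadditiveD) auto
  have "hausdorff2 (F - E) \<le> hausdorff2 F"
    by (rule hausdorff2_mono) blast
  then have "hausdorff2 E + hausdorff2 (F - E) \<le> hausdorff2 E + hausdorff2 F"
    by (rule add_left_mono)
  with * have "hausdorff2 (E \<union> (F - E)) \<le> hausdorff2 E + hausdorff2 F"
    by (rule order_trans)
  then show ?thesis by simp
qed

lemma hausdorff2_pre_add_separated:
  fixes A B :: "'a::metric_space set"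
  assumes sep: "\<And>x y. x \<in> A \<Longrightarrow> y \<in> B \<Longrightarrow> \<epsilon> \<le> dist x y"
  shows "hausdorff2_pre \<epsilon> A + hausdorff2_pre \<epsilon> B \<le> hausdorff2_pre \<epsilon> (A \<union> B)"
  unfolding hausdorff2_pre_def[of \<epsilon> "A \<union> B"]
proof (rule Inf_greatest, clarify)
  fix C :: "nat \<Rightarrow> 'a set"
  assume AB: "A \<union> B \<subseteq> (\<Union>j. C j)" and C: "\<forall>j. bounded (C j) \<and> diameter (C j) < \<epsilon>"
  then have eps: "\<epsilon> > 0"
    using diameter_ge_0[of "C 0"] by (metis le_less_trans)
  define D where "D j = (if C j \<inter> A = {} then {} else C j)" for j
  define F where "F j = (if C j \<inter> A = {} then C j else {})" for j
  have coverA: "A \<subseteq> (\<Union>j. D j)"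
  proof
    fix x assume "x \<in> A"
    with AB obtain j where "x \<in> C j" by blast
    moreover from this \<open>x \<in> A\<close> have "C j \<inter> A \<noteq> {}" by blast
    ultimately have "x \<in> D j" by (simp add: D_def)
    then show "x \<in> (\<Union>j. D j)" by blast
  qed
  have 1: "hausdorff2_pre \<epsilon> A \<le> (\<Sum>j. ennreal (pi / 4 * diameter (D j) ^ 2))"
    by (rule hausdorff2_pre_le_cover[OF coverA]) (use C eps in \<open>auto simp: D_def\<close>)
  have coverB: "B \<subseteq> (\<Union>j. F j)"
  proof
    fix y assume "y \<in> B"
    with AB obtain j where j: "y \<in> C j" by blast
    have "C j \<inter> A = {}"
    proof (rule ccontr)
      assume "C j \<inter> A \<noteq> {}"
      then obtain x where "x \<in> C j" "x \<in> A" by blast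
      have "dist x y \<le> diameter (C j)"
        using C \<open>x \<in> C j\<close> j by (intro diameter_bounded_bound) auto
      also have "\<dots> < \<epsilon>" using C by blast
      also have "\<epsilon> \<le> dist x y" using \<open>x \<in> A\<close> \<open>y \<in> B\<close> by (rule sep)
      finally show False by simp
    qed
    with j have "y \<in> F j" by (simp add: F_def)
    then show "y \<in> (\<Union>j. F j)" by blast
  qed
  have 2: "hausdorff2_pre \<epsilon> B \<le> (\<Sum>j. ennreal (pi / 4 * diameter (F j) ^ 2))"
    by (rule hausdorff2_pre_le_cover[OF coverB]) (use C eps in \<open>auto simp: F_def\<close>)
  have "(\<Sum>j. ennreal (pi / 4 * diameter (D j) ^ 2)) + (\<Sum>j. ennreal (pi / 4 * diameter (F j) ^ 2))
     = (\<Sum>j. ennreal (pi / 4 * diameter (D j) ^ 2) + ennreal (pi / 4 * diameter (F j) ^ 2))"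
    by (intro suminf_add) auto
  also have "\<dots> = (\<Sum>j. ennreal (pi / 4 * diameter (C j) ^ 2))"
    by (intro suminf_cong) (auto simp: D_def F_def)
  finally show "hausdorff2_pre \<epsilon> A + hausdorff2_pre \<epsilon> B
      \<le> (\<Sum>j. ennreal (pi / 4 * diameter (C j) ^ 2))"
    using add_mono[OF 1 2] by simp
qed

lemma hausdorff2_add_separated:
  fixes A B :: "'a::metric_space set"
  assumes "\<delta> > 0" and sep: "\<And>x y. x \<in> A \<Longrightarrow> y \<in> B \<Longrightarrow> \<delta> \<le> dist x y"
  shows "hausdorff2 A + hausdorff2 B \<le> hausdorff2 (A \<union> B)"
proof (rule tendsto_upperbound)
  show "((\<lambda>\<epsilon>. hausdorff2_pre \<epsilon> A + hausdorff2_pre \<epsilon> B) \<longlongrightarrow> hausdorff2 A + hausdorff2 B) (at_right 0)"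
    unfolding hausdorff2_eq_SUP by (intro tendsto_add tendsto_hausdorff2_pre)
  have "eventually (\<lambda>\<epsilon>. \<epsilon> \<in> {0<..<\<delta>}) (at_right (0::real))"
    using assms(1) by (rule eventually_at_right_real)
  then show "eventually (\<lambda>\<epsilon>. hausdorff2_pre \<epsilon> A + hausdorff2_pre \<epsilon> B \<le> hausdorff2 (A \<union> B)) (at_right 0)"
  proof eventually_elim
    case (elim \<epsilon>)
    then have "hausdorff2_pre \<epsilon> A + hausdorff2_pre \<epsilon> B \<le> hausdorff2_pre \<epsilon> (A \<union> B)"
      using sep by (intro hausdorff2_pre_add_separated) force
    also have "\<dots> \<le> hausdorff2 (A \<union> B)"
      using elim by (intro hausdorff2_pre_le) auto
    finally show ?case .
  qed
qed simp

lemma hausdorff2_sum_separated: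
  fixes R :: "nat \<Rightarrow> 'a::metric_space set"
  assumes sep: "\<And>i j. i < j \<Longrightarrow> \<exists>\<delta>>0. \<forall>x\<in>R i. \<forall>y\<in>R j. \<delta> \<le> dist x y"
  shows "(\<Sum>i<n. hausdorff2 (R i)) \<le> hausdorff2 (\<Union>i<n. R i)"
proof (induction n)
  case (Suc n)
  have "\<forall>i\<in>{..<n}. \<exists>\<delta>>0. \<forall>x\<in>R i. \<forall>y\<in>R n. \<delta> \<le> dist x y"
    using sep by blast
  from bchoice[OF this] obtain d
    where "\<forall>i\<in>{..<n}. d i > 0 \<and> (\<forall>x\<in>R i. \<forall>y\<in>R n. d i \<le> dist x y)" ..
  then have d: "\<And>i. i < n \<Longrightarrow> d i > 0"
      "\<And>i x y. i < n \<Longrightarrow> x \<in> R i \<Longrightarrow> y \<in> R n \<Longrightarrow> d i \<le> dist x y" by auto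
  define \<delta> where "\<delta> = Min (insert 1 (d ` {..<n}))"
  have "hausdorff2 (\<Union>i<n. R i) + hausdorff2 (R n) \<le> hausdorff2 ((\<Union>i<n. R i) \<union> R n)"
  proof (rule hausdorff2_add_separated)
    show "\<delta> > 0" using d by (auto simp: \<delta>_def)
    fix x y assume "x \<in> (\<Union>i<n. R i)" "y \<in> R n"
    then obtain i where "i < n" "x \<in> R i" by blast
    then have "\<delta> \<le> d i" by (auto simp: \<delta>_def)
    with d(2)[OF \<open>i < n\<close> \<open>x \<in> R i\<close> \<open>y \<in> R n\<close>] show "\<delta> \<le> dist x y" by simp
  qed
  also have "(\<Union>i<n. R i) \<union> R n = (\<Union>i<Suc n. R i)"
    by (auto simp: less_Suc_eq)
  finally have "hausdorff2 (\<Union>i<n. R i) + hausdorff2 (R n) \<le> hausdorff2 (\<Union>i<Suc n. R i)" .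
  moreover have "(\<Sum>i<Suc n. hausdorff2 (R i)) \<le> hausdorff2 (\<Union>i<n. R i) + hausdorff2 (R n)"
    using Suc.IH by (simp add: add_right_mono)
  ultimately show ?case by (rule order_trans[rotated])
qed simp

text \<open>Caratheodory's criterion for metric outer measures.\<close>

lemma hausdorff2_closed_split:
  fixes F :: "'a::metric_space set"
  assumes "closed F"
  shows "hausdorff2 (T \<inter> F) + hausdorff2 (T - F) = hausdorff2 T"
proof (rule antisym)
  have "T = (T \<inter> F) \<union> (T - F)" by blast
  then show "hausdorff2 T \<le> hausdorff2 (T \<inter> F) + hausdorff2 (T - F)"
    by (metis hausdorff2_subadditive)
next
  show "hausdorff2 (T \<inter> F) + hausdorff2 (T - F) \<le> hausdorff2 T"
  proof (cases "F = {} \<or> hausdorff2 T = \<infinity>")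
    case True
    then show ?thesis by (auto simp: hausdorff2_empty)
  next
    case False
    then have ne: "F \<noteq> {}" and fin: "hausdorff2 T < \<infinity>"
      by (auto simp: less_top)
    define S where "S n = {x \<in> T. infdist x F \<ge> 1 / real (Suc n)}" for n
    define R where "R n = {x \<in> T. infdist x F < 1 / real (Suc n) \<and> infdist x F \<ge> 1 / real (Suc (Suc n))}" for n
    have sepR: "1 / real (Suc (Suc i)) - 1 / real (Suc j) \<le> dist x y"
      if "x \<in> R i" "y \<in> R j" for i j x y
      using that infdist_triangle[of x F y] by (auto simp: R_def)
    have pos: "0 < 1 / real (Suc (Suc i)) - 1 / real (Suc j)" if "Suc i < j" for i j
      using that frac_less2[of 1 1 "real (Suc (Suc i))" "real (Suc j)"] by simp
    have evn: "(\<Sum>i<n. hausdorff2 (R (2 * i))) \<le> hausdorff2 T" for n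
    proof -
      have "(\<Sum>i<n. hausdorff2 (R (2 * i))) \<le> hausdorff2 (\<Union>i<n. R (2 * i))"
      proof (rule hausdorff2_sum_separated)
        fix i j :: nat assume "i < j"
        then show "\<exists>\<delta>>0. \<forall>x\<in>R (2*i). \<forall>y\<in>R (2*j). \<delta> \<le> dist x y"
          by (intro exI[of _ "1 / real (Suc (Suc (2*i))) - 1 / real (Suc (2*j))"] conjI ballI sepR pos) auto
      qed
      also have "\<dots> \<le> hausdorff2 T" by (rule hausdorff2_mono) (auto simp: R_def)
      finally show ?thesis .
    qed
    have odd: "(\<Sum>i<n. hausdorff2 (R (Suc (2 * i)))) \<le> hausdorff2 T" for n
    proof -
      have "(\<Sum>i<n. hausdorff2 (R (Suc (2 * i)))) \<le> hausdorff2 (\<Union>i<n. R (Suc (2 * i)))"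
      proof (rule hausdorff2_sum_separated)
        fix i j :: nat assume "i < j"
        then show "\<exists>\<delta>>0. \<forall>x\<in>R (Suc (2*i)). \<forall>y\<in>R (Suc (2*j)). \<delta> \<le> dist x y"
          by (intro exI[of _ "1 / real (Suc (Suc (Suc (2*i)))) - 1 / real (Suc (Suc (2*j)))"] conjI ballI sepR pos) auto
      qed
      also have "\<dots> \<le> hausdorff2 T" by (rule hausdorff2_mono) (auto simp: R_def)
      finally show ?thesis .
    qed
    have part: "(\<Sum>i<2*n. hausdorff2 (R i)) \<le> hausdorff2 T + hausdorff2 T" for n
    proof -
      have "(\<Sum>i<2*n. hausdorff2 (R i))
          = (\<Sum>i<n. hausdorff2 (R (2 * i))) + (\<Sum>i<n. hausdorff2 (R (Suc (2 * i))))"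
        by (induction n) (auto simp: algebra_simps)
      also have "\<dots> \<le> hausdorff2 T + hausdorff2 T"
        by (intro add_mono evn odd)
      finally show ?thesis .
    qed
    have "(\<Sum>i<n. hausdorff2 (R i)) \<le> hausdorff2 T + hausdorff2 T" for n
      by (rule order_trans[OF _ part[of n]]) (rule sum_mono2, auto)
    then have "(\<Sum>i. hausdorff2 (R i)) \<le> hausdorff2 T + hausdorff2 T"
      by (intro suminf_le_const) auto
    also have "\<dots> < \<infinity>" using fin by (simp add: less_top)
    finally have sumfin: "(\<Sum>i. hausdorff2 (R i)) \<noteq> \<infinity>" by simp
    have tail: "(\<lambda>n. \<Sum>i. hausdorff2 (R (i + n))) \<longlonglongrightarrow> 0"
    proof -
      define f where "f i = enn2real (hausdorff2 (R i))" for i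
      have fi: "hausdorff2 (R i) = ennreal (f i)" for i
      proof -
        have "hausdorff2 (R i) \<le> hausdorff2 T" by (rule hausdorff2_mono) (auto simp: R_def)
        with fin have "hausdorff2 (R i) < top" by (metis infinity_ennreal_def le_less_trans)
        then show ?thesis by (simp add: f_def)
      qed
      have f0: "f i \<ge> 0" for i by (simp add: f_def)
      have summ: "summable f"
        using sumfin f0 by (intro summable_suminf_not_top) (auto simp: fi)
      have "(\<Sum>i. hausdorff2 (R (i + n))) = ennreal (\<Sum>i. f (i + n))" for n
        unfolding fi using summ f0 by (intro suminf_ennreal2) auto
      moreover have "(\<lambda>n. \<Sum>i. f (i + n)) \<longlonglongrightarrow> 0"
        using summ by (rule suminf_exist_split2)
      ultimately show ?thesis
        by (simp add: tendsto_ennreal_iff[where x = 0, simplified] flip: ennreal_0)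
    qed
    have bound: "hausdorff2 (T \<inter> F) + hausdorff2 (T - F)
        \<le> hausdorff2 T + (\<Sum>i. hausdorff2 (R (i + n)))" for n
    proof -
      have "T - F \<subseteq> S n \<union> (\<Union>i. R (i + n))"
      proof
        fix x assume x: "x \<in> T - F"
        then have p: "infdist x F > 0"
          using assms ne by (simp add: infdist_pos_not_in_closed)
        show "x \<in> S n \<union> (\<Union>i. R (i + n))"
        proof (cases "infdist x F \<ge> 1 / real (Suc n)")
          case True
          with x show ?thesis by (simp add: S_def)
        next
          case False
          obtain m where m: "1 / real (Suc m) < infdist x F"
            using p reals_Archimedean[of "infdist x F"] by (auto simp: inverse_eq_divide)
          define k where "k = (LEAST k. 1 / real (Suc k) \<le> infdist x F)"
          have k: "1 / real (Suc k) \<le> infdist x F"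
            unfolding k_def by (rule LeastI[of _ m]) (use m in simp)
          have nk: "n < k"
          proof (rule ccontr)
            assume "\<not> n < k"
            then have "1 / real (Suc n) \<le> 1 / real (Suc k)" by (simp add: field_simps)
            with k False show False by simp
          qed
          then obtain l where l: "k = Suc l" by (cases k) auto
          have "\<not> 1 / real (Suc l) \<le> infdist x F"
            using not_less_Least[of l "\<lambda>k. 1 / real (Suc k) \<le> infdist x F"] l
            unfolding k_def by auto
          with k x l have "x \<in> R l" by (auto simp: R_def)
          moreover have "l = (l - n) + n" using nk l by simp
          ultimately show ?thesis by (metis UNIV_I UN_I UnI2)
        qed
      qed
      then have "hausdorff2 (T - F) \<le> hausdorff2 (S n \<union> (\<Union>i. R (i + n)))"
        by (rule hausdorff2_mono)
      also have "\<dots> \<le> hausdorff2 (S n) + hausdorff2 (\<Union>i. R (i + n))"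
        by (rule hausdorff2_subadditive)
      also have "\<dots> \<le> hausdorff2 (S n) + (\<Sum>i. hausdorff2 (R (i + n)))"
        by (intro add_left_mono hausdorff2_countably_subadditive)
      finally have 1: "hausdorff2 (T - F) \<le> hausdorff2 (S n) + (\<Sum>i. hausdorff2 (R (i + n)))" .
      have "hausdorff2 (T \<inter> F) + hausdorff2 (S n) \<le> hausdorff2 ((T \<inter> F) \<union> S n)"
      proof (rule hausdorff2_add_separated[of "1 / real (Suc n)"])
        fix x y assume "x \<in> T \<inter> F" "y \<in> S n"
        then show "1 / real (Suc n) \<le> dist x y"
          using infdist_le[of x F y] by (auto simp: S_def dist_commute)
      qed simp
      also have "\<dots> \<le> hausdorff2 T"
        by (rule hausdorff2_mono) (auto simp: S_def)
      finally have 2: "hausdorff2 (T \<inter> F) + hausdorff2 (S n) \<le> hausdorff2 T" .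
      have "hausdorff2 (T \<inter> F) + hausdorff2 (T - F)
          \<le> hausdorff2 (T \<inter> F) + (hausdorff2 (S n) + (\<Sum>i. hausdorff2 (R (i + n))))"
        using 1 by (rule add_left_mono)
      also have "\<dots> \<le> hausdorff2 T + (\<Sum>i. hausdorff2 (R (i + n)))"
        using 2 by (simp add: add.assoc[symmetric] add_right_mono)
      finally show ?thesis .
    qed
    have "(\<lambda>n. hausdorff2 T + (\<Sum>i. hausdorff2 (R (i + n)))) \<longlonglongrightarrow> hausdorff2 T + 0"
      by (intro tendsto_add tendsto_const tail)
    then show ?thesis
      using bound by (intro LIMSEQ_le_const) auto
  qed
qed

lemma measure_space_hausdorff2: "measure_space UNIV (sets borel) (hausdorff2 :: 'a::metric_space set \<Rightarrow> _)"
proof -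
  define L where "L = lambda_system UNIV UNIV (hausdorff2 :: 'a set \<Rightarrow> ennreal)"
  interpret P: sigma_algebra "UNIV :: 'a set" "UNIV :: 'a set set"
    using sigma_algebra_Pow[of "UNIV :: 'a set"] by simp
  have L: "measure_space UNIV L hausdorff2"
    unfolding L_def by (rule P.caratheodory_lemma[OF outer_measure_space_hausdorff2])
  then have sa: "sigma_algebra UNIV L" by (simp add: measure_space_def)
  have "{F :: 'a set. closed F} \<subseteq> L"
    by (auto simp: L_def P.lambda_system_eq hausdorff2_closed_split)
  then have "sigma_sets UNIV {F :: 'a set. closed F} \<subseteq> L"
    by (rule sigma_algebra.sigma_sets_subset[OF sa])
  moreover have "sets (borel :: 'a measure) = sigma_sets UNIV {F. closed F}"
    by (simp add: borel_eq_closed)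
  ultimately have "sets (borel :: 'a measure) \<subseteq> L" by simp
  with L show ?thesis
    by (auto simp: measure_space_def positive_def countably_additive_def
        intro: sets.sigma_algebra_axioms[of borel, simplified])
qed

lemma sets_hausdorff2_measure [simp, measurable_cong]: "sets hausdorff2_measure = sets borel"
  unfolding hausdorff2_measure_def using sets.sigma_sets_eq[of borel] by simp

lemma emeasure_hausdorff2_measure:
  assumes "E \<in> sets borel"
  shows "emeasure hausdorff2_measure E = hausdorff2 E"
  using measure_space_hausdorff2 assms unfolding hausdorff2_measure_def measure_space_def
  by (intro emeasure_measure_of_sigma) auto

section \<open>Curves, line integrals and modulus\<close>

text \<open>Curves are non-constant continuous maps on compact intervals, normalised to \<open>{0..1}\<close>; for
  these, locally rectifiable means rectifiable. The subcurve of \<open>\<gamma>\<close> given by the restriction to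
  \<open>{a..b} \<subseteq> {0..1}\<close> is represented by the triple \<open>\<gamma>, a, b\<close>.\<close>

definition curve_in :: "'a::metric_space set \<Rightarrow> (real \<Rightarrow> 'a) \<Rightarrow> bool" where
  "curve_in Q \<gamma> \<longleftrightarrow> path \<gamma> \<and> \<not> \<gamma> constant_on {0..1} \<and> path_image \<gamma> \<subseteq> Q"

definition curve_length :: "(real \<Rightarrow> 'a::metric_space) \<Rightarrow> real \<Rightarrow> real \<Rightarrow> ennreal" where
  "curve_length \<gamma> a b =
     Sup {(\<Sum>i<n. ennreal (dist (\<gamma> (t i)) (\<gamma> (t (Suc i))))) | (n :: nat) t.
            mono t \<and> range t \<subseteq> {a..b}}"

definition rectifiable :: "(real \<Rightarrow> 'a::metric_space) \<Rightarrow> bool" where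
  "rectifiable \<gamma> \<longleftrightarrow> curve_length \<gamma> 0 1 < \<infinity>"

definition arclength_param :: "(real \<Rightarrow> 'a::metric_space) \<Rightarrow> real \<Rightarrow> real \<Rightarrow> real \<Rightarrow> 'a" where
  "arclength_param \<gamma> a b s = (THE x. \<exists>t\<in>{a..b}. curve_length \<gamma> a t = ennreal s \<and> \<gamma> t = x)"

text \<open>Only meaningful when \<open>\<gamma>\<close> has finite length on \<open>{a..b}\<close>.\<close>

definition line_integral :: "('a::metric_space \<Rightarrow> ennreal) \<Rightarrow> (real \<Rightarrow> 'a) \<Rightarrow> real \<Rightarrow> real \<Rightarrow> ennreal" where
  "line_integral \<rho> \<gamma> a b =
     (\<integral>\<^sup>+s\<in>{0..enn2real (curve_length \<gamma> a b)}. \<rho> (arclength_param \<gamma> a b s) \<partial>lborel)"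

definition admissible :: "(real \<Rightarrow> 'a::metric_space) set \<Rightarrow> ('a \<Rightarrow> ennreal) \<Rightarrow> bool" where
  "admissible \<Gamma> \<rho> \<longleftrightarrow> \<rho> \<in> borel_measurable borel \<and>
     (\<forall>\<gamma>\<in>\<Gamma>. rectifiable \<gamma> \<longrightarrow> 1 \<le> line_integral \<rho> \<gamma> 0 1)"

definition modulus :: "(real \<Rightarrow> 'a::metric_space) set \<Rightarrow> ennreal" where
  "modulus \<Gamma> = (INF \<rho> \<in> Collect (admissible \<Gamma>). \<integral>\<^sup>+x. \<rho> x ^ 2 \<partial>hausdorff2_measure)"

section \<open>Quadrilaterals and the function \<open>u\<close>\<close>

text \<open>A quadrilateral is given by its parametrizing homeomorphism \<open>\<phi>\<close> on the unit square.\<close>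

definition quad :: "(real \<times> real \<Rightarrow> 'a::metric_space) \<Rightarrow> 'a set" where
  "quad \<phi> = \<phi> ` ({0..1} \<times> {0..1})"

definition zeta1 :: "(real \<times> real \<Rightarrow> 'a::metric_space) \<Rightarrow> 'a set" where
  "zeta1 \<phi> = \<phi> ` ({0..1} \<times> {0})"

definition zeta3 :: "(real \<times> real \<Rightarrow> 'a::metric_space) \<Rightarrow> 'a set" where
  "zeta3 \<phi> = \<phi> ` ({0..1} \<times> {1})"

definition Gamma1 :: "(real \<times> real \<Rightarrow> 'a::metric_space) \<Rightarrow> (real \<Rightarrow> 'a) set" where
  "Gamma1 \<phi> = {\<gamma>. curve_in (quad \<phi>) \<gamma> \<and>
     (pathstart \<gamma> \<in> zeta1 \<phi> \<and> pathfinish \<gamma> \<in> zeta3 \<phi> \<or>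
      pathstart \<gamma> \<in> zeta3 \<phi> \<and> pathfinish \<gamma> \<in> zeta1 \<phi>)}"

definition integrals_converge ::
  "(nat \<Rightarrow> 'a::metric_space \<Rightarrow> ennreal) \<Rightarrow> ('a \<Rightarrow> ennreal) \<Rightarrow> (real \<Rightarrow> 'a) \<Rightarrow> real \<Rightarrow> real \<Rightarrow> bool" where
  "integrals_converge \<rho>k \<rho> \<gamma> a b \<longleftrightarrow>
     (\<lambda>k. line_integral (\<rho>k k) \<gamma> a b) \<longlonglongrightarrow> line_integral \<rho> \<gamma> a b \<and> line_integral \<rho> \<gamma> a b < \<infinity>"

definition Gamma0 ::
  "(real \<times> real \<Rightarrow> 'a::metric_space) \<Rightarrow> (nat \<Rightarrow> 'a \<Rightarrow> ennreal) \<Rightarrow> ('a \<Rightarrow> ennreal) \<Rightarrow> (real \<Rightarrow> 'a) set" where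
  "Gamma0 \<phi> \<rho>k \<rho> = {\<gamma>. curve_in (quad \<phi>) \<gamma> \<and>
     (\<not> rectifiable \<gamma> \<or>
      (\<exists>a b. 0 \<le> a \<and> a < b \<and> b \<le> 1 \<and> \<not> integrals_converge \<rho>k \<rho> \<gamma> a b))}"

text \<open>The truncated differences make \<open>(\<rho> x - \<sigma> x) + (\<sigma> x - \<rho> x)\<close> the absolute
  difference of two values in \<open>[0,\<infinity>]\<close>.\<close>

definition L2_converges_on ::
  "'a::metric_space set \<Rightarrow> (nat \<Rightarrow> 'a \<Rightarrow> ennreal) \<Rightarrow> ('a \<Rightarrow> ennreal) \<Rightarrow> bool" where
  "L2_converges_on Q \<rho>k \<rho> \<longleftrightarrow>
     (\<lambda>k. \<integral>\<^sup>+x\<in>Q. ((\<rho>k k x - \<rho> x) + (\<rho> x - \<rho>k k x)) ^ 2 \<partial>hausdorff2_measure) \<longlonglongrightarrow> 0"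

definition E_u ::
  "(real \<times> real \<Rightarrow> 'a::metric_space) \<Rightarrow> (nat \<Rightarrow> 'a \<Rightarrow> ennreal) \<Rightarrow> ('a \<Rightarrow> ennreal) \<Rightarrow> 'a set" where
  "E_u \<phi> \<rho>k \<rho> = {x \<in> quad \<phi>. \<exists>\<gamma> \<in> Gamma1 \<phi> - Gamma0 \<phi> \<rho>k \<rho>. x \<in> path_image \<gamma>}"

text \<open>The subcurve joining \<open>\<zeta>\<^sub>1\<close> and \<open>x\<close> is the part of \<open>\<gamma>\<close> between parameters \<open>s\<close> and \<open>t\<close>, in
  either order; \<open>s = t\<close> is allowed, so the value is \<open>0\<close> at points of \<open>\<zeta>\<^sub>1\<close>.\<close>

definition u_inf ::
  "(real \<times> real \<Rightarrow> 'a::metric_space) \<Rightarrow> (nat \<Rightarrow> 'a \<Rightarrow> ennreal) \<Rightarrow> ('a \<Rightarrow> ennreal) \<Rightarrow> 'a \<Rightarrow> ennreal" where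
  "u_inf \<phi> \<rho>k \<rho> x =
     Inf {line_integral \<rho> \<gamma> (min s t) (max s t) | \<gamma> s t.
            \<gamma> \<in> Gamma1 \<phi> - Gamma0 \<phi> \<rho>k \<rho> \<and> s \<in> {0..1} \<and> t \<in> {0..1} \<and> \<gamma> s \<in> zeta1 \<phi> \<and> \<gamma> t = x}"

text \<open>On \<open>quad \<phi>\<close> the values lie in \<open>[0,1]\<close>; outside, \<open>u\<close> is irrelevant.\<close>

definition harmonic_u ::
  "(real \<times> real \<Rightarrow> 'a::metric_space) \<Rightarrow> (nat \<Rightarrow> 'a \<Rightarrow> ennreal) \<Rightarrow> ('a \<Rightarrow> ennreal) \<Rightarrow> 'a \<Rightarrow> ennreal" where
  "harmonic_u \<phi> \<rho>k \<rho> x =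
     (if x \<in> E_u \<phi> \<rho>k \<rho> then u_inf \<phi> \<rho>k \<rho> x
      else Liminf (at x within E_u \<phi> \<rho>k \<rho>) (u_inf \<phi> \<rho>k \<rho>))"

end

theory Submission
  imports Defs
begin

text \<open>
  Call a path good if it is rectifiable and the convergence of integrals holds on all its subpaths.
  Splicing good paths gives good paths, so on \<open>E\<^sub>u\<close> the function \<open>u\<close> is the \<open>\<rho>\<close>-length distance from
  \<open>\<zeta>\<^sub>1\<close>, measured along good paths. As \<open>\<rho>\<close> is merely square integrable and no Poincare inequality is
  assumed, the existence of short paths has to come from planar topology and the finiteness of area.

  The source of paths is a coarea argument, lemma \<open>crossing\<close>. Let the continua \<open>Y\<close> and \<open>Z\<close> in \<open>Q\<close>
  have distance at least \<open>\<tau>\<close> in the \<open>k\<close>-length metric. The level sets of the distance from \<open>Y\<close>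
  separate \<open>Y\<close> from \<open>Z\<close>, so for \<open>0 < t < \<tau>\<close> some component of the \<open>t\<close>-level meets every continuum
  that meets both. Averaged over \<open>t\<close>, the \<open>w\<close>-length of the levels is at most a constant times
  \<open>(\<integral> k w) / \<tau>\<close>; hence any two continua joining \<open>Y\<close> to \<open>Z\<close> are connected by a path of at most that
  \<open>w\<close>-length. For unbounded \<open>k\<close> the distance may be discontinuous. It is therefore replaced by
  distances along chains of vanishing mesh, which are locally Lipschitz, and the paths arise as limits of
  chains (\<open>chain_limit\<close>). This needs lower semicontinuous weights. By \<open>lsc_majorant\<close> there is such a
  weight \<open>H\<close>, square integrable and above \<open>1\<close>, above \<open>\<rho>\<close> and above a weight whose integral is infinite
  along every bad curve (\<open>modulus_zero_weight\<close>); paths of finite \<open>H\<close>-length are good.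

  Suppose now that \<open>y\<^sub>n \<rightarrow> p\<close>, \<open>z\<^sub>n \<rightarrow> p\<close> and \<open>u(y\<^sub>n) < a < b < u(z\<^sub>n)\<close>. There is a good path from \<open>\<zeta>\<^sub>1\<close>
  to \<open>y\<^sub>n\<close> of \<open>\<rho>\<close>-length below \<open>a\<close>, and by the maximum principle \<open>joined_to_zeta3_near\<close> there is one
  of \<open>\<rho>\<close>-length below \<open>1 - b\<close> from some point close to \<open>z\<^sub>n\<close> to \<open>\<zeta>\<^sub>3\<close>: otherwise
  no nearly shortest path from \<open>\<zeta>\<^sub>1\<close> to \<open>\<zeta>\<^sub>3\<close> would come close to \<open>z\<^sub>n\<close>, and \<open>\<rho>\<close> could be lowered there, against
  its minimality. Let \<open>Y\<^sub>n\<close> and \<open>Z\<^sub>n\<close> be the unions of these paths with \<open>\<zeta>\<^sub>1\<close> and \<open>\<zeta>\<^sub>3\<close>.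
  Both come close to \<open>p\<close>, both meet the two vertical sides, one of which misses \<open>p\<close>, and every
  path between them has \<open>H\<close>-length at least \<open>b - a\<close>, since good paths from \<open>\<zeta>\<^sub>1\<close> to \<open>\<zeta>\<^sub>3\<close> have
  \<open>\<rho>\<close>-length at least \<open>1\<close>. Lemma \<open>limit_point_near_continua\<close> produces paths of arbitrarily small
  \<open>H\<close>-length from \<open>p\<close> to some \<open>Y\<^sub>n\<close> and, by symmetry, to some \<open>Z\<^sub>m\<close>. Passing through \<open>p\<close> then yields a good path
  from \<open>\<zeta>\<^sub>1\<close> to \<open>\<zeta>\<^sub>3\<close> of \<open>\<rho>\<close>-length below \<open>1\<close>, a contradiction. So \<open>u\<close> does not oscillate on \<open>E\<^sub>u\<close>,
  and since \<open>E\<^sub>u\<close> is dense, the lower limits defining \<open>u\<close> elsewhere give a continuous extension.\<close>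

section \<open>Length of curves\<close>

lemma curve_length_upper:
  assumes "mono t" "range t \<subseteq> {a..b}"
  shows "(\<Sum>i<n. ennreal (dist (\<gamma> (t i)) (\<gamma> (t (Suc i))))) \<le> curve_length \<gamma> a b"
  unfolding curve_length_def using assms by (intro Sup_upper) blast

lemma curve_length_least:
  assumes "\<And>n t. mono t \<Longrightarrow> range t \<subseteq> {a..b} \<Longrightarrow>
    (\<Sum>i<n. ennreal (dist (\<gamma> (t i)) (\<gamma> (t (Suc i))))) \<le> c"
  shows "curve_length \<gamma> a b \<le> c"
  unfolding curve_length_def using assms by (intro Sup_least) blast

lemma curve_length_mono:
  assumes "{a..b} \<subseteq> {a'..b'}"
  shows "curve_length \<gamma> a b \<le> curve_length \<gamma> a' b'"
  by (intro curve_length_least curve_length_upper) (use assms in auto)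

lemma dist_le_curve_length:
  assumes "a \<le> s" "s \<le> t" "t \<le> b"
  shows "ennreal (dist (\<gamma> s) (\<gamma> t)) \<le> curve_length \<gamma> a b"
proof -
  define r :: "nat \<Rightarrow> real" where "r i = (if i = 0 then s else t)" for i
  have "mono r" using assms by (auto simp: r_def mono_def)
  moreover have "range r \<subseteq> {a..b}" using assms by (auto simp: r_def)
  ultimately show ?thesis using curve_length_upper[of r a b \<gamma> 1] by (simp add: r_def)
qed

lemma curve_length_cong_le:
  assumes "\<And>t. t \<in> {a..b} \<Longrightarrow> \<gamma> t = \<gamma>' t"
  shows "curve_length \<gamma> a b \<le> curve_length \<gamma>' a b"
proof (rule curve_length_least)
  fix n :: nat and t :: "nat \<Rightarrow> real" assume t: "mono t" "range t \<subseteq> {a..b}"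
  then have "\<gamma> (t i) = \<gamma>' (t i)" for i by (intro assms) (simp add: image_subset_iff)
  then show "(\<Sum>i<n. ennreal (dist (\<gamma> (t i)) (\<gamma> (t (Suc i))))) \<le> curve_length \<gamma>' a b"
    using curve_length_upper[OF t, of \<gamma>' n] by simp
qed

lemma curve_length_cong:
  assumes "\<And>t. t \<in> {a..b} \<Longrightarrow> \<gamma> t = \<gamma>' t"
  shows "curve_length \<gamma> a b = curve_length \<gamma>' a b"
  by (intro antisym curve_length_cong_le) (simp_all add: assms)

lemma mono_max_min:
  fixes t :: "nat \<Rightarrow> real"
  assumes "mono t"
  shows "mono (\<lambda>i. max (t i) c)" "mono (\<lambda>i. min (t i) c)"
  using assms by (simp_all add: mono_def max.coboundedI1 min.coboundedI1)

text \<open>Over any partition the increments of \<open>F\<close> telescope.\<close>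

lemma curve_length_le_increment:
  fixes F :: "real \<Rightarrow> real"
  assumes "a \<le> b" and F: "\<And>s t. a \<le> s \<Longrightarrow> s \<le> t \<Longrightarrow> t \<le> b \<Longrightarrow> dist (\<gamma> s) (\<gamma> t) \<le> F t - F s"
  shows "curve_length \<gamma> a b \<le> ennreal (F b - F a)"
proof (rule curve_length_least)
  fix n :: nat and t :: "nat \<Rightarrow> real" assume t: "mono t" "range t \<subseteq> {a..b}"
  have m: "t i \<le> t (Suc i)" "a \<le> t i" "t i \<le> b" for i
    using t by (auto simp: mono_def image_subset_iff)
  have mF: "F s \<le> F t" if "a \<le> s" "s \<le> t" "t \<le> b" for s t
    using F[OF that] zero_le_dist[of "\<gamma> s" "\<gamma> t"] by linarith
  have "(\<Sum>i<n. ennreal (dist (\<gamma> (t i)) (\<gamma> (t (Suc i))))) = ennreal (\<Sum>i<n. dist (\<gamma> (t i)) (\<gamma> (t (Suc i))))"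
    by (simp add: sum_ennreal)
  also have "\<dots> \<le> ennreal (\<Sum>i<n. F (t (Suc i)) - F (t i))"
    by (intro ennreal_leI sum_mono F m)
  also have "(\<Sum>i<n. F (t (Suc i)) - F (t i)) = F (t n) - F (t 0)"
    by (rule sum_lessThan_telescope)
  also have "\<dots> \<le> F b - F a"
    using mF[of "t n" b] mF[of a "t 0"] m[of n] m[of 0] assms(1) by simp
  finally show "(\<Sum>i<n. ennreal (dist (\<gamma> (t i)) (\<gamma> (t (Suc i))))) \<le> ennreal (F b - F a)"
    by (simp add: ennreal_leI)
qed

lemma dist_split_at:
  fixes \<gamma> :: "real \<Rightarrow> 'a::metric_space"
  assumes "x \<le> y"
  shows "ennreal (dist (\<gamma> x) (\<gamma> y)) \<le>
    ennreal (dist (\<gamma> (min x b)) (\<gamma> (min y b))) + ennreal (dist (\<gamma> (max x b)) (\<gamma> (max y b)))"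
proof -
  have "dist (\<gamma> x) (\<gamma> y) \<le> dist (\<gamma> (min x b)) (\<gamma> (min y b)) + dist (\<gamma> (max x b)) (\<gamma> (max y b))"
    using assms dist_triangle[of "\<gamma> x" "\<gamma> y" "\<gamma> b"] by (cases "x \<le> b"; cases "y \<le> b") simp_all
  then show ?thesis by (simp add: ennreal_leI flip: ennreal_plus)
qed

lemma curve_length_add:
  assumes ab: "a \<le> b" and bc: "b \<le> c"
  shows "curve_length \<gamma> a c = curve_length \<gamma> a b + curve_length \<gamma> b c"
proof (rule antisym)
  show "curve_length \<gamma> a c \<le> curve_length \<gamma> a b + curve_length \<gamma> b c"
  proof (rule curve_length_least)
    fix n :: nat and t :: "nat \<Rightarrow> real" assume t: "mono t" "range t \<subseteq> {a..c}"
    have tt: "t i \<le> t (Suc i)" for i using t by (auto simp: mono_def)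
    let ?d = "\<lambda>x y. ennreal (dist (\<gamma> x) (\<gamma> y))"
    have "?d (t i) (t (Suc i)) \<le> ?d (min (t i) b) (min (t (Suc i)) b) + ?d (max (t i) b) (max (t (Suc i)) b)" for i
      using tt[of i] by (rule dist_split_at)
    then have "(\<Sum>i<n. ?d (t i) (t (Suc i))) \<le>
       (\<Sum>i<n. ?d (min (t i) b) (min (t (Suc i)) b)) + (\<Sum>i<n. ?d (max (t i) b) (max (t (Suc i)) b))"
      unfolding sum.distrib[symmetric] by (intro sum_mono)
    also have "\<dots> \<le> curve_length \<gamma> a b + curve_length \<gamma> b c"
      using t ab bc
      by (intro add_mono curve_length_upper[where t = "\<lambda>i. min (t i) b"] curve_length_upper[where t = "\<lambda>i. max (t i) b"])
         (auto simp: mono_max_min image_subset_iff min_le_iff_disj le_max_iff_disj)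
    finally show "(\<Sum>i<n. ?d (t i) (t (Suc i))) \<le> curve_length \<gamma> a b + curve_length \<gamma> b c" .
  qed
next
  have *: "(\<Sum>i<n. ennreal (dist (\<gamma> (t i)) (\<gamma> (t (Suc i))))) + (\<Sum>i<m. ennreal (dist (\<gamma> (s i)) (\<gamma> (s (Suc i)))))
      \<le> curve_length \<gamma> a c" (is "?T + ?S \<le> _")
    if t: "mono t" "range t \<subseteq> {a..b}" and s: "mono s" "range s \<subseteq> {b..c}" for n m and t s :: "nat \<Rightarrow> real"
  proof -
    define r where "r i = (if i \<le> n then t i else s (i - Suc n))" for i
    have ts: "t i \<le> s j" for i j using t(2) s(2) by (meson atLeastAtMost_iff order_trans range_subsetD)
    have "mono r" using t(1) s(1) ts by (auto simp: r_def mono_def)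
    moreover have "range r \<subseteq> {a..c}" using t(2) s(2) ab bc by (auto simp: r_def image_subset_iff intro: order_trans)
    ultimately have 1: "(\<Sum>i<Suc n + m. ennreal (dist (\<gamma> (r i)) (\<gamma> (r (Suc i))))) \<le> curve_length \<gamma> a c"
      by (rule curve_length_upper)
    let ?X = "\<Sum>i<Suc n. ennreal (dist (\<gamma> (r i)) (\<gamma> (r (Suc i))))"
    let ?Y = "\<Sum>i<m. ennreal (dist (\<gamma> (r (Suc n + i))) (\<gamma> (r (Suc (Suc n + i)))))"
    have "?T = (\<Sum>i<n. ennreal (dist (\<gamma> (r i)) (\<gamma> (r (Suc i)))))"
      by (intro sum.cong) (auto simp: r_def)
    then have 2: "?T \<le> ?X" by simp
    have 3: "?S = ?Y"
      by (intro sum.cong) (auto simp: r_def Suc_diff_le)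
    have "?T + ?S \<le> ?X + ?Y" by (rule add_mono[OF 2 eq_refl[OF 3]])
    also have "?X + ?Y = (\<Sum>i<Suc n + m. ennreal (dist (\<gamma> (r i)) (\<gamma> (r (Suc i)))))"
      by (induction m) (simp_all add: add.assoc)
    finally show ?thesis using 1 by (rule order_trans)
  qed
  let ?A = "{(\<Sum>i<n. ennreal (dist (\<gamma> (t i)) (\<gamma> (t (Suc i))))) | (n :: nat) t. mono t \<and> range t \<subseteq> {a..b}}"
  let ?B = "{(\<Sum>i<n. ennreal (dist (\<gamma> (t i)) (\<gamma> (t (Suc i))))) | (n :: nat) t. mono t \<and> range t \<subseteq> {b..c}}"
  have ne: "?A \<noteq> {}" "?B \<noteq> {}"
    using ab bc by (auto simp: mono_def simp del: sum_ennreal intro!: exI[of _ 0] exI[of _ "\<lambda>_::nat. b"])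
  have "curve_length \<gamma> a b + curve_length \<gamma> b c = (SUP x\<in>?A. x) + (SUP y\<in>?B. y)"
    by (simp add: curve_length_def)
  also have "\<dots> = (SUP x\<in>?A. x + (SUP y\<in>?B. y))"
    using ne by (subst ennreal_SUP_add_left) auto
  also have "\<dots> = (SUP x\<in>?A. SUP y\<in>?B. x + y)"
    using ne by (intro SUP_cong refl) (subst ennreal_SUP_add_right, auto)
  also have "\<dots> \<le> curve_length \<gamma> a c"
    using * by (intro SUP_least) blast
  finally show "curve_length \<gamma> a b + curve_length \<gamma> b c \<le> curve_length \<gamma> a c" .
qed

lemma curve_length_affine:
  assumes "c > 0"
  shows "curve_length (\<lambda>t. \<gamma> (c * t + d)) a b = curve_length \<gamma> (c * a + d) (c * b + d)"
proof (rule antisym; rule curve_length_least)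
  fix n :: nat and t :: "nat \<Rightarrow> real"
  assume t: "mono t" "range t \<subseteq> {a..b}"
  then have "mono (\<lambda>i. c * t i + d)" "range (\<lambda>i. c * t i + d) \<subseteq> {c * a + d..c * b + d}"
    using assms by (auto simp: mono_def image_subset_iff)
  from curve_length_upper[OF this, of \<gamma> n]
  show "(\<Sum>i<n. ennreal (dist (\<gamma> (c * t i + d)) (\<gamma> (c * t (Suc i) + d)))) \<le> curve_length \<gamma> (c * a + d) (c * b + d)" .
next
  fix n :: nat and t :: "nat \<Rightarrow> real"
  assume t: "mono t" "range t \<subseteq> {c * a + d..c * b + d}"
  have 1: "mono (\<lambda>i. (t i - d) / c)"
    using assms t(1) by (simp add: mono_def divide_right_mono)
  have 2: "range (\<lambda>i. (t i - d) / c) \<subseteq> {a..b}"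
  proof clarify
    fix i
    have "c * a + d \<le> t i" "t i \<le> c * b + d" using t(2) by (simp_all add: image_subset_iff)
    then have "a * c \<le> t i - d" "t i - d \<le> b * c" by (simp_all add: mult.commute)
    then show "(t i - d) / c \<in> {a..b}"
      using assms by (simp add: pos_le_divide_eq pos_divide_le_eq)
  qed
  from curve_length_upper[OF 1 2, of "\<lambda>t. \<gamma> (c * t + d)" n]
  show "(\<Sum>i<n. ennreal (dist (\<gamma> (t i)) (\<gamma> (t (Suc i))))) \<le> curve_length (\<lambda>t. \<gamma> (c * t + d)) a b"
    using assms by simp
qed

lemma curve_length_reverse_le: "curve_length (\<lambda>t. \<gamma> (d - t)) a b \<le> curve_length \<gamma> (d - b) (d - a)"
proof (rule curve_length_least)
  fix n :: nat and t :: "nat \<Rightarrow> real"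
  assume t: "mono t" "range t \<subseteq> {a..b}"
  define r where "r i = d - t (n - i)" for i
  have "mono r" "range r \<subseteq> {d - b..d - a}"
    using t by (auto simp: mono_def image_subset_iff r_def)
  then have "(\<Sum>i<n. ennreal (dist (\<gamma> (r i)) (\<gamma> (r (Suc i))))) \<le> curve_length \<gamma> (d - b) (d - a)"
    by (rule curve_length_upper)
  also have "(\<Sum>i<n. ennreal (dist (\<gamma> (r i)) (\<gamma> (r (Suc i))))) =
     (\<Sum>i<n. ennreal (dist (\<gamma> (r (n - Suc i))) (\<gamma> (r (Suc (n - Suc i))))))"
    by (rule sum.nat_diff_reindex[symmetric])
  also have "\<dots> = (\<Sum>i<n. ennreal (dist (\<gamma> (d - t i)) (\<gamma> (d - t (Suc i)))))"
  proof (intro sum.cong refl)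
    fix i assume i: "i \<in> {..<n}"
    then have "n - (n - Suc i) = Suc i" "n - Suc (n - Suc i) = i" by auto
    then show "ennreal (dist (\<gamma> (r (n - Suc i))) (\<gamma> (r (Suc (n - Suc i))))) = ennreal (dist (\<gamma> (d - t i)) (\<gamma> (d - t (Suc i))))"
      by (simp add: r_def dist_commute)
  qed
  finally show "(\<Sum>i<n. ennreal (dist (\<gamma> (d - t i)) (\<gamma> (d - t (Suc i))))) \<le> curve_length \<gamma> (d - b) (d - a)" .
qed

lemma curve_length_reverse: "curve_length (\<lambda>t. \<gamma> (d - t)) a b = curve_length \<gamma> (d - b) (d - a)"
  using curve_length_reverse_le[of \<gamma> d a b] curve_length_reverse_le[of "\<lambda>t. \<gamma> (d - t)" d "d - b" "d - a"]
  by simp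

lemma curve_length_refl: "curve_length \<gamma> a a = 0"
proof -
  have "curve_length \<gamma> a a \<le> ennreal (0 - 0)"
    proof (rule curve_length_le_increment)
    fix s t :: real assume "a \<le> s" "s \<le> t" "t \<le> a"
    then have "s = t" by linarith
    then show "dist (\<gamma> s) (\<gamma> t) \<le> (0 - 0 :: real)" by simp
  qed simp
  then show ?thesis by simp
qed

text \<open>If a partition nearly attains the length, then an interval so short that \<open>\<gamma>\<close> moves by
  less than \<open>\<epsilon>/(2n)\<close> on it meets the \<open>n\<close> steps of the partition in negligible pieces, so the
  partition restricted to the complement still nearly attains the length.\<close>

lemma curve_length_uniformly_small:
  fixes \<gamma> :: "real \<Rightarrow> 'a::metric_space"
  assumes cont: "continuous_on {a..b} \<gamma>" and fin: "curve_length \<gamma> a b < \<infinity>" and e: "\<epsilon> > 0"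
  obtains \<delta> where "\<delta> > 0"
    "\<And>s s'. a \<le> s \<Longrightarrow> s \<le> s' \<Longrightarrow> s' \<le> b \<Longrightarrow> s' - s \<le> \<delta> \<Longrightarrow> curve_length \<gamma> s s' \<le> ennreal \<epsilon>"
proof (cases "a \<le> b")
  case False
  then show ?thesis by (intro that[of 1]) auto
next
  case True
  let ?d = "\<lambda>x y. ennreal (dist (\<gamma> x) (\<gamma> y))"
  have "curve_length \<gamma> a b < curve_length \<gamma> a b + ennreal (\<epsilon>/2)"
    using fin e by (auto simp: ennreal_add_left_cancel_less less_top)
  then obtain n and t :: "nat \<Rightarrow> real" where t: "mono t" "range t \<subseteq> {a..b}"
    and near: "curve_length \<gamma> a b < (\<Sum>i<n. ?d (t i) (t (Suc i))) + ennreal (\<epsilon>/2)"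
  proof -
    have "\<exists>n t. mono t \<and> range t \<subseteq> {a..b} \<and> curve_length \<gamma> a b < (\<Sum>i<n. ?d (t i) (t (Suc i))) + ennreal (\<epsilon>/2)"
    proof (rule ccontr)
      assume *: "\<not> ?thesis"
      have pos: "curve_length \<gamma> a b \<ge> ennreal (\<epsilon>/2)"
        using * True by (auto dest!: spec[of _ "0"] spec[of _ "\<lambda>_::nat. a"] simp: mono_def)
      have "curve_length \<gamma> a b \<le> curve_length \<gamma> a b - ennreal (\<epsilon>/2)"
      proof (rule curve_length_least)
        fix n and t :: "nat \<Rightarrow> real" assume "mono t" "range t \<subseteq> {a..b}"
        with * have "(\<Sum>i<n. ?d (t i) (t (Suc i))) + ennreal (\<epsilon>/2) \<le> curve_length \<gamma> a b" by (meson not_le)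
        then show "(\<Sum>i<n. ?d (t i) (t (Suc i))) \<le> curve_length \<gamma> a b - ennreal (\<epsilon>/2)"
          by (simp add: ennreal_le_minus_iff add.commute)
      qed
      then have "curve_length \<gamma> a b + ennreal (\<epsilon>/2) \<le> curve_length \<gamma> a b"
        using pos by (metis add.commute add_left_mono diff_add_cancel_ennreal)
      then show False using \<open>curve_length \<gamma> a b < curve_length \<gamma> a b + ennreal (\<epsilon>/2)\<close> by simp
    qed
    then show ?thesis using that by blast
  qed
  define \<eta> where "\<eta> = \<epsilon> / (2 * (real n + 1))"
  have \<eta>: "\<eta> > 0" "real n * \<eta> \<le> \<epsilon>/2" using e by (auto simp: \<eta>_def field_simps)
  have "uniformly_continuous_on {a..b} \<gamma>"
    using cont by (intro compact_uniformly_continuous) auto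
  then obtain \<delta> where \<delta>: "\<delta> > 0" and \<delta>': "\<And>x y. x \<in> {a..b} \<Longrightarrow> y \<in> {a..b} \<Longrightarrow> dist y x < \<delta> \<Longrightarrow> dist (\<gamma> y) (\<gamma> x) < \<eta>"
    using \<eta>(1) unfolding uniformly_continuous_on_def by meson
  show ?thesis
  proof (rule that[of "\<delta>/2"])
    show "\<delta>/2 > 0" using \<delta> by simp
    fix s s' assume s: "a \<le> s" "s \<le> s'" "s' \<le> b" "s' - s \<le> \<delta>/2"
    have m: "t i \<le> t (Suc i)" "a \<le> t i" "t i \<le> b" for i using t by (auto simp: mono_def image_subset_iff)
    let ?c = "\<lambda>x. min (max x s) s'"
    have step: "?d (t i) (t (Suc i)) \<le> ?d (min (t i) s) (min (t (Suc i)) s) + ?d (?c (t i)) (?c (t (Suc i)))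
       + ?d (max (t i) s') (max (t (Suc i)) s')" for i
    proof -
      have mm: "max (max x s) s' = max x s'" for x using s(2) by (simp add: max.assoc max.absorb2)
      have "max (t i) s \<le> max (t (Suc i)) s" using m(1)[of i] by (rule max.mono) simp
      from dist_split_at[OF this, of \<gamma> s'] dist_split_at[OF m(1)[of i], of \<gamma> s] show ?thesis
        unfolding mm add.assoc by (rule order_trans[OF _ add_left_mono, rotated])
    qed
    have "(\<Sum>i<n. ?d (t i) (t (Suc i))) \<le> (\<Sum>i<n. ?d (min (t i) s) (min (t (Suc i)) s))
        + (\<Sum>i<n. ?d (?c (t i)) (?c (t (Suc i)))) + (\<Sum>i<n. ?d (max (t i) s') (max (t (Suc i)) s'))"
      using step unfolding sum.distrib[symmetric] by (intro sum_mono)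
    also have "\<dots> \<le> curve_length \<gamma> a s + ennreal (\<epsilon>/2) + curve_length \<gamma> s' b"
    proof (intro add_mono)
      show "(\<Sum>i<n. ?d (min (t i) s) (min (t (Suc i)) s)) \<le> curve_length \<gamma> a s"
        using t m s by (intro curve_length_upper[where t = "\<lambda>i. min (t i) s"])
          (auto simp: mono_max_min min_le_iff_disj)
      show "(\<Sum>i<n. ?d (max (t i) s') (max (t (Suc i)) s')) \<le> curve_length \<gamma> s' b"
        using t m s by (intro curve_length_upper[where t = "\<lambda>i. max (t i) s'"])
          (auto simp: mono_max_min le_max_iff_disj)
      have "(\<Sum>i<n. ?d (?c (t i)) (?c (t (Suc i)))) \<le> (\<Sum>i<n. ennreal \<eta>)"
      proof (intro sum_mono ennreal_leI less_imp_le \<delta>')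
        fix i show "?c (t (Suc i)) \<in> {a..b}" "?c (t i) \<in> {a..b}" using s by auto
        show "dist (?c (t i)) (?c (t (Suc i))) < \<delta>" using s \<delta> by (auto simp: dist_real_def min_def max_def)
      qed
      also have "\<dots> = ennreal (real n * \<eta>)" using \<eta> by (simp add: ennreal_mult ennreal_of_nat_eq_real_of_nat)
      also have "\<dots> \<le> ennreal (\<epsilon>/2)" using \<eta>(2) by (rule ennreal_leI)
      finally show "(\<Sum>i<n. ?d (?c (t i)) (?c (t (Suc i)))) \<le> ennreal (\<epsilon>/2)" .
    qed
    finally have "curve_length \<gamma> a b \<le> curve_length \<gamma> a s + ennreal (\<epsilon>/2) + curve_length \<gamma> s' b + ennreal (\<epsilon>/2)"
      using near by (meson add_right_mono less_imp_le order_trans)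
    also have "\<dots> = curve_length \<gamma> a s + curve_length \<gamma> s' b + ennreal \<epsilon>"
      using e by (simp add: ac_simps flip: ennreal_plus)
    finally have 1: "curve_length \<gamma> a b \<le> curve_length \<gamma> a s + curve_length \<gamma> s' b + ennreal \<epsilon>" .
    have 2: "curve_length \<gamma> a b = (curve_length \<gamma> a s + curve_length \<gamma> s' b) + curve_length \<gamma> s s'"
      using s curve_length_add[of a s b \<gamma>] curve_length_add[of s s' b \<gamma>] by (simp add: ac_simps)
    have "curve_length \<gamma> a s + curve_length \<gamma> s' b \<noteq> \<infinity>"
      using 2 fin by (auto simp: less_top)
    then show "curve_length \<gamma> s s' \<le> ennreal \<epsilon>"
      using 1 unfolding 2 by (simp add: ennreal_add_left_cancel_le top_unique)
  qed
qed

section \<open>Line integrals\<close>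

definition rect_on :: "(real \<Rightarrow> 'a::metric_space) \<Rightarrow> real \<Rightarrow> real \<Rightarrow> bool" where
  "rect_on \<gamma> a b \<longleftrightarrow> a \<le> b \<and> continuous_on {a..b} \<gamma> \<and> curve_length \<gamma> a b < \<infinity>"

definition len :: "(real \<Rightarrow> 'a::metric_space) \<Rightarrow> real \<Rightarrow> real \<Rightarrow> real" where
  "len \<gamma> a b = enn2real (curve_length \<gamma> a b)"

lemma rect_on_subinterval:
  assumes "rect_on \<gamma> a b" "a \<le> s" "s \<le> t" "t \<le> b"
  shows "rect_on \<gamma> s t"
proof -
  have "curve_length \<gamma> s t \<le> curve_length \<gamma> a b" using assms by (intro curve_length_mono) auto
  then show ?thesis
    using assms unfolding rect_on_def by (auto intro: continuous_on_subset le_less_trans)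
qed

lemma curve_length_eq_len:
  assumes "rect_on \<gamma> a b" "a \<le> s" "s \<le> t" "t \<le> b"
  shows "curve_length \<gamma> s t = ennreal (len \<gamma> s t)"
  using rect_on_subinterval[OF assms] by (simp add: rect_on_def len_def)

lemma rect_on_continuum:
  assumes "rect_on \<gamma> a b"
  shows "compact (\<gamma> ` {a..b})" "connected (\<gamma> ` {a..b})"
  using assms by (auto simp: rect_on_def intro!: compact_continuous_image connected_continuous_image)

lemma len_nonneg: "len \<gamma> a b \<ge> 0"
  by (simp add: len_def)

lemma len_refl [simp]: "len \<gamma> a a = 0"
  by (simp add: len_def curve_length_refl)

lemma len_add:
  assumes "rect_on \<gamma> a c" "a \<le> b" "b \<le> c"
  shows "len \<gamma> a c = len \<gamma> a b + len \<gamma> b c"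
proof -
  have "ennreal (len \<gamma> a c) = ennreal (len \<gamma> a b) + ennreal (len \<gamma> b c)"
    using assms curve_length_add[of a b c \<gamma>] by (simp add: curve_length_eq_len[OF assms(1)])
  then have "ennreal (len \<gamma> a c) = ennreal (len \<gamma> a b + len \<gamma> b c)" by (simp add: len_nonneg)
  then show ?thesis by (subst (asm) ennreal_inj) (auto simp: len_nonneg)
qed

lemma dist_le_len:
  assumes "rect_on \<gamma> a b" "a \<le> b"
  shows "dist (\<gamma> a) (\<gamma> b) \<le> len \<gamma> a b"
  using dist_le_curve_length[of a a b b \<gamma>] assms by (simp add: curve_length_eq_len[OF assms(1)] len_nonneg)

lemma len_mono:
  assumes "rect_on \<gamma> a b" "a \<le> s" "s \<le> t" "t \<le> b"
  shows "len \<gamma> a s \<le> len \<gamma> a t"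
  using len_add[OF rect_on_subinterval[OF assms(1), of a t], of s] len_nonneg[of \<gamma> s t] assms by simp

lemma continuous_on_len:
  assumes "rect_on \<gamma> a b"
  shows "continuous_on {a..b} (len \<gamma> a)"
  unfolding continuous_on_iff
proof (intro ballI allI impI)
  fix x e :: real assume x: "x \<in> {a..b}" and e: "e > 0"
  obtain \<delta> where \<delta>: "\<delta> > 0"
    "\<And>s s'. a \<le> s \<Longrightarrow> s \<le> s' \<Longrightarrow> s' \<le> b \<Longrightarrow> s' - s \<le> \<delta> \<Longrightarrow> curve_length \<gamma> s s' \<le> ennreal (e/2)"
    using curve_length_uniformly_small[of a b \<gamma> "e/2"] assms e unfolding rect_on_def by auto
  have step: "\<bar>len \<gamma> a s' - len \<gamma> a s\<bar> < e" if "a \<le> s" "s \<le> s'" "s' \<le> b" "s' - s \<le> \<delta>" for s s'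
  proof -
    have "ennreal (len \<gamma> s s') \<le> ennreal (e/2)"
      using \<delta>(2)[OF that] curve_length_eq_len[OF assms that(1-3)] by simp
    then have "len \<gamma> s s' \<le> e/2" using e by simp
    moreover have "len \<gamma> a s' = len \<gamma> a s + len \<gamma> s s'"
      using that by (intro len_add rect_on_subinterval[OF assms]) auto
    ultimately show ?thesis using e len_nonneg[of \<gamma> s s'] by simp
  qed
  show "\<exists>d>0. \<forall>x'\<in>{a..b}. dist x' x < d \<longrightarrow> dist (len \<gamma> a x') (len \<gamma> a x) < e"
  proof (intro exI conjI ballI impI)
    fix x' assume "x' \<in> {a..b}" "dist x' x < \<delta>"
    then show "dist (len \<gamma> a x') (len \<gamma> a x) < e"
      using step[of x x'] step[of x' x] x by (cases "x \<le> x'") (auto simp: dist_real_def)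
  qed (rule \<delta>)
qed

lemma len_surj:
  assumes "rect_on \<gamma> a b" "s \<in> {0..len \<gamma> a b}"
  obtains t where "t \<in> {a..b}" "len \<gamma> a t = s"
proof -
  have "\<exists>t. a \<le> t \<and> t \<le> b \<and> len \<gamma> a t = s"
    using assms by (intro IVT' continuous_on_len) (auto simp: rect_on_def)
  then show ?thesis using that by auto
qed

lemma eq_if_len_eq:
  assumes "rect_on \<gamma> a b" "s \<in> {a..b}" "t \<in> {a..b}" "len \<gamma> a s = len \<gamma> a t"
  shows "\<gamma> s = \<gamma> t"
proof -
  have *: "\<gamma> s = \<gamma> t" if "s \<le> t" "s \<in> {a..b}" "t \<in> {a..b}" "len \<gamma> a s = len \<gamma> a t" for s t
  proof -
    have "len \<gamma> a t = len \<gamma> a s + len \<gamma> s t"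
      using that by (intro len_add rect_on_subinterval[OF assms(1)]) auto
    then have "len \<gamma> s t = 0" using that by simp
    moreover have "dist (\<gamma> s) (\<gamma> t) \<le> len \<gamma> s t"
      using that by (intro dist_le_len rect_on_subinterval[OF assms(1)]) auto
    ultimately show ?thesis by simp
  qed
  show ?thesis
  proof (cases "s \<le> t")
    case True
    then show ?thesis using assms(2-) by (rule *)
  next
    case False
    then show ?thesis using assms(2-) by (intro *[symmetric]) simp_all
  qed
qed

lemma arclength_param_len:
  assumes "rect_on \<gamma> a b" "t \<in> {a..b}"
  shows "arclength_param \<gamma> a b (len \<gamma> a t) = \<gamma> t"
  unfolding arclength_param_def
proof (rule the_equality)
  show "\<exists>r\<in>{a..b}. curve_length \<gamma> a r = ennreal (len \<gamma> a t) \<and> \<gamma> r = \<gamma> t"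
    using assms by (intro bexI[of _ t]) (auto intro!: curve_length_eq_len[OF assms(1)])
  fix x assume "\<exists>r\<in>{a..b}. curve_length \<gamma> a r = ennreal (len \<gamma> a t) \<and> \<gamma> r = x"
  then obtain r where r: "r \<in> {a..b}" "curve_length \<gamma> a r = ennreal (len \<gamma> a t)" "\<gamma> r = x" by auto
  then have "len \<gamma> a r = len \<gamma> a t" by (simp add: len_def)
  then show "x = \<gamma> t" using eq_if_len_eq[OF assms(1) r(1) assms(2)] r(3) by simp
qed

text \<open>Clamping the parameter makes the arclength parametrization continuous on the whole line,
  hence Borel measurable.\<close>

definition arc_clamped :: "(real \<Rightarrow> 'a::metric_space) \<Rightarrow> real \<Rightarrow> real \<Rightarrow> real \<Rightarrow> 'a" where
  "arc_clamped \<gamma> a b s = arclength_param \<gamma> a b (max 0 (min s (len \<gamma> a b)))"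

lemma arc_clamped_len:
  assumes "rect_on \<gamma> a b" "t \<in> {a..b}"
  shows "arc_clamped \<gamma> a b (len \<gamma> a t) = \<gamma> t"
  using arclength_param_len[OF assms] len_mono[OF assms(1), of t b] assms(2) len_nonneg[of \<gamma> a t]
  by (auto simp: arc_clamped_def)

lemma dist_arc_clamped_le:
  assumes "rect_on \<gamma> a b"
  shows "dist (arc_clamped \<gamma> a b s) (arc_clamped \<gamma> a b t) \<le> dist s t"
proof -
  let ?c = "\<lambda>s. max 0 (min s (len \<gamma> a b))"
  have c: "?c s \<in> {0..len \<gamma> a b}" for s using len_nonneg[of \<gamma> a b] by auto
  obtain s' where s': "s' \<in> {a..b}" "len \<gamma> a s' = ?c s" using len_surj[OF assms c] .
  obtain t' where t': "t' \<in> {a..b}" "len \<gamma> a t' = ?c t" using len_surj[OF assms c] .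
  have *: "dist (\<gamma> x) (\<gamma> y) \<le> \<bar>len \<gamma> a x - len \<gamma> a y\<bar>" if "x \<le> y" "x \<in> {a..b}" "y \<in> {a..b}" for x y
  proof -
    have "len \<gamma> a y = len \<gamma> a x + len \<gamma> x y"
      using that by (intro len_add rect_on_subinterval[OF assms(1)]) auto
    moreover have "dist (\<gamma> x) (\<gamma> y) \<le> len \<gamma> x y"
      using that by (intro dist_le_len rect_on_subinterval[OF assms(1)]) auto
    ultimately show ?thesis by simp
  qed
  have "dist (\<gamma> s') (\<gamma> t') \<le> \<bar>len \<gamma> a s' - len \<gamma> a t'\<bar>"
  proof (cases "s' \<le> t'")
    case True
    then show ?thesis using s' t' by (intro *)
  next
    case False
    then have "dist (\<gamma> t') (\<gamma> s') \<le> \<bar>len \<gamma> a t' - len \<gamma> a s'\<bar>" using s' t' by (intro *) simp_all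
    then show ?thesis by (simp only: dist_commute abs_minus_commute)
  qed
  also have "\<dots> \<le> dist s t" unfolding s' t' by (simp add: dist_real_def max_def min_def)
  finally show ?thesis
    using arclength_param_len[OF assms s'(1)] arclength_param_len[OF assms t'(1)] s' t'
    by (simp add: arc_clamped_def)
qed

lemma measurable_arc_clamped:
  assumes "rect_on \<gamma> a b"
  shows "arc_clamped \<gamma> a b \<in> borel_measurable borel"
proof (rule borel_measurable_continuous_onI)
  show "continuous_on UNIV (arc_clamped \<gamma> a b)"
    unfolding continuous_on_iff using dist_arc_clamped_le[OF assms] le_less_trans by blast
qed

text \<open>Any parametrization \<open>c\<close> that agrees with \<open>\<gamma>\<close> at arclength may be used in the line integral. This is how
  subarcs, reparametrizations and reversals are reduced to substitutions in the parameter.\<close>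

lemma line_integral_eqI:
  assumes "rect_on \<gamma> a b" "\<And>t. t \<in> {a..b} \<Longrightarrow> c (len \<gamma> a t) = \<gamma> t"
  shows "line_integral f \<gamma> a b = (\<integral>\<^sup>+s\<in>{0..len \<gamma> a b}. f (c s) \<partial>lborel)"
  unfolding line_integral_def len_def[symmetric]
proof (intro nn_integral_cong)
  fix s :: real
  show "f (arclength_param \<gamma> a b s) * indicator {0..len \<gamma> a b} s = f (c s) * indicator {0..len \<gamma> a b} s"
  proof (cases "s \<in> {0..len \<gamma> a b}")
    case True
    then obtain t where "t \<in> {a..b}" "len \<gamma> a t = s" using len_surj[OF assms(1)] by blast
    then show ?thesis using assms(2)[of t] arclength_param_len[OF assms(1), of t] by simp
  qed simp
qed

lemma line_integral_arc_clamped: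
  assumes "rect_on \<gamma> a b"
  shows "line_integral f \<gamma> a b = (\<integral>\<^sup>+s\<in>{0..len \<gamma> a b}. f (arc_clamped \<gamma> a b s) \<partial>lborel)"
  using line_integral_eqI[OF assms, of "arc_clamped \<gamma> a b"] arc_clamped_len[OF assms] by simp

lemma line_integral_add:
  assumes r: "rect_on \<gamma> a c" and b: "a \<le> b" "b \<le> c" and f: "f \<in> borel_measurable borel"
  shows "line_integral f \<gamma> a c = line_integral f \<gamma> a b + line_integral f \<gamma> b c"
proof -
  let ?c = "arc_clamped \<gamma> a c" and ?l = "len \<gamma> a b" and ?m = "len \<gamma> b c"
  have r1: "rect_on \<gamma> a b" and r2: "rect_on \<gamma> b c" using rect_on_subinterval[OF r] b by auto
  have [measurable]: "(\<lambda>s. f (?c s)) \<in> borel_measurable borel"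
    using measurable_compose[OF measurable_arc_clamped[OF r] f] .
  have l: "len \<gamma> a c = ?l + ?m" by (rule len_add[OF r b])
  have 1: "line_integral f \<gamma> a b = (\<integral>\<^sup>+s\<in>{0..?l}. f (?c s) \<partial>lborel)"
    using b by (intro line_integral_eqI r1 arc_clamped_len[OF r]) auto
  have 2: "line_integral f \<gamma> b c = (\<integral>\<^sup>+s\<in>{0..?m}. f (?c (?l + s)) \<partial>lborel)"
  proof (intro line_integral_eqI r2)
    fix t assume t: "t \<in> {b..c}"
    then have "len \<gamma> a t = ?l + len \<gamma> b t"
      using b by (intro len_add rect_on_subinterval[OF r]) auto
    then show "?c (?l + len \<gamma> b t) = \<gamma> t" using arc_clamped_len[OF r, of t] t b by simp
  qed
  have 3: "(\<integral>\<^sup>+s\<in>{?l<..?l + ?m}. f (?c s) \<partial>lborel) = (\<integral>\<^sup>+s\<in>{0<..?m}. f (?c (?l + s)) \<partial>lborel)"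
    using nn_integral_real_affine[of "\<lambda>s. f (?c s) * indicator {?l<..?l + ?m} s" 1 ?l]
    by (simp add: indicator_def)
  have 4: "(\<integral>\<^sup>+s\<in>{0<..?m}. f (?c (?l + s)) \<partial>lborel) = (\<integral>\<^sup>+s\<in>{0..?m}. f (?c (?l + s)) \<partial>lborel)"
  proof (rule nn_integral_cong_AE)
    show "AE s in lborel. f (?c (?l + s)) * indicator {0<..?m} s = f (?c (?l + s)) * indicator {0..?m} s"
      using AE_lborel_singleton[of 0] by eventually_elim (auto simp: indicator_def)
  qed
  have "line_integral f \<gamma> a c = (\<integral>\<^sup>+s\<in>{0..?l + ?m}. f (?c s) \<partial>lborel)"
    using line_integral_arc_clamped[OF r] l by simp
  also have "\<dots> = (\<integral>\<^sup>+s. f (?c s) * indicator {0..?l} s + f (?c s) * indicator {?l<..?l + ?m} s \<partial>lborel)"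
    using len_nonneg[of \<gamma> a b] len_nonneg[of \<gamma> b c] by (intro nn_integral_cong) (auto simp: indicator_def)
  also have "\<dots> = (\<integral>\<^sup>+s\<in>{0..?l}. f (?c s) \<partial>lborel) + (\<integral>\<^sup>+s\<in>{?l<..?l + ?m}. f (?c s) \<partial>lborel)"
    by (intro nn_integral_add) measurable
  finally show ?thesis using 1 2 3 4 by simp
qed

lemma rect_on_cong:
  assumes "\<And>t. t \<in> {a..b} \<Longrightarrow> \<gamma> t = \<gamma>' t"
  shows "rect_on \<gamma> a b = rect_on \<gamma>' a b"
proof -
  have "curve_length \<gamma> a b = curve_length \<gamma>' a b" using assms by (rule curve_length_cong)
  moreover have "continuous_on {a..b} \<gamma> = continuous_on {a..b} \<gamma>'" using assms by (intro continuous_on_cong) auto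
  ultimately show ?thesis by (simp add: rect_on_def)
qed

lemma line_integral_cong:
  assumes "rect_on \<gamma> a b" "\<And>t. t \<in> {a..b} \<Longrightarrow> \<gamma> t = \<gamma>' t"
  shows "line_integral f \<gamma> a b = line_integral f \<gamma>' a b"
proof -
  have r: "rect_on \<gamma>' a b" using rect_on_cong[OF assms(2)] assms(1) by simp
  have l: "len \<gamma> a t = len \<gamma>' a t" if "t \<in> {a..b}" for t
    unfolding len_def using that by (intro arg_cong[of _ _ enn2real] curve_length_cong assms(2)) auto
  have "a \<le> b" using r by (simp add: rect_on_def)
  have "line_integral f \<gamma>' a b = (\<integral>\<^sup>+s\<in>{0..len \<gamma>' a b}. f (arc_clamped \<gamma> a b s) \<partial>lborel)"
    using arc_clamped_len[OF assms(1)] assms(2) l by (intro line_integral_eqI r) simp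
  then show ?thesis using line_integral_arc_clamped[OF assms(1)] l[of b] \<open>a \<le> b\<close> by simp
qed

lemma rect_on_affine:
  assumes "c > 0" "rect_on \<gamma> (c * a + d) (c * b + d)"
  shows "rect_on (\<lambda>t. \<gamma> (c * t + d)) a b"
  unfolding rect_on_def
proof (intro conjI)
  show "a \<le> b" using assms by (simp add: rect_on_def)
  have "continuous_on ((\<lambda>t. c * t + d) ` {a..b}) \<gamma>"
    by (rule continuous_on_subset[of "{c * a + d..c * b + d}"]) (use assms in \<open>auto simp: rect_on_def\<close>)
  then show "continuous_on {a..b} (\<lambda>t. \<gamma> (c * t + d))"
    by (rule continuous_on_compose2) (auto intro!: continuous_intros)
  show "curve_length (\<lambda>t. \<gamma> (c * t + d)) a b < \<infinity>"
    unfolding curve_length_affine[OF assms(1), of \<gamma> d a b] using assms by (simp add: rect_on_def)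
qed

lemma line_integral_affine:
  assumes "c > 0" "rect_on \<gamma> (c * a + d) (c * b + d)"
  shows "line_integral f (\<lambda>t. \<gamma> (c * t + d)) a b = line_integral f \<gamma> (c * a + d) (c * b + d)"
proof -
  have l: "len (\<lambda>t. \<gamma> (c * t + d)) a t = len \<gamma> (c * a + d) (c * t + d)" for t
    unfolding len_def curve_length_affine[OF assms(1), of \<gamma> d a t] by (rule refl)
  have "line_integral f (\<lambda>t. \<gamma> (c * t + d)) a b =
    (\<integral>\<^sup>+s\<in>{0..len (\<lambda>t. \<gamma> (c * t + d)) a b}. f (arc_clamped \<gamma> (c * a + d) (c * b + d) s) \<partial>lborel)"
    using arc_clamped_len[OF assms(2)] assms(1) l by (intro line_integral_eqI rect_on_affine assms) auto
  then show ?thesis using line_integral_arc_clamped[OF assms(2)] l by simp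
qed

lemma rect_on_reverse:
  assumes "rect_on \<gamma> (d - b) (d - a)"
  shows "rect_on (\<lambda>t. \<gamma> (d - t)) a b"
  unfolding rect_on_def
proof (intro conjI)
  show "a \<le> b" using assms by (simp add: rect_on_def)
  have "continuous_on ((\<lambda>t. d - t) ` {a..b}) \<gamma>"
    by (rule continuous_on_subset[of "{d - b..d - a}"]) (use assms in \<open>auto simp: rect_on_def\<close>)
  then show "continuous_on {a..b} (\<lambda>t. \<gamma> (d - t))"
    by (rule continuous_on_compose2) (auto intro!: continuous_intros)
  show "curve_length (\<lambda>t. \<gamma> (d - t)) a b < \<infinity>"
    unfolding curve_length_reverse[of \<gamma> d a b] using assms by (simp add: rect_on_def)
qed

lemma line_integral_reverse:
  assumes r: "rect_on \<gamma> (d - b) (d - a)" and f: "f \<in> borel_measurable borel"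
  shows "line_integral f (\<lambda>t. \<gamma> (d - t)) a b = line_integral f \<gamma> (d - b) (d - a)"
proof -
  let ?l = "len \<gamma> (d - b) (d - a)" and ?c = "arc_clamped \<gamma> (d - b) (d - a)"
  have [measurable]: "(\<lambda>s. f (?c s)) \<in> borel_measurable borel"
    using measurable_compose[OF measurable_arc_clamped[OF r] f] .
  have l: "len (\<lambda>t. \<gamma> (d - t)) a t = len \<gamma> (d - t) (d - a)" for t
    unfolding len_def curve_length_reverse[of \<gamma> d a t] by (rule refl)
  have "line_integral f (\<lambda>t. \<gamma> (d - t)) a b = (\<integral>\<^sup>+s\<in>{0..len (\<lambda>t. \<gamma> (d - t)) a b}. f (?c (?l - s)) \<partial>lborel)"
  proof (intro line_integral_eqI rect_on_reverse r)
    fix t assume "t \<in> {a..b}"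
    moreover from this have "?l = len \<gamma> (d - b) (d - t) + len \<gamma> (d - t) (d - a)" by (intro len_add r) auto
    ultimately show "?c (?l - len (\<lambda>t. \<gamma> (d - t)) a t) = \<gamma> (d - t)"
      using arc_clamped_len[OF r, of "d - t"] by (simp add: l)
  qed
  also have "\<dots> = (\<integral>\<^sup>+s\<in>{0..?l}. f (?c s) \<partial>lborel)"
    using nn_integral_real_affine[of "\<lambda>s. f (?c s) * indicator {0..?l} s" "-1" ?l]
    by (simp add: l indicator_def conj_commute)
  finally show ?thesis using line_integral_arc_clamped[OF r] by simp
qed

lemma line_integral_mono:
  assumes "rect_on \<gamma> a b" "\<And>t. t \<in> {a..b} \<Longrightarrow> f (\<gamma> t) \<le> g (\<gamma> t)"
  shows "line_integral f \<gamma> a b \<le> line_integral g \<gamma> a b"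
  unfolding line_integral_arc_clamped[OF assms(1)]
proof (intro nn_integral_mono)
  fix s :: real
  show "f (arc_clamped \<gamma> a b s) * indicator {0..len \<gamma> a b} s \<le> g (arc_clamped \<gamma> a b s) * indicator {0..len \<gamma> a b} s"
  proof (cases "s \<in> {0..len \<gamma> a b}")
    case True
    then obtain t where "t \<in> {a..b}" "len \<gamma> a t = s" using len_surj[OF assms(1)] by blast
    then show ?thesis using assms(2)[of t] arc_clamped_len[OF assms(1), of t] by (simp add: mult_right_mono)
  qed simp
qed

text \<open>The final point has measure zero in the arclength parameter.\<close>

lemma line_integral_cong_except_end:
  assumes "rect_on \<gamma> a b" "\<And>t. t \<in> {a..<b} \<Longrightarrow> f (\<gamma> t) = g (\<gamma> t)"
  shows "line_integral f \<gamma> a b = line_integral g \<gamma> a b"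
  unfolding line_integral_arc_clamped[OF assms(1)]
proof (intro nn_integral_cong_AE)
  show "AE s in lborel. f (arc_clamped \<gamma> a b s) * indicator {0..len \<gamma> a b} s = g (arc_clamped \<gamma> a b s) * indicator {0..len \<gamma> a b} s"
    using AE_lborel_singleton[of "len \<gamma> a b"]
  proof eventually_elim
    case (elim s)
    show ?case
    proof (cases "s \<in> {0..len \<gamma> a b}")
      case True
      then obtain t where t: "t \<in> {a..b}" "len \<gamma> a t = s" using len_surj[OF assms(1)] by blast
      then have "t \<noteq> b" using elim by auto
      then show ?thesis using t assms(2)[of t] arc_clamped_len[OF assms(1), of t] by simp
    qed simp
  qed
qed

lemma line_integral_cmult:
  assumes "rect_on \<gamma> a b" "f \<in> borel_measurable borel"
  shows "line_integral (\<lambda>x. c * f x) \<gamma> a b = c * line_integral f \<gamma> a b"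
proof -
  have [measurable]: "(\<lambda>s. f (arc_clamped \<gamma> a b s)) \<in> borel_measurable borel"
    using measurable_compose[OF measurable_arc_clamped[OF assms(1)] assms(2)] .
  show ?thesis
    unfolding line_integral_arc_clamped[OF assms(1)]
    by (subst nn_integral_cmult[symmetric]) (auto simp: mult.assoc)
qed

lemma line_integral_const: "rect_on \<gamma> a b \<Longrightarrow> line_integral (\<lambda>_. c) \<gamma> a b = c * curve_length \<gamma> a b"
  using len_nonneg[of \<gamma> a b]
  by (simp add: line_integral_arc_clamped nn_integral_cmult_indicator curve_length_eq_len rect_on_def)

lemma line_integral_SUP:
  assumes "rect_on \<gamma> a b" "\<And>i::nat. f i \<in> borel_measurable borel" "\<And>x. mono (\<lambda>i. f i x)"
  shows "line_integral (\<lambda>x. SUP i. f i x) \<gamma> a b = (SUP i. line_integral (f i) \<gamma> a b)"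
proof -
  have [measurable]: "(\<lambda>s. f i (arc_clamped \<gamma> a b s)) \<in> borel_measurable borel" for i
    using measurable_compose[OF measurable_arc_clamped[OF assms(1)] assms(2)] .
  have "(\<integral>\<^sup>+s. (SUP i. f i (arc_clamped \<gamma> a b s) * indicator {0..len \<gamma> a b} s) \<partial>lborel) =
     (SUP i. \<integral>\<^sup>+s. f i (arc_clamped \<gamma> a b s) * indicator {0..len \<gamma> a b} s \<partial>lborel)"
    using assms(3) by (intro nn_integral_monotone_convergence_SUP)
      (auto simp: incseq_def le_fun_def mono_def intro!: mult_right_mono)
  then show ?thesis
    unfolding line_integral_arc_clamped[OF assms(1)] by (simp add: SUP_mult_right_ennreal)
qed

lemma line_integral_length_zero:
  assumes r: "rect_on \<gamma> a b" and z: "curve_length \<gamma> a b = 0"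
  shows "line_integral f \<gamma> a b = 0"
proof -
  have l: "len \<gamma> a b = 0" using z by (simp add: len_def)
  have "(\<integral>\<^sup>+s. f (arc_clamped \<gamma> a b s) * indicator {0..0} s \<partial>lborel) = (\<integral>\<^sup>+(s::real). 0 \<partial>lborel)"
  proof (rule nn_integral_cong_AE)
    show "AE s in lborel. f (arc_clamped \<gamma> a b s) * indicator {0..0} s = 0"
      using AE_lborel_singleton[of "0::real"] by eventually_elim auto
  qed
  then show ?thesis unfolding line_integral_arc_clamped[OF r] l by simp
qed

text \<open>Absolute continuity of the integral at the initial point.\<close>

lemma line_integral_small_start:
  assumes r: "rect_on \<gamma> a b" and f: "f \<in> borel_measurable borel"
    and fin: "line_integral f \<gamma> a b < \<infinity>" and e: "\<epsilon> > 0"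
  obtains \<delta> where "\<delta> > 0" "\<And>s. a \<le> s \<Longrightarrow> s \<le> b \<Longrightarrow> s \<le> a + \<delta> \<Longrightarrow> line_integral f \<gamma> a s < \<epsilon>"
proof -
  let ?l = "len \<gamma> a b" and ?c = "arc_clamped \<gamma> a b"
  have ab: "a \<le> b" using r by (simp add: rect_on_def)
  have [measurable]: "(\<lambda>s. f (?c s)) \<in> borel_measurable borel"
    using measurable_compose[OF measurable_arc_clamped[OF r] f] .
  define M where "M = density lborel (\<lambda>s. f (?c s) * indicator {0..?l} s)"
  define A where "A n = {0..1 / real (Suc n)}" for n
  have M: "emeasure M X = (\<integral>\<^sup>+s\<in>X. f (?c s) * indicator {0..?l} s \<partial>lborel)" if "X \<in> sets borel" for X
    unfolding M_def using that by (intro emeasure_density) auto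
  have "(\<lambda>n. emeasure M (A n)) \<longlonglongrightarrow> emeasure M (\<Inter>n. A n)"
  proof (rule Lim_emeasure_decseq)
    show "range A \<subseteq> sets M" by (auto simp: A_def M_def)
    show "decseq A" by (auto simp: decseq_def A_def intro: order_trans divide_left_mono)
    fix i
    have "emeasure M (A i) \<le> line_integral f \<gamma> a b"
      unfolding line_integral_arc_clamped[OF r] by (subst M) (auto simp: A_def indicator_def intro!: nn_integral_mono)
    then show "emeasure M (A i) \<noteq> \<infinity>" using fin by (auto simp: top_unique)
  qed
  moreover have "(\<Inter>n. A n) = {0}"
  proof -
    have "x = 0" if "\<And>n. x \<in> A n" for x
    proof (rule ccontr)
      assume "x \<noteq> 0"
      then have "x > 0" using that[of 0] by (auto simp: A_def)
      then obtain n where "inverse (real (Suc n)) < x" using reals_Archimedean by blast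
      then show False using that[of n] by (auto simp: A_def inverse_eq_divide)
    qed
    then show ?thesis by (auto simp: A_def)
  qed
  moreover have "emeasure M {0} = 0"
  proof -
    have "emeasure M {0} = (\<integral>\<^sup>+s. 0 \<partial>lborel)"
      using AE_lborel_singleton[of "0::real"] by (subst M) (auto intro!: nn_integral_cong_AE)
    then show ?thesis by simp
  qed
  ultimately have "(\<lambda>n. emeasure M (A n)) \<longlonglongrightarrow> 0" by simp
  then have "eventually (\<lambda>n. emeasure M (A n) < \<epsilon>) sequentially" using e by (rule order_tendstoD)
  then obtain n where n: "emeasure M (A n) < \<epsilon>" by (auto simp: eventually_sequentially)
  have "continuous_on {a..b} (len \<gamma> a)" by (rule continuous_on_len[OF r])
  then obtain d where d: "d > 0" "\<And>x. x \<in> {a..b} \<Longrightarrow> dist x a < d \<Longrightarrow> dist (len \<gamma> a x) (len \<gamma> a a) < 1 / real (Suc n)"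
    unfolding continuous_on_iff using ab by (metis atLeastAtMost_iff divide_pos_pos of_nat_0_less_iff order_refl zero_less_Suc zero_less_one)
  show ?thesis
  proof (rule that[of "d/2"])
    fix s assume s: "a \<le> s" "s \<le> b" "s \<le> a + d/2"
    then have "len \<gamma> a s < 1 / real (Suc n)" using d(1) d(2)[of s] by (auto simp: dist_real_def)
    moreover have "len \<gamma> a s \<le> ?l" using s by (intro len_mono[OF r]) auto
    moreover have "line_integral f \<gamma> a s = (\<integral>\<^sup>+x\<in>{0..len \<gamma> a s}. f (?c x) \<partial>lborel)"
      using s by (intro line_integral_eqI rect_on_subinterval[OF r] arc_clamped_len[OF r]) auto
    ultimately have "line_integral f \<gamma> a s \<le> emeasure M (A n)"
      by (subst M) (auto simp: A_def indicator_def intro!: nn_integral_mono)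
    then show "line_integral f \<gamma> a s < \<epsilon>" using n by (rule le_less_trans)
  qed (use d in simp)
qed

section \<open>Lower semicontinuous weights\<close>

definition lsc :: "('a::metric_space \<Rightarrow> ennreal) \<Rightarrow> bool" where
  "lsc w \<longleftrightarrow> (\<forall>a. open {x. a < w x})"

lemma lsc_measurable: "lsc w \<Longrightarrow> w \<in> borel_measurable borel"
  unfolding lsc_def by (intro borel_measurableI_greater) (auto intro: borel_open)

lemma lsc_SUP: "(\<And>i. i \<in> I \<Longrightarrow> lsc (w i)) \<Longrightarrow> lsc (\<lambda>x. SUP i\<in>I. w i x)"
proof -
  assume *: "\<And>i. i \<in> I \<Longrightarrow> lsc (w i)"
  have "{x. a < (SUP i\<in>I. w i x)} = (\<Union>i\<in>I. {x. a < w i x})" for a by (auto simp: less_SUP_iff)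
  then show ?thesis using * by (auto simp: lsc_def)
qed

lemma lsc_max:
  assumes "lsc v" "lsc w"
  shows "lsc (\<lambda>x. max (v x) (w x))"
  using assms by (simp add: lsc_def less_max_iff_disj Collect_disj_eq open_Un)

lemma lsc_const: "lsc (\<lambda>_. c)"
  by (simp add: lsc_def)

lemma lsc_mult_indicator:
  assumes "lsc w" "open G"
  shows "lsc (\<lambda>x. w x * indicator G x)"
  unfolding lsc_def
proof
  fix a :: ennreal
  have "{x. a < w x * indicator G x} = G \<inter> {x. a < w x}" by (auto simp: indicator_def)
  then show "open {x. a < w x * indicator G x}" using assms by (simp add: lsc_def open_Int)
qed

lemma lsc_cmult:
  assumes w: "lsc w" and c: "c > 0"
  shows "lsc (\<lambda>x. ennreal c * w x)"
  unfolding lsc_def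
proof
  fix a :: ennreal
  have "a < ennreal c * y \<longleftrightarrow> a / ennreal c < y" for y
    using c divide_less_ennreal[of "ennreal c" a y] by (simp add: mult.commute)
  then show "open {x. a < ennreal c * w x}" using w by (simp add: lsc_def)
qed

text \<open>Moreau--Yosida regularization: the infimal convolution with \<open>(m+1) dist\<close> is Lipschitz and
  increases to the weight.\<close>

lemma lsc_lipschitz_approx:
  fixes w :: "'a::metric_space \<Rightarrow> ennreal"
  assumes w: "lsc w" and w1: "\<And>x. 1 \<le> w x"
  obtains v :: "nat \<Rightarrow> 'a \<Rightarrow> real" where
    "\<And>m x. 1 \<le> v m x" "\<And>m x y. \<bar>v m x - v m y\<bar> \<le> (real m + 1) * dist x y"
    "\<And>x. mono (\<lambda>m. v m x)" "\<And>x. w x = (SUP m. ennreal (v m x))"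
proof -
  define u where "u m x = enn2real (min (w x) (ennreal (real m + 1)))" for m x
  have u1: "1 \<le> u m x" for m x
  proof -
    have "ennreal 1 \<le> min (w x) (ennreal (real m + 1))" using w1[of x] by (simp del: ennreal_1 flip: ennreal_1)
    then have "enn2real (ennreal 1) \<le> enn2real (min (w x) (ennreal (real m + 1)))"
      by (rule enn2real_mono) (simp add: min_less_iff_disj)
    then show ?thesis by (simp add: u_def)
  qed
  have eu: "ennreal (u m x) = min (w x) (ennreal (real m + 1))" for m x
    unfolding u_def by (rule ennreal_enn2real) (simp add: min_less_iff_disj)
  have um: "u m x \<le> u m' x" if "m \<le> m'" for m m' x
  proof -
    have "ennreal (u m x) \<le> ennreal (u m' x)" unfolding eu using that by (intro min.mono) (auto intro: ennreal_leI)
    then show ?thesis using u1[of m' x] by (subst (asm) ennreal_le_iff) auto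
  qed
  define v where "v m x = (INF y. u m y + (real m + 1) * dist x y)" for m x
  have bdd: "bdd_below (range (\<lambda>y. u m y + (real m + 1) * dist x y))" for m x
    using u1 by (intro bdd_belowI[of _ 0]) (auto intro!: add_nonneg_nonneg order_trans[OF _ u1])
  have vle: "v m x \<le> u m y + (real m + 1) * dist x y" for m x y
    unfolding v_def by (rule cINF_lower[OF bdd]) simp
  have v1: "1 \<le> v m x" for m x
    unfolding v_def
  proof (rule cINF_greatest)
    fix y
    have "0 \<le> (real m + 1) * dist x y" by simp
    then show "1 \<le> u m y + (real m + 1) * dist x y" using u1[of m y] by linarith
  qed simp
  have lip: "v m x \<le> v m y + (real m + 1) * dist x y" for m x y
  proof -
    have "v m x - (real m + 1) * dist x y \<le> v m y"
      unfolding v_def[of m y]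
    proof (rule cINF_greatest)
      fix z
      have "(real m + 1) * dist x z \<le> (real m + 1) * (dist x y + dist y z)"
        by (intro mult_left_mono dist_triangle) simp
      then show "v m x - (real m + 1) * dist x y \<le> u m z + (real m + 1) * dist y z"
        using vle[of m x z] by (simp add: distrib_left)
    qed simp
    then show ?thesis by simp
  qed
  have mono: "v m x \<le> v m' x" if "m \<le> m'" for m m' x
    unfolding v_def[of m' x]
  proof (rule cINF_greatest)
    fix y
    have "(real m + 1) * dist x y \<le> (real m' + 1) * dist x y" using that by (intro mult_right_mono) auto
    then show "v m x \<le> u m' y + (real m' + 1) * dist x y"
      using vle[of m x y] um[OF that, of y] by linarith
  qed simp
  show ?thesis
  proof (rule that[of v])
    fix m x y
    show "\<bar>v m x - v m y\<bar> \<le> (real m + 1) * dist x y"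
      using lip[of m x y] lip[of m y x] by (simp add: dist_commute abs_le_iff)
  next
    fix x
    show "w x = (SUP m. ennreal (v m x))"
    proof (rule antisym)
      show "(SUP m. ennreal (v m x)) \<le> w x"
      proof (rule SUP_least)
        fix m
        have "v m x \<le> u m x" using vle[of m x x] by simp
        then have "ennreal (v m x) \<le> min (w x) (ennreal (real m + 1))" unfolding eu[symmetric] by (rule ennreal_leI)
        then show "ennreal (v m x) \<le> w x" by simp
      qed
      show "w x \<le> (SUP m. ennreal (v m x))"
      proof (rule dense_le)
        fix a assume a: "a < w x"
        then obtain b where b: "a = ennreal b" "b \<ge> 0" by (cases a) auto
        have "open {y. a < w y}" using w by (simp add: lsc_def)
        then obtain r where r: "r > 0" "ball x r \<subseteq> {y. a < w y}" using a by (auto elim: openE)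
        obtain m :: nat where m: "b / r \<le> real m" "b \<le> real m"
          using real_arch_simple[of "max (b / r) b"] by auto
        have "b \<le> v m x"
          unfolding v_def
        proof (rule cINF_greatest)
          fix y
          show "b \<le> u m y + (real m + 1) * dist x y"
          proof (cases "dist x y < r")
            case True
            then have "a < w y" using r by (auto simp: mem_ball)
            then have "ennreal b \<le> ennreal (u m y)" unfolding eu b using m(2) by (intro min.boundedI ennreal_leI) auto
            then have "b \<le> u m y" using u1[of m y] by (subst (asm) ennreal_le_iff) auto
            then show ?thesis by (simp add: add_increasing2)
          next
            case False
            have "b \<le> real m * r" using m r by (simp add: pos_divide_le_eq)
            also have "\<dots> \<le> (real m + 1) * dist x y" using False r by (intro mult_mono) auto
            finally show ?thesis using u1[of m y] by linarith
          qed
        qed simp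
        then have "a \<le> ennreal (v m x)" unfolding b by (rule ennreal_leI)
        also have "\<dots> \<le> (SUP m. ennreal (v m x))" by (rule SUP_upper) simp
        finally show "a \<le> (SUP m. ennreal (v m x))" .
      qed
    qed
  qed (auto simp: v1 mono mono_def)
qed

section \<open>Limits of chains and of curves\<close>

text \<open>A countable power of a compact metric space is metrizable and compact, hence sequentially compact.\<close>

lemma compact_product_subsequence:
  fixes f :: "nat \<Rightarrow> 'i::countable \<Rightarrow> 'a::metric_space"
  assumes Q: "compact Q" and f: "\<And>m i. f m i \<in> Q"
  obtains r g where "strict_mono (r :: nat \<Rightarrow> nat)" "\<And>i. g i \<in> Q" "\<And>i. (\<lambda>k. f (r k) i) \<longlonglongrightarrow> g i"
proof -
  have "compactin (product_topology (\<lambda>_. euclidean) UNIV) (PiE (UNIV :: 'i set) (\<lambda>_. Q))"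
    unfolding compactin_PiE using Q by simp
  then have "compact (PiE (UNIV :: 'i set) (\<lambda>_. Q))"
    by (simp only: euclidean_product_topology compactin_euclidean_iff)
  then have "seq_compact (PiE (UNIV :: 'i set) (\<lambda>_. Q))" by (simp only: compact_eq_seq_compact_metric)
  moreover have "\<forall>m. f m \<in> PiE UNIV (\<lambda>_. Q)" using f by auto
  ultimately obtain g r where g: "g \<in> PiE UNIV (\<lambda>_. Q)" "strict_mono (r :: nat \<Rightarrow> nat)" "(f \<circ> r) \<longlonglongrightarrow> g"
    by (rule seq_compactE)
  show ?thesis
  proof (rule that[OF g(2)])
    fix i
    show "g i \<in> Q" using g(1) by auto
    have "continuous_on UNIV (\<lambda>h::'i \<Rightarrow> 'a. h i)" by (rule continuous_on_product_coordinates)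
    from continuous_on_tendsto_compose[OF this g(3)] have "(\<lambda>k. (f \<circ> r) k i) \<longlonglongrightarrow> g i" by simp
    then show "(\<lambda>k. f (r k) i) \<longlonglongrightarrow> g i" by simp
  qed
qed

text \<open>An Arzela--Ascoli argument for maps that are Lipschitz up to a vanishing error; it applies
  to step functions.\<close>

lemma asymptotically_lipschitz_subsequence:
  fixes c :: "nat \<Rightarrow> real \<Rightarrow> 'a::metric_space"
  assumes Q: "compact Q" and c: "\<And>m s. s \<in> {0..1} \<Longrightarrow> c m s \<in> Q"
    and e: "e \<longlonglongrightarrow> 0" and K: "K \<ge> 0"
    and lip: "\<And>m s t. s \<in> {0..1} \<Longrightarrow> t \<in> {0..1} \<Longrightarrow> dist (c m s) (c m t) \<le> e m + K * \<bar>s - t\<bar>"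
  obtains r \<gamma> where "strict_mono (r :: nat \<Rightarrow> nat)" "\<And>s. s \<in> {0..1} \<Longrightarrow> \<gamma> s \<in> Q"
    "\<And>s. s \<in> {0..1} \<Longrightarrow> (\<lambda>k. c (r k) s) \<longlonglongrightarrow> \<gamma> s"
proof -
  \<comment> \<open>The subsequence is chosen to converge at all rational parameters, clamped to the unit interval.\<close>
  define h :: "rat \<Rightarrow> real" where "h q = max 0 (min 1 (of_rat q))" for q
  have h: "h q \<in> {0..1}" for q by (auto simp: h_def)
  obtain r g where r: "strict_mono (r :: nat \<Rightarrow> nat)" and "\<And>q. g q \<in> Q"
    and g: "\<And>q. (\<lambda>k. c (r k) (h q)) \<longlonglongrightarrow> g q"
    by (rule compact_product_subsequence[OF Q, of "\<lambda>m q. c m (h q)", OF c[OF h]]) (rule that)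
  have er: "(\<lambda>k. e (r k)) \<longlonglongrightarrow> 0" using LIMSEQ_subseq_LIMSEQ[OF e r] by (simp add: o_def)
  have "\<exists>l\<in>Q. (\<lambda>k. c (r k) s) \<longlonglongrightarrow> l" if s: "s \<in> {0..1}" for s
  proof -
    have "Cauchy (\<lambda>k. c (r k) s)"
      unfolding Cauchy_altdef2
    proof (intro allI impI)
      fix \<epsilon> :: real assume \<epsilon>: "\<epsilon> > 0"
      define \<delta> where "\<delta> = \<epsilon> / (6 * (K + 1))"
      have \<delta>: "\<delta> > 0" "K * \<delta> \<le> \<epsilon>/6" using \<epsilon> K by (auto simp: \<delta>_def field_simps)
      obtain q where q: "s - \<delta> < of_rat q" "of_rat q < s + \<delta>"
        using of_rat_dense[of "s - \<delta>" "s + \<delta>"] \<delta> by auto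
      have "\<bar>s - max 0 (min 1 x)\<bar> \<le> \<delta>" if "s - \<delta> < x" "x < s + \<delta>" for x
        using that s by (auto simp: max_def min_def)
      with q have "\<bar>s - h q\<bar> \<le> \<delta>" unfolding h_def by blast
      then have Kq: "K * \<bar>s - h q\<bar> \<le> \<epsilon>/6" using \<delta> K mult_left_mono[of "\<bar>s - h q\<bar>" \<delta> K] by linarith
      have "eventually (\<lambda>k. e (r k) < \<epsilon>/6) sequentially" using er \<epsilon> by (intro order_tendstoD) auto
      moreover have "eventually (\<lambda>k. dist (c (r k) (h q)) (g q) < \<epsilon>/6) sequentially" using g[of q] \<epsilon> by (intro tendstoD) auto
      ultimately have "eventually (\<lambda>k. dist (c (r k) s) (g q) < \<epsilon>/2) sequentially"
      proof eventually_elim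
        case (elim k)
        have "dist (c (r k) s) (g q) \<le> dist (c (r k) s) (c (r k) (h q)) + dist (c (r k) (h q)) (g q)"
          by (rule dist_triangle)
        then show ?case using lip[OF s h, of "r k" q] elim Kq by linarith
      qed
      then obtain N where N: "\<And>k. k \<ge> N \<Longrightarrow> dist (c (r k) s) (g q) < \<epsilon>/2" by (auto simp: eventually_sequentially)
      show "\<exists>N. \<forall>n\<ge>N. dist (c (r n) s) (c (r N) s) < \<epsilon>"
      proof (intro exI allI impI)
        fix n assume "N \<le> n"
        then show "dist (c (r n) s) (c (r N) s) < \<epsilon>"
          using dist_triangle_half_l[OF N[of n] N[of N]] by simp
      qed
    qed
    moreover have "\<forall>k. c (r k) s \<in> Q" using c[OF s] by simp
    ultimately show ?thesis
      using compact_imp_complete[OF Q] unfolding complete_def by (elim allE[of _ "\<lambda>k. c (r k) s"]) simp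
  qed
  then have "\<forall>s\<in>{0..1}. \<exists>l. l \<in> Q \<and> (\<lambda>k. c (r k) s) \<longlonglongrightarrow> l" by blast
  from bchoice[OF this] obtain \<gamma> where "\<forall>s\<in>{0..1}. \<gamma> s \<in> Q \<and> (\<lambda>k. c (r k) s) \<longlonglongrightarrow> \<gamma> s" ..
  then show ?thesis using that[OF r, of \<gamma>] by simp
qed

lemma lipschitz_measurable:
  fixes v :: "'a::metric_space \<Rightarrow> real"
  assumes lip: "\<And>x y. \<bar>v x - v y\<bar> \<le> L * dist x y"
  shows "v \<in> borel_measurable borel"
proof -
  have "\<bar>v x - v y\<bar> \<le> \<bar>L\<bar> * dist x y" for x y
    using lip[of x y] mult_right_mono[OF abs_ge_self[of L], of "dist x y"] by simp
  then have "\<bar>L\<bar>-lipschitz_on UNIV v" by (intro lipschitz_onI) (simp_all add: dist_real_def)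
  then show ?thesis by (intro borel_measurable_continuous_onI lipschitz_on_continuous_on)
qed

text \<open>The assumption \<open>vd\<close> bounds the speed at \<open>\<gamma> s\<close> by \<open>M / v (\<gamma> s)\<close>, up to first order errors. Sum over
  short intervals, on which \<open>v\<close> is nearly constant.\<close>

lemma line_integral_le_if_weighted_speed:
  fixes v :: "'a::metric_space \<Rightarrow> real"
  assumes v1: "\<And>x. 1 \<le> v x" and L: "L \<ge> 0" and lip: "\<And>x y. \<bar>v x - v y\<bar> \<le> L * dist x y" and M: "M \<ge> 0"
    and d: "\<And>s t. 0 \<le> s \<Longrightarrow> s \<le> t \<Longrightarrow> t \<le> 1 \<Longrightarrow> dist (\<gamma> s) (\<gamma> t) \<le> M * (t - s)"
    and vd: "\<And>s t. 0 \<le> s \<Longrightarrow> s \<le> t \<Longrightarrow> t \<le> 1 \<Longrightarrow> (v (\<gamma> s) - L * (M * (t - s))) * dist (\<gamma> s) (\<gamma> t) \<le> M * (t - s)"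
    and r: "rect_on \<gamma> 0 1"
  shows "line_integral (\<lambda>x. ennreal (v x)) \<gamma> 0 1 \<le> ennreal M"
proof -
  have vm: "(\<lambda>x. ennreal (v x)) \<in> borel_measurable borel" using lipschitz_measurable[OF lip] by measurable
  have main: "line_integral (\<lambda>x. ennreal (v x)) \<gamma> 0 1 \<le> ennreal (M * (1 + 6 * (L * M / real N)))"
    if N: "N > 0" "4 * (L * M) \<le> real N" for N :: nat
  proof -
    define h where "h = 1 / real N"
    define x where "x = L * M * h"
    have h: "h > 0" "real N * h = 1" using N by (auto simp: h_def)
    have x: "0 \<le> x" "x \<le> 1/4" using N L M by (auto simp: x_def h_def field_simps)
    have piece: "line_integral (\<lambda>x. ennreal (v x)) \<gamma> a (a + h) \<le> ennreal (M * h * (1 + 6 * x))"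
      if a: "0 \<le> a" "a + h \<le> 1" for a
    proof -
      \<comment> \<open>On a piece of length \<open>h\<close> the values of \<open>v\<close> along \<open>\<gamma>\<close> differ from \<open>W\<close> by at most \<open>x\<close>, so the piece
        has length at most \<open>M h / (W - 2 x)\<close> and weighted length at most \<open>(W + x) M h / (W - 2 x)\<close>.\<close>
      define W where "W = v (\<gamma> a)"
      have W: "W \<ge> 1" using v1 by (simp add: W_def)
      have vW: "\<bar>v (\<gamma> s) - W\<bar> \<le> x" if s: "a \<le> s" "s \<le> a + h" for s
      proof -
        have "dist (\<gamma> a) (\<gamma> s) \<le> M * (s - a)" using s a by (intro d) auto
        also have "\<dots> \<le> M * h" using s M by (intro mult_left_mono) auto
        finally have "L * dist (\<gamma> a) (\<gamma> s) \<le> L * (M * h)" using L by (rule mult_left_mono)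
        then show ?thesis using lip[of "\<gamma> s" "\<gamma> a"] by (simp add: W_def x_def dist_commute mult.assoc)
      qed
      define F where "F = (\<lambda>t. M / (W - 2 * x) * t)"
      have dF: "dist (\<gamma> s) (\<gamma> t) \<le> F t - F s" if st: "a \<le> s" "s \<le> t" "t \<le> a + h" for s t
      proof -
        have "L * (M * (t - s)) \<le> x" unfolding x_def mult.assoc using st L M by (intro mult_left_mono) auto
        then have "W - 2 * x \<le> v (\<gamma> s) - L * (M * (t - s))" using vW[of s] st by linarith
        then have "(W - 2 * x) * dist (\<gamma> s) (\<gamma> t) \<le> (v (\<gamma> s) - L * (M * (t - s))) * dist (\<gamma> s) (\<gamma> t)"
          by (rule mult_right_mono) simp
        also have "\<dots> \<le> M * (t - s)" using st a by (intro vd) auto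
        finally have "dist (\<gamma> s) (\<gamma> t) \<le> M * (t - s) / (W - 2 * x)"
          using W x by (simp add: pos_le_divide_eq mult.commute)
        then show ?thesis by (simp add: F_def right_diff_distrib diff_divide_distrib)
      qed
      have "curve_length \<gamma> a (a + h) \<le> ennreal (F (a + h) - F a)"
        using h dF by (intro curve_length_le_increment) auto
      also have "F (a + h) - F a = M * h / (W - 2 * x)" by (simp add: F_def distrib_left add_divide_distrib)
      finally have len: "curve_length \<gamma> a (a + h) \<le> ennreal (M * h / (W - 2 * x))" .
      have ra: "rect_on \<gamma> a (a + h)" using a h by (intro rect_on_subinterval[OF r]) auto
      have "line_integral (\<lambda>x. ennreal (v x)) \<gamma> a (a + h) \<le> line_integral (\<lambda>_. ennreal (W + x)) \<gamma> a (a + h)"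
      proof (intro line_integral_mono ra ennreal_leI)
        fix t assume "t \<in> {a..a + h}"
        then show "v (\<gamma> t) \<le> W + x" using vW[of t] by (simp add: abs_le_iff)
      qed
      also have "\<dots> = ennreal (W + x) * curve_length \<gamma> a (a + h)" by (rule line_integral_const[OF ra])
      also have "\<dots> \<le> ennreal (W + x) * ennreal (M * h / (W - 2 * x))" using len by (rule mult_left_mono) simp
      also have "\<dots> = ennreal (M * h * ((W + x) / (W - 2 * x)))"
        using W x by (subst ennreal_mult'[symmetric]) (simp_all add: mult_ac)
      also have "\<dots> \<le> ennreal (M * h * (1 + 6 * x))"
      proof (intro ennreal_leI mult_left_mono)
        have "W + x \<le> (1 + 6 * x) * (W - 2 * x)"
        proof -
          have "x * (6 * W - 12 * x - 3) \<ge> 0" using W x by (intro mult_nonneg_nonneg) auto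
          then show ?thesis by (simp add: algebra_simps)
        qed
        then show "(W + x) / (W - 2 * x) \<le> 1 + 6 * x" using W x by (simp add: pos_divide_le_eq)
      qed (use M h in auto)
      finally show ?thesis .
    qed
    have "line_integral (\<lambda>x. ennreal (v x)) \<gamma> 0 (real k * h) \<le> ennreal (real k * (M * h * (1 + 6 * x)))"
      if "k \<le> N" for k
      using that
    proof (induction k)
      case 0
      have "rect_on \<gamma> 0 0" by (rule rect_on_subinterval[OF r]) auto
      then show ?case by (simp add: line_integral_length_zero curve_length_refl)
    next
      case (Suc k)
      have k1: "real k * h + h \<le> 1"
      proof -
        have "real (Suc k) * h \<le> real N * h" using Suc.prems h by (intro mult_right_mono) auto
        then show ?thesis using h by (simp add: distrib_right)
      qed
      have k0: "0 \<le> real k * h" using h by simp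
      have eq: "real (Suc k) * h = real k * h + h" by (simp add: distrib_right)
      have nn: "0 \<le> M * h * (1 + 6 * x)" using M h x by simp
      have "line_integral (\<lambda>x. ennreal (v x)) \<gamma> 0 (real (Suc k) * h) =
        line_integral (\<lambda>x. ennreal (v x)) \<gamma> 0 (real k * h) + line_integral (\<lambda>x. ennreal (v x)) \<gamma> (real k * h) (real k * h + h)"
        unfolding eq using k0 k1 h by (intro line_integral_add vm rect_on_subinterval[OF r]) auto
      also have "\<dots> \<le> ennreal (real k * (M * h * (1 + 6 * x))) + ennreal (M * h * (1 + 6 * x))"
        using Suc by (intro add_mono piece k0 k1) auto
      also have "\<dots> = ennreal (real (Suc k) * (M * h * (1 + 6 * x)))"
        using nn by (subst ennreal_plus[symmetric]) (auto simp: distrib_right)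
      finally show ?case .
    qed
    from this[of N] have "line_integral (\<lambda>x. ennreal (v x)) \<gamma> 0 (real N * h) \<le> ennreal (real N * (M * h * (1 + 6 * x)))"
      by simp
    also have "real N * (M * h * (1 + 6 * x)) = (real N * h) * (M * (1 + 6 * x))" by (simp only: mult_ac)
    finally show ?thesis unfolding h(2) by (simp add: x_def h_def)
  qed
  have lim: "(\<lambda>N. ennreal (M * (1 + 6 * (L * M / real N)))) \<longlonglongrightarrow> ennreal (M * (1 + 6 * 0))"
    by (intro tendsto_intros lim_const_over_n)
  obtain N0 :: nat where N0: "4 * (L * M) \<le> real N0" using real_arch_simple by blast
  have "eventually (\<lambda>N. line_integral (\<lambda>x. ennreal (v x)) \<gamma> 0 1 \<le> ennreal (M * (1 + 6 * (L * M / real N)))) sequentially"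
    using eventually_ge_at_top[of "max 1 N0"]
  proof eventually_elim
    case (elim N)
    then show ?case using N0 by (intro main) auto
  qed
  from tendsto_lowerbound[OF lim this] show ?thesis by simp
qed

text \<open>Each chain is parametrized on \<open>{0..1}\<close> by its weighted length, as a step function. As the mesh
  vanishes, these step functions are Lipschitz up to a vanishing error, and the speed of the limit curve is
  controlled by the weight.\<close>

lemma chain_limit:
  fixes v :: "nat \<Rightarrow> 'a::metric_space \<Rightarrow> real" and p :: "nat \<Rightarrow> nat \<Rightarrow> 'a" and n :: "nat \<Rightarrow> nat"
  assumes Q: "compact Q"
    and v1: "\<And>m x. 1 \<le> v m x" and lip: "\<And>m x y. \<bar>v m x - v m y\<bar> \<le> (real m + 1) * dist x y"
    and vmono: "\<And>x. mono (\<lambda>m. v m x)" and w: "\<And>x. w x = (SUP m. ennreal (v m x))"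
    and p: "\<And>m i. i \<le> n m \<Longrightarrow> p m i \<in> Q"
    and mesh: "\<And>m i. i < n m \<Longrightarrow> dist (p m i) (p m (Suc i)) \<le> e m"
    and e: "e \<longlonglongrightarrow> 0" and e0: "\<And>m. e m > 0" and M: "M \<ge> 0"
    and wt: "\<And>m. (\<Sum>i<n m. v m (p m i) * dist (p m i) (p m (Suc i))) \<le> M + e m"
  obtains r \<gamma> where "strict_mono (r :: nat \<Rightarrow> nat)" "rect_on \<gamma> 0 1" "\<And>s. s \<in> {0..1} \<Longrightarrow> \<gamma> s \<in> Q"
    "\<And>s. s \<in> {0..1} \<Longrightarrow> \<exists>j. (\<forall>k. j k \<le> n (r k)) \<and> (\<lambda>k. p (r k) (j k)) \<longlonglongrightarrow> \<gamma> s"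
    "(\<lambda>k. p (r k) 0) \<longlonglongrightarrow> \<gamma> 0" "(\<lambda>k. p (r k) (n (r k))) \<longlonglongrightarrow> \<gamma> 1"
    "line_integral w \<gamma> 0 1 \<le> ennreal M"
proof -
  define \<delta> where "\<delta> m i = dist (p m i) (p m (Suc i))" for m i
  define \<sigma> where "\<sigma> m j = (\<Sum>i<j. v m (p m i) * \<delta> m i)" for m j
  define Mm where "Mm m = M + e m" for m
  have Mm: "Mm m > 0" for m using M e0[of m] by (simp add: Mm_def)
  have v0: "0 \<le> v m x" for m x using v1[of m x] by linarith
  have \<sigma>_mono: "\<sigma> m i \<le> \<sigma> m j" if "i \<le> j" for m i j
    unfolding \<sigma>_def using that v0 by (intro sum_mono2) (auto simp: \<delta>_def)
  have \<sigma>n: "\<sigma> m (n m) \<le> Mm m" for m using wt[of m] by (simp add: \<sigma>_def \<delta>_def Mm_def)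
  \<comment> \<open>The last vertex that is reached within weighted length \<open>s (M + e m)\<close>.\<close>
  define J where "J m s = Max {j. j \<le> n m \<and> \<sigma> m j \<le> s * Mm m}" for m s
  have J: "J m s \<le> n m" "\<sigma> m (J m s) \<le> s * Mm m" "\<And>j. j \<le> n m \<Longrightarrow> \<sigma> m j \<le> s * Mm m \<Longrightarrow> j \<le> J m s"
    if "s \<ge> 0" for m s
  proof -
    let ?S = "{j. j \<le> n m \<and> \<sigma> m j \<le> s * Mm m}"
    have fin: "finite ?S" by simp
    have "0 \<in> ?S" using that Mm[of m] by (simp add: \<sigma>_def)
    then have "J m s \<in> ?S" unfolding J_def by (intro Max_in) auto
    then show "J m s \<le> n m" "\<sigma> m (J m s) \<le> s * Mm m" by auto
    show "j \<le> J m s" if "j \<le> n m" "\<sigma> m j \<le> s * Mm m" for j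
      unfolding J_def using that by (intro Max_ge) auto
  qed
  define c where "c m s = p m (J m s)" for m s
  have cQ: "c m s \<in> Q" if "s \<in> {0..1}" for m s
    unfolding c_def using J(1)[of s m] that by (intro p) auto
  have chain_dist: "dist (p m i) (p m j) \<le> (\<Sum>l=i..<j. \<delta> m l)" if "i \<le> j" for m i j
    using that
  proof (induction j rule: dec_induct)
    case (step j)
    then show ?case using dist_triangle[of "p m i" "p m (Suc j)" "p m j"] by (simp add: \<delta>_def)
  qed simp
  \<comment> \<open>Between the parameters \<open>s < t\<close> lie a first jump, of length at most the mesh but of weighted length
    not controlled by \<open>t - s\<close>, and further jumps of total length \<open>D\<close>, whose weighted length is at most
    \<open>(M + e m) (t - s)\<close>.\<close>
  have key: "\<exists>D\<ge>0. dist (c m s) (c m t) \<le> e m + D \<and> D \<le> Mm m * (t - s) \<and>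
      (\<forall>k\<le>m. (v k (c m s) - (real k + 1) * (Mm m * (t - s) + e m)) * D \<le> Mm m * (t - s))"
    if st: "0 \<le> s" "s \<le> t" "t \<le> 1" for m s t
  proof -
    have t0: "0 \<le> t" using st by simp
    have JJ: "J m s \<le> J m t"
    proof (rule J(3)[OF t0])
      show "J m s \<le> n m" using J(1)[OF st(1)] .
      have "s * Mm m \<le> t * Mm m" using st Mm[of m] by (intro mult_right_mono) auto
      then show "\<sigma> m (J m s) \<le> t * Mm m" using J(2)[OF st(1), of m] by linarith
    qed
    have Ms: "0 \<le> Mm m * (t - s)" using Mm[of m] st by simp
    show ?thesis
    proof (cases "J m s = J m t")
      case True
      then show ?thesis using Ms e0[of m] by (intro exI[of _ 0]) (auto simp: c_def)
    next
      case False
      define a where "a = J m s"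
      define b where "b = J m t"
      have ab: "a < b" using False JJ by (simp add: a_def b_def)
      have bn: "b \<le> n m" using J(1)[OF t0] by (simp add: b_def)
      define D where "D = (\<Sum>l=Suc a..<b. \<delta> m l)"
      have D0: "D \<ge> 0" by (simp add: D_def \<delta>_def sum_nonneg)
      have "s * Mm m < \<sigma> m (Suc a)"
      proof (rule ccontr)
        assume "\<not> ?thesis"
        then have "Suc a \<le> a" unfolding a_def using ab bn J(3)[OF st(1), of "Suc (J m s)" m] by (auto simp: a_def)
        then show False by simp
      qed
      moreover have "\<sigma> m b \<le> t * Mm m" using J(2)[OF t0] by (simp add: b_def)
      moreover have "\<sigma> m b - \<sigma> m (Suc a) = (\<Sum>l=Suc a..<b. v m (p m l) * \<delta> m l)"
        unfolding \<sigma>_def lessThan_atLeast0 using ab by (subst sum_diff_nat_ivl) auto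
      ultimately have wsum: "(\<Sum>l=Suc a..<b. v m (p m l) * \<delta> m l) \<le> Mm m * (t - s)"
        by (simp add: right_diff_distrib mult.commute)
      have wB: "B * D \<le> Mm m * (t - s)" if "\<And>l. l \<in> {Suc a..<b} \<Longrightarrow> B \<le> v m (p m l)" for B
      proof -
        have "B * D = (\<Sum>l=Suc a..<b. B * \<delta> m l)" by (simp add: D_def sum_distrib_left)
        also have "\<dots> \<le> (\<Sum>l=Suc a..<b. v m (p m l) * \<delta> m l)"
          using that by (intro sum_mono mult_right_mono) (auto simp: \<delta>_def)
        finally show ?thesis using wsum by simp
      qed
      have DM: "D \<le> Mm m * (t - s)" using wB[of 1] v1 by simp
      have ea: "\<delta> m a \<le> e m" using mesh[of a m] ab bn by (simp add: \<delta>_def)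
      have split: "(\<Sum>l=a..<j. \<delta> m l) = \<delta> m a + (\<Sum>l=Suc a..<j. \<delta> m l)" if "a < j" for j
        using that by (simp add: sum.atLeast_Suc_lessThan)
      have dab: "dist (p m a) (p m b) \<le> e m + D"
        using chain_dist[of a b m] split[OF ab] ab ea by (simp add: D_def)
      have "(v k (p m a) - (real k + 1) * (Mm m * (t - s) + e m)) * D \<le> Mm m * (t - s)" if k: "k \<le> m" for k
      proof (rule wB)
        fix l assume l: "l \<in> {Suc a..<b}"
        have "dist (p m a) (p m l) \<le> \<delta> m a + (\<Sum>l=Suc a..<l. \<delta> m l)"
          using chain_dist[of a l m] split[of l] l by simp
        also have "(\<Sum>l=Suc a..<l. \<delta> m l) \<le> D"
          unfolding D_def using l by (intro sum_mono2) (auto simp: \<delta>_def)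
        finally have "dist (p m a) (p m l) \<le> Mm m * (t - s) + e m" using ea DM by linarith
        then have "(real k + 1) * dist (p m a) (p m l) \<le> (real k + 1) * (Mm m * (t - s) + e m)"
          by (intro mult_left_mono) auto
        moreover have "v k (p m l) \<le> v m (p m l)" using vmono k by (auto simp: mono_def)
        ultimately show "v k (p m a) - (real k + 1) * (Mm m * (t - s) + e m) \<le> v m (p m l)"
          using lip[of k "p m a" "p m l"] by linarith
      qed
      then show ?thesis using D0 dab DM by (intro exI[of _ D]) (auto simp: c_def a_def b_def)
    qed
  qed
  obtain E where E: "\<And>m. e m \<le> E"
  proof -
    have "Bseq e" using e by (intro convergent_imp_Bseq) (auto simp: convergent_def)
    then show ?thesis using that by (auto simp: Bseq_def abs_le_iff)
  qed
  have E0: "E > 0" using E[of 0] e0[of 0] by simp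
  have lipc: "dist (c m s) (c m t) \<le> e m + (M + E) * \<bar>s - t\<bar>" if st: "s \<in> {0..1}" "t \<in> {0..1}" for m s t
  proof -
    have *: "dist (c m s) (c m t) \<le> e m + (M + E) * (t - s)" if "0 \<le> s" "s \<le> t" "t \<le> 1" for s t
    proof -
      have "dist (c m s) (c m t) \<le> e m + Mm m * (t - s)" using key[OF that, of m] by force
      moreover have "Mm m * (t - s) \<le> (M + E) * (t - s)"
        using E[of m] that by (intro mult_right_mono) (auto simp: Mm_def)
      ultimately show ?thesis by linarith
    qed
    show ?thesis
    proof (cases "s \<le> t")
      case True
      then have "\<bar>s - t\<bar> = t - s" by simp
      then show ?thesis using *[of s t] st True by simp
    next
      case False
      then have "dist (c m t) (c m s) \<le> e m + (M + E) * (s - t)" using *[of t s] st by simp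
      then show ?thesis using False by (simp add: dist_commute)
    qed
  qed
  have ME: "0 \<le> M + E" using M E0 by simp
  obtain r \<gamma> where r: "strict_mono (r :: nat \<Rightarrow> nat)" and \<gamma>Q: "\<And>s. s \<in> {0..1} \<Longrightarrow> \<gamma> s \<in> Q"
    and lim: "\<And>s. s \<in> {0..1} \<Longrightarrow> (\<lambda>k. c (r k) s) \<longlonglongrightarrow> \<gamma> s"
    using asymptotically_lipschitz_subsequence[OF Q cQ e ME lipc] by metis
  have er: "(\<lambda>k. e (r k)) \<longlonglongrightarrow> 0" using LIMSEQ_subseq_LIMSEQ[OF e r] by (simp add: o_def)
  have Mr: "(\<lambda>k. Mm (r k)) \<longlonglongrightarrow> M" using tendsto_add[OF tendsto_const er, of M] by (simp add: Mm_def)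
  have d\<gamma>: "dist (\<gamma> s) (\<gamma> t) \<le> M * (t - s)" if st: "0 \<le> s" "s \<le> t" "t \<le> 1" for s t
  proof (rule LIMSEQ_le)
    show "(\<lambda>k. dist (c (r k) s) (c (r k) t)) \<longlonglongrightarrow> dist (\<gamma> s) (\<gamma> t)"
      using st by (intro tendsto_dist lim) auto
    show "(\<lambda>k. e (r k) + Mm (r k) * (t - s)) \<longlonglongrightarrow> M * (t - s)"
      using tendsto_add[OF er tendsto_mult_right[OF Mr, of "t - s"]] by simp
    show "\<exists>N. \<forall>k\<ge>N. dist (c (r k) s) (c (r k) t) \<le> e (r k) + Mm (r k) * (t - s)"
    proof (intro exI allI impI)
      fix k
      show "dist (c (r k) s) (c (r k) t) \<le> e (r k) + Mm (r k) * (t - s)" using key[OF st, of "r k"] by force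
    qed
  qed
  have vk_lim: "(\<lambda>i. v k (x i)) \<longlonglongrightarrow> v k l" if "x \<longlonglongrightarrow> l" for k and x :: "nat \<Rightarrow> 'a" and l
  proof (rule LIM_zero_cancel, rule tendsto_rabs_zero_cancel, rule tendsto_sandwich)
    show "\<forall>\<^sub>F i in sequentially. 0 \<le> \<bar>v k (x i) - v k l\<bar>" by simp
    show "\<forall>\<^sub>F i in sequentially. \<bar>v k (x i) - v k l\<bar> \<le> (real k + 1) * dist (x i) l" using lip by simp
    have "(\<lambda>i. dist (x i) l) \<longlonglongrightarrow> 0" using that by (rule tendsto_dist_iff[THEN iffD1])
    from tendsto_mult_left[OF this] show "(\<lambda>i. (real k + 1) * dist (x i) l) \<longlonglongrightarrow> 0" by simp
  qed simp
  have vd\<gamma>: "(v k (\<gamma> s) - (real k + 1) * (M * (t - s))) * dist (\<gamma> s) (\<gamma> t) \<le> M * (t - s)"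
    if st: "0 \<le> s" "s \<le> t" "t \<le> 1" for k s t
  proof (rule LIMSEQ_le)
    let ?B = "\<lambda>i. v k (c (r i) s) - (real k + 1) * (Mm (r i) * (t - s) + e (r i))"
    have cs: "(\<lambda>i. c (r i) s) \<longlonglongrightarrow> \<gamma> s" using st by (intro lim) auto
    have B: "?B \<longlonglongrightarrow> v k (\<gamma> s) - (real k + 1) * (M * (t - s) + 0)"
      by (intro tendsto_diff vk_lim cs tendsto_mult_left tendsto_add tendsto_mult_right Mr er)
    show "(\<lambda>i. ?B i * dist (c (r i) s) (c (r i) t)) \<longlonglongrightarrow>
        (v k (\<gamma> s) - (real k + 1) * (M * (t - s))) * dist (\<gamma> s) (\<gamma> t)"
      using st by (intro tendsto_mult tendsto_dist lim) (use B in simp_all)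
    show "(\<lambda>i. \<bar>?B i\<bar> * e (r i) + Mm (r i) * (t - s)) \<longlonglongrightarrow> M * (t - s)"
      using tendsto_add[OF tendsto_mult[OF tendsto_rabs[OF B] er] tendsto_mult_right[OF Mr, of "t - s"]] by simp
    show "\<exists>N. \<forall>i\<ge>N. ?B i * dist (c (r i) s) (c (r i) t) \<le> \<bar>?B i\<bar> * e (r i) + Mm (r i) * (t - s)"
    proof (intro exI allI impI)
      fix i assume "i \<ge> k"
      then have k: "k \<le> r i" using seq_suble[OF r, of i] by simp
      obtain D where D: "D \<ge> 0" "dist (c (r i) s) (c (r i) t) \<le> e (r i) + D" "?B i * D \<le> Mm (r i) * (t - s)"
        using key[OF st, of "r i"] k by blast
      have Ms: "0 \<le> Mm (r i) * (t - s)" using Mm[of "r i"] st by simp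
      show "?B i * dist (c (r i) s) (c (r i) t) \<le> \<bar>?B i\<bar> * e (r i) + Mm (r i) * (t - s)"
      proof (cases "?B i \<ge> 0")
        case True
        have "?B i * dist (c (r i) s) (c (r i) t) \<le> ?B i * (e (r i) + D)" by (rule mult_left_mono[OF D(2) True])
        also have "\<dots> = ?B i * e (r i) + ?B i * D" by (rule distrib_left)
        finally show ?thesis using D(3) True by simp
      next
        case False
        then have "?B i * dist (c (r i) s) (c (r i) t) \<le> 0" by (intro mult_nonpos_nonneg) auto
        moreover have "0 \<le> \<bar>?B i\<bar> * e (r i)" using e0[of "r i"] by simp
        ultimately show ?thesis using Ms by linarith
      qed
    qed
  qed
  have rect: "rect_on \<gamma> 0 1"
    unfolding rect_on_def
  proof (intro conjI)
    have "M-lipschitz_on {0..1} \<gamma>"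
    proof (rule lipschitz_onI)
      fix s t :: real assume st: "s \<in> {0..1}" "t \<in> {0..1}"
      show "dist (\<gamma> s) (\<gamma> t) \<le> M * dist s t"
      proof (cases "s \<le> t")
        case True
        then show ?thesis using d\<gamma>[of s t] st by (simp add: dist_real_def)
      next
        case False
        then have "dist (\<gamma> t) (\<gamma> s) \<le> M * (s - t)" using d\<gamma>[of t s] st by simp
        then show ?thesis using False by (simp add: dist_real_def dist_commute)
      qed
    qed (rule M)
    then show "continuous_on {0..1} \<gamma>" by (rule lipschitz_on_continuous_on)
    have "curve_length \<gamma> 0 1 \<le> ennreal (M * 1 - M * 0)"
      by (rule curve_length_le_increment) (auto dest: d\<gamma> simp: right_diff_distrib)
    then show "curve_length \<gamma> 0 1 < \<infinity>" by (rule le_less_trans) simp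
  qed simp
  have "line_integral (\<lambda>x. ennreal (v k x)) \<gamma> 0 1 \<le> ennreal M" for k
    by (rule line_integral_le_if_weighted_speed[where L = "real k + 1"])
      (use v1 lip M d\<gamma> vd\<gamma> rect in auto)
  moreover have "line_integral w \<gamma> 0 1 = (SUP k. line_integral (\<lambda>x. ennreal (v k x)) \<gamma> 0 1)"
  proof -
    have "(\<lambda>x. ennreal (v k x)) \<in> borel_measurable borel" for k using lipschitz_measurable[OF lip] by measurable
    moreover have "mono (\<lambda>k. ennreal (v k x))" for x using vmono[of x] by (auto simp: mono_def intro: ennreal_leI)
    moreover have "w = (\<lambda>x. SUP k. ennreal (v k x))" using w by blast
    ultimately show ?thesis using line_integral_SUP[OF rect, of "\<lambda>k x. ennreal (v k x)"] by simp
  qed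
  ultimately have I: "line_integral w \<gamma> 0 1 \<le> ennreal M" by (simp add: SUP_least)
  have c0: "c m 0 = p m 0" for m
  proof -
    have "dist (p m 0) (p m (J m 0)) \<le> (\<Sum>l=0..<J m 0. \<delta> m l)" by (rule chain_dist) simp
    also have "\<dots> \<le> (\<Sum>l=0..<J m 0. v m (p m l) * \<delta> m l)"
    proof (rule sum_mono)
      fix l
      show "\<delta> m l \<le> v m (p m l) * \<delta> m l" using mult_right_mono[OF v1[of m "p m l"], of "\<delta> m l"] by (simp add: \<delta>_def)
    qed
    also have "\<dots> \<le> 0" using J(2)[of 0 m] by (simp add: \<sigma>_def lessThan_atLeast0)
    finally show ?thesis by (simp add: c_def)
  qed
  have c1: "c m 1 = p m (n m)" for m
  proof -
    have "n m \<le> J m 1" using J(3)[of 1 "n m" m] \<sigma>n[of m] by simp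
    then show ?thesis using J(1)[of 1 m] by (simp add: c_def)
  qed
  show ?thesis
  proof (rule that[OF r rect \<gamma>Q])
    fix s :: real assume s: "s \<in> {0..1}"
    show "\<exists>j. (\<forall>k. j k \<le> n (r k)) \<and> (\<lambda>k. p (r k) (j k)) \<longlonglongrightarrow> \<gamma> s"
      using lim[OF s] J(1)[of s] s by (intro exI[of _ "\<lambda>k. J (r k) s"]) (auto simp: c_def)
  next
    show "(\<lambda>k. p (r k) 0) \<longlonglongrightarrow> \<gamma> 0" using lim[of 0] by (simp add: c0)
    show "(\<lambda>k. p (r k) (n (r k))) \<longlonglongrightarrow> \<gamma> 1" using lim[of 1] by (simp add: c1)
  qed (use I in auto)
qed

lemma line_integral_plus:
  assumes "rect_on \<gamma> a b" "f \<in> borel_measurable borel" "g \<in> borel_measurable borel"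
  shows "line_integral (\<lambda>x. f x + g x) \<gamma> a b = line_integral f \<gamma> a b + line_integral g \<gamma> a b"
proof -
  have [measurable]: "(\<lambda>s. f (arc_clamped \<gamma> a b s)) \<in> borel_measurable borel"
    "(\<lambda>s. g (arc_clamped \<gamma> a b s)) \<in> borel_measurable borel"
    using measurable_compose[OF measurable_arc_clamped[OF assms(1)]] assms(2,3) by blast+
  show ?thesis
    unfolding line_integral_arc_clamped[OF assms(1)]
    by (subst nn_integral_add[symmetric]) (auto simp: distrib_right)
qed

text \<open>The chain consists of the vertices of a fine subdivision. Between consecutive vertices \<open>v\<close> is nearly
  constant, and their distance is at most the length of the arc in between.\<close>

lemma chain_of_curve:
  fixes v :: "'a::metric_space \<Rightarrow> real"
  assumes r: "rect_on \<gamma> 0 1" and v0: "\<And>x. 0 \<le> v x" and L: "L \<ge> 0"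
    and lip: "\<And>x y. \<bar>v x - v y\<bar> \<le> L * dist x y" and e: "e > 0"
  obtains n :: nat where "n > 0"
    "\<And>i. i < n \<Longrightarrow> dist (\<gamma> (real i / real n)) (\<gamma> (real (Suc i) / real n)) \<le> e"
    "ennreal (\<Sum>i<n. v (\<gamma> (real i / real n)) * dist (\<gamma> (real i / real n)) (\<gamma> (real (Suc i) / real n)))
      \<le> line_integral (\<lambda>x. ennreal (v x)) \<gamma> 0 1 + ennreal e"
proof -
  define l where "l = len \<gamma> 0 1"
  have l: "l \<ge> 0" by (simp add: l_def len_nonneg)
  \<comment> \<open>Steps of length at most \<open>\<eta>\<close> cost an error of at most \<open>L \<eta>\<close> per unit of length.\<close>
  define \<eta> where "\<eta> = min e (e / (L * l + 1))"
  have Ll: "L * l + 1 > 0" using L l by (simp add: add_nonneg_pos)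
  have \<eta>: "\<eta> > 0" "\<eta> \<le> e" using e Ll by (auto simp: \<eta>_def)
  have \<eta>e: "L * \<eta> * l \<le> e"
  proof -
    have "\<eta> * (L * l + 1) \<le> e" using Ll by (simp add: \<eta>_def flip: pos_le_divide_eq)
    then show ?thesis using \<eta> by (simp add: algebra_simps)
  qed
  obtain \<delta> where \<delta>: "\<delta> > 0"
    "\<And>s s'. 0 \<le> s \<Longrightarrow> s \<le> s' \<Longrightarrow> s' \<le> 1 \<Longrightarrow> s' - s \<le> \<delta> \<Longrightarrow> curve_length \<gamma> s s' \<le> ennreal \<eta>"
    using curve_length_uniformly_small[of 0 1 \<gamma> \<eta>] r \<eta> unfolding rect_on_def by blast
  obtain n :: nat where n: "n > 0" "inverse (real n) < \<delta>" using reals_Archimedean[OF \<delta>(1)] by (metis zero_less_Suc)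
  define t where "t i = real i / real n" for i
  have t: "0 \<le> t i" "t i \<le> t (Suc i)" for i using n by (auto simp: t_def divide_right_mono)
  have t1: "t i \<le> 1" if "i \<le> n" for i using n that by (simp add: t_def)
  have tS: "t (Suc i) - t i \<le> \<delta>" for i using n by (simp add: t_def field_simps)
  have rr: "rect_on \<gamma> a b" if "0 \<le> a" "a \<le> b" "b \<le> 1" for a b using that by (intro rect_on_subinterval[OF r])
  have small: "len \<gamma> (t i) s \<le> \<eta>" if "i < n" "t i \<le> s" "s \<le> t (Suc i)" for i s
  proof -
    have "s \<le> 1" using that t1[of "Suc i"] by simp
    then have "curve_length \<gamma> (t i) s \<le> ennreal \<eta>" using that tS[of i] t[of i] by (intro \<delta>(2)) auto
    moreover have "curve_length \<gamma> (t i) s = ennreal (len \<gamma> (t i) s)"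
      using that t[of i] \<open>s \<le> 1\<close> by (intro curve_length_eq_len[OF r]) auto
    ultimately show ?thesis using \<eta> by simp
  qed
  have dl: "dist (\<gamma> (t i)) (\<gamma> s) \<le> len \<gamma> (t i) s" if "i < n" "t i \<le> s" "s \<le> t (Suc i)" for i s
    using that t1[of "Suc i"] t(1)[of i] by (intro dist_le_len rr) auto
  let ?v = "\<lambda>x. ennreal (v x)" and ?d = "\<lambda>i. dist (\<gamma> (t i)) (\<gamma> (t (Suc i)))"
  have vm: "?v \<in> borel_measurable borel" using lipschitz_measurable[OF lip] by measurable
  have piece: "ennreal (v (\<gamma> (t i)) * ?d i) \<le> line_integral ?v \<gamma> (t i) (t (Suc i)) + ennreal (L * \<eta> * len \<gamma> (t i) (t (Suc i)))"
    if i: "i < n" for i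
  proof -
    have ri: "rect_on \<gamma> (t i) (t (Suc i))" using t[of i] t1[of "Suc i"] i by (intro rr) auto
    have cl: "curve_length \<gamma> (t i) (t (Suc i)) = ennreal (len \<gamma> (t i) (t (Suc i)))"
      using t[of i] t1[of "Suc i"] i by (intro curve_length_eq_len[OF r]) auto
    have "ennreal (v (\<gamma> (t i)) * ?d i) \<le> ennreal (v (\<gamma> (t i)) * len \<gamma> (t i) (t (Suc i)))"
      using dl[OF i t(2) order_refl] v0 by (intro ennreal_leI mult_left_mono)
    also have "\<dots> = line_integral (\<lambda>_. ?v (\<gamma> (t i))) \<gamma> (t i) (t (Suc i))"
      using v0 by (simp add: line_integral_const[OF ri] cl ennreal_mult')
    also have "\<dots> \<le> line_integral (\<lambda>x. ?v x + ennreal (L * \<eta>)) \<gamma> (t i) (t (Suc i))"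
    proof (intro line_integral_mono ri)
      fix s assume s: "s \<in> {t i..t (Suc i)}"
      have "L * dist (\<gamma> (t i)) (\<gamma> s) \<le> L * \<eta>"
        using small[OF i, of s] dl[OF i, of s] s L by (intro mult_left_mono) auto
      then have "v (\<gamma> (t i)) \<le> v (\<gamma> s) + L * \<eta>" using lip[of "\<gamma> (t i)" "\<gamma> s"] by linarith
      then show "?v (\<gamma> (t i)) \<le> ?v (\<gamma> s) + ennreal (L * \<eta>)"
        using v0 L \<eta> ennreal_leI[of "v (\<gamma> (t i))" "v (\<gamma> s) + L * \<eta>"] by (simp add: ennreal_plus)
    qed
    also have "\<dots> = line_integral ?v \<gamma> (t i) (t (Suc i)) + ennreal (L * \<eta> * len \<gamma> (t i) (t (Suc i)))"
      using L \<eta> by (simp add: line_integral_plus[OF ri vm] line_integral_const[OF ri] cl ennreal_mult')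
    finally show ?thesis .
  qed
  have "ennreal (\<Sum>i<k. v (\<gamma> (t i)) * ?d i) \<le> line_integral ?v \<gamma> 0 (t k) + ennreal (L * \<eta> * len \<gamma> 0 (t k))"
    if "k \<le> n" for k
    using that
  proof (induction k)
    case (Suc k)
    then have k: "k < n" by simp
    have a: "line_integral ?v \<gamma> 0 (t (Suc k)) = line_integral ?v \<gamma> 0 (t k) + line_integral ?v \<gamma> (t k) (t (Suc k))"
      using t[of k] t1[of "Suc k"] Suc.prems by (intro line_integral_add vm rr) auto
    have b: "len \<gamma> 0 (t (Suc k)) = len \<gamma> 0 (t k) + len \<gamma> (t k) (t (Suc k))"
      using t[of k] t1[of "Suc k"] Suc.prems by (intro len_add rr) auto
    have "ennreal (\<Sum>i<Suc k. v (\<gamma> (t i)) * ?d i) = ennreal (\<Sum>i<k. v (\<gamma> (t i)) * ?d i) + ennreal (v (\<gamma> (t k)) * ?d k)"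
      using v0 by (simp add: sum_nonneg)
    also have "\<dots> \<le> (line_integral ?v \<gamma> 0 (t k) + ennreal (L * \<eta> * len \<gamma> 0 (t k))) +
        (line_integral ?v \<gamma> (t k) (t (Suc k)) + ennreal (L * \<eta> * len \<gamma> (t k) (t (Suc k))))"
      using Suc by (intro add_mono piece) auto
    also have "\<dots> = line_integral ?v \<gamma> 0 (t (Suc k)) + (ennreal (L * \<eta> * len \<gamma> 0 (t k)) + ennreal (L * \<eta> * len \<gamma> (t k) (t (Suc k))))"
      unfolding a by (simp only: ac_simps)
    also have "ennreal (L * \<eta> * len \<gamma> 0 (t k)) + ennreal (L * \<eta> * len \<gamma> (t k) (t (Suc k))) = ennreal (L * \<eta> * len \<gamma> 0 (t (Suc k)))"
      unfolding b distrib_left using L \<eta> by (intro ennreal_plus[symmetric]) (auto simp: len_nonneg)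
    finally show ?case .
  qed simp
  from this[of n] have "ennreal (\<Sum>i<n. v (\<gamma> (t i)) * ?d i) \<le> line_integral ?v \<gamma> 0 1 + ennreal (L * \<eta> * l)"
    using n by (simp add: t_def l_def)
  also have "\<dots> \<le> line_integral ?v \<gamma> 0 1 + ennreal e" using \<eta>e by (intro add_left_mono ennreal_leI)
  finally have "ennreal (\<Sum>i<n. v (\<gamma> (t i)) * ?d i) \<le> line_integral ?v \<gamma> 0 1 + ennreal e" .
  moreover have "?d i \<le> e" if "i < n" for i
    using dl[OF that t(2) order_refl] small[OF that t(2) order_refl] \<eta> by linarith
  ultimately show ?thesis using that[OF n(1)] unfolding t_def by blast
qed

definition rect_path :: "'a::metric_space set \<Rightarrow> (real \<Rightarrow> 'a) \<Rightarrow> bool" where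
  "rect_path Q \<gamma> \<longleftrightarrow> rect_on \<gamma> 0 1 \<and> \<gamma> ` {0..1} \<subseteq> Q"

text \<open>A limit theorem for curves of bounded weighted length: the curves are replaced by chains of their
  points, to which the limit theorem for chains applies.\<close>

lemma curve_limit:
  fixes \<gamma> :: "nat \<Rightarrow> real \<Rightarrow> 'a::metric_space"
  assumes Q: "compact Q" and w: "lsc w" and w1: "\<And>x. 1 \<le> w x"
    and \<gamma>: "\<And>m. rect_path Q (\<gamma> m)" and M: "M \<ge> 0" and wt: "\<And>m. line_integral w (\<gamma> m) 0 1 \<le> ennreal M"
  obtains r \<beta> where "strict_mono (r :: nat \<Rightarrow> nat)" "rect_path Q \<beta>"
    "\<And>s. s \<in> {0..1} \<Longrightarrow> \<exists>t. (\<forall>k. t k \<in> {0..1}) \<and> (\<lambda>k. \<gamma> (r k) (t k)) \<longlonglongrightarrow> \<beta> s"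
    "(\<lambda>k. \<gamma> (r k) 0) \<longlonglongrightarrow> \<beta> 0" "(\<lambda>k. \<gamma> (r k) 1) \<longlonglongrightarrow> \<beta> 1"
    "line_integral w \<beta> 0 1 \<le> ennreal M"
proof -
  obtain v :: "nat \<Rightarrow> 'a \<Rightarrow> real" where
    v1: "\<And>m x. 1 \<le> v m x" and lip: "\<And>m x y. \<bar>v m x - v m y\<bar> \<le> (real m + 1) * dist x y"
    and vmono: "\<And>x. mono (\<lambda>m. v m x)" and wv: "\<And>x. w x = (SUP m. ennreal (v m x))"
    by (rule lsc_lipschitz_approx[OF w w1]) (rule that)
  define e where "e m = 1 / real (Suc m)" for m
  have e0: "e m > 0" for m by (simp add: e_def)
  have e: "e \<longlonglongrightarrow> 0" unfolding e_def by (rule LIMSEQ_Suc[OF lim_1_over_n])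
  have v0: "0 \<le> v m x" for m x using v1[of m x] by linarith
  have \<gamma>r: "rect_on (\<gamma> m) 0 1" for m using \<gamma>[of m] by (simp add: rect_path_def)
  have "\<exists>n>0. (\<forall>i<n. dist (\<gamma> m (real i / real n)) (\<gamma> m (real (Suc i) / real n)) \<le> e m) \<and>
    (\<Sum>i<n. v m (\<gamma> m (real i / real n)) * dist (\<gamma> m (real i / real n)) (\<gamma> m (real (Suc i) / real n))) \<le> M + e m" for m
  proof -
    obtain n :: nat where n: "n > 0"
      "\<And>i. i < n \<Longrightarrow> dist (\<gamma> m (real i / real n)) (\<gamma> m (real (Suc i) / real n)) \<le> e m"
      "ennreal (\<Sum>i<n. v m (\<gamma> m (real i / real n)) * dist (\<gamma> m (real i / real n)) (\<gamma> m (real (Suc i) / real n)))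
        \<le> line_integral (\<lambda>x. ennreal (v m x)) (\<gamma> m) 0 1 + ennreal (e m)"
      by (rule chain_of_curve[OF \<gamma>r v0 _ lip e0]) (auto intro: that)
    have "line_integral (\<lambda>x. ennreal (v m x)) (\<gamma> m) 0 1 \<le> line_integral w (\<gamma> m) 0 1"
      unfolding wv by (intro line_integral_mono \<gamma>r SUP_upper) simp
    also have "\<dots> \<le> ennreal M" by (rule wt)
    finally have "line_integral (\<lambda>x. ennreal (v m x)) (\<gamma> m) 0 1 + ennreal (e m) \<le> ennreal M + ennreal (e m)"
      by (rule add_right_mono)
    also have "\<dots> = ennreal (M + e m)" using M e0[of m] by simp
    finally have "ennreal (\<Sum>i<n. v m (\<gamma> m (real i / real n)) * dist (\<gamma> m (real i / real n)) (\<gamma> m (real (Suc i) / real n))) \<le> ennreal (M + e m)"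
      using n(3) by (rule order_trans[rotated])
    then have "(\<Sum>i<n. v m (\<gamma> m (real i / real n)) * dist (\<gamma> m (real i / real n)) (\<gamma> m (real (Suc i) / real n))) \<le> M + e m"
      using M e0[of m] by (subst (asm) ennreal_le_iff) auto
    then show ?thesis using n by blast
  qed
  then have "\<forall>m. \<exists>n. n > 0 \<and> (\<forall>i<n. dist (\<gamma> m (real i / real n)) (\<gamma> m (real (Suc i) / real n)) \<le> e m) \<and>
    (\<Sum>i<n. v m (\<gamma> m (real i / real n)) * dist (\<gamma> m (real i / real n)) (\<gamma> m (real (Suc i) / real n))) \<le> M + e m"
    by blast
  from choice[OF this] obtain n where n: "\<And>m. n m > 0"
    "\<And>m i. i < n m \<Longrightarrow> dist (\<gamma> m (real i / real (n m))) (\<gamma> m (real (Suc i) / real (n m))) \<le> e m"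
    "\<And>m. (\<Sum>i<n m. v m (\<gamma> m (real i / real (n m))) * dist (\<gamma> m (real i / real (n m))) (\<gamma> m (real (Suc i) / real (n m)))) \<le> M + e m"
    by blast
  have in01: "real i / real (n m) \<in> {0..1}" if "i \<le> n m" for m i using n(1)[of m] that by simp
  have pQ: "\<gamma> m (real i / real (n m)) \<in> Q" if "i \<le> n m" for m i
    using \<gamma>[of m] in01[OF that] by (auto simp: rect_path_def)
  obtain r \<beta> where r: "strict_mono (r :: nat \<Rightarrow> nat)" and \<beta>: "rect_on \<beta> 0 1" "\<And>s. s \<in> {0..1} \<Longrightarrow> \<beta> s \<in> Q"
    and pts: "\<And>s. s \<in> {0..1} \<Longrightarrow> \<exists>j. (\<forall>k. j k \<le> n (r k)) \<and> (\<lambda>k. \<gamma> (r k) (real (j k) / real (n (r k)))) \<longlonglongrightarrow> \<beta> s"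
    and st: "(\<lambda>k. \<gamma> (r k) (real 0 / real (n (r k)))) \<longlonglongrightarrow> \<beta> 0"
    and fi: "(\<lambda>k. \<gamma> (r k) (real (n (r k)) / real (n (r k)))) \<longlonglongrightarrow> \<beta> 1"
    and I: "line_integral w \<beta> 0 1 \<le> ennreal M"
    by (rule chain_limit[where p = "\<lambda>m i. \<gamma> m (real i / real (n m))" and n = n,
          OF Q v1 lip vmono wv _ _ e e0 M n(3)], erule pQ, erule n(2), rule that)
  show ?thesis
  proof (rule that[OF r])
    show "rect_path Q \<beta>" using \<beta> by (auto simp: rect_path_def)
    fix s :: real assume "s \<in> {0..1}"
    from pts[OF this] obtain j where "\<forall>k. j k \<le> n (r k)" "(\<lambda>k. \<gamma> (r k) (real (j k) / real (n (r k)))) \<longlonglongrightarrow> \<beta> s" by blast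
    then show "\<exists>t. (\<forall>k. t k \<in> {0..1}) \<and> (\<lambda>k. \<gamma> (r k) (t k)) \<longlonglongrightarrow> \<beta> s"
      using in01 by (intro exI[of _ "\<lambda>k. real (j k) / real (n (r k))"]) blast
  next
    show "(\<lambda>k. \<gamma> (r k) 0) \<longlonglongrightarrow> \<beta> 0" using st by simp
    show "(\<lambda>k. \<gamma> (r k) 1) \<longlonglongrightarrow> \<beta> 1" using fi n(1) by (simp add: less_imp_neq[symmetric])
  qed (rule I)
qed

section \<open>Separation in a quadrilateral\<close>

text \<open>The square is a retract of the plane, so the level set extends to a closed subset of the plane
  separating \<open>A\<close> from \<open>B\<close>; in the plane some component of it already separates.\<close>

lemma square_level_set_component:
  fixes f :: "real \<times> real \<Rightarrow> real"
  assumes f: "continuous_on ({0..1} \<times> {0..1}) f"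
    and A: "connected A" "A \<subseteq> {0..1} \<times> {0..1}" "A \<noteq> {}" "\<And>x. x \<in> A \<Longrightarrow> f x < t"
    and B: "connected B" "B \<subseteq> {0..1} \<times> {0..1}" "B \<noteq> {}" "\<And>x. x \<in> B \<Longrightarrow> t < f x"
  obtains C where "connected C" "C \<subseteq> {0..1} \<times> {0..1}" "\<And>x. x \<in> C \<Longrightarrow> f x = t"
    "\<And>S. connected S \<Longrightarrow> S \<subseteq> {0..1} \<times> {0..1} \<Longrightarrow> S \<inter> A \<noteq> {} \<Longrightarrow> S \<inter> B \<noteq> {} \<Longrightarrow> C \<inter> S \<noteq> {}"
proof -
  define sq :: "(real \<times> real) set" where "sq = {0..1} \<times> {0..1}"
  have sq: "convex sq" "closed sq" "sq \<noteq> {}"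
    unfolding sq_def by (auto intro: convex_Times closed_Times)
  define r where "r = closest_point sq"
  have r: "r x \<in> sq" for x unfolding r_def using sq by (intro closest_point_in_set)
  have rid: "r x = x" if "x \<in> sq" for x unfolding r_def using that by (rule closest_point_self)
  have cr: "continuous_on X r" for X unfolding r_def using sq by (intro continuous_on_closest_point)
  define L where "L = {x. f (r x) = t}"
  have cfr: "continuous_on UNIV (\<lambda>x. f (r x))"
    by (rule continuous_on_compose2[OF f cr]) (use r[unfolded sq_def] in blast)
  have cL: "closed L" unfolding L_def by (intro closed_Collect_eq cfr continuous_on_const)
  obtain a b where ab: "a \<in> A" "b \<in> B" using A B by blast
  have sep: "\<not> connected_component (- L) a b"
  proof
    assume "connected_component (- L) a b"
    then obtain T where T: "connected T" "T \<subseteq> - L" "a \<in> T" "b \<in> T" by (auto simp: connected_component_def)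
    have "connected ((\<lambda>x. f (r x)) ` T)"
      by (intro connected_continuous_image continuous_on_subset[OF cfr] T) simp
    moreover have "f (r a) < t" "t < f (r b)" using A B ab rid by (auto simp: sq_def)
    ultimately have "t \<in> (\<lambda>x. f (r x)) ` T"
      using T(3,4) unfolding connected_iff_interval by (metis imageI less_imp_le)
    then show False using T(2) by (auto simp: L_def)
  qed
  obtain C' where C': "C' \<in> components L" "\<not> connected_component (- C') a b"
    using separation_by_component_closed_pointwise[OF cL sep] by blast
  have C'L: "C' \<subseteq> L" using C' in_components_subset by blast
  show ?thesis
  proof (rule that[of "r ` C'"])
    show "connected (r ` C')"
      using C' by (intro connected_continuous_image cr) (rule in_components_connected)
    show "r ` C' \<subseteq> {0..1} \<times> {0..1}" using r[unfolded sq_def] by blast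
    show "f x = t" if "x \<in> r ` C'" for x using that C'L by (auto simp: L_def)
    fix S assume S: "connected S" "S \<subseteq> {0..1} \<times> {0..1}" "S \<inter> A \<noteq> {}" "S \<inter> B \<noteq> {}"
    show "r ` C' \<inter> S \<noteq> {}"
    proof
      assume e: "r ` C' \<inter> S = {}"
      have "connected ((A \<union> S) \<union> B)"
        using A B S by (intro connected_Un) auto
      moreover have "x \<notin> C'" if "x \<in> (A \<union> S) \<union> B" for x
      proof
        assume x: "x \<in> C'"
        have "x \<in> sq" using that A(2) B(2) S(2) by (auto simp: sq_def)
        then have rx: "r x = x" by (rule rid)
        have "f x = t" using x C'L rx by (auto simp: L_def)
        then have "x \<in> S" using that A(4)[of x] B(4)[of x] by auto
        then show False using e imageI[OF x, of r] rx by auto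
      qed
      ultimately have "connected_component (- C') a b"
        unfolding connected_component_def using ab by (intro exI[of _ "(A \<union> S) \<union> B"]) auto
      then show False using C'(2) by simp
    qed
  qed
qed

lemma quad_level_set_component:
  fixes \<phi> :: "real \<times> real \<Rightarrow> 'a::metric_space"
  assumes hom: "homeomorphism ({0..1} \<times> {0..1}) (quad \<phi>) \<phi> \<psi>"
    and f: "continuous_on (quad \<phi>) f"
    and A: "connected A" "A \<subseteq> quad \<phi>" "A \<noteq> {}" "\<And>x. x \<in> A \<Longrightarrow> f x < (t::real)"
    and B: "connected B" "B \<subseteq> quad \<phi>" "B \<noteq> {}" "\<And>x. x \<in> B \<Longrightarrow> t < f x"
  obtains C where "connected C" "C \<subseteq> quad \<phi>" "\<And>x. x \<in> C \<Longrightarrow> f x = t"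
    "\<And>S. connected S \<Longrightarrow> S \<subseteq> quad \<phi> \<Longrightarrow> S \<inter> A \<noteq> {} \<Longrightarrow> S \<inter> B \<noteq> {} \<Longrightarrow> C \<inter> S \<noteq> {}"
proof -
  have \<psi>: "continuous_on (quad \<phi>) \<psi>" "\<And>x. x \<in> quad \<phi> \<Longrightarrow> \<phi> (\<psi> x) = x" "\<psi> ` quad \<phi> = {0..1} \<times> {0..1}"
    and \<phi>: "continuous_on ({0..1} \<times> {0..1}) \<phi>" "\<phi> ` ({0..1} \<times> {0..1}) = quad \<phi>"
    using hom by (auto simp: homeomorphism_def)
  have inj: "inj_on \<psi> (quad \<phi>)" using \<psi>(2) by (metis inj_onI)
  have con: "connected (\<psi> ` S)" "\<psi> ` S \<subseteq> {0..1} \<times> {0..1}" if "connected S" "S \<subseteq> quad \<phi>" for S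
    using that \<psi> by (auto intro!: connected_continuous_image intro: continuous_on_subset)
  have "continuous_on ({0..1} \<times> {0..1}) (\<lambda>x. f (\<phi> x))"
    by (rule continuous_on_compose2[OF f \<phi>(1)]) (simp add: \<phi>(2))
  then obtain C where C: "connected C" "C \<subseteq> {0..1} \<times> {0..1}" "\<And>x. x \<in> C \<Longrightarrow> f (\<phi> x) = t"
    "\<And>S. connected S \<Longrightarrow> S \<subseteq> {0..1} \<times> {0..1} \<Longrightarrow> S \<inter> \<psi> ` A \<noteq> {} \<Longrightarrow> S \<inter> \<psi> ` B \<noteq> {} \<Longrightarrow> C \<inter> S \<noteq> {}"
  proof (rule square_level_set_component)
    show "connected (\<psi> ` A)" "\<psi> ` A \<subseteq> {0..1} \<times> {0..1}" "\<psi> ` A \<noteq> {}" using con[of A] A by auto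
    show "connected (\<psi> ` B)" "\<psi> ` B \<subseteq> {0..1} \<times> {0..1}" "\<psi> ` B \<noteq> {}" using con[of B] B by auto
    show "f (\<phi> x) < t" if "x \<in> \<psi> ` A" for x using that A \<psi>(2) by auto
    show "t < f (\<phi> x)" if "x \<in> \<psi> ` B" for x using that B \<psi>(2) by auto
  qed (rule that)
  show ?thesis
  proof (rule that[of "\<phi> ` C"])
    show "connected (\<phi> ` C)" using C \<phi> by (auto intro!: connected_continuous_image intro: continuous_on_subset)
    show "\<phi> ` C \<subseteq> quad \<phi>" using C(2) \<phi>(2) by blast
    show "f x = t" if "x \<in> \<phi> ` C" for x using that C(3) by auto
    fix S assume S: "connected S" "S \<subseteq> quad \<phi>" "S \<inter> A \<noteq> {}" "S \<inter> B \<noteq> {}"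
    have "C \<inter> \<psi> ` S \<noteq> {}" using S con[of S] by (intro C(4)) auto
    then show "\<phi> ` C \<inter> S \<noteq> {}" using S(2) \<psi>(2) by force
  qed
qed

section \<open>Coverings by small balls\<close>

lemma suminf_half_ennreal:
  assumes "\<eta> \<ge> 0"
  shows "(\<Sum>k. ennreal (\<eta> * (1/2) ^ Suc k)) = ennreal \<eta>"
proof -
  have "(\<lambda>k. \<eta> * (1/2) ^ Suc k) sums (\<eta> * 1)" by (intro sums_mult power_half_series)
  then show ?thesis using assms by (intro sums_unique[symmetric]) (simp add: sums_ennreal)
qed

text \<open>A set of diameter \<open>d\<close> lies in any ball of radius larger than \<open>d\<close> around one of its points. Passing to balls
  therefore costs the factor \<open>4 / \<pi> < 2\<close>. Sets that miss \<open>E\<close> are replaced by empty balls.\<close>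

lemma hausdorff2_ball_cover:
  fixes E :: "'a::metric_space set"
  assumes fin: "hausdorff2 E < \<infinity>" and \<epsilon>: "\<epsilon> > 0" and \<eta>: "\<eta> > 0" and Q: "E \<subseteq> Q" "Q \<noteq> {}"
  obtains x r where "\<And>j::nat. x j \<in> Q" "\<And>j. 0 \<le> r j \<and> r j < \<epsilon>" "E \<subseteq> (\<Union>j. ball (x j) (r j))"
    "(\<Sum>j. ennreal ((r j)\<^sup>2)) \<le> 2 * hausdorff2 E + ennreal \<eta>"
    "\<And>j. r j > 0 \<Longrightarrow> x j \<in> E"
proof -
  define c where "c = min 1 \<eta> / 4"
  have c: "c > 0" "4 * c \<le> \<eta>" using \<eta> by (auto simp: c_def)
  have "hausdorff2_pre (\<epsilon>/2) E \<le> hausdorff2 E" using \<epsilon> by (intro hausdorff2_pre_le) auto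
  also have "hausdorff2 E < hausdorff2 E + ennreal c" using fin c by (auto simp: ennreal_add_left_cancel_less less_top)
  finally obtain A where A: "E \<subseteq> (\<Union>j. A j)" "\<And>j::nat. bounded (A j)" "\<And>j. diameter (A j) < \<epsilon>/2"
    "(\<Sum>j. ennreal (pi / 4 * diameter (A j) ^ 2)) < hausdorff2 E + ennreal c"
    unfolding hausdorff2_pre_def Inf_less_iff by blast
  define d where "d j = diameter (A j)" for j
  have d0: "d j \<ge> 0" for j using A(2) by (simp add: d_def diameter_ge_0)
  have "\<exists>r>d j. r < \<epsilon> \<and> r\<^sup>2 \<le> (d j)\<^sup>2 + c * (1/2) ^ Suc j" for j
  proof -
    have "((\<lambda>r. r\<^sup>2) \<longlongrightarrow> (d j)\<^sup>2) (at_right (d j))" by (intro tendsto_intros)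
    then have "eventually (\<lambda>r. r\<^sup>2 < (d j)\<^sup>2 + c * (1/2) ^ Suc j) (at_right (d j))"
      using c by (intro order_tendstoD) auto
    moreover have "d j < \<epsilon>" using A(3)[of j] \<epsilon> d0[of j] by (simp add: d_def)
    then have "eventually (\<lambda>r. r \<in> {d j<..<\<epsilon>}) (at_right (d j))" by (rule eventually_at_right_real)
    ultimately have "eventually (\<lambda>r. r > d j \<and> r < \<epsilon> \<and> r\<^sup>2 \<le> (d j)\<^sup>2 + c * (1/2) ^ Suc j) (at_right (d j))"
      by eventually_elim auto
    then show ?thesis using eventually_happens by force
  qed
  then obtain \<rho> where \<rho>: "\<And>j. \<rho> j > d j" "\<And>j. \<rho> j < \<epsilon>" "\<And>j. (\<rho> j)\<^sup>2 \<le> (d j)\<^sup>2 + c * (1/2) ^ Suc j" by metis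
  obtain q where q: "q \<in> Q" using Q by blast
  define x where "x j = (if A j \<inter> E = {} then q else (SOME y. y \<in> A j \<inter> E))" for j
  define r where "r j = (if A j \<inter> E = {} then 0 else \<rho> j)" for j
  have xE: "x j \<in> A j \<inter> E" if "A j \<inter> E \<noteq> {}" for j
    using that some_in_eq[of "A j \<inter> E"] by (simp add: x_def)
  have rr: "0 \<le> r j \<and> r j < \<epsilon>" for j using \<rho>[of j] d0[of j] \<epsilon> by (auto simp: r_def)
  have "(\<Sum>j. ennreal ((r j)\<^sup>2)) \<le> (\<Sum>j. 2 * ennreal (pi / 4 * (d j)\<^sup>2) + ennreal (c * (1/2) ^ Suc j))"
  proof (intro suminf_le summableI)
    fix j
    have "(r j)\<^sup>2 \<le> (d j)\<^sup>2 + c * (1/2) ^ Suc j" using \<rho>(3)[of j] c by (auto simp: r_def)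
    also have "(d j)\<^sup>2 \<le> 2 * (pi / 4 * (d j)\<^sup>2)"
      using mult_right_mono[of 1 "pi / 2" "(d j)\<^sup>2"] pi_gt3 by simp
    finally have "ennreal ((r j)\<^sup>2) \<le> ennreal (2 * (pi / 4 * (d j)\<^sup>2) + c * (1/2) ^ Suc j)"
      by (intro ennreal_leI) simp
    also have "\<dots> = ennreal (2 * (pi / 4 * (d j)\<^sup>2)) + ennreal (c * (1/2) ^ Suc j)"
      using c by (intro ennreal_plus) auto
    also have "ennreal (2 * (pi / 4 * (d j)\<^sup>2)) = ennreal 2 * ennreal (pi / 4 * (d j)\<^sup>2)"
      by (rule ennreal_mult) auto
    finally show "ennreal ((r j)\<^sup>2) \<le> 2 * ennreal (pi / 4 * (d j)\<^sup>2) + ennreal (c * (1/2) ^ Suc j)" by simp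
  qed
  also have "\<dots> = (\<Sum>j. 2 * ennreal (pi / 4 * (d j)\<^sup>2)) + (\<Sum>j. ennreal (c * (1/2) ^ Suc j))"
    by (intro suminf_add[symmetric] summableI)
  also have "(\<Sum>j. 2 * ennreal (pi / 4 * (d j)\<^sup>2)) = 2 * (\<Sum>j. ennreal (pi / 4 * (d j)\<^sup>2))"
    by (rule ennreal_suminf_cmult)
  also have "(\<Sum>j. ennreal (c * (1/2) ^ Suc j)) = ennreal c" using c by (intro suminf_half_ennreal) simp
  also have "2 * (\<Sum>j. ennreal (pi / 4 * (d j)\<^sup>2)) + ennreal c \<le> 2 * (hausdorff2 E + ennreal c) + ennreal c"
    using A(4) unfolding d_def by (intro add_right_mono mult_left_mono less_imp_le) auto
  also have "\<dots> = 2 * hausdorff2 E + (2 * ennreal c + ennreal c)" by (simp only: distrib_left add.assoc)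
  also have "2 * ennreal c + ennreal c \<le> ennreal \<eta>"
  proof -
    have "2 * ennreal c = ennreal (2 * c)" by (simp add: ennreal_mult')
    then have "2 * ennreal c + ennreal c = ennreal (2 * c + c)" using c by (simp only: ennreal_plus)
    also have "\<dots> \<le> ennreal \<eta>" using c by (intro ennreal_leI) simp
    finally show ?thesis .
  qed
  finally have S: "(\<Sum>j. ennreal ((r j)\<^sup>2)) \<le> 2 * hausdorff2 E + ennreal \<eta>"
    by this (erule add_left_mono)
  show ?thesis
  proof (rule that[OF _ rr _ S])
    show "x j \<in> Q" for j using xE[of j] q Q by (cases "A j \<inter> E = {}") (auto simp: x_def)
    show "E \<subseteq> (\<Union>j. ball (x j) (r j))"
    proof
      fix y assume y: "y \<in> E"
      then obtain j where j: "y \<in> A j" using A(1) by blast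
      then have ne: "A j \<inter> E \<noteq> {}" using y by blast
      have "dist (x j) y \<le> d j" unfolding d_def using xE[OF ne] j A(2) by (intro diameter_bounded_bound) auto
      then show "y \<in> (\<Union>j. ball (x j) (r j))" using \<rho>(1)[of j] ne by (auto simp: r_def intro!: exI[of _ j])
    qed
    show "x j \<in> E" if "r j > 0" for j using that xE[of j] by (auto simp: r_def split: if_splits)
  qed
qed

text \<open>The pieces of \<open>P\<close> on which \<open>F\<close> lies between consecutive integers are covered separately. On each
  piece \<open>F\<close> varies by a factor of at most \<open>2\<close>, and balls of positive radius have their centres in
  the piece, so the covering is efficient for the measure with density \<open>F\<close>.\<close>

lemma weighted_ball_cover:
  fixes F :: "'a::metric_space \<Rightarrow> real"
  assumes P: "P \<in> sets borel" and fin: "hausdorff2 P < \<infinity>" and F: "F \<in> borel_measurable borel" "\<And>x. 1 \<le> F x"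
    and \<epsilon>: "\<epsilon> > 0" and \<eta>: "\<eta> > 0" and Q: "P \<subseteq> Q" "Q \<noteq> {}"
  obtains x r where "\<And>j::nat. x j \<in> Q" "\<And>j. 0 \<le> r j \<and> r j < \<epsilon>" "P \<subseteq> (\<Union>j. ball (x j) (r j))"
    "(\<Sum>j. ennreal (F (x j) * (r j)\<^sup>2)) \<le> 4 * (\<integral>\<^sup>+y\<in>P. ennreal (F y) \<partial>hausdorff2_measure) + ennreal \<eta>"
proof -
  define E where "E k = {y\<in>P. real (Suc k) \<le> F y \<and> F y < real (Suc (Suc k))}" for k
  have Em: "E k \<in> sets borel" for k unfolding E_def using P F(1) by measurable
  have EP: "E k \<subseteq> P" for k by (auto simp: E_def)
  have EU: "P = (\<Union>k. E k)"
  proof -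
    have "\<exists>k. y \<in> E k" if "y \<in> P" for y
    proof -
      define k where "k = nat \<lfloor>F y\<rfloor> - 1"
      have "\<lfloor>F y\<rfloor> \<ge> 1" using F(2)[of y] by linarith
      then have "real (Suc k) = of_int \<lfloor>F y\<rfloor>" by (simp add: k_def of_nat_diff)
      then have "real (Suc k) \<le> F y" "F y < real (Suc (Suc k))" by linarith+
      then show ?thesis using that by (auto simp: E_def)
    qed
    then show ?thesis by (auto simp: E_def)
  qed
  have finE: "hausdorff2 (E k) < \<infinity>" for k using hausdorff2_mono[OF EP] fin by (rule le_less_trans)
  define \<eta>' where "\<eta>' k = \<eta> * (1/2) ^ Suc k / real (Suc (Suc k))" for k
  have \<eta>': "\<eta>' k > 0" for k using \<eta> by (simp add: \<eta>'_def)
  have "\<exists>x r. (\<forall>j::nat. x j \<in> Q \<and> 0 \<le> r j \<and> r j < \<epsilon> \<and> (r j > 0 \<longrightarrow> x j \<in> E k)) \<and> E k \<subseteq> (\<Union>j. ball (x j) (r j)) \<and>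
      (\<Sum>j. ennreal ((r j)\<^sup>2)) \<le> 2 * hausdorff2 (E k) + ennreal (\<eta>' k)" for k
    by (rule hausdorff2_ball_cover[OF finE \<epsilon> \<eta>' order_trans[OF EP Q(1)] Q(2), of k]) blast
  then have "\<forall>k. \<exists>x r. (\<forall>j::nat. x j \<in> Q \<and> 0 \<le> r j \<and> r j < \<epsilon> \<and> (r j > 0 \<longrightarrow> x j \<in> E k)) \<and> E k \<subseteq> (\<Union>j. ball (x j) (r j)) \<and>
      (\<Sum>j. ennreal ((r j)\<^sup>2)) \<le> 2 * hausdorff2 (E k) + ennreal (\<eta>' k)" by blast
  then obtain x r where xr: "\<And>k j. x k j \<in> Q" "\<And>k j. 0 \<le> r k j \<and> r k j < \<epsilon>" "\<And>k j. r k j > 0 \<Longrightarrow> x k j \<in> E k"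
     "\<And>k. E k \<subseteq> (\<Union>j::nat. ball (x k j) (r k j))"
     "\<And>k. (\<Sum>j. ennreal ((r k j)\<^sup>2)) \<le> 2 * hausdorff2 (E k) + ennreal (\<eta>' k)"
    unfolding choice_iff by blast
  define X where "X n = (case prod_decode n of (k, j) \<Rightarrow> x k j)" for n
  define R where "R n = (case prod_decode n of (k, j) \<Rightarrow> r k j)" for n
  have "(\<Sum>n. ennreal (F (X n) * (R n)\<^sup>2)) = (\<Sum>k. \<Sum>j. ennreal (F (x k j) * (r k j)\<^sup>2))"
  proof -
    have "(\<Sum>n. (\<lambda>p. ennreal (F (case_prod x p) * (case_prod r p)\<^sup>2)) (prod_decode n)) =
        (\<Sum>k. \<Sum>j. (\<lambda>p. ennreal (F (case_prod x p) * (case_prod r p)\<^sup>2)) (k, j))"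
      by (rule suminf_ennreal_2dimen) simp
    then show ?thesis by (simp add: X_def R_def case_prod_unfold)
  qed
  also have "\<dots> \<le> (\<Sum>k. 4 * (\<integral>\<^sup>+y\<in>E k. ennreal (F y) \<partial>hausdorff2_measure) + ennreal (\<eta> * (1/2) ^ Suc k))"
  proof (intro suminf_le summableI)
    fix k
    let ?s = "real (Suc (Suc k))"
    have "(\<Sum>j. ennreal (F (x k j) * (r k j)\<^sup>2)) \<le> (\<Sum>j. ennreal ?s * ennreal ((r k j)\<^sup>2))"
    proof (intro suminf_le summableI)
      fix j
      have "F (x k j) * (r k j)\<^sup>2 \<le> ?s * (r k j)\<^sup>2"
      proof (cases "r k j > 0")
        case True
        then have "F (x k j) \<le> ?s" using xr(3)[OF True] by (auto simp: E_def)
        then show ?thesis by (rule mult_right_mono) simp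
      next
        case False
        then have "r k j = 0" using xr(2)[of k j] by linarith
        then show ?thesis by simp
      qed
      then show "ennreal (F (x k j) * (r k j)\<^sup>2) \<le> ennreal ?s * ennreal ((r k j)\<^sup>2)"
        by (subst ennreal_mult[symmetric]) (auto intro: ennreal_leI)
    qed
    also have "\<dots> = ennreal ?s * (\<Sum>j. ennreal ((r k j)\<^sup>2))" by (rule ennreal_suminf_cmult)
    also have "\<dots> \<le> ennreal ?s * (2 * hausdorff2 (E k) + ennreal (\<eta>' k))"
      by (rule mult_left_mono[OF xr(5)]) simp
    also have "\<dots> = ennreal (2 * ?s) * hausdorff2 (E k) + ennreal (\<eta> * (1/2) ^ Suc k)"
    proof -
      have "?s * \<eta>' k = \<eta> * (1/2) ^ Suc k" by (simp add: \<eta>'_def del: of_nat_Suc power_Suc)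
      then have "ennreal ?s * ennreal (\<eta>' k) = ennreal (\<eta> * (1/2) ^ Suc k)"
        using \<eta>'[of k] by (subst ennreal_mult[symmetric]) (auto simp del: power_Suc)
      moreover have "ennreal ?s * 2 = ennreal (2 * ?s)"
        by (subst ennreal_mult) (auto simp: mult.commute)
      ultimately show ?thesis by (simp only: distrib_left mult.assoc[symmetric])
    qed
    also have "\<dots> \<le> 4 * (\<integral>\<^sup>+y\<in>E k. ennreal (F y) \<partial>hausdorff2_measure) + ennreal (\<eta> * (1/2) ^ Suc k)"
    proof (rule add_right_mono)
      have "ennreal (2 * ?s) * hausdorff2 (E k) \<le> ennreal (4 * real (Suc k)) * hausdorff2 (E k)"
        by (intro mult_right_mono ennreal_leI) auto
      also have "\<dots> = 4 * (ennreal (real (Suc k)) * emeasure hausdorff2_measure (E k))"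
        unfolding emeasure_hausdorff2_measure[OF Em] mult.assoc[symmetric]
        by (subst ennreal_mult') auto
      also have "ennreal (real (Suc k)) * emeasure hausdorff2_measure (E k) =
          (\<integral>\<^sup>+y. ennreal (real (Suc k)) * indicator (E k) y \<partial>hausdorff2_measure)"
        using Em by (intro nn_integral_cmult_indicator[symmetric]) simp
      also have "4 * \<dots> \<le> 4 * (\<integral>\<^sup>+y\<in>E k. ennreal (F y) \<partial>hausdorff2_measure)"
        by (intro mult_left_mono nn_integral_mono)
           (auto simp: E_def indicator_def intro: ennreal_leI simp del: ennreal_plus of_nat_Suc)
      finally show "ennreal (2 * ?s) * hausdorff2 (E k) \<le> 4 * (\<integral>\<^sup>+y\<in>E k. ennreal (F y) \<partial>hausdorff2_measure)" .
    qed
    finally show "(\<Sum>j. ennreal (F (x k j) * (r k j)\<^sup>2))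
        \<le> 4 * (\<integral>\<^sup>+y\<in>E k. ennreal (F y) \<partial>hausdorff2_measure) + ennreal (\<eta> * (1/2) ^ Suc k)" .
  qed
  also have "\<dots> = (\<Sum>k. 4 * (\<integral>\<^sup>+y\<in>E k. ennreal (F y) \<partial>hausdorff2_measure)) + (\<Sum>k. ennreal (\<eta> * (1/2) ^ Suc k))"
    by (intro suminf_add[symmetric] summableI)
  also have "(\<Sum>k. 4 * (\<integral>\<^sup>+y\<in>E k. ennreal (F y) \<partial>hausdorff2_measure)) = 4 * (\<Sum>k. \<integral>\<^sup>+y\<in>E k. ennreal (F y) \<partial>hausdorff2_measure)"
    by (rule ennreal_suminf_cmult)
  also have "(\<Sum>k. \<integral>\<^sup>+y\<in>E k. ennreal (F y) \<partial>hausdorff2_measure) = (\<integral>\<^sup>+y\<in>P. ennreal (F y) \<partial>hausdorff2_measure)"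
  proof -
    have "disjoint_family E"
    proof -
      have "k = l" if "y \<in> E k" "y \<in> E l" for y k l using that by (auto simp: E_def)
      then show ?thesis by (auto simp: disjoint_family_on_def)
    qed
    then show ?thesis
      unfolding EU using Em F(1) by (intro nn_integral_disjoint_family[symmetric]) auto
  qed
  also have "(\<Sum>k. ennreal (\<eta> * (1/2) ^ Suc k)) = ennreal \<eta>" using \<eta> by (intro suminf_half_ennreal) simp
  finally have S: "(\<Sum>j. ennreal (F (X j) * (R j)\<^sup>2)) \<le> 4 * (\<integral>\<^sup>+y\<in>P. ennreal (F y) \<partial>hausdorff2_measure) + ennreal \<eta>" .
  show ?thesis
  proof (rule that[OF _ _ _ S])
    show "X j \<in> Q" "0 \<le> R j \<and> R j < \<epsilon>" for j using xr by (auto simp: X_def R_def split: prod.split)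
    show "P \<subseteq> (\<Union>j. ball (X j) (R j))"
    proof
      fix y assume "y \<in> P"
      then obtain k j where "y \<in> ball (x k j) (r k j)" using EU xr(4) by blast
      then have "y \<in> ball (X (prod_encode (k, j))) (R (prod_encode (k, j)))" by (simp add: X_def R_def)
      then show "y \<in> (\<Union>j. ball (X j) (R j))" by blast
    qed
  qed
qed

section \<open>Chains\<close>

text \<open>A shortest chain of balls from \<open>a\<close> to \<open>b\<close> uses every ball at most once.\<close>

lemma chain_through_cover:
  fixes B :: "'i \<Rightarrow> 'a::metric_space set"
  assumes C: "connected C" "a \<in> C" "b \<in> C" and cover: "C \<subseteq> (\<Union>i\<in>I. B i)" and op: "\<And>i. i \<in> I \<Longrightarrow> open (B i)"
  obtains n :: nat and p \<iota> where "p 0 = a" "p n = b" "\<And>i. i \<le> n \<Longrightarrow> p i \<in> C" "inj_on \<iota> {..<n}"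
    "\<And>i. i < n \<Longrightarrow> \<iota> i \<in> I \<and> p i \<in> B (\<iota> i) \<and> p (Suc i) \<in> B (\<iota> i)"
proof -
  define step where "step y z \<longleftrightarrow> (\<exists>i\<in>I. y \<in> B i \<inter> C \<and> z \<in> B i \<inter> C)" for y z
  have sym: "step\<^sup>*\<^sup>* z y" if "step\<^sup>*\<^sup>* y z" for y z
    using that
  proof (induction rule: rtranclp_induct)
    case (step y z)
    then have "step z y" by (auto simp: step_def)
    then show ?case using step by (simp add: converse_rtranclp_into_rtranclp)
  qed simp
  have "step\<^sup>*\<^sup>* a b"
  proof (rule connected_equivalence_relation[where R = "step\<^sup>*\<^sup>*", OF C])
    show "step\<^sup>*\<^sup>* z y" if "step\<^sup>*\<^sup>* y z" for y z using that by (rule sym)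
    show "step\<^sup>*\<^sup>* x z" if "step\<^sup>*\<^sup>* x y" "step\<^sup>*\<^sup>* y z" for x y z using that by (rule rtranclp_trans)
    show "\<exists>T. openin (top_of_set C) T \<and> y \<in> T \<and> (\<forall>x\<in>T. step\<^sup>*\<^sup>* y x)" if y: "y \<in> C" for y
    proof -
      obtain i where i: "i \<in> I" "y \<in> B i" using y cover by blast
      have "openin (top_of_set C) (C \<inter> B i)" using op[OF i(1)] by auto
      moreover have "\<forall>x\<in>C \<inter> B i. step\<^sup>*\<^sup>* y x" using i y by (auto simp: step_def intro!: r_into_rtranclp)
      ultimately show ?thesis using i y by blast
    qed
  qed
  then have ex: "\<exists>n. (step ^^ n) a b" by (rule rtranclp_imp_relpowp)
  define n where "n = (LEAST n. (step ^^ n) a b)"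
  have n: "(step ^^ n) a b" unfolding n_def using ex by (rule LeastI_ex)
  have least: "n \<le> m" if "(step ^^ m) a b" for m unfolding n_def using that by (rule Least_le)
  obtain p where p: "p 0 = a" "p n = b" "\<And>i. i < n \<Longrightarrow> step (p i) (p (Suc i))"
    using n unfolding relpowp_fun_conv by blast
  then have "\<forall>i. \<exists>j. i < n \<longrightarrow> j \<in> I \<and> p i \<in> B j \<inter> C \<and> p (Suc i) \<in> B j \<inter> C"
    unfolding step_def by blast
  from choice[OF this] obtain \<iota> where \<iota>: "\<And>i. i < n \<Longrightarrow> \<iota> i \<in> I \<and> p i \<in> B (\<iota> i) \<inter> C \<and> p (Suc i) \<in> B (\<iota> i) \<inter> C"
    by blast
  have neq: "\<iota> i \<noteq> \<iota> j" if ij: "i < j" "j < n" for i j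
  proof
    assume eq: "\<iota> i = \<iota> j"
    have "(step ^^ i) a (p i)" unfolding relpowp_fun_conv using p ij by (intro exI[of _ p]) auto
    moreover have "step (p i) (p (Suc j))" using \<iota>[of i] \<iota>[of j] ij eq by (auto simp: step_def)
    ultimately have 1: "(step ^^ Suc i) a (p (Suc j))" by auto
    have 2: "(step ^^ (n - Suc j)) (p (Suc j)) b"
      unfolding relpowp_fun_conv using p ij by (intro exI[of _ "\<lambda>l. p (Suc j + l)"]) auto
    from 1 2 have "(step ^^ (Suc i + (n - Suc j))) a b" unfolding relpowp_add by blast
    from least[OF this] show False using ij by simp
  qed
  show ?thesis
  proof (rule that[OF p(1,2)])
    show "p i \<in> C" if "i \<le> n" for i
      using that p(2) C(3) \<iota>[of i] by (cases "i = n") auto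
    show "inj_on \<iota> {..<n}"
    proof (rule inj_onI)
      fix i j assume "i \<in> {..<n}" "j \<in> {..<n}" "\<iota> i = \<iota> j"
      then show "i = j" using neq[of i j] neq[of j i] by (cases i j rule: linorder_cases) auto
    qed
  qed (use \<iota> in auto)
qed

definition chain_weight :: "('a::metric_space \<Rightarrow> real) \<Rightarrow> nat \<Rightarrow> (nat \<Rightarrow> 'a) \<Rightarrow> real" where
  "chain_weight v n p = (\<Sum>i<n. v (p i) * dist (p i) (p (Suc i)))"

definition is_chain :: "'a::metric_space set \<Rightarrow> real \<Rightarrow> nat \<Rightarrow> (nat \<Rightarrow> 'a) \<Rightarrow> bool" where
  "is_chain Q e n p \<longleftrightarrow> (\<forall>i\<le>n. p i \<in> Q) \<and> (\<forall>i<n. dist (p i) (p (Suc i)) \<le> e)"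

text \<open>Unlike the infimum of line integrals, the infimum over chains of a fixed mesh is locally Lipschitz
  with respect to the given metric. It is capped at \<open>\<tau>\<close>, which makes it finite.\<close>

definition chain_dist :: "'a::metric_space set \<Rightarrow> 'a set \<Rightarrow> ('a \<Rightarrow> real) \<Rightarrow> real \<Rightarrow> real \<Rightarrow> 'a \<Rightarrow> real" where
  "chain_dist Q Y v e \<tau> x =
     Inf (insert \<tau> {chain_weight v n p |n p. is_chain Q e n p \<and> p 0 \<in> Y \<and> p n = x})"

context
  fixes Q Y :: "'a::metric_space set" and v :: "'a \<Rightarrow> real" and e \<tau> :: real
  assumes v1: "\<And>x. 1 \<le> v x" and \<tau>: "\<tau> > 0" and e: "e > 0" and YQ: "Y \<subseteq> Q"
begin

lemma chain_weight_nonneg: "0 \<le> chain_weight v n p"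
  unfolding chain_weight_def using v1 by (intro sum_nonneg mult_nonneg_nonneg) (auto intro: order_trans[OF zero_le_one])

lemma chain_dist_bdd: "bdd_below (insert \<tau> {chain_weight v n p |n p. is_chain Q e n p \<and> p 0 \<in> Y \<and> p n = x})"
  using chain_weight_nonneg \<tau> by (intro bdd_belowI[of _ 0]) auto

lemma chain_dist_le_cap: "chain_dist Q Y v e \<tau> x \<le> \<tau>"
  unfolding chain_dist_def by (rule cInf_lower[OF _ chain_dist_bdd]) simp

lemma chain_dist_le: "is_chain Q e n p \<Longrightarrow> p 0 \<in> Y \<Longrightarrow> p n = x \<Longrightarrow> chain_dist Q Y v e \<tau> x \<le> chain_weight v n p"
  unfolding chain_dist_def by (rule cInf_lower[OF _ chain_dist_bdd]) blast

lemma chain_dist_greatest: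
  assumes "b \<le> \<tau>" "\<And>n p. is_chain Q e n p \<Longrightarrow> p 0 \<in> Y \<Longrightarrow> p n = x \<Longrightarrow> b \<le> chain_weight v n p"
  shows "b \<le> chain_dist Q Y v e \<tau> x"
  unfolding chain_dist_def using assms by (intro cInf_greatest) auto

lemma chain_dist_zero: "y \<in> Y \<Longrightarrow> chain_dist Q Y v e \<tau> y = 0"
proof (rule antisym)
  assume y: "y \<in> Y"
  then have "is_chain Q e 0 (\<lambda>_. y)" using YQ by (auto simp: is_chain_def)
  from chain_dist_le[OF this, of y] y show "chain_dist Q Y v e \<tau> y \<le> 0" by (simp add: chain_weight_def)
  show "0 \<le> chain_dist Q Y v e \<tau> y" using \<tau> chain_weight_nonneg by (intro chain_dist_greatest) auto
qed

lemma chain_dist_lessE: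
  assumes "chain_dist Q Y v e \<tau> x < s" "s \<le> \<tau>"
  obtains n p where "is_chain Q e n p" "p 0 \<in> Y" "p n = x" "chain_weight v n p < s"
proof -
  have "\<exists>n p. is_chain Q e n p \<and> p 0 \<in> Y \<and> p n = x \<and> chain_weight v n p < s"
  proof (rule ccontr)
    assume "\<not> ?thesis"
    then have "s \<le> chain_dist Q Y v e \<tau> x" using assms(2) by (intro chain_dist_greatest) (auto simp: not_less)
    then show False using assms(1) by simp
  qed
  then show ?thesis using that by blast
qed

lemma chain_dist_step:
  assumes "x \<in> Q" "y \<in> Q" "dist x y \<le> e"
  shows "chain_dist Q Y v e \<tau> y \<le> chain_dist Q Y v e \<tau> x + v x * dist x y"
proof -
  have vx: "0 \<le> v x * dist x y" using v1[of x] by simp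
  have "chain_dist Q Y v e \<tau> y - v x * dist x y \<le> chain_dist Q Y v e \<tau> x"
  proof (rule chain_dist_greatest)
    show "chain_dist Q Y v e \<tau> y - v x * dist x y \<le> \<tau>" using chain_dist_le_cap[of y] vx by linarith
    fix n p assume p: "is_chain Q e n p" "p 0 \<in> Y" "p n = x"
    define p' where "p' i = (if i \<le> n then p i else y)" for i
    have "is_chain Q e (Suc n) p'" using p assms by (auto simp: is_chain_def p'_def le_Suc_eq less_Suc_eq)
    moreover have "p' 0 \<in> Y" "p' (Suc n) = y" using p by (auto simp: p'_def)
    moreover have "chain_weight v (Suc n) p' = chain_weight v n p + v x * dist x y"
      unfolding chain_weight_def using p by (simp add: p'_def)
    ultimately show "chain_dist Q Y v e \<tau> y - v x * dist x y \<le> chain_weight v n p"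
      using chain_dist_le[of "Suc n" p' y] by simp
  qed
  then show ?thesis by simp
qed

lemma infdist_less_if_chain_dist_less:
  assumes "chain_dist Q Y v e \<tau> x < \<tau>"
  shows "infdist x Y < \<tau>"
proof -
  obtain n p where p: "is_chain Q e n p" "p 0 \<in> Y" "p n = x" "chain_weight v n p < \<tau>"
    by (rule chain_dist_lessE[OF assms order_refl]) (rule that)
  have "dist (p 0) (p n) \<le> chain_weight v n p"
  proof (induction n)
    case (Suc n)
    have "1 * dist (p n) (p (Suc n)) \<le> v (p n) * dist (p n) (p (Suc n))" by (intro mult_right_mono v1) simp
    moreover have "chain_weight v (Suc n) p = chain_weight v n p + v (p n) * dist (p n) (p (Suc n))" by (simp add: chain_weight_def)
    ultimately show ?case using Suc dist_triangle[of "p 0" "p (Suc n)" "p n"] by linarith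
  qed (simp add: chain_weight_def)
  moreover have "infdist x Y \<le> dist x (p 0)" using p(2) by (rule infdist_le)
  ultimately show ?thesis using p by (simp add: dist_commute)
qed

lemma chain_dist_local_lipschitz:
  assumes "x \<in> Q" "y \<in> Q" "dist x y \<le> e" "v y \<le> v x + 1"
  shows "\<bar>chain_dist Q Y v e \<tau> y - chain_dist Q Y v e \<tau> x\<bar> \<le> (v x + 1) * dist x y"
proof -
  have "chain_dist Q Y v e \<tau> x \<le> chain_dist Q Y v e \<tau> y + v y * dist y x"
    using assms by (intro chain_dist_step) (auto simp: dist_commute)
  moreover have "v y * dist y x \<le> (v x + 1) * dist x y"
    unfolding dist_commute[of y x] by (intro mult_right_mono assms) simp
  moreover have "v x * dist x y \<le> (v x + 1) * dist x y" by (intro mult_right_mono) auto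
  ultimately show ?thesis using chain_dist_step[OF assms(1-3)] by linarith
qed

lemma continuous_on_chain_dist:
  assumes L: "L > 0" and lip: "\<And>x y. \<bar>v x - v y\<bar> \<le> L * dist x y"
  shows "continuous_on Q (chain_dist Q Y v e \<tau>)"
  unfolding continuous_on_iff
proof (intro ballI allI impI)
  fix x \<epsilon> assume x: "x \<in> Q" and \<epsilon>: "\<epsilon> > (0::real)"
  define d where "d = min e (min (1 / L) (\<epsilon> / (v x + 2)))"
  have vx: "v x \<ge> 1" by (rule v1)
  show "\<exists>d>0. \<forall>y\<in>Q. dist y x < d \<longrightarrow> dist (chain_dist Q Y v e \<tau> y) (chain_dist Q Y v e \<tau> x) < \<epsilon>"
  proof (intro exI conjI ballI impI)
    show "d > 0" using e L \<epsilon> vx by (simp add: d_def)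
    fix y assume y: "y \<in> Q" "dist y x < d"
    then have d: "dist x y \<le> e" "dist x y < 1 / L" "dist x y < \<epsilon> / (v x + 2)" by (auto simp: d_def dist_commute)
    then have "L * dist x y \<le> 1" using L by (simp add: field_simps)
    then have "v y \<le> v x + 1" using lip[of y x] by (simp add: dist_commute abs_le_iff)
    then have "\<bar>chain_dist Q Y v e \<tau> y - chain_dist Q Y v e \<tau> x\<bar> \<le> (v x + 1) * dist x y"
      using x y d by (intro chain_dist_local_lipschitz) auto
    also have "\<dots> \<le> (v x + 2) * dist x y" by (intro mult_right_mono) auto
    also have "\<dots> < \<epsilon>" using d(3) vx by (simp add: field_simps)
    finally show "dist (chain_dist Q Y v e \<tau> y) (chain_dist Q Y v e \<tau> x) < \<epsilon>" by (simp add: dist_real_def)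
  qed
qed

end

text \<open>As the mesh vanishes, chain distances recover the infimum of line integrals.\<close>

lemma curve_from_chain_dists:
  fixes v :: "nat \<Rightarrow> 'a::metric_space \<Rightarrow> real"
  assumes Q: "compact Q"
    and v1: "\<And>m x. 1 \<le> v m x" and lip: "\<And>m x y. \<bar>v m x - v m y\<bar> \<le> (real m + 1) * dist x y"
    and vmono: "\<And>x. mono (\<lambda>m. v m x)" and w: "\<And>x. w x = (SUP m. ennreal (v m x))"
    and Y: "compact Y" "Y \<subseteq> Q" and r: "strict_mono (r :: nat \<Rightarrow> nat)" and s: "0 < s" "s \<le> \<tau>"
    and z: "\<And>i. chain_dist Q Y (v (r i)) (1 / real (Suc (r i))) \<tau> (z i) < s" "z \<longlonglongrightarrow> l"
  obtains \<alpha> where "rect_path Q \<alpha>" "\<alpha> 0 \<in> Y" "\<alpha> 1 = l" "line_integral w \<alpha> 0 1 \<le> ennreal s"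
proof -
  have v0: "0 \<le> v m x" for m x using v1[of m x] by linarith
  have \<tau>: "\<tau> > 0" using s by simp
  have "\<exists>n p. is_chain Q (1 / real (Suc (r i))) n p \<and> p 0 \<in> Y \<and> p n = z i \<and> chain_weight (v (r i)) n p < s" for i
    by (rule chain_dist_lessE[OF v1 \<tau> _ Y(2) z(1) s(2)]) auto
  then have "\<forall>i. \<exists>n p. is_chain Q (1 / real (Suc (r i))) n p \<and> p 0 \<in> Y \<and> p n = z i \<and> chain_weight (v (r i)) n p < s" by blast
  then obtain n p where np: "\<And>i. is_chain Q (1 / real (Suc (r i))) (n i) (p i)" "\<And>i. p i 0 \<in> Y" "\<And>i. p i (n i) = z i"
    "\<And>i. chain_weight (v (r i)) (n i) (p i) < s" unfolding choice_iff by blast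
  define e where "e i = 1 / real (Suc i)" for i
  have e0: "e i > 0" for i by (simp add: e_def)
  have elim: "e \<longlonglongrightarrow> 0" unfolding e_def by (rule LIMSEQ_Suc[OF lim_1_over_n])
  have ri: "i \<le> r i" for i by (rule seq_suble[OF r])
  have re: "1 / real (Suc (r i)) \<le> e i" for i unfolding e_def using ri[of i] by (intro divide_left_mono) auto
  have pQ: "p i j \<in> Q" if "j \<le> n i" for i j using np(1)[of i] that by (simp add: is_chain_def)
  have mesh: "dist (p i j) (p i (Suc j)) \<le> e i" if "j < n i" for i j
    using np(1)[of i] that re[of i] by (auto simp: is_chain_def intro: order_trans)
  have wt: "(\<Sum>j<n i. v i (p i j) * dist (p i j) (p i (Suc j))) \<le> s + e i" for i
  proof -
    have "(\<Sum>j<n i. v i (p i j) * dist (p i j) (p i (Suc j))) \<le> chain_weight (v (r i)) (n i) (p i)"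
      unfolding chain_weight_def using vmono ri[of i] by (intro sum_mono mult_right_mono) (auto simp: mono_def)
    then show ?thesis using np(4)[of i] e0[of i] by linarith
  qed
  have s0: "0 \<le> s" using s by simp
  obtain r' \<alpha> where r': "strict_mono (r' :: nat \<Rightarrow> nat)" and \<alpha>: "rect_on \<alpha> 0 1" "\<And>t. t \<in> {0..1} \<Longrightarrow> \<alpha> t \<in> Q"
    and st: "(\<lambda>k. p (r' k) 0) \<longlonglongrightarrow> \<alpha> 0" and fi: "(\<lambda>k. p (r' k) (n (r' k))) \<longlonglongrightarrow> \<alpha> 1"
    and I: "line_integral w \<alpha> 0 1 \<le> ennreal s"
    by (rule chain_limit[where p = p and n = n, OF Q v1 lip vmono w _ _ elim e0 s0 wt], erule pQ, erule mesh, rule that)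
  show ?thesis
  proof (rule that[of \<alpha>])
    show "rect_path Q \<alpha>" using \<alpha> by (auto simp: rect_path_def)
    show "\<alpha> 0 \<in> Y" by (rule closed_sequentially[OF compact_imp_closed[OF Y(1)] _ st]) (simp add: np)
    have "(\<lambda>k. z (r' k)) \<longlonglongrightarrow> l" using LIMSEQ_subseq_LIMSEQ[OF z(2) r'] by (simp add: o_def)
    then show "\<alpha> 1 = l" using fi unfolding np(3) by (rule LIMSEQ_unique[rotated])
  qed (rule I)
qed

section \<open>The crossing lemma\<close>

text \<open>The coarea argument. The distance \<open>V m\<close> from \<open>Y\<close> along chains of mesh \<open>1/(m+1)\<close> is Lipschitz with constant
  about \<open>k\<close> at small scales, so a ball of radius \<open>r\<close> centred at \<open>x\<close> meets a set of levels of measure about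
  \<open>2 k(x) r\<close>, while its contribution to the \<open>w\<close>-length of a level is about \<open>2 w(x) r\<close>. Summing over a
  covering that is efficient for the density \<open>k w\<close> bounds the \<open>w\<close>-length averaged over the levels. A good
  level contains a connected set joining \<open>S1\<close> to \<open>S2\<close>, along which the covering balls can be
  arranged in a chain; these chains converge to \<open>\<beta>\<close>.

  The constant \<open>64\<close> is the product of \<open>4\<close> from the covering, \<open>2 \<cdot> 2\<close> from the diameters in
  the domain and on the line of levels, and \<open>2 \<cdot> 2\<close> from replacing \<open>k\<close> and \<open>w\<close> by their values at the centre
  plus \<open>1\<close>.\<close>

lemma crossing:
  fixes \<phi> :: "real \<times> real \<Rightarrow> 'a::metric_space" and k w :: "'a \<Rightarrow> ennreal"
  assumes hom: "homeomorphism ({0..1} \<times> {0..1}) (quad \<phi>) \<phi> \<psi>"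
    and fin: "hausdorff2 (quad \<phi>) < \<infinity>"
    and k: "lsc k" "\<And>x. 1 \<le> k x" and w: "lsc w" "\<And>x. 1 \<le> w x"
    and Y: "compact Y" "connected Y" "Y \<subseteq> quad \<phi>" "Y \<noteq> {}"
    and Z: "compact Z" "connected Z" "Z \<subseteq> quad \<phi>" "Z \<noteq> {}"
    and S1: "compact S1" "connected S1" "S1 \<subseteq> quad \<phi>" "S1 \<inter> Y \<noteq> {}" "S1 \<inter> Z \<noteq> {}"
    and S2: "compact S2" "connected S2" "S2 \<subseteq> quad \<phi>" "S2 \<inter> Y \<noteq> {}" "S2 \<inter> Z \<noteq> {}"
    and \<tau>: "\<tau> > 0" and far: "\<And>\<gamma>. rect_path (quad \<phi>) \<gamma> \<Longrightarrow> \<gamma> 0 \<in> Y \<Longrightarrow> \<gamma> 1 \<in> Z \<Longrightarrow> ennreal \<tau> \<le> line_integral k \<gamma> 0 1"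
    and small: "64 * (\<integral>\<^sup>+x\<in>{x\<in>quad \<phi>. infdist x Y < \<tau>}. k x * w x \<partial>hausdorff2_measure) < ennreal (c * \<tau>)"
    and c: "c > 0"
  obtains \<beta> where "rect_path (quad \<phi>) \<beta>" "\<beta> 0 \<in> S1" "\<beta> 1 \<in> S2" "line_integral w \<beta> 0 1 \<le> ennreal c"
    "\<And>s. s \<in> {0..1} \<Longrightarrow> \<exists>\<alpha>. rect_path (quad \<phi>) \<alpha> \<and> \<alpha> 0 \<in> Y \<and> \<alpha> 1 = \<beta> s \<and> line_integral k \<alpha> 0 1 \<le> ennreal \<tau>"
proof -
  define Q where "Q = quad \<phi>"
  have "compact ({0..1} \<times> {0..1} :: (real \<times> real) set)" by (intro compact_Times compact_Icc)
  then have Q: "compact Q"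
    using hom unfolding Q_def homeomorphism_def by (metis compact_continuous_image)
  \<comment> \<open>As \<open>k \<ge> 1\<close>, the levels below \<open>\<tau>\<close> lie in \<open>P\<close>, and only this set has to be covered.\<close>
  define P where "P = {x\<in>Q. infdist x Y < \<tau>}"
  define I0 where "I0 = (\<integral>\<^sup>+x\<in>P. k x * w x \<partial>hausdorff2_measure)"
  have I0: "64 * I0 < ennreal (c * \<tau>)" using small by (simp add: I0_def P_def Q_def)
  have Pm: "P \<in> sets borel"
  proof -
    have "open {x. infdist x Y < \<tau>}" by (intro open_Collect_less continuous_intros)
    then show ?thesis using Q compact_imp_closed[OF Q] unfolding P_def
      by (subst Collect_conj_eq) (auto intro: sets.Int)
  qed
  have PQ: "P \<subseteq> Q" by (auto simp: P_def)
  have Pfin: "hausdorff2 P < \<infinity>" using hausdorff2_mono[OF PQ] fin unfolding Q_def by (rule le_less_trans)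
  have Qne: "Q \<noteq> {}" using Y by (auto simp: Q_def)
  \<comment> \<open>Only levels below some \<open>\<tau>' < \<tau>\<close> are used, so that a path of \<open>k\<close>-length at most \<open>\<tau>'\<close> from \<open>Y\<close> to \<open>Z\<close>
    contradicts the assumption.\<close>
  obtain \<tau>' where \<tau>': "0 < \<tau>'" "\<tau>' < \<tau>" "64 * I0 < ennreal (c * \<tau>')"
  proof -
    obtain a where a: "64 * I0 = ennreal a" "a \<ge> 0" using I0 by (cases "64 * I0") (auto simp: top_unique)
    have "a < c * \<tau>" using I0 a by (simp add: ennreal_less_iff)
    then have "max 0 (a / c) < \<tau>" using c \<tau> by (simp add: pos_divide_less_eq mult.commute)
    then obtain \<tau>' where t: "max 0 (a / c) < \<tau>'" "\<tau>' < \<tau>" using dense by blast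
    then have "a < c * \<tau>'" using c by (simp add: pos_divide_less_eq mult.commute)
    then show ?thesis using that[of \<tau>'] t a by (simp add: ennreal_less_iff)
  qed
  obtain kv :: "nat \<Rightarrow> 'a \<Rightarrow> real" where
    kv1: "\<And>m x. 1 \<le> kv m x" and klip: "\<And>m x y. \<bar>kv m x - kv m y\<bar> \<le> (real m + 1) * dist x y"
    and kmono: "\<And>x. mono (\<lambda>m. kv m x)" and kSUP: "\<And>x. k x = (SUP m. ennreal (kv m x))"
    by (rule lsc_lipschitz_approx[OF k]) (rule that)
  obtain wv :: "nat \<Rightarrow> 'a \<Rightarrow> real" where
    wv1: "\<And>m x. 1 \<le> wv m x" and wlip: "\<And>m x y. \<bar>wv m x - wv m y\<bar> \<le> (real m + 1) * dist x y"
    and wmono: "\<And>x. mono (\<lambda>m. wv m x)" and wSUP: "\<And>x. w x = (SUP m. ennreal (wv m x))"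
    by (rule lsc_lipschitz_approx[OF w]) (rule that)
  define e where "e m = 1 / real (Suc m)" for m
  have e0: "e m > 0" for m by (simp add: e_def)
  have elim: "e \<longlonglongrightarrow> 0" unfolding e_def by (rule LIMSEQ_Suc[OF lim_1_over_n])
  have k0: "0 \<le> kv m x" and w0: "0 \<le> wv m x" for m x using kv1[of m x] wv1[of m x] by linarith+
  define V where "V m = chain_dist Q Y (kv m) (e m) \<tau>" for m
  have YQ: "Y \<subseteq> Q" using Y by (simp add: Q_def)
  have Vcont: "continuous_on Q (V m)" for m
    unfolding V_def by (rule continuous_on_chain_dist[OF kv1 \<tau> e0 YQ _ klip]) simp
  have VY: "V m y = 0" if "y \<in> Y" for m y unfolding V_def using that by (rule chain_dist_zero[OF kv1 \<tau> e0 YQ])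
  define F where "F m x = kv m x * wv m x" for m x
  have F1: "1 \<le> F m x" for m x
    using mult_mono[OF kv1[of m x] wv1[of m x]] k0[of m x] by (simp add: F_def)
  have Fm: "F m \<in> borel_measurable borel" for m
    unfolding F_def using lipschitz_measurable[OF klip] lipschitz_measurable[OF wlip] by measurable
  have FI: "(\<integral>\<^sup>+y\<in>P. ennreal (F m y) \<partial>hausdorff2_measure) \<le> I0" for m
    unfolding I0_def
  proof (intro nn_integral_mono mult_right_mono)
    fix y
    have "ennreal (F m y) = ennreal (kv m y) * ennreal (wv m y)" using k0 by (simp add: F_def ennreal_mult')
    also have "\<dots> \<le> k y * w y" unfolding kSUP wSUP by (intro mult_mono SUP_upper) auto
    finally show "ennreal (F m y) \<le> k y * w y" .
  qed simp
  have "\<exists>x r. (\<forall>j::nat. x j \<in> Q \<and> 0 \<le> r j \<and> r j < e m / 2) \<and> P \<subseteq> (\<Union>j. ball (x j) (r j)) \<and>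
      (\<Sum>j. ennreal (F m (x j) * (r j)\<^sup>2)) \<le> 4 * I0 + ennreal (e m)" for m
  proof -
    have "e m / 2 > 0" using e0[of m] by simp
    then obtain x r where xr: "\<And>j::nat. x j \<in> Q" "\<And>j. 0 \<le> r j \<and> r j < e m / 2" "P \<subseteq> (\<Union>j. ball (x j) (r j))"
      "(\<Sum>j. ennreal (F m (x j) * (r j)\<^sup>2)) \<le> 4 * (\<integral>\<^sup>+y\<in>P. ennreal (F m y) \<partial>hausdorff2_measure) + ennreal (e m)"
      by (rule weighted_ball_cover[OF Pm Pfin Fm F1 _ e0 PQ Qne]) (rule that)
    have "4 * (\<integral>\<^sup>+y\<in>P. ennreal (F m y) \<partial>hausdorff2_measure) + ennreal (e m) \<le> 4 * I0 + ennreal (e m)"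
      using FI by (intro add_right_mono mult_left_mono) auto
    with xr(4) have "(\<Sum>j. ennreal (F m (x j) * (r j)\<^sup>2)) \<le> 4 * I0 + ennreal (e m)" by (rule order_trans)
    then show ?thesis using xr by blast
  qed
  then have "\<forall>m. \<exists>x r. (\<forall>j::nat. x j \<in> Q \<and> 0 \<le> r j \<and> r j < e m / 2) \<and> P \<subseteq> (\<Union>j. ball (x j) (r j)) \<and>
      (\<Sum>j. ennreal (F m (x j) * (r j)\<^sup>2)) \<le> 4 * I0 + ennreal (e m)" by blast
  then obtain x r where xr: "\<forall>m. (\<forall>j::nat. x m j \<in> Q \<and> 0 \<le> r m j \<and> r m j < e m / 2) \<and>
      P \<subseteq> (\<Union>j. ball (x m j) (r m j)) \<and> (\<Sum>j. ennreal (F m (x m j) * (r m j)\<^sup>2)) \<le> 4 * I0 + ennreal (e m)"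
    unfolding choice_iff by blast
  have x: "x m j \<in> Q" and r: "0 \<le> r m j" "r m j < e m / 2" for m j using xr by blast+
  have cov: "P \<subseteq> (\<Union>j. ball (x m j) (r m j))" for m using xr by blast
  have sumF: "(\<Sum>j. ennreal (F m (x m j) * (r m j)\<^sup>2)) \<le> 4 * I0 + ennreal (e m)" for m using xr by blast
  define W where "W m j = wv m (x m j) + 1" for m j
  define K where "K m j = kv m (x m j) + 1" for m j
  have near: "\<bar>wv m y - wv m (x m j)\<bar> \<le> 1" "\<bar>kv m y - kv m (x m j)\<bar> \<le> 1" "dist (x m j) y \<le> e m"
    if "y \<in> ball (x m j) (r m j)" for m j y
  proof -
    have d: "dist (x m j) y < e m" using that r(2)[of m j] e0[of m] by (simp add: mem_ball)
    then show "dist (x m j) y \<le> e m" by simp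
    have "(real m + 1) * dist y (x m j) \<le> (real m + 1) * e m"
      using d by (intro mult_left_mono) (auto simp: dist_commute)
    also have "\<dots> = 1" by (simp add: e_def)
    finally have "(real m + 1) * dist y (x m j) \<le> 1" .
    then show "\<bar>wv m y - wv m (x m j)\<bar> \<le> 1" "\<bar>kv m y - kv m (x m j)\<bar> \<le> 1"
      using wlip[of m y "x m j"] klip[of m y "x m j"] by linarith+
  qed
  define J where "J m j = {V m (x m j) - K m j * r m j..V m (x m j) + K m j * r m j}" for m j
  have VJ: "V m y \<in> J m j" if y: "y \<in> Q" "y \<in> ball (x m j) (r m j)" for m j y
  proof -
    have "\<bar>V m y - V m (x m j)\<bar> \<le> (kv m (x m j) + 1) * dist (x m j) y"
      unfolding V_def using near[OF y(2)] y
      by (intro chain_dist_local_lipschitz[OF kv1 \<tau> e0 YQ] x) (auto simp: abs_le_iff)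
    also have "\<dots> \<le> K m j * r m j"
      unfolding K_def using y k0[of m "x m j"] by (intro mult_left_mono) auto
    finally show ?thesis by (auto simp: J_def)
  qed
  \<comment> \<open>The weighted size of the part of the covering that meets the level \<open>t\<close>.\<close>
  define \<Phi> where "\<Phi> m t = (\<Sum>j. ennreal (2 * (W m j * r m j)) * indicator (J m j) t)" for m and t :: real
  have \<Phi>m [measurable]: "\<Phi> m \<in> borel_measurable lborel" for m unfolding \<Phi>_def J_def by measurable
  have \<Phi>I: "(\<integral>\<^sup>+t. \<Phi> m t \<partial>lborel) \<le> 64 * I0 + ennreal (16 * e m)" for m
  proof -
    have "(\<integral>\<^sup>+t. \<Phi> m t \<partial>lborel) = (\<Sum>j. \<integral>\<^sup>+t. ennreal (2 * (W m j * r m j)) * indicator (J m j) t \<partial>lborel)"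
      unfolding \<Phi>_def J_def by (intro nn_integral_suminf) measurable
    also have "\<dots> \<le> (\<Sum>j. 16 * ennreal (F m (x m j) * (r m j)\<^sup>2))"
    proof (intro suminf_le summableI)
      fix j
      have W: "0 \<le> W m j" "W m j \<le> 2 * wv m (x m j)" and K: "0 \<le> K m j" "K m j \<le> 2 * kv m (x m j)"
        using wv1[of m "x m j"] kv1[of m "x m j"] by (auto simp: W_def K_def)
      have "(\<integral>\<^sup>+t. ennreal (2 * (W m j * r m j)) * indicator (J m j) t \<partial>lborel) =
          ennreal (2 * (W m j * r m j)) * emeasure lborel (J m j)"
        by (intro nn_integral_cmult_indicator) (simp add: J_def)
      also have "emeasure lborel (J m j) = ennreal (2 * (K m j * r m j))"
        unfolding J_def using K r(1)[of m j] by (subst emeasure_lborel_Icc) auto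
      also have "ennreal (2 * (W m j * r m j)) * ennreal (2 * (K m j * r m j)) = ennreal (4 * ((W m j * K m j) * (r m j)\<^sup>2))"
        using W r(1)[of m j] by (subst ennreal_mult'[symmetric]) (auto simp: power2_eq_square mult_ac)
      also have "\<dots> \<le> ennreal (16 * (F m (x m j) * (r m j)\<^sup>2))"
      proof (rule ennreal_leI)
        have "W m j * K m j \<le> (2 * wv m (x m j)) * (2 * kv m (x m j))" using W K by (intro mult_mono) auto
        then have "(W m j * K m j) * (r m j)\<^sup>2 \<le> (4 * F m (x m j)) * (r m j)\<^sup>2"
          by (intro mult_right_mono) (auto simp: F_def mult.commute)
        then show "4 * ((W m j * K m j) * (r m j)\<^sup>2) \<le> 16 * (F m (x m j) * (r m j)\<^sup>2)" by (simp add: mult_ac)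
      qed
      also have "\<dots> = 16 * ennreal (F m (x m j) * (r m j)\<^sup>2)" by (subst ennreal_mult') auto
      finally show "(\<integral>\<^sup>+t. ennreal (2 * (W m j * r m j)) * indicator (J m j) t \<partial>lborel)
        \<le> 16 * ennreal (F m (x m j) * (r m j)\<^sup>2)" .
    qed
    also have "\<dots> = 16 * (\<Sum>j. ennreal (F m (x m j) * (r m j)\<^sup>2))" by (rule ennreal_suminf_cmult)
    also have "\<dots> \<le> 16 * (4 * I0 + ennreal (e m))" by (rule mult_left_mono[OF sumF]) simp
    also have "\<dots> = 64 * I0 + ennreal (16 * e m)"
      using e0[of m] by (simp add: distrib_left mult.assoc[symmetric] ennreal_mult')
    finally show ?thesis .
  qed
  \<comment> \<open>By Fatou's lemma some level is met infinitely often by little of the covering.\<close>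
  obtain t where t: "0 < t" "t < \<tau>'" "liminf (\<lambda>m. \<Phi> m t) < ennreal c"
  proof -
    have "\<exists>t. 0 < t \<and> t < \<tau>' \<and> liminf (\<lambda>m. \<Phi> m t) < ennreal c"
    proof (rule ccontr)
      assume "\<not> ?thesis"
      then have *: "ennreal c \<le> liminf (\<lambda>m. \<Phi> m t)" if "0 < t" "t < \<tau>'" for t using that by (meson not_less)
      have "ennreal (c * \<tau>') = ennreal c * emeasure lborel {0<..<\<tau>'}" using \<tau>' c by (simp add: ennreal_mult)
      also have "\<dots> = (\<integral>\<^sup>+t. ennreal c * indicator {0<..<\<tau>'} t \<partial>lborel)"
        by (intro nn_integral_cmult_indicator[symmetric]) simp
      also have "\<dots> \<le> (\<integral>\<^sup>+t. liminf (\<lambda>m. \<Phi> m t) \<partial>lborel)"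
        using * by (intro nn_integral_mono) (auto simp: indicator_def)
      also have "\<dots> \<le> liminf (\<lambda>m. \<integral>\<^sup>+t. \<Phi> m t \<partial>lborel)" by (rule nn_integral_liminf) measurable
      also have "\<dots> \<le> liminf (\<lambda>m. 64 * I0 + ennreal (16 * e m))"
        using \<Phi>I by (intro Liminf_mono always_eventually) auto
      also have "\<dots> = 64 * I0 + ennreal (16 * 0)"
        by (intro lim_imp_Liminf tendsto_intros elim) simp
      finally show False using \<tau>'(3) by simp
    qed
    then show ?thesis using that by blast
  qed
  have freq: "\<exists>\<^sub>F m in sequentially. \<Phi> m t < ennreal c"
  proof (rule ccontr)
    assume "\<not> ?thesis"
    then have "eventually (\<lambda>m. ennreal c \<le> \<Phi> m t) sequentially" by (simp add: frequently_def not_less)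
    then have "ennreal c \<le> liminf (\<lambda>m. \<Phi> m t)" by (rule Liminf_bounded)
    then show False using t by simp
  qed
  \<comment> \<open>Otherwise chains of bounded weight would end in \<open>Z\<close> for infinitely many meshes, and their limit would be
    a path from \<open>Y\<close> to \<open>Z\<close> that is too short.\<close>
  have VZ: "eventually (\<lambda>m. \<forall>z\<in>Z. t < V m z) sequentially"
  proof (rule ccontr)
    assume "\<not> ?thesis"
    then have "\<exists>\<^sub>F m in sequentially. \<exists>z\<in>Z. V m z \<le> t" by (simp add: frequently_def not_le)
    then have "infinite {m. \<exists>z\<in>Z. V m z \<le> t}" by (simp add: frequently_cofinite flip: cofinite_eq_sequentially)
    from infinite_enumerate[OF this] obtain q where q: "strict_mono (q :: nat \<Rightarrow> nat)" "\<And>i. \<exists>z\<in>Z. V (q i) z \<le> t" by blast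
    then obtain z where z: "\<And>i. z i \<in> Z" "\<And>i. V (q i) (z i) \<le> t" by metis
    obtain l p where l: "l \<in> Z" "strict_mono (p :: nat \<Rightarrow> nat)" "(z \<circ> p) \<longlonglongrightarrow> l"
      using Z(1) z(1) unfolding compact_eq_seq_compact_metric seq_compact_def by metis
    have "chain_dist Q Y (kv ((q \<circ> p) i)) (1 / real (Suc ((q \<circ> p) i))) \<tau> ((z \<circ> p) i) < \<tau>'" for i
      using z(2)[of "p i"] t by (simp add: V_def e_def)
    from curve_from_chain_dists[OF Q kv1 klip kmono kSUP Y(1) YQ strict_mono_o[OF q(1) l(2)] \<tau>'(1) less_imp_le[OF \<tau>'(2)] this l(3)]
    obtain \<alpha> where \<alpha>: "rect_path Q \<alpha>" "\<alpha> 0 \<in> Y" "\<alpha> 1 = l" "line_integral k \<alpha> 0 1 \<le> ennreal \<tau>'" by metis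
    then have "ennreal \<tau> \<le> ennreal \<tau>'" using far[of \<alpha>] l(1) by (auto simp: Q_def)
    then show False using \<tau>' by simp
  qed
  have "\<exists>\<^sub>F m in sequentially. \<Phi> m t < ennreal c \<and> (\<forall>z\<in>Z. t < V m z)"
    using frequently_eventually_conj[OF freq VZ] by (simp add: conj_commute)
  then have "infinite {m. \<Phi> m t < ennreal c \<and> (\<forall>z\<in>Z. t < V m z)}"
    by (simp add: frequently_cofinite flip: cofinite_eq_sequentially)
  from infinite_enumerate[OF this] obtain q where q: "strict_mono (q :: nat \<Rightarrow> nat)"
    and \<Phi>q: "\<And>i. \<Phi> (q i) t < ennreal c" and Zq: "\<And>i z. z \<in> Z \<Longrightarrow> t < V (q i) z" by blast
  have qi: "i \<le> q i" for i by (rule seq_suble[OF q])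
  have chains: "\<exists>n p. is_chain Q (e i) n p \<and> p 0 \<in> S1 \<and> p n \<in> S2 \<and> chain_weight (wv i) n p \<le> c \<and> (\<forall>j\<le>n. V (q i) (p j) = t)" for i
  proof -
    define m where "m = q i"
    obtain C where C: "connected C" "C \<subseteq> Q" "\<And>y. y \<in> C \<Longrightarrow> V m y = t"
      "\<And>S. connected S \<Longrightarrow> S \<subseteq> Q \<Longrightarrow> S \<inter> Y \<noteq> {} \<Longrightarrow> S \<inter> Z \<noteq> {} \<Longrightarrow> C \<inter> S \<noteq> {}"
      unfolding Q_def
    proof (rule quad_level_set_component[where A = Y and B = Z and t = t and f = "V m", OF hom Vcont[of m, unfolded Q_def] Y(2,3,4) _ Z(2,3,4)])
      show "V m y < t" if "y \<in> Y" for y using VY[OF that] t by simp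
      show "t < V m y" if "y \<in> Z" for y using Zq[OF that] by (simp add: m_def)
    qed (rule that[unfolded Q_def])
    obtain a b where ab: "a \<in> C" "a \<in> S1" "b \<in> C" "b \<in> S2"
      using C(4)[of S1] C(4)[of S2] S1 S2 by (auto simp: Q_def)
    have CP: "C \<subseteq> P"
    proof
      fix y assume y: "y \<in> C"
      then have "chain_dist Q Y (kv m) (e m) \<tau> y < \<tau>" using C(3)[OF y] t \<tau>' by (simp add: V_def)
      then have "infdist y Y < \<tau>" by (rule infdist_less_if_chain_dist_less[OF kv1 \<tau> e0 YQ])
      then show "y \<in> P" using y C(2) by (auto simp: P_def)
    qed
    define I where "I = {j. t \<in> J m j}"
    have "C \<subseteq> (\<Union>j\<in>I. ball (x m j) (r m j))"
    proof
      fix y assume y: "y \<in> C"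
      then obtain j where j: "y \<in> ball (x m j) (r m j)" using CP cov[of m] by blast
      then have "t \<in> J m j" using VJ[of y m j] C(2,3) y by auto
      then show "y \<in> (\<Union>j\<in>I. ball (x m j) (r m j))" using j by (auto simp: I_def)
    qed
    then obtain n p \<iota> where p: "p 0 = a" "p n = b" "\<And>i. i \<le> n \<Longrightarrow> p i \<in> C" "inj_on \<iota> {..<n}"
      "\<And>i. i < n \<Longrightarrow> \<iota> i \<in> I \<and> p i \<in> ball (x m (\<iota> i)) (r m (\<iota> i)) \<and> p (Suc i) \<in> ball (x m (\<iota> i)) (r m (\<iota> i))"
      by (rule chain_through_cover[OF C(1) ab(1,3)]) (auto intro: that)
    have dp: "dist (p l) (p (Suc l)) \<le> 2 * r m (\<iota> l)" if "l < n" for l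
      using p(5)[OF that] dist_triangle3[of "p l" "p (Suc l)" "x m (\<iota> l)"] by (auto simp: mem_ball)
    have em: "e m \<le> e i" unfolding e_def using qi[of i] by (intro divide_left_mono) (auto simp: m_def)
    have "is_chain Q (e i) n p"
      unfolding is_chain_def
    proof (intro conjI allI impI)
      fix l assume "l < n"
      then show "dist (p l) (p (Suc l)) \<le> e i" using dp[of l] r(2)[of m "\<iota> l"] em by linarith
    qed (use p(3) C(2) in auto)
    moreover have "chain_weight (wv i) n p \<le> c"
    proof -
      have "chain_weight (wv i) n p \<le> (\<Sum>l<n. 2 * (W m (\<iota> l) * r m (\<iota> l)))"
        unfolding chain_weight_def
      proof (intro sum_mono)
        fix l assume l: "l \<in> {..<n}"
        have "wv i (p l) \<le> wv m (p l)" using wmono qi[of i] by (auto simp: mono_def m_def)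
        also have "\<dots> \<le> W m (\<iota> l)" using near(1)[of "p l" m "\<iota> l"] p(5)[of l] l by (auto simp: W_def abs_le_iff)
        finally have "wv i (p l) * dist (p l) (p (Suc l)) \<le> W m (\<iota> l) * (2 * r m (\<iota> l))"
          using dp[of l] l w0[of i "p l"] by (intro mult_mono) auto
        then show "wv i (p l) * dist (p l) (p (Suc l)) \<le> 2 * (W m (\<iota> l) * r m (\<iota> l))" by simp
      qed
      then have "ennreal (chain_weight (wv i) n p) \<le> ennreal (\<Sum>l<n. 2 * (W m (\<iota> l) * r m (\<iota> l)))" by (rule ennreal_leI)
      also have "\<dots> = (\<Sum>l<n. ennreal (2 * (W m (\<iota> l) * r m (\<iota> l))))"
        using r(1) w0 by (intro sum_ennreal[symmetric]) (auto simp: W_def)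
      also have "\<dots> = (\<Sum>j\<in>\<iota> ` {..<n}. ennreal (2 * (W m j * r m j)))"
        using p(4) by (simp add: sum.reindex)
      also have "\<dots> = (\<Sum>j\<in>\<iota> ` {..<n}. ennreal (2 * (W m j * r m j)) * indicator (J m j) t)"
        using p(5) by (intro sum.cong) (auto simp: I_def indicator_def)
      also have "\<dots> \<le> \<Phi> m t"
        unfolding \<Phi>_def by (intro sum_le_suminf summableI) auto
      also have "\<dots> < ennreal c" using \<Phi>q[of i] by (simp add: m_def)
      finally have "\<not> ennreal c \<le> ennreal (chain_weight (wv i) n p)" by (simp add: not_le)
      then show ?thesis using ennreal_leI[of c "chain_weight (wv i) n p"] by linarith
    qed
    moreover have "p 0 \<in> S1" "p n \<in> S2" using p ab by auto
    moreover have "\<forall>j\<le>n. V (q i) (p j) = t" using p(3) C(3) by (auto simp: m_def)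
    ultimately show ?thesis by blast
  qed
  then have "\<forall>i. \<exists>n p. is_chain Q (e i) n p \<and> p 0 \<in> S1 \<and> p n \<in> S2 \<and> chain_weight (wv i) n p \<le> c \<and> (\<forall>j\<le>n. V (q i) (p j) = t)" by blast
  then obtain n p where np: "\<And>i. is_chain Q (e i) (n i) (p i)" "\<And>i. p i 0 \<in> S1" "\<And>i. p i (n i) \<in> S2"
      "\<And>i. chain_weight (wv i) (n i) (p i) \<le> c" "\<And>i j. j \<le> n i \<Longrightarrow> V (q i) (p i j) = t"
    unfolding choice_iff by blast
  have wt: "(\<Sum>j<n i. wv i (p i j) * dist (p i j) (p i (Suc j))) \<le> c + e i" for i
    using np(4)[of i] e0[of i] by (simp add: chain_weight_def)
  have pQ: "p i j \<in> Q" if "j \<le> n i" for i j using np(1)[of i] that by (simp add: is_chain_def)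
  have mesh: "dist (p i j) (p i (Suc j)) \<le> e i" if "j < n i" for i j using np(1)[of i] that by (simp add: is_chain_def)
  have c0: "0 \<le> c" using c by simp
  obtain g \<beta> where g: "strict_mono (g :: nat \<Rightarrow> nat)" and \<beta>: "rect_on \<beta> 0 1" "\<And>s. s \<in> {0..1} \<Longrightarrow> \<beta> s \<in> Q"
    and pts: "\<And>s. s \<in> {0..1} \<Longrightarrow> \<exists>j. (\<forall>k. j k \<le> n (g k)) \<and> (\<lambda>k. p (g k) (j k)) \<longlonglongrightarrow> \<beta> s"
    and st: "(\<lambda>k. p (g k) 0) \<longlonglongrightarrow> \<beta> 0" and fi: "(\<lambda>k. p (g k) (n (g k))) \<longlonglongrightarrow> \<beta> 1"
    and I: "line_integral w \<beta> 0 1 \<le> ennreal c"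
    by (rule chain_limit[where p = p and n = n, OF Q wv1 wlip wmono wSUP _ _ elim e0 c0 wt], erule pQ, erule mesh, rule that)
  show ?thesis
  proof (rule that[of \<beta>])
    show "rect_path (quad \<phi>) \<beta>" using \<beta> by (auto simp: rect_path_def Q_def)
    show "\<beta> 0 \<in> S1" by (rule closed_sequentially[OF compact_imp_closed[OF S1(1)] _ st]) (rule np)
    show "\<beta> 1 \<in> S2" by (rule closed_sequentially[OF compact_imp_closed[OF S2(1)] _ fi]) (rule np)
    show "line_integral w \<beta> 0 1 \<le> ennreal c" by (rule I)
    fix s :: real assume "s \<in> {0..1}"
    from pts[OF this] obtain j where j: "\<And>k. j k \<le> n (g k)" "(\<lambda>k. p (g k) (j k)) \<longlonglongrightarrow> \<beta> s" by blast
    have "chain_dist Q Y (kv ((q \<circ> g) i)) (1 / real (Suc ((q \<circ> g) i))) \<tau> (p (g i) (j i)) < \<tau>" for i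
      using np(5)[OF j(1), of i] t \<tau>' by (simp add: V_def e_def)
    from curve_from_chain_dists[OF Q kv1 klip kmono kSUP Y(1) YQ strict_mono_o[OF q g] \<tau> order_refl this j(2)]
    obtain \<alpha> where "rect_path Q \<alpha>" "\<alpha> 0 \<in> Y" "\<alpha> 1 = \<beta> s" "line_integral k \<alpha> 0 1 \<le> ennreal \<tau>" by metis
    then show "\<exists>\<alpha>. rect_path (quad \<phi>) \<alpha> \<and> \<alpha> 0 \<in> Y \<and> \<alpha> 1 = \<beta> s \<and> line_integral k \<alpha> 0 1 \<le> ennreal \<tau>"
      unfolding Q_def by blast
  qed
qed

text \<open>When no particular region near \<open>Y\<close> is known to be light, the whole integral may be used.\<close>

lemma crossing_finite:
  fixes \<phi> :: "real \<times> real \<Rightarrow> 'a::metric_space" and k w :: "'a \<Rightarrow> ennreal"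
  assumes hom: "homeomorphism ({0..1} \<times> {0..1}) (quad \<phi>) \<phi> \<psi>" and fin: "hausdorff2 (quad \<phi>) < \<infinity>"
    and k: "lsc k" "\<And>x. 1 \<le> k x" and w: "lsc w" "\<And>x. 1 \<le> w x"
    and I: "(\<integral>\<^sup>+x\<in>quad \<phi>. k x * w x \<partial>hausdorff2_measure) = ennreal i" "i \<ge> 0"
    and Y: "compact Y" "connected Y" "Y \<subseteq> quad \<phi>" "Y \<noteq> {}"
    and Z: "compact Z" "connected Z" "Z \<subseteq> quad \<phi>" "Z \<noteq> {}"
    and S1: "compact S1" "connected S1" "S1 \<subseteq> quad \<phi>" "S1 \<inter> Y \<noteq> {}" "S1 \<inter> Z \<noteq> {}"
    and S2: "compact S2" "connected S2" "S2 \<subseteq> quad \<phi>" "S2 \<inter> Y \<noteq> {}" "S2 \<inter> Z \<noteq> {}"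
    and \<tau>: "\<tau> > 0" and far: "\<And>\<gamma>. rect_path (quad \<phi>) \<gamma> \<Longrightarrow> \<gamma> 0 \<in> Y \<Longrightarrow> \<gamma> 1 \<in> Z \<Longrightarrow> ennreal \<tau> \<le> line_integral k \<gamma> 0 1"
  obtains \<beta> where "rect_path (quad \<phi>) \<beta>" "\<beta> 0 \<in> S1" "\<beta> 1 \<in> S2" "line_integral w \<beta> 0 1 \<le> ennreal ((64 * i + 1) / \<tau>)"
    "\<And>s. s \<in> {0..1} \<Longrightarrow> \<exists>\<alpha>. rect_path (quad \<phi>) \<alpha> \<and> \<alpha> 0 \<in> Y \<and> \<alpha> 1 = \<beta> s \<and> line_integral k \<alpha> 0 1 \<le> ennreal \<tau>"
proof -
  have c: "(64 * i + 1) / \<tau> > 0" "(64 * i + 1) / \<tau> * \<tau> = 64 * i + 1" using I(2) \<tau> by (auto simp: add_nonneg_pos)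
  have "(\<integral>\<^sup>+x\<in>{x\<in>quad \<phi>. infdist x Y < \<tau>}. k x * w x \<partial>hausdorff2_measure) \<le> ennreal i"
    unfolding I(1)[symmetric] by (intro nn_integral_mono) (auto simp: indicator_def)
  then have "64 * (\<integral>\<^sup>+x\<in>{x\<in>quad \<phi>. infdist x Y < \<tau>}. k x * w x \<partial>hausdorff2_measure) \<le> 64 * ennreal i"
    by (rule mult_left_mono) simp
  also have "\<dots> = ennreal (64 * i)" by (subst ennreal_mult') auto
  also have "\<dots> < ennreal ((64 * i + 1) / \<tau> * \<tau>)" unfolding c(2) using I(2) by (intro ennreal_lessI) auto
  finally have small: "64 * (\<integral>\<^sup>+x\<in>{x\<in>quad \<phi>. infdist x Y < \<tau>}. k x * w x \<partial>hausdorff2_measure)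
    < ennreal ((64 * i + 1) / \<tau> * \<tau>)" .
  show ?thesis by (rule crossing[OF hom fin k w Y Z S1 S2 \<tau> _ small c(1)]) (erule (2) far, rule that)
qed

section \<open>Hausdorff measure of compact sets and of rectifiable curves\<close>

lemma hausdorff2_compact_finite:
  fixes Q :: "'a::metric_space set"
  assumes lf: "locally_finite_hausdorff2 TYPE('a)" and Q: "compact Q"
  shows "hausdorff2 Q < \<infinity>"
proof -
  have "\<forall>x::'a. \<exists>U. open U \<and> x \<in> U \<and> hausdorff2 U < \<infinity>" using lf by (simp add: locally_finite_hausdorff2_def)
  then obtain U :: "'a \<Rightarrow> 'a set" where U: "\<And>x. open (U x)" "\<And>x. x \<in> U x" "\<And>x. hausdorff2 (U x) < \<infinity>"
    unfolding choice_iff by blast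
  have "Q \<subseteq> (\<Union>x\<in>Q. U x)" using U(2) by blast
  from compactE_image[OF Q U(1) this] obtain D where D: "D \<subseteq> Q" "finite D" "Q \<subseteq> (\<Union>x\<in>D. U x)" by blast
  have "hausdorff2 (\<Union>x\<in>D. U x) < \<infinity>"
    using D(2)
  proof induction
    case (insert x D)
    have "hausdorff2 (\<Union>x\<in>insert x D. U x) \<le> hausdorff2 (U x) + hausdorff2 (\<Union>x\<in>D. U x)"
      using hausdorff2_subadditive[of "U x" "\<Union>x\<in>D. U x"] by simp
    also have "\<dots> < \<infinity>" using U(3)[of x] insert by (simp add: less_top)
    finally show ?case .
  qed (simp add: hausdorff2_empty)
  with hausdorff2_mono[OF D(3)] show ?thesis by (rule le_less_trans)
qed

text \<open>\<open>N\<close> arcs of length \<open>l / N\<close> have total squared diameter at most \<open>l\<^sup>2 / N\<close>.\<close>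

lemma hausdorff2_rectifiable_image:
  assumes r: "rect_on \<gamma> a b"
  shows "hausdorff2 (\<gamma> ` {a..b}) = 0"
proof -
  define l where "l = len \<gamma> a b"
  define c where "c = arc_clamped \<gamma> a b"
  have l: "l \<ge> 0" by (simp add: l_def len_nonneg)
  have "hausdorff2_pre \<epsilon> (\<gamma> ` {a..b}) = 0" if \<epsilon>: "\<epsilon> > 0" for \<epsilon>
  proof -
    have bound: "hausdorff2_pre \<epsilon> (\<gamma> ` {a..b}) \<le> ennreal (pi / 4 * l\<^sup>2 / real N)" if N: "N > 0" "l / real N < \<epsilon>" for N :: nat
    proof -
      define h where "h = l / real N"
      have h: "h \<ge> 0" "real N * h = l" using l N by (auto simp: h_def)
      define A where "A j = (if j < N then c ` {real j * h..real (Suc j) * h} else {})" for j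
      have dA: "bounded (A j)" "diameter (A j) \<le> h" for j
      proof -
        have *: "dist x y \<le> h" if "x \<in> A j" "y \<in> A j" for x y
        proof -
          have "x \<in> c ` {real j * h..real (Suc j) * h}" "y \<in> c ` {real j * h..real (Suc j) * h}"
            using that unfolding A_def by (cases "j < N"; simp)+
          then obtain s t where "x = c s" "y = c t" "s \<in> {real j * h..real (Suc j) * h}" "t \<in> {real j * h..real (Suc j) * h}"
            by blast
          then show ?thesis
            using dist_arc_clamped_le[OF r, of s t] unfolding c_def by (auto simp: dist_real_def distrib_right)
        qed
        show "bounded (A j)" using * unfolding bounded_two_points by blast
        show "diameter (A j) \<le> h" using * h unfolding diameter_def by (auto intro!: cSUP_least)
      qed
      have "\<gamma> ` {a..b} \<subseteq> (\<Union>j. A j)"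
      proof
        fix x assume "x \<in> \<gamma> ` {a..b}"
        then obtain t where t: "t \<in> {a..b}" "x = \<gamma> t" by auto
        define s where "s = len \<gamma> a t"
        have s: "0 \<le> s" "s \<le> l" using t len_mono[OF r, of t b] by (auto simp: s_def l_def len_nonneg)
        have x: "x = c s" using arc_clamped_len[OF r t(1)] t by (simp add: c_def s_def)
        have "\<exists>j<N. s \<in> {real j * h..real (Suc j) * h}"
        proof (cases "s = l")
          case True
          have "real (Suc (N - 1)) * h = l" "real (N - 1) * h \<le> l"
            using h N mult_right_mono[of "real (N - 1)" "real N" h] by auto
          then show ?thesis using True N by (intro exI[of _ "N - 1"]) auto
        next
          case False
          then have hp: "h > 0" "s < l" using s N by (auto simp: h_def)
          define j where "j = nat \<lfloor>s / h\<rfloor>"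
          have fl: "real j = of_int \<lfloor>s / h\<rfloor>" using s hp by (simp add: j_def)
          have j: "real j \<le> s / h" "s / h < real j + 1" using fl by linarith+
          then have "real j * h \<le> s" "s < (real j + 1) * h" using hp by (auto simp: pos_le_divide_eq pos_divide_less_eq)
          moreover have "real j < real N"
          proof -
            have "real j * h < real N * h" using \<open>real j * h \<le> s\<close> hp h by linarith
            then show ?thesis using hp by simp
          qed
          ultimately show ?thesis by (intro exI[of _ j]) (auto simp: add.commute)
        qed
        then show "x \<in> (\<Union>j. A j)" unfolding x by (auto simp: A_def)
      qed
      then have "hausdorff2_pre \<epsilon> (\<gamma> ` {a..b}) \<le> (\<Sum>j. ennreal (pi / 4 * diameter (A j) ^ 2))"
      proof (rule hausdorff2_pre_le_cover)
        show "bounded (A j)" "diameter (A j) < \<epsilon>" for j using dA[of j] N by (auto simp: h_def)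
      qed
      also have "\<dots> = (\<Sum>j<N. ennreal (pi / 4 * diameter (A j) ^ 2))"
        by (rule suminf_finite) (auto simp: A_def)
      also have "\<dots> \<le> (\<Sum>j<N. ennreal (pi / 4 * h\<^sup>2))"
        using dA by (intro sum_mono ennreal_leI mult_left_mono power_mono diameter_ge_0) auto
      also have "\<dots> = ennreal (real N * (pi / 4 * h\<^sup>2))"
        by (simp add: ennreal_of_nat_eq_real_of_nat flip: ennreal_mult')
      also have "real N * (pi / 4 * h\<^sup>2) = pi / 4 * l\<^sup>2 / real N"
        using N by (simp add: h_def power2_eq_square)
      finally show ?thesis .
    qed
    have "(\<lambda>N. ennreal (pi / 4 * l\<^sup>2 / real N)) \<longlonglongrightarrow> ennreal 0"
      by (intro tendsto_ennrealI lim_const_over_n)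
    moreover have "eventually (\<lambda>N. hausdorff2_pre \<epsilon> (\<gamma> ` {a..b}) \<le> ennreal (pi / 4 * l\<^sup>2 / real N)) sequentially"
    proof -
      have "(\<lambda>N. l / real N) \<longlonglongrightarrow> 0" by (rule lim_const_over_n)
      then have "eventually (\<lambda>N. l / real N < \<epsilon>) sequentially" using \<epsilon> by (rule order_tendstoD)
      then show ?thesis using eventually_gt_at_top[of 0] by eventually_elim (rule bound)
    qed
    ultimately have "hausdorff2_pre \<epsilon> (\<gamma> ` {a..b}) \<le> ennreal 0" by (rule tendsto_lowerbound) simp
    then show ?thesis by simp
  qed
  then show ?thesis by (simp add: hausdorff2_eq_SUP)
qed

lemma integrable_if_square:
  fixes K :: "'a::metric_space \<Rightarrow> ennreal"
  assumes "\<And>x. 1 \<le> K x" "(\<integral>\<^sup>+x\<in>Q. (K x)\<^sup>2 \<partial>hausdorff2_measure) < \<infinity>"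
  shows "(\<integral>\<^sup>+x\<in>Q. K x \<partial>hausdorff2_measure) < \<infinity>"
proof -
  have "K x * 1 \<le> K x * K x" for x by (intro mult_left_mono assms) simp
  then have "(\<integral>\<^sup>+x\<in>Q. K x \<partial>hausdorff2_measure) \<le> (\<integral>\<^sup>+x\<in>Q. (K x)\<^sup>2 \<partial>hausdorff2_measure)"
    unfolding power2_eq_square by (intro nn_integral_mono mult_right_mono) auto
  then show ?thesis using assms(2) by (rule le_less_trans)
qed

section \<open>Regularity and lower semicontinuous majorants\<close>

lemma infdist_neighbourhoods:
  fixes S :: "'a::metric_space set"
  assumes "closed S" "S \<noteq> {}"
  defines "U \<equiv> \<lambda>n. {x. infdist x S < 1 / real (Suc n)}"
  shows "open (U n)" "decseq U" "(\<Inter>n. U n) = S"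
proof -
  show "open (U n)" unfolding U_def by (intro open_Collect_less continuous_intros)
  show "decseq U" unfolding decseq_def U_def
  proof clarify
    fix m n :: nat and x assume "m \<le> n" "infdist x S < 1 / real (Suc n)"
    moreover from this have "1 / real (Suc n) \<le> 1 / real (Suc m)" by (intro divide_left_mono) auto
    ultimately show "infdist x S < 1 / real (Suc m)" by linarith
  qed
  show "(\<Inter>n. U n) = S"
  proof (intro set_eqI iffI)
    fix x assume x: "x \<in> (\<Inter>n. U n)"
    have "infdist x S = 0"
    proof (rule ccontr)
      assume "infdist x S \<noteq> 0"
      then have "infdist x S > 0" using infdist_nonneg[of x S] by linarith
      then obtain n where "inverse (real (Suc n)) < infdist x S" using reals_Archimedean by blast
      moreover have "x \<in> U n" using x by blast
      ultimately show False by (simp add: U_def inverse_eq_divide)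
    qed
    then show "x \<in> S" using assms by (simp add: in_closed_iff_infdist_zero)
  next
    fix x assume "x \<in> S"
    then show "x \<in> (\<Inter>n. U n)" by (auto simp: U_def)
  qed
qed

text \<open>The sets with this property form a \<open>\<sigma>\<close>-algebra, and closed sets belong to it because they are
  intersections of decreasing sequences of open sets. The approximation property is symmetric in \<open>F\<close> and \<open>U\<close>,
  which gives complements.\<close>

lemma finite_borel_measure_regular:
  fixes M :: "'a::metric_space measure"
  assumes sM: "sets M = sets borel" and fin: "emeasure M UNIV < \<infinity>"
    and B: "B \<in> sets borel" and e: "e > (0::real)"
  obtains F U where "closed F" "F \<subseteq> B" "B \<subseteq> U" "open U" "emeasure M (U - F) \<le> ennreal e"
proof -
  have sp: "space M = UNIV" using sets_eq_imp_space_eq[OF sM] by simp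
  have fin': "emeasure M A \<noteq> \<infinity>" for A
  proof -
    have "emeasure M A \<le> emeasure M UNIV" using emeasure_space[of M A] sp by simp
    then show ?thesis using fin by (auto simp: top_unique)
  qed
  have op: "U \<in> sets M" if "open U" for U using that sM by simp
  have cl: "F \<in> sets M" if "closed F" for F using that sM by simp
  have "B \<in> sigma_sets UNIV {F. closed F}" using B by (simp add: borel_eq_closed)
  then have "\<forall>e>0. \<exists>F U. closed F \<and> F \<subseteq> B \<and> B \<subseteq> U \<and> open U \<and> emeasure M (U - F) \<le> ennreal e"
  proof induction
    case (Basic S)
    then have S: "closed S" by simp
    show ?case
    proof (cases "S = {}")
      case True
      then show ?thesis by (intro allI impI exI[of _ "{}"]) auto
    next
      case False
      define U where "U n = {x. infdist x S < 1 / real (Suc n)}" for n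
      note U = infdist_neighbourhoods[OF S False, folded U_def]
      have "(\<lambda>n. emeasure M (U n - S)) \<longlonglongrightarrow> emeasure M (\<Inter>n. U n - S)"
        using U op cl[OF S] fin' by (intro Lim_emeasure_decseq) (auto simp: decseq_def)
      also have "(\<Inter>n. U n - S) = {}" using U(3) by blast
      finally have lim: "(\<lambda>n. emeasure M (U n - S)) \<longlonglongrightarrow> 0" by simp
      show ?thesis
      proof (intro allI impI)
        fix e :: real assume "e > 0"
        then have "eventually (\<lambda>n. emeasure M (U n - S) < ennreal e) sequentially" using lim by (intro order_tendstoD) auto
        then obtain n where "emeasure M (U n - S) < ennreal e" by (auto simp: eventually_sequentially)
        then show "\<exists>F U. closed F \<and> F \<subseteq> S \<and> S \<subseteq> U \<and> open U \<and> emeasure M (U - F) \<le> ennreal e"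
          using S U by (intro exI[of _ S] exI[of _ "U n"]) auto
      qed
    qed
  next
    case Empty
    show ?case by (intro allI impI exI[of _ "{}"]) auto
  next
    case (Compl A)
    show ?case
    proof (intro allI impI)
      fix e :: real assume "e > 0"
      then have "\<exists>F U. closed F \<and> F \<subseteq> A \<and> A \<subseteq> U \<and> open U \<and> emeasure M (U - F) \<le> ennreal e"
        using Compl.IH by simp
      then obtain F U where FU: "closed F" "F \<subseteq> A" "A \<subseteq> U" "open U" "emeasure M (U - F) \<le> ennreal e" by blast
      have eq: "(- F) - (- U) = U - F" by blast
      show "\<exists>F U. closed F \<and> F \<subseteq> UNIV - A \<and> UNIV - A \<subseteq> U \<and> open U \<and> emeasure M (U - F) \<le> ennreal e"
      proof (intro exI conjI)
        show "closed (- U)" "open (- F)" using FU by (auto simp: open_closed)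
        show "- U \<subseteq> UNIV - A" "UNIV - A \<subseteq> - F" using FU by auto
        show "emeasure M ((- F) - (- U)) \<le> ennreal e" unfolding eq by (rule FU)
      qed
    qed
  next
    case (Union A)
    show ?case
    proof (intro allI impI)
      fix e :: real assume e: "e > 0"
      have "\<forall>i. \<exists>F U. closed F \<and> F \<subseteq> A i \<and> A i \<subseteq> U \<and> open U \<and> emeasure M (U - F) \<le> ennreal ((e/2) * (1/2) ^ Suc i)"
      proof
        fix i
        have "(e/2) * (1/2) ^ Suc i > 0" using e by simp
        then show "\<exists>F U. closed F \<and> F \<subseteq> A i \<and> A i \<subseteq> U \<and> open U \<and> emeasure M (U - F) \<le> ennreal ((e/2) * (1/2) ^ Suc i)"
          using Union.IH[of i] by simp
      qed
      then obtain F U where FU: "\<And>i. closed (F i)" "\<And>i. F i \<subseteq> A i" "\<And>i. A i \<subseteq> U i" "\<And>i. open (U i)"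
        "\<And>i. emeasure M (U i - F i) \<le> ennreal ((e/2) * (1/2) ^ Suc i)"
        unfolding choice_iff by blast
      define V where "V = (\<Union>i. U i)"
      have V: "open V" using FU by (auto simp: V_def)
      have Gm: "(\<Union>i<n. F i) \<in> sets M" for n using FU(1) cl by auto
      have "emeasure M (V - (\<Union>i. F i)) \<le> emeasure M (\<Union>i. U i - F i)"
        using FU(1,4) op cl by (intro emeasure_mono) (auto simp: V_def)
      also have "\<dots> \<le> (\<Sum>i. emeasure M (U i - F i))"
        using FU(1,4) op cl by (intro emeasure_subadditive_countably) auto
      also have "\<dots> \<le> (\<Sum>i. ennreal ((e/2) * (1/2) ^ Suc i))" using FU(5) by (intro suminf_le summableI)
      also have "\<dots> = ennreal (e/2)" using e by (intro suminf_half_ennreal) simp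
      finally have half: "emeasure M (V - (\<Union>i. F i)) \<le> ennreal (e/2)" .
      have "(\<lambda>n. emeasure M (V - (\<Union>i<n. F i))) \<longlonglongrightarrow> emeasure M (\<Inter>n. V - (\<Union>i<n. F i))"
        using op[OF V] Gm fin' by (intro Lim_emeasure_decseq) (auto simp: decseq_def dest: less_le_trans)
      also have "(\<Inter>n. V - (\<Union>i<n. F i)) = V - (\<Union>i. F i)" by blast
      finally have "(\<lambda>n. emeasure M (V - (\<Union>i<n. F i))) \<longlonglongrightarrow> emeasure M (V - (\<Union>i. F i))" .
      moreover have "emeasure M (V - (\<Union>i. F i)) < ennreal e"
        using half e by (elim le_less_trans) (auto intro: ennreal_lessI)
      ultimately have "eventually (\<lambda>n. emeasure M (V - (\<Union>i<n. F i)) < ennreal e) sequentially" by (rule order_tendstoD)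
      then obtain n where n: "emeasure M (V - (\<Union>i<n. F i)) < ennreal e" by (auto simp: eventually_sequentially)
      show "\<exists>F U. closed F \<and> F \<subseteq> (\<Union>i. A i) \<and> (\<Union>i. A i) \<subseteq> U \<and> open U \<and> emeasure M (U - F) \<le> ennreal e"
      proof (intro exI conjI)
        show "closed (\<Union>i<n. F i)" using FU(1) by (intro closed_UN) auto
        show "(\<Union>i<n. F i) \<subseteq> (\<Union>i. A i)" using FU(2) by blast
        show "(\<Union>i. A i) \<subseteq> V" using FU(3) by (auto simp: V_def)
        show "emeasure M (V - (\<Union>i<n. F i)) \<le> ennreal e" using n by simp
      qed (rule V)
    qed
  qed
  then show ?thesis using that e by blast
qed

text \<open>Square integrable weights are combined by suprema: these preserve lower semicontinuity, dominate each
  weight, and their squares are bounded by the sum of the squares.\<close>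

lemma SUP_square_le_suminf:
  fixes a :: "nat \<Rightarrow> ennreal"
  shows "(SUP i. a i)\<^sup>2 \<le> (\<Sum>i. (a i)\<^sup>2)"
proof -
  have le: "(a i)\<^sup>2 \<le> (\<Sum>i. (a i)\<^sup>2)" for i
    using sum_le_suminf[OF summableI, of "{i}" "\<lambda>i. (a i)\<^sup>2"] by simp
  have "a i * a j \<le> (\<Sum>i. (a i)\<^sup>2)" for i j
  proof (cases "a i \<le> a j")
    case True
    then have "a i * a j \<le> (a j)\<^sup>2" by (simp add: power2_eq_square mult_right_mono)
    then show ?thesis using le[of j] by (rule order_trans)
  next
    case False
    then have "a i * a j \<le> (a i)\<^sup>2" by (simp add: power2_eq_square mult_left_mono)
    then show ?thesis using le[of i] by (rule order_trans)
  qed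
  then have "(SUP j. SUP i. a i * a j) \<le> (\<Sum>i. (a i)\<^sup>2)" by (intro SUP_least)
  then show ?thesis by (simp add: power2_eq_square SUP_mult_left_ennreal SUP_mult_right_ennreal)
qed

text \<open>A Vitali--Caratheodory theorem. The level sets of \<open>f\<close> at multiples of \<open>\<delta>\<close> are enclosed in open
  sets of nearly the same measure, and the null set where \<open>f\<close> is infinite in open sets of tiny measure.\<close>

lemma lsc_majorant:
  fixes f :: "'a::metric_space \<Rightarrow> ennreal"
  assumes Q: "Q \<in> sets borel" "hausdorff2 Q < \<infinity>" and f: "f \<in> borel_measurable borel"
    and fin: "(\<integral>\<^sup>+x\<in>Q. (f x)\<^sup>2 \<partial>hausdorff2_measure) < \<infinity>" and \<epsilon>: "\<epsilon> > 0"
  obtains g where "lsc g" "\<And>x. f x \<le> g x"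
    "(\<integral>\<^sup>+x\<in>Q. (g x)\<^sup>2 \<partial>hausdorff2_measure) \<le> (\<integral>\<^sup>+x\<in>Q. (f x)\<^sup>2 \<partial>hausdorff2_measure) + ennreal \<epsilon>"
proof -
  define M where "M = density hausdorff2_measure (indicator Q :: 'a \<Rightarrow> ennreal)"
  have sM [measurable_cong]: "sets M = sets borel" by (simp add: M_def)
  have MI: "(\<integral>\<^sup>+x. u x \<partial>M) = (\<integral>\<^sup>+x\<in>Q. u x \<partial>hausdorff2_measure)" if "u \<in> borel_measurable borel" for u
    unfolding M_def using that Q(1) by (subst nn_integral_density) (auto simp: mult.commute)
  have ME: "emeasure M A = hausdorff2 (Q \<inter> A)" if "A \<in> sets borel" for A
    unfolding M_def using that Q(1)
    by (subst emeasure_density) (auto simp: emeasure_hausdorff2_measure nn_integral_indicator simp flip: indicator_inter_arith)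
  have finM: "emeasure M UNIV < \<infinity>" using ME[of UNIV] Q by simp
  note [measurable] = f
  define I where "I = (\<integral>\<^sup>+x. (f x)\<^sup>2 \<partial>M)"
  have I: "I < \<infinity>" unfolding I_def using fin by (subst MI) auto
  have fin1: "(\<integral>\<^sup>+x. f x \<partial>M) < \<infinity>"
  proof -
    have "f x \<le> 1 + (f x)\<^sup>2" for x
    proof (cases "f x \<le> 1")
      case True
      then show ?thesis by (simp add: add_increasing2)
    next
      case False
      then have "f x * 1 \<le> f x * f x" by (intro mult_left_mono) auto
      then show ?thesis by (simp add: power2_eq_square add_increasing)
    qed
    then have "(\<integral>\<^sup>+x. f x \<partial>M) \<le> (\<integral>\<^sup>+x. 1 + (f x)\<^sup>2 \<partial>M)" by (intro nn_integral_mono)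
    also have "\<dots> = emeasure M (space M) + I" unfolding I_def by (subst nn_integral_add) auto
    also have "space M = UNIV" using sets_eq_imp_space_eq[OF sM] by simp
    also have "emeasure M UNIV + I < \<infinity>" using finM I by (simp add: less_top)
    finally show ?thesis .
  qed
  obtain \<delta> where \<delta>: "\<delta> > 0" "(\<integral>\<^sup>+x. (f x + ennreal \<delta>)\<^sup>2 \<partial>M) \<le> I + ennreal (\<epsilon>/2)"
  proof -
    define c where "c = enn2real (2 * (\<integral>\<^sup>+x. f x \<partial>M) + emeasure M UNIV)"
    have c: "2 * (\<integral>\<^sup>+x. f x \<partial>M) + emeasure M UNIV = ennreal c"
      unfolding c_def using fin1 finM by (subst ennreal_enn2real) (auto simp: less_top[symmetric] ennreal_mult_eq_top_iff)
    have c0: "c \<ge> 0" by (simp add: c_def)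
    define \<delta> where "\<delta> = min 1 (\<epsilon> / (2 * (c + 1)))"
    have \<delta>: "\<delta> > 0" "\<delta> \<le> 1" using \<epsilon> c0 by (auto simp: \<delta>_def)
    have "\<delta> * (c + 1) \<le> \<epsilon> / 2"
    proof -
      have "\<delta> \<le> \<epsilon> / (2 * (c + 1))" by (simp add: \<delta>_def)
      then show ?thesis using c0 by (simp add: field_simps)
    qed
    then have \<delta>c: "\<delta> * c \<le> \<epsilon> / 2" using \<delta> by (simp add: distrib_left)
    have "(f x + ennreal \<delta>)\<^sup>2 \<le> (f x)\<^sup>2 + ennreal \<delta> * (2 * f x + 1)" for x
    proof -
      have "ennreal \<delta> * ennreal \<delta> \<le> ennreal \<delta> * 1" using \<delta> by (intro mult_left_mono) auto
      moreover have "(f x + ennreal \<delta>)\<^sup>2 = (f x)\<^sup>2 + ennreal \<delta> * (2 * f x) + ennreal \<delta> * ennreal \<delta>"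
        by (simp only: power2_eq_square distrib_left distrib_right mult_2 mult_2_right ac_simps)
      ultimately show ?thesis by (simp add: distrib_left add.assoc add_left_mono)
    qed
    then have "(\<integral>\<^sup>+x. (f x + ennreal \<delta>)\<^sup>2 \<partial>M) \<le> (\<integral>\<^sup>+x. (f x)\<^sup>2 + ennreal \<delta> * (2 * f x + 1) \<partial>M)" by (intro nn_integral_mono)
    also have "\<dots> = I + ennreal \<delta> * (2 * (\<integral>\<^sup>+x. f x \<partial>M) + emeasure M (space M))"
      unfolding I_def by (simp add: nn_integral_add nn_integral_cmult)
    also have "space M = UNIV" using sets_eq_imp_space_eq[OF sM] by simp
    also have "I + ennreal \<delta> * (2 * (\<integral>\<^sup>+x. f x \<partial>M) + emeasure M UNIV) \<le> I + ennreal (\<epsilon>/2)"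
      unfolding c using \<delta> \<delta>c by (intro add_left_mono) (simp add: ennreal_leI flip: ennreal_mult')
    finally show ?thesis using that \<delta> by blast
  qed
  \<comment> \<open>On \<open>B k\<close> the majorant takes the value \<open>(k + 1) \<delta> \<le> f + \<delta>\<close>.\<close>
  define B where "B k = {x. ennreal (real k * \<delta>) \<le> f x \<and> f x < ennreal (real (Suc k) * \<delta>)}" for k
  have Bm: "B k \<in> sets borel" for k unfolding B_def by measurable
  define N where "N = {x. f x = \<infinity>}"
  have Nm: "N \<in> sets borel" unfolding N_def by measurable
  have N0: "emeasure M N = 0"
  proof -
    have "AE x in M. (f x)\<^sup>2 \<noteq> \<infinity>" using I unfolding I_def by (intro nn_integral_PInf_AE) auto
    then have "AE x in M. x \<notin> N" by eventually_elim (auto simp: N_def power2_eq_square)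
    then show ?thesis using Nm sM sets_eq_imp_space_eq[OF sM] by (subst (asm) AE_iff_measurable[OF _ refl]) (auto simp: N_def)
  qed
  define \<eta> where "\<eta> k = (\<epsilon> / 4) * (1/2) ^ Suc k" for k
  have \<eta>: "\<eta> k > 0" for k using \<epsilon> by (simp add: \<eta>_def)
  have \<eta>sum: "(\<Sum>k. ennreal (\<eta> k)) = ennreal (\<epsilon>/4)" unfolding \<eta>_def using \<epsilon> by (intro suminf_half_ennreal) simp
  have open_ex: "\<exists>U. open U \<and> A \<subseteq> U \<and> ennreal s * emeasure M U \<le> ennreal s * emeasure M A + ennreal t"
    if A: "A \<in> sets borel" and t: "t > 0" and s: "s > 0" for A s t
  proof -
    obtain F U where FU: "closed F" "F \<subseteq> A" "A \<subseteq> U" "open U" "emeasure M (U - F) \<le> ennreal (t / s)"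
      by (rule finite_borel_measure_regular[OF sM finM A, of "t / s"]) (use t s in auto)
    have "U \<subseteq> A \<union> (U - F)" using FU by blast
    then have "emeasure M U \<le> emeasure M (A \<union> (U - F))"
      using FU A sM by (intro emeasure_mono) auto
    also have "\<dots> \<le> emeasure M A + emeasure M (U - F)" using FU A sM by (intro emeasure_subadditive) auto
    also have "\<dots> \<le> emeasure M A + ennreal (t / s)" by (rule add_left_mono[OF FU(5)])
    finally have "ennreal s * emeasure M U \<le> ennreal s * (emeasure M A + ennreal (t / s))" by (rule mult_left_mono) simp
    also have "\<dots> = ennreal s * emeasure M A + ennreal t"
      using s t by (simp add: distrib_left flip: ennreal_mult')
    finally show ?thesis using FU by blast
  qed
  define a where "a k = real (Suc k) * \<delta>" for k
  have a: "a k > 0" for k using \<delta> by (simp add: a_def)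
  have "\<forall>k. \<exists>U. open U \<and> B k \<subseteq> U \<and> ennreal ((a k)\<^sup>2) * emeasure M U \<le> ennreal ((a k)\<^sup>2) * emeasure M (B k) + ennreal (\<eta> k)"
  proof
    fix k
    show "\<exists>U. open U \<and> B k \<subseteq> U \<and> ennreal ((a k)\<^sup>2) * emeasure M U \<le> ennreal ((a k)\<^sup>2) * emeasure M (B k) + ennreal (\<eta> k)"
      using open_ex[OF Bm[of k] \<eta>[of k], of "(a k)\<^sup>2"] a[of k] by simp
  qed
  then obtain U where U: "\<And>k. open (U k)" "\<And>k. B k \<subseteq> U k"
    "\<And>k. ennreal ((a k)\<^sup>2) * emeasure M (U k) \<le> ennreal ((a k)\<^sup>2) * emeasure M (B k) + ennreal (\<eta> k)"
    unfolding choice_iff by blast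
  have "\<forall>k. \<exists>V. open V \<and> N \<subseteq> V \<and> ennreal ((a k)\<^sup>2) * emeasure M V \<le> ennreal ((a k)\<^sup>2) * emeasure M N + ennreal (\<eta> k)"
  proof
    fix k
    show "\<exists>V. open V \<and> N \<subseteq> V \<and> ennreal ((a k)\<^sup>2) * emeasure M V \<le> ennreal ((a k)\<^sup>2) * emeasure M N + ennreal (\<eta> k)"
      using open_ex[OF Nm \<eta>[of k], of "(a k)\<^sup>2"] a[of k] by simp
  qed
  then obtain V where V: "\<And>k. open (V k)" "\<And>k. N \<subseteq> V k" "\<And>k. ennreal ((a k)\<^sup>2) * emeasure M (V k) \<le> ennreal (\<eta> k)"
    unfolding choice_iff N0 by auto
  define g where "g x = (SUP k. ennreal (a k) * indicator (U k \<union> V k) x)" for x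
  have gl: "lsc g"
    unfolding g_def by (intro lsc_SUP lsc_mult_indicator[OF lsc_const] open_Un U(1) V(1))
  have fg: "f x \<le> g x" for x
  proof (cases "x \<in> N")
    case True
    have "ennreal (a k) \<le> g x" for k
    proof -
      have "ennreal (a k) = ennreal (a k) * indicator (U k \<union> V k) x" using V(2)[of k] True by auto
      also have "\<dots> \<le> g x" unfolding g_def by (rule SUP_upper) simp
      finally show ?thesis .
    qed
    have "g x = top"
    proof (rule ccontr)
      assume "g x \<noteq> top"
      then obtain r where r: "g x = ennreal r" "r \<ge> 0" by (cases "g x") auto
      obtain k :: nat where "r / \<delta> < real k" using reals_Archimedean2 by blast
      then have "r < a k" using \<delta> by (simp add: a_def field_simps)
      moreover have "a k \<le> r" using \<open>\<And>k. ennreal (a k) \<le> g x\<close>[of k] r by simp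
      ultimately show False by simp
    qed
    then show ?thesis by simp
  next
    case False
    then obtain r where r: "f x = ennreal r" "r \<ge> 0" by (cases "f x") (auto simp: N_def)
    define k where "k = nat \<lfloor>r / \<delta>\<rfloor>"
    have "real k = of_int \<lfloor>r / \<delta>\<rfloor>" using r \<delta> by (simp add: k_def)
    then have "real k \<le> r / \<delta>" "r / \<delta> < real k + 1" by linarith+
    then have k: "real k * \<delta> \<le> r" "r < real (Suc k) * \<delta>" using \<delta> by (auto simp: pos_le_divide_eq pos_divide_less_eq add.commute)
    then have "x \<in> B k" unfolding B_def using r \<delta> by (auto simp: ennreal_leI intro: ennreal_lessI)
    then have xU: "x \<in> U k" using U(2) by blast
    have "f x \<le> ennreal (a k)" using r k by (auto simp: a_def intro: ennreal_leI)
    also have "\<dots> = ennreal (a k) * indicator (U k \<union> V k) x" using xU by simp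
    also have "\<dots> \<le> g x" unfolding g_def by (rule SUP_upper) simp
    finally show ?thesis .
  qed
  have "(\<integral>\<^sup>+x. (g x)\<^sup>2 \<partial>M) \<le> (\<integral>\<^sup>+x. (\<Sum>k. (ennreal (a k) * indicator (U k \<union> V k) x)\<^sup>2) \<partial>M)"
    unfolding g_def by (intro nn_integral_mono SUP_square_le_suminf)
  also have "\<dots> = (\<Sum>k. \<integral>\<^sup>+x. (ennreal (a k) * indicator (U k \<union> V k) x)\<^sup>2 \<partial>M)"
    using U V by (intro nn_integral_suminf) (auto intro!: borel_measurable_power_ennreal borel_measurable_times_ennreal borel_measurable_indicator simp: sM)
  also have "\<dots> \<le> (\<Sum>k. ennreal ((a k)\<^sup>2) * emeasure M (B k) + (ennreal (\<eta> k) + ennreal (\<eta> k)))"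
  proof (intro suminf_le summableI)
    fix k
    have "(ennreal (a k) * indicator (U k \<union> V k) x)\<^sup>2 = ennreal ((a k)\<^sup>2) * indicator (U k \<union> V k) x" for x
      using a[of k] by (auto simp: indicator_def ennreal_power)
    then have "(\<integral>\<^sup>+x. (ennreal (a k) * indicator (U k \<union> V k) x)\<^sup>2 \<partial>M) = ennreal ((a k)\<^sup>2) * emeasure M (U k \<union> V k)"
      using U V sM by (simp add: nn_integral_cmult_indicator open_Un)
    also have "\<dots> \<le> ennreal ((a k)\<^sup>2) * (emeasure M (U k) + emeasure M (V k))"
      using U V sM by (intro mult_left_mono emeasure_subadditive) auto
    also have "\<dots> \<le> (ennreal ((a k)\<^sup>2) * emeasure M (B k) + ennreal (\<eta> k)) + ennreal (\<eta> k)"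
      unfolding distrib_left by (intro add_mono U V)
    finally show "(\<integral>\<^sup>+x. (ennreal (a k) * indicator (U k \<union> V k) x)\<^sup>2 \<partial>M) \<le>
        ennreal ((a k)\<^sup>2) * emeasure M (B k) + (ennreal (\<eta> k) + ennreal (\<eta> k))" by (simp only: add.assoc)
  qed
  also have "\<dots> = (\<Sum>k. ennreal ((a k)\<^sup>2) * emeasure M (B k)) + ((\<Sum>k. ennreal (\<eta> k)) + (\<Sum>k. ennreal (\<eta> k)))"
    by (simp only: suminf_add[symmetric, OF summableI summableI])
  also have "(\<Sum>k. ennreal (\<eta> k)) + (\<Sum>k. ennreal (\<eta> k)) = ennreal (\<epsilon>/2)"
    unfolding \<eta>sum using \<epsilon> by (simp flip: ennreal_plus)
  also have "(\<Sum>k. ennreal ((a k)\<^sup>2) * emeasure M (B k)) + ennreal (\<epsilon>/2) \<le> (I + ennreal (\<epsilon>/2)) + ennreal (\<epsilon>/2)"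
  proof (rule add_right_mono)
    have dis: "disjoint_family B"
    proof -
      have le: "k \<le> l" if "x \<in> B k" "x \<in> B l" for x k l
      proof -
        have "ennreal (real k * \<delta>) < ennreal (real (Suc l) * \<delta>)" using that by (auto simp: B_def)
        then have "real k * \<delta> < real (Suc l) * \<delta>" using \<delta> by (subst (asm) ennreal_less_iff) auto
        then show ?thesis using \<delta> by simp
      qed
      show ?thesis
        unfolding disjoint_family_on_def
      proof (intro ballI impI equals0I)
        fix k l x assume "k \<noteq> l" "x \<in> B k \<inter> B l"
        then show False using le[of x k l] le[of x l k] by simp
      qed
    qed
    have "(\<Sum>k. ennreal ((a k)\<^sup>2) * emeasure M (B k)) = (\<Sum>k. \<integral>\<^sup>+x. ennreal ((a k)\<^sup>2) * indicator (B k) x \<partial>M)"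
      using Bm sM by (simp add: nn_integral_cmult_indicator)
    also have "\<dots> \<le> (\<Sum>k. \<integral>\<^sup>+x\<in>B k. (f x + ennreal \<delta>)\<^sup>2 \<partial>M)"
    proof (intro suminf_le summableI nn_integral_mono)
      fix k x
      show "ennreal ((a k)\<^sup>2) * indicator (B k) x \<le> (f x + ennreal \<delta>)\<^sup>2 * indicator (B k) x"
      proof (cases "x \<in> B k")
        case True
        have "ennreal (a k) = ennreal (real k * \<delta>) + ennreal \<delta>" using \<delta> by (simp add: a_def distrib_right add.commute)
        also have "\<dots> \<le> f x + ennreal \<delta>" using True by (intro add_right_mono) (auto simp: B_def)
        finally have "(ennreal (a k))\<^sup>2 \<le> (f x + ennreal \<delta>)\<^sup>2" by (intro power_mono) auto
        then show ?thesis using True a[of k] by (simp add: ennreal_power)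
      qed simp
    qed
    also have "\<dots> = (\<integral>\<^sup>+x\<in>(\<Union>k. B k). (f x + ennreal \<delta>)\<^sup>2 \<partial>M)"
      using Bm sM dis by (intro nn_integral_disjoint_family[symmetric]) auto
    also have "\<dots> \<le> (\<integral>\<^sup>+x. (f x + ennreal \<delta>)\<^sup>2 \<partial>M)" by (intro nn_integral_mono) (auto simp: indicator_def)
    finally show "(\<Sum>k. ennreal ((a k)\<^sup>2) * emeasure M (B k)) \<le> I + ennreal (\<epsilon>/2)" using \<delta>(2) by (rule order_trans)
  qed
  also have "(I + ennreal (\<epsilon>/2)) + ennreal (\<epsilon>/2) = I + ennreal \<epsilon>"
    unfolding add.assoc using \<epsilon> by (simp flip: ennreal_plus)
  finally have le: "(\<integral>\<^sup>+x. (g x)\<^sup>2 \<partial>M) \<le> I + ennreal \<epsilon>" .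
  have gm: "(\<lambda>x. (g x)\<^sup>2) \<in> borel_measurable borel" using lsc_measurable[OF gl] by measurable
  show ?thesis
    using le unfolding I_def by (intro that[OF gl fg]) (simp add: MI[OF gm] MI)
qed

lemma nn_integral_SUP_square_finite:
  assumes r [measurable]: "\<And>k::nat. r k \<in> borel_measurable M" and r2: "\<And>k. (\<integral>\<^sup>+x. (r k x)\<^sup>2 \<partial>M) \<le> ennreal ((1/8) ^ k)"
  shows "(\<integral>\<^sup>+x. (SUP k. ennreal (2 ^ k) * r k x)\<^sup>2 \<partial>M) < \<infinity>"
proof -
  have "(\<integral>\<^sup>+x. (SUP k. ennreal (2 ^ k) * r k x)\<^sup>2 \<partial>M) \<le> (\<integral>\<^sup>+x. (\<Sum>k. (ennreal (2 ^ k) * r k x)\<^sup>2) \<partial>M)"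
    by (intro nn_integral_mono SUP_square_le_suminf)
  also have "\<dots> = (\<Sum>k. \<integral>\<^sup>+x. (ennreal (2 ^ k) * r k x)\<^sup>2 \<partial>M)" by (rule nn_integral_suminf) measurable
  also have "\<dots> \<le> (\<Sum>k. ennreal (2 * (1/2) ^ Suc k))"
  proof (intro suminf_le summableI)
    fix k
    have "(2 ^ k)\<^sup>2 = (4::real) ^ k" by (simp add: power_mult_distrib[symmetric] power2_eq_square)
    then have "(ennreal (2 ^ k))\<^sup>2 = ennreal (4 ^ k)" by (simp add: ennreal_power)
    then have "(\<integral>\<^sup>+x. (ennreal (2 ^ k) * r k x)\<^sup>2 \<partial>M) = (\<integral>\<^sup>+x. ennreal (4 ^ k) * (r k x)\<^sup>2 \<partial>M)"
      by (simp add: power_mult_distrib)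
    also have "\<dots> = ennreal (4 ^ k) * (\<integral>\<^sup>+x. (r k x)\<^sup>2 \<partial>M)" by (rule nn_integral_cmult) measurable
    also have "\<dots> \<le> ennreal (4 ^ k) * ennreal ((1/8) ^ k)" by (rule mult_left_mono[OF r2]) simp
    also have "\<dots> = ennreal (2 * (1/2) ^ Suc k)"
    proof -
      have "(4::real) ^ k * (1/8) ^ k = 2 * (1/2) ^ Suc k" by (simp add: power_mult_distrib[symmetric])
      then show ?thesis by (subst ennreal_mult'[symmetric]) auto
    qed
    finally show "(\<integral>\<^sup>+x. (ennreal (2 ^ k) * r k x)\<^sup>2 \<partial>M) \<le> ennreal (2 * (1/2) ^ Suc k)" .
  qed
  also have "\<dots> = ennreal 2" by (rule suminf_half_ennreal) simp
  also have "\<dots> < \<infinity>" by simp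
  finally show ?thesis .
qed

text \<open>Fuglede's description of families of modulus zero: a supremum of rapidly growing multiples of admissible
  functions with rapidly decreasing energies.\<close>

lemma modulus_zero_weight:
  fixes \<Gamma> :: "(real \<Rightarrow> 'a::metric_space) set"
  assumes "modulus \<Gamma> = 0"
  obtains h where "h \<in> borel_measurable borel" "(\<integral>\<^sup>+x. (h x)\<^sup>2 \<partial>hausdorff2_measure) < \<infinity>"
    "\<And>\<gamma>. \<gamma> \<in> \<Gamma> \<Longrightarrow> rect_on \<gamma> 0 1 \<Longrightarrow> line_integral h \<gamma> 0 1 = \<infinity>"
proof -
  have "\<exists>\<rho>. admissible \<Gamma> \<rho> \<and> (\<integral>\<^sup>+x. (\<rho> x)\<^sup>2 \<partial>hausdorff2_measure) \<le> ennreal ((1/8) ^ k)" for k :: nat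
  proof -
    have "modulus \<Gamma> < ennreal ((1/8) ^ k)" using assms by simp
    then show ?thesis unfolding modulus_def INF_less_iff by (auto intro: less_imp_le)
  qed
  then have "\<forall>k::nat. \<exists>\<rho>. admissible \<Gamma> \<rho> \<and> (\<integral>\<^sup>+x. (\<rho> x)\<^sup>2 \<partial>hausdorff2_measure) \<le> ennreal ((1/8) ^ k)" by blast
  then obtain r where r: "\<And>k::nat. admissible \<Gamma> (r k)" "\<And>k. (\<integral>\<^sup>+x. (r k x)\<^sup>2 \<partial>hausdorff2_measure) \<le> ennreal ((1/8) ^ k)"
    unfolding choice_iff by blast
  have rm [measurable]: "r k \<in> borel_measurable borel" for k using r(1)[of k] by (simp add: admissible_def)
  define h where "h x = (SUP k. ennreal (2 ^ k) * r k x)" for x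
  have hm: "h \<in> borel_measurable borel" unfolding h_def by measurable
  have h2: "(\<integral>\<^sup>+x. (h x)\<^sup>2 \<partial>hausdorff2_measure) < \<infinity>"
    unfolding h_def by (rule nn_integral_SUP_square_finite[OF _ r(2)]) measurable
  have inf: "line_integral h \<gamma> 0 1 = \<infinity>" if \<gamma>: "\<gamma> \<in> \<Gamma>" "rect_on \<gamma> 0 1" for \<gamma>
  proof -
    have le: "ennreal (2 ^ k) \<le> line_integral h \<gamma> 0 1" for k
    proof -
      have "rectifiable \<gamma>" using \<gamma>(2) by (simp add: rect_on_def rectifiable_def)
      then have "1 \<le> line_integral (r k) \<gamma> 0 1" using r(1)[of k] \<gamma>(1) by (auto simp: admissible_def)
      then have "ennreal (2 ^ k) * 1 \<le> ennreal (2 ^ k) * line_integral (r k) \<gamma> 0 1" by (rule mult_left_mono) simp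
      also have "\<dots> = line_integral (\<lambda>x. ennreal (2 ^ k) * r k x) \<gamma> 0 1" by (rule line_integral_cmult[OF \<gamma>(2) rm, symmetric])
      also have "\<dots> \<le> line_integral h \<gamma> 0 1" unfolding h_def by (intro line_integral_mono \<gamma>(2) SUP_upper) simp
      finally show ?thesis by simp
    qed
    show ?thesis
    proof (rule ccontr)
      assume "line_integral h \<gamma> 0 1 \<noteq> \<infinity>"
      then obtain x where x: "line_integral h \<gamma> 0 1 = ennreal x" "x \<ge> 0" by (cases "line_integral h \<gamma> 0 1") auto
      obtain k :: nat where "x < 2 ^ k" using real_arch_pow[of 2 x] by auto
      then show False using le[of k] x by simp
    qed
  qed
  show ?thesis using that hm h2 inf by blast
qed

section \<open>Operations on rectifiable paths\<close>

lemma rect_pathD: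
  assumes "rect_path Q \<gamma>"
  shows "rect_on \<gamma> 0 1" "t \<in> {0..1} \<Longrightarrow> \<gamma> t \<in> Q"
  using assms by (auto simp: rect_path_def)

lemma rect_path_const: "x \<in> Q \<Longrightarrow> rect_path Q (\<lambda>_. x)"
proof -
  assume x: "x \<in> Q"
  have "curve_length (\<lambda>_. x) 0 1 \<le> ennreal (0 - 0)"
    using curve_length_le_increment[of 0 1 "\<lambda>_. x" "\<lambda>_. 0"] by simp
  then show ?thesis using x by (auto simp: rect_path_def rect_on_def)
qed

lemma curve_length_const_zero:
  assumes "a \<le> b" "\<And>t. t \<in> {a..b} \<Longrightarrow> \<gamma> t = x"
  shows "curve_length \<gamma> a b = 0"
proof -
  have "curve_length \<gamma> a b \<le> ennreal (0 - 0)"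
    by (rule curve_length_le_increment[where F = "\<lambda>_. 0"]) (use assms in auto)
  then show ?thesis by simp
qed

lemma line_integral_mono_interval:
  assumes r: "rect_on \<gamma> a b" and st: "a \<le> s" "s \<le> t" "t \<le> b" and f: "f \<in> borel_measurable borel"
  shows "line_integral f \<gamma> s t \<le> line_integral f \<gamma> a b"
proof -
  have "line_integral f \<gamma> a b = line_integral f \<gamma> a s + line_integral f \<gamma> s b"
    using st by (intro line_integral_add r f) auto
  also have "line_integral f \<gamma> s b = line_integral f \<gamma> s t + line_integral f \<gamma> t b"
    using st by (intro line_integral_add rect_on_subinterval[OF r] f) auto
  finally show ?thesis by (simp add: add_increasing add_increasing2)
qed

lemma rect_path_reverse:
  assumes "rect_path Q \<gamma>"
  shows "rect_path Q (\<lambda>t. \<gamma> (1 - t))"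
proof -
  have "rect_on (\<lambda>t. \<gamma> (1 - t)) 0 1" using assms by (intro rect_on_reverse) (simp add: rect_path_def)
  then show ?thesis using assms by (auto simp: rect_path_def)
qed

lemma rect_path_sub:
  assumes "rect_path Q \<gamma>" "0 \<le> a" "a \<le> b" "b \<le> 1"
  shows "rect_path Q (\<lambda>t. \<gamma> ((b - a) * t + a))"
proof (cases "a = b")
  case True
  then show ?thesis using rect_path_const[of "\<gamma> a" Q] rect_pathD(2)[OF assms(1), of a] assms by simp
next
  case False
  have r: "rect_on \<gamma> a b" by (rule rect_on_subinterval[OF rect_pathD(1)[OF assms(1)] assms(2-4)])
  have "rect_on (\<lambda>t. \<gamma> ((b - a) * t + a)) 0 1" using False assms r by (intro rect_on_affine) auto
  moreover have "\<gamma> ((b - a) * t + a) \<in> Q" if t: "t \<in> {0..1}" for t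
  proof (rule rect_pathD(2)[OF assms(1)])
    have "(b - a) * t \<le> (b - a) * 1" using assms t by (intro mult_left_mono) auto
    then show "(b - a) * t + a \<in> {0..1}" using assms t by auto
  qed
  ultimately show ?thesis by (simp add: rect_path_def image_subset_iff)
qed

lemma line_integral_sub:
  assumes "rect_path Q \<gamma>" "0 \<le> a" "a \<le> b" "b \<le> 1"
  shows "line_integral f (\<lambda>t. \<gamma> ((b - a) * t + a)) 0 1 = line_integral f \<gamma> a b"
proof (cases "a = b")
  case True
  have b: "b \<in> {0..1}" using assms True by simp
  then have r: "rect_on \<gamma> b b" by (intro rect_on_subinterval[OF rect_pathD(1)[OF assms(1)]]) simp_all
  have "rect_on (\<lambda>t. \<gamma> b) 0 1" by (rule rect_pathD(1)[OF rect_path_const[OF rect_pathD(2)[OF assms(1) b]]])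
  then have "line_integral f (\<lambda>t. \<gamma> b) 0 1 = 0"
    by (rule line_integral_length_zero) (rule curve_length_const_zero, simp_all)
  moreover have "line_integral f \<gamma> b b = 0" by (rule line_integral_length_zero[OF r curve_length_refl])
  ultimately show ?thesis unfolding True by simp
next
  case False
  have "rect_on \<gamma> a b" by (rule rect_on_subinterval[OF rect_pathD(1)[OF assms(1)] assms(2-4)])
  then show ?thesis using line_integral_affine[of "b - a" \<gamma> 0 a 1 f] False assms by simp
qed

lemma rect_path_join_left:
  assumes \<gamma>: "rect_path Q \<gamma>" and ab: "0 \<le> a" "a \<le> b" "b \<le> 1/2"
  shows "rect_on (\<gamma> +++ \<gamma>') a b" "line_integral f (\<gamma> +++ \<gamma>') a b = line_integral f \<gamma> (2 * a) (2 * b)"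
proof -
  have r: "rect_on \<gamma> (2 * a + 0) (2 * b + 0)" using ab by (intro rect_on_subinterval[OF rect_pathD(1)[OF \<gamma>]]) auto
  have r': "rect_on (\<lambda>t. \<gamma> (2 * t + 0)) a b" by (rule rect_on_affine[OF _ r]) simp
  have c: "(\<lambda>t. \<gamma> (2 * t + 0)) t = (\<gamma> +++ \<gamma>') t" if "t \<in> {a..b}" for t
    using that ab by (simp add: joinpaths_def)
  show "rect_on (\<gamma> +++ \<gamma>') a b" using rect_on_cong[OF c] r' by simp
  show "line_integral f (\<gamma> +++ \<gamma>') a b = line_integral f \<gamma> (2 * a) (2 * b)"
    using line_integral_cong[OF r' c, of f] line_integral_affine[OF _ r, of f] by simp
qed

lemma rect_path_join_right:
  assumes \<gamma>': "rect_path Q \<gamma>'" and j: "\<gamma> 1 = \<gamma>' 0" and ab: "1/2 \<le> a" "a \<le> b" "b \<le> 1"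
  shows "rect_on (\<gamma> +++ \<gamma>') a b" "line_integral f (\<gamma> +++ \<gamma>') a b = line_integral f \<gamma>' (2 * a - 1) (2 * b - 1)"
proof -
  have r: "rect_on \<gamma>' (2 * a + (-1)) (2 * b + (-1))" using ab by (intro rect_on_subinterval[OF rect_pathD(1)[OF \<gamma>']]) auto
  have r': "rect_on (\<lambda>t. \<gamma>' (2 * t + (-1))) a b" by (rule rect_on_affine[OF _ r]) simp
  have c: "(\<lambda>t. \<gamma>' (2 * t + (-1))) t = (\<gamma> +++ \<gamma>') t" if "t \<in> {a..b}" for t
  proof (cases "t = 1/2")
    case True
    show ?thesis unfolding True using j by (simp add: joinpaths_def)
  next
    case False
    then show ?thesis using that ab by (simp add: joinpaths_def)
  qed
  show "rect_on (\<gamma> +++ \<gamma>') a b" using rect_on_cong[OF c] r' by simp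
  show "line_integral f (\<gamma> +++ \<gamma>') a b = line_integral f \<gamma>' (2 * a - 1) (2 * b - 1)"
    using line_integral_cong[OF r' c, of f] line_integral_affine[OF _ r, of f] by simp
qed

lemma rect_path_join:
  assumes \<gamma>: "rect_path Q \<gamma>" and \<gamma>': "rect_path Q \<gamma>'" and j: "\<gamma> 1 = \<gamma>' 0"
  shows "rect_path Q (\<gamma> +++ \<gamma>')"
proof -
  have 1: "rect_on (\<gamma> +++ \<gamma>') 0 (1/2)" by (rule rect_path_join_left[OF \<gamma>]) auto
  have 2: "rect_on (\<gamma> +++ \<gamma>') (1/2) 1" by (rule rect_path_join_right[where \<gamma> = \<gamma>, OF \<gamma>' j]) auto
  have "continuous_on ({0..1/2} \<union> {1/2..1}) (\<gamma> +++ \<gamma>')"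
    using 1 2 by (intro continuous_on_closed_Un) (auto simp: rect_on_def)
  moreover have "{0..1/2} \<union> {1/2..1} = {0..(1::real)}" by auto
  moreover have "curve_length (\<gamma> +++ \<gamma>') 0 1 = curve_length (\<gamma> +++ \<gamma>') 0 (1/2) + curve_length (\<gamma> +++ \<gamma>') (1/2) 1"
    by (rule curve_length_add) auto
  ultimately have "rect_on (\<gamma> +++ \<gamma>') 0 1" using 1 2 by (auto simp: rect_on_def less_top[symmetric])
  moreover have "(\<gamma> +++ \<gamma>') t \<in> Q" if "t \<in> {0..1}" for t
    using that rect_pathD(2)[OF \<gamma>, of "2 * t"] rect_pathD(2)[OF \<gamma>', of "2 * t - 1"] by (auto simp: joinpaths_def)
  ultimately show ?thesis by (simp add: rect_path_def image_subset_iff)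
qed

lemma joinpaths_0_1: "(\<gamma> +++ \<gamma>') 0 = \<gamma> 0" "(\<gamma> +++ \<gamma>') 1 = \<gamma>' 1"
  by (simp_all add: joinpaths_def)

lemma line_integral_join:
  assumes \<gamma>: "rect_path Q \<gamma>" and \<gamma>': "rect_path Q \<gamma>'" and j: "\<gamma> 1 = \<gamma>' 0" and f: "f \<in> borel_measurable borel"
  shows "line_integral f (\<gamma> +++ \<gamma>') 0 1 = line_integral f \<gamma> 0 1 + line_integral f \<gamma>' 0 1"
proof -
  have "line_integral f (\<gamma> +++ \<gamma>') 0 1 = line_integral f (\<gamma> +++ \<gamma>') 0 (1/2) + line_integral f (\<gamma> +++ \<gamma>') (1/2) 1"
    using rect_pathD(1)[OF rect_path_join[OF \<gamma> \<gamma>' j]] f by (intro line_integral_add) auto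
  also have "line_integral f (\<gamma> +++ \<gamma>') 0 (1/2) = line_integral f \<gamma> 0 1"
    using rect_path_join_left(2)[where a = 0 and b = "1/2" and \<gamma>' = \<gamma>' and f = f, OF \<gamma>] by simp
  also have "line_integral f (\<gamma> +++ \<gamma>') (1/2) 1 = line_integral f \<gamma>' 0 1"
    using rect_path_join_right(2)[where a = "1/2" and b = 1 and \<gamma> = \<gamma> and f = f, OF \<gamma>' j] by simp
  finally show ?thesis .
qed

text \<open>The relation records an upper bound for the \<open>w\<close>-length distance rather than the distance itself, which
  would be an infimum that need not be attained.\<close>

definition w_joined :: "'a::metric_space set \<Rightarrow> ('a \<Rightarrow> ennreal) \<Rightarrow> 'a \<Rightarrow> 'a \<Rightarrow> ennreal \<Rightarrow> bool" where
  "w_joined Q w x y c \<longleftrightarrow> (\<exists>\<gamma>. rect_path Q \<gamma> \<and> \<gamma> 0 = x \<and> \<gamma> 1 = y \<and> line_integral w \<gamma> 0 1 \<le> c)"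

lemma w_joined_trans:
  assumes "w_joined Q w x y c" "w_joined Q w y z d" "w \<in> borel_measurable borel"
  shows "w_joined Q w x z (c + d)"
proof -
  obtain \<gamma> where \<gamma>: "rect_path Q \<gamma>" "\<gamma> 0 = x" "\<gamma> 1 = y" "line_integral w \<gamma> 0 1 \<le> c" using assms(1) unfolding w_joined_def by blast
  obtain \<gamma>' where \<gamma>': "rect_path Q \<gamma>'" "\<gamma>' 0 = y" "\<gamma>' 1 = z" "line_integral w \<gamma>' 0 1 \<le> d" using assms(2) unfolding w_joined_def by blast
  have j: "\<gamma> 1 = \<gamma>' 0" using \<gamma> \<gamma>' by simp
  show ?thesis
    unfolding w_joined_def
  proof (intro exI conjI)
    show "rect_path Q (\<gamma> +++ \<gamma>')" by (rule rect_path_join[OF \<gamma>(1) \<gamma>'(1) j])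
    show "(\<gamma> +++ \<gamma>') 0 = x" "(\<gamma> +++ \<gamma>') 1 = z" using \<gamma> \<gamma>' by (simp_all add: joinpaths_0_1)
    show "line_integral w (\<gamma> +++ \<gamma>') 0 1 \<le> c + d"
      unfolding line_integral_join[OF \<gamma>(1) \<gamma>'(1) j assms(3)] by (intro add_mono \<gamma> \<gamma>')
  qed
qed

lemma w_joined_sym:
  assumes "w_joined Q w x y c" "w \<in> borel_measurable borel"
  shows "w_joined Q w y x c"
proof -
  obtain \<gamma> where \<gamma>: "rect_path Q \<gamma>" "\<gamma> 0 = x" "\<gamma> 1 = y" "line_integral w \<gamma> 0 1 \<le> c" using assms(1) unfolding w_joined_def by blast
  have "line_integral w (\<lambda>t. \<gamma> (1 - t)) 0 1 = line_integral w \<gamma> 0 1"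
    using line_integral_reverse[of \<gamma> 1 1 0 w] rect_pathD(1)[OF \<gamma>(1)] assms(2) by simp
  then show ?thesis
    unfolding w_joined_def using \<gamma> rect_path_reverse[OF \<gamma>(1)] by (intro exI[of _ "\<lambda>t. \<gamma> (1 - t)"]) simp
qed

lemma w_joined_mono: "w_joined Q w x y c \<Longrightarrow> c \<le> d \<Longrightarrow> w_joined Q w x y d"
  unfolding w_joined_def by (blast intro: order_trans)

lemma w_joined_sub:
  assumes "rect_path Q \<gamma>" "0 \<le> a" "a \<le> b" "b \<le> 1" "line_integral w \<gamma> a b \<le> c"
  shows "w_joined Q w (\<gamma> a) (\<gamma> b) c"
  unfolding w_joined_def using rect_path_sub[OF assms(1-4)] line_integral_sub[OF assms(1-4), of w] assms(5)
  by (intro exI[of _ "\<lambda>t. \<gamma> ((b - a) * t + a)"]) simp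

section \<open>Good paths\<close>

text \<open>Unlike the curves of the modulus, good paths may be constant; this makes the infimum of their
  \<open>\<rho>\<close>-lengths a pseudometric.\<close>

definition good :: "'a::metric_space set \<Rightarrow> (nat \<Rightarrow> 'a \<Rightarrow> ennreal) \<Rightarrow> ('a \<Rightarrow> ennreal) \<Rightarrow> (real \<Rightarrow> 'a) \<Rightarrow> bool" where
  "good Q \<rho>k \<rho> \<gamma> \<longleftrightarrow> rect_path Q \<gamma> \<and> (\<forall>a b. 0 \<le> a \<longrightarrow> a \<le> b \<longrightarrow> b \<le> 1 \<longrightarrow> integrals_converge \<rho>k \<rho> \<gamma> a b)"

lemma integrals_converge_length_zero:
  assumes "rect_on \<gamma> a b" "curve_length \<gamma> a b = 0"
  shows "integrals_converge \<rho>k \<rho> \<gamma> a b"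
  unfolding integrals_converge_def by (simp add: line_integral_length_zero[OF assms])

lemma integrals_converge_add:
  assumes r: "rect_on \<gamma> a c" and b: "a \<le> b" "b \<le> c"
    and m: "\<And>k. \<rho>k k \<in> borel_measurable borel" "\<rho> \<in> borel_measurable borel"
    and c: "integrals_converge \<rho>k \<rho> \<gamma> a b" "integrals_converge \<rho>k \<rho> \<gamma> b c"
  shows "integrals_converge \<rho>k \<rho> \<gamma> a c"
  using c unfolding integrals_converge_def line_integral_add[OF r b m(1)] line_integral_add[OF r b m(2)]
  by (auto intro: tendsto_add simp: less_top[symmetric])

lemma good_const: "x \<in> Q \<Longrightarrow> good Q \<rho>k \<rho> (\<lambda>_. x)"
  unfolding good_def using rect_path_const[of x Q]
  by (auto intro!: integrals_converge_length_zero curve_length_const_zero[where x = x]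
      rect_on_subinterval[OF rect_pathD(1)])

lemma good_reverse:
  assumes g: "good Q \<rho>k \<rho> \<gamma>" and m: "\<And>k. \<rho>k k \<in> borel_measurable borel" "\<rho> \<in> borel_measurable borel"
  shows "good Q \<rho>k \<rho> (\<lambda>t. \<gamma> (1 - t))"
  unfolding good_def
proof (intro conjI allI impI)
  have r: "rect_path Q \<gamma>" using g by (simp add: good_def)
  show "rect_path Q (\<lambda>t. \<gamma> (1 - t))" by (rule rect_path_reverse[OF r])
  fix a b :: real assume ab: "0 \<le> a" "a \<le> b" "b \<le> 1"
  have rr: "rect_on \<gamma> (1 - b) (1 - a)" using ab by (intro rect_on_subinterval[OF rect_pathD(1)[OF r]]) auto
  have "integrals_converge \<rho>k \<rho> \<gamma> (1 - b) (1 - a)" using g ab by (simp add: good_def)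
  then show "integrals_converge \<rho>k \<rho> (\<lambda>t. \<gamma> (1 - t)) a b"
    unfolding integrals_converge_def line_integral_reverse[OF rr m(1)] line_integral_reverse[OF rr m(2)] .
qed

lemma good_sub:
  assumes g: "good Q \<rho>k \<rho> \<gamma>" and st: "0 \<le> s" "s \<le> t" "t \<le> 1"
  shows "good Q \<rho>k \<rho> (\<lambda>x. \<gamma> ((t - s) * x + s))"
proof (cases "s = t")
  case True
  have "rect_path Q \<gamma>" using g by (simp add: good_def)
  then have "\<gamma> s \<in> Q" using rect_pathD(2)[of Q \<gamma> s] st by simp
  then show ?thesis using good_const[of "\<gamma> s" Q] True by simp
next
  case False
  have r: "rect_path Q \<gamma>" using g by (simp add: good_def)
  show ?thesis
    unfolding good_def
  proof (intro conjI allI impI)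
    show "rect_path Q (\<lambda>x. \<gamma> ((t - s) * x + s))" by (rule rect_path_sub[OF r st])
    fix a b :: real assume ab: "0 \<le> a" "a \<le> b" "b \<le> 1"
    have ts: "t - s > 0" using False st by simp
    let ?A = "(t - s) * a + s" and ?B = "(t - s) * b + s"
    have "(t - s) * b \<le> (t - s) * 1" "(t - s) * a \<le> (t - s) * b" "0 \<le> (t - s) * a"
      using ts ab by (auto intro!: mult_left_mono)
    then have AB: "0 \<le> ?A" "?A \<le> ?B" "?B \<le> 1" using st by auto
    have rr: "rect_on \<gamma> ?A ?B" using AB by (intro rect_on_subinterval[OF rect_pathD(1)[OF r]])
    have "integrals_converge \<rho>k \<rho> \<gamma> ?A ?B" using g AB by (simp add: good_def)
    then show "integrals_converge \<rho>k \<rho> (\<lambda>x. \<gamma> ((t - s) * x + s)) a b"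
      unfolding integrals_converge_def line_integral_affine[OF ts rr] .
  qed
qed

lemma good_join:
  assumes g: "good Q \<rho>k \<rho> \<gamma>" and g': "good Q \<rho>k \<rho> \<gamma>'" and j: "\<gamma> 1 = \<gamma>' 0"
    and m: "\<And>k. \<rho>k k \<in> borel_measurable borel" "\<rho> \<in> borel_measurable borel"
  shows "good Q \<rho>k \<rho> (\<gamma> +++ \<gamma>')"
  unfolding good_def
proof (intro conjI allI impI)
  have r: "rect_path Q \<gamma>" and r': "rect_path Q \<gamma>'" using g g' by (auto simp: good_def)
  show J: "rect_path Q (\<gamma> +++ \<gamma>')" by (rule rect_path_join[OF r r' j])
  fix a b :: real assume ab: "0 \<le> a" "a \<le> b" "b \<le> 1"
  have L: "integrals_converge \<rho>k \<rho> (\<gamma> +++ \<gamma>') a b" if "0 \<le> a" "a \<le> b" "b \<le> 1/2" for a b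
    using g that unfolding integrals_converge_def rect_path_join_left(2)[OF r that] good_def by simp
  have R: "integrals_converge \<rho>k \<rho> (\<gamma> +++ \<gamma>') a b" if "1/2 \<le> a" "a \<le> b" "b \<le> 1" for a b
    using g' that unfolding integrals_converge_def rect_path_join_right(2)[where \<gamma> = \<gamma>, OF r' j that] good_def by simp
  consider "b \<le> 1/2" | "1/2 \<le> a" | "a \<le> 1/2" "1/2 \<le> b" by linarith
  then show "integrals_converge \<rho>k \<rho> (\<gamma> +++ \<gamma>') a b"
  proof cases
    case 3
    show ?thesis
      by (rule integrals_converge_add[OF rect_on_subinterval[OF rect_pathD(1)[OF J] ab] 3 m]) (use 3 ab in \<open>auto intro: L R\<close>)
  qed (use L R ab in auto)
qed

text \<open>The strict inequality matches infima: \<open>u x < c\<close> holds iff \<open>x\<close> is joined to a point of \<open>\<zeta>\<^sub>1\<close> within \<open>c\<close>,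
  for \<open>x\<close> in \<open>E\<^sub>u\<close>.\<close>

definition rho_joined :: "'a::metric_space set \<Rightarrow> (nat \<Rightarrow> 'a \<Rightarrow> ennreal) \<Rightarrow> ('a \<Rightarrow> ennreal) \<Rightarrow> 'a \<Rightarrow> 'a \<Rightarrow> ennreal \<Rightarrow> bool" where
  "rho_joined Q \<rho>k \<rho> x y c \<longleftrightarrow> (\<exists>\<gamma>. good Q \<rho>k \<rho> \<gamma> \<and> \<gamma> 0 = x \<and> \<gamma> 1 = y \<and> line_integral \<rho> \<gamma> 0 1 < c)"

context
  fixes Q :: "'a::metric_space set" and \<rho>k :: "nat \<Rightarrow> 'a \<Rightarrow> ennreal" and \<rho> :: "'a \<Rightarrow> ennreal"
  assumes m: "\<And>k. \<rho>k k \<in> borel_measurable borel" "\<rho> \<in> borel_measurable borel"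
begin

lemma rho_joined_refl:
  assumes "x \<in> Q" "c > 0"
  shows "rho_joined Q \<rho>k \<rho> x x c"
proof -
  have "line_integral \<rho> (\<lambda>_. x) 0 1 = 0"
    using rect_pathD(1)[OF rect_path_const[OF assms(1)]] by (intro line_integral_length_zero curve_length_const_zero) auto
  then show ?thesis unfolding rho_joined_def using good_const[OF assms(1)] assms(2) by (intro exI[of _ "\<lambda>_. x"]) simp
qed

lemma rho_joined_trans:
  assumes "rho_joined Q \<rho>k \<rho> x y c" "rho_joined Q \<rho>k \<rho> y z d"
  shows "rho_joined Q \<rho>k \<rho> x z (c + d)"
proof -
  obtain \<gamma> where \<gamma>: "good Q \<rho>k \<rho> \<gamma>" "\<gamma> 0 = x" "\<gamma> 1 = y" "line_integral \<rho> \<gamma> 0 1 < c" using assms(1) unfolding rho_joined_def by blast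
  obtain \<gamma>' where \<gamma>': "good Q \<rho>k \<rho> \<gamma>'" "\<gamma>' 0 = y" "\<gamma>' 1 = z" "line_integral \<rho> \<gamma>' 0 1 < d" using assms(2) unfolding rho_joined_def by blast
  have j: "\<gamma> 1 = \<gamma>' 0" using \<gamma> \<gamma>' by simp
  have r: "rect_path Q \<gamma>" "rect_path Q \<gamma>'" using \<gamma> \<gamma>' by (auto simp: good_def)
  show ?thesis
    unfolding rho_joined_def
  proof (intro exI conjI)
    show "good Q \<rho>k \<rho> (\<gamma> +++ \<gamma>')" by (rule good_join[OF \<gamma>(1) \<gamma>'(1) j m])
    show "(\<gamma> +++ \<gamma>') 0 = x" "(\<gamma> +++ \<gamma>') 1 = z" using \<gamma> \<gamma>' by (simp_all add: joinpaths_0_1)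
    show "line_integral \<rho> (\<gamma> +++ \<gamma>') 0 1 < c + d"
      unfolding line_integral_join[OF r j m(2)] using \<gamma>(4) \<gamma>'(4) by (rule add_strict_mono)
  qed
qed

lemma rho_joined_sym:
  assumes "rho_joined Q \<rho>k \<rho> x y c"
  shows "rho_joined Q \<rho>k \<rho> y x c"
proof -
  obtain \<gamma> where \<gamma>: "good Q \<rho>k \<rho> \<gamma>" "\<gamma> 0 = x" "\<gamma> 1 = y" "line_integral \<rho> \<gamma> 0 1 < c" using assms(1) unfolding rho_joined_def by blast
  have r: "rect_path Q \<gamma>" using \<gamma> by (auto simp: good_def)
  have "line_integral \<rho> (\<lambda>t. \<gamma> (1 - t)) 0 1 = line_integral \<rho> \<gamma> 0 1"
    using line_integral_reverse[of \<gamma> 1 1 0 \<rho>] rect_pathD(1)[OF r] m(2) by simp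
  then show ?thesis
    unfolding rho_joined_def using \<gamma> good_reverse[OF \<gamma>(1) m] by (intro exI[of _ "\<lambda>t. \<gamma> (1 - t)"]) simp
qed

lemma rho_joined_mono: "rho_joined Q \<rho>k \<rho> x y c \<Longrightarrow> c \<le> d \<Longrightarrow> rho_joined Q \<rho>k \<rho> x y d"
  unfolding rho_joined_def by (blast intro: less_le_trans)

lemma rho_joined_sub:
  assumes g: "good Q \<rho>k \<rho> \<gamma>" and ab: "0 \<le> a" "a \<le> b" "b \<le> 1" and c: "line_integral \<rho> \<gamma> a b < c"
  shows "rho_joined Q \<rho>k \<rho> (\<gamma> a) (\<gamma> b) c"
proof -
  have "rect_path Q \<gamma>" using g by (simp add: good_def)
  then show ?thesis
    unfolding rho_joined_def using good_sub[OF g ab] line_integral_sub[of Q \<gamma> a b \<rho>] ab c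
    by (intro exI[of _ "\<lambda>t. \<gamma> ((b - a) * t + a)"]) simp
qed

text \<open>The weight \<open>h\<close> detects only whole curves that violate the convergence of integrals. Every subpath is a
  curve in its own right, unless it is constant, and then the integrals vanish.\<close>

lemma good_if_weight_finite:
  assumes h: "h \<in> borel_measurable borel"
      "\<And>\<gamma>. curve_in Q \<gamma> \<Longrightarrow> \<not> integrals_converge \<rho>k \<rho> \<gamma> 0 1 \<Longrightarrow> rect_on \<gamma> 0 1 \<Longrightarrow> line_integral h \<gamma> 0 1 = \<infinity>"
    and r: "rect_path Q \<gamma>" and hw: "\<And>x. x \<in> Q \<Longrightarrow> h x \<le> w x" and fin: "line_integral w \<gamma> 0 1 < \<infinity>"
  shows "good Q \<rho>k \<rho> \<gamma>"
  unfolding good_def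
proof (intro conjI allI impI r)
  fix a b :: real assume ab: "0 \<le> a" "a \<le> b" "b \<le> 1"
  have rab: "rect_on \<gamma> a b" using ab by (intro rect_on_subinterval[OF rect_pathD(1)[OF r]])
  have finh: "line_integral h \<gamma> a b < \<infinity>"
  proof -
    have "line_integral h \<gamma> a b \<le> line_integral h \<gamma> 0 1" using ab by (intro line_integral_mono_interval rect_pathD(1)[OF r] h)
    also have "\<dots> \<le> line_integral w \<gamma> 0 1" using rect_pathD[OF r] hw by (intro line_integral_mono) auto
    finally show ?thesis using fin by (rule le_less_trans)
  qed
  let ?\<gamma> = "\<lambda>t. \<gamma> ((b - a) * t + a)"
  have r': "rect_path Q ?\<gamma>" by (rule rect_path_sub[OF r ab])
  have conv: "integrals_converge \<rho>k \<rho> \<gamma> a b = integrals_converge \<rho>k \<rho> ?\<gamma> 0 1"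
    unfolding integrals_converge_def line_integral_sub[OF r ab] ..
  show "integrals_converge \<rho>k \<rho> \<gamma> a b"
  proof (cases "?\<gamma> constant_on {0..1}")
    case True
    then obtain x where "\<And>t. t \<in> {0..1} \<Longrightarrow> ?\<gamma> t = x" by (auto simp: constant_on_def)
    then have "curve_length ?\<gamma> 0 1 = 0" by (intro curve_length_const_zero) auto
    then show ?thesis unfolding conv by (rule integrals_converge_length_zero[OF rect_pathD(1)[OF r']])
  next
    case False
    have "path ?\<gamma>" using rect_pathD(1)[OF r'] by (simp add: path_def rect_on_def)
    then have "curve_in Q ?\<gamma>" using False rect_pathD(2)[OF r'] by (auto simp: curve_in_def path_image_def)
    then show ?thesis
      unfolding conv using h(2)[of ?\<gamma>] rect_pathD(1)[OF r'] finh line_integral_sub[OF r ab, of h] by fastforce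
  qed
qed

end

section \<open>Joining and accessibility\<close>

lemma quad_homeomorphismD:
  fixes \<phi> :: "real \<times> real \<Rightarrow> 'a::metric_space"
  assumes "homeomorphism ({0..1} \<times> {0..1}) (quad \<phi>) \<phi> \<psi>"
  shows "continuous_on ({0..1} \<times> {0..1}) \<phi>" "continuous_on (quad \<phi>) \<psi>"
    "x \<in> quad \<phi> \<Longrightarrow> \<phi> (\<psi> x) = x" "x \<in> quad \<phi> \<Longrightarrow> \<psi> x \<in> {0..1} \<times> {0..1}"
    "z \<in> {0..1} \<times> {0..1} \<Longrightarrow> \<psi> (\<phi> z) = z" "z \<in> {0..1} \<times> {0..1} \<Longrightarrow> \<phi> z \<in> quad \<phi>"
    "compact (quad \<phi>)" "inj_on \<phi> ({0..1} \<times> {0..1})"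
proof -
  show inv: "z \<in> {0..1} \<times> {0..1} \<Longrightarrow> \<psi> (\<phi> z) = z" for z using assms by (auto simp: homeomorphism_def)
  show "inj_on \<phi> ({0..1} \<times> {0..1})" using inv by (metis inj_onI)
  show "compact (quad \<phi>)"
    unfolding quad_def using assms
    by (intro compact_continuous_image compact_Times compact_Icc) (auto simp: homeomorphism_def)
  show "x \<in> quad \<phi> \<Longrightarrow> \<psi> x \<in> {0..1} \<times> {0..1}" using assms unfolding homeomorphism_def by blast
qed (use assms in \<open>auto simp: homeomorphism_def quad_def\<close>)

lemma quad_image_continuum:
  fixes \<phi> :: "real \<times> real \<Rightarrow> 'a::metric_space"
  assumes "homeomorphism ({0..1} \<times> {0..1}) (quad \<phi>) \<phi> \<psi>" "compact A" "connected A" "A \<subseteq> {0..1} \<times> {0..1}"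
  shows "compact (\<phi> ` A)" "connected (\<phi> ` A)" "\<phi> ` A \<subseteq> quad \<phi>"
  using assms quad_homeomorphismD(1)[OF assms(1)]
  by (auto intro!: compact_continuous_image connected_continuous_image intro: continuous_on_subset simp: quad_def)

lemma zeta_continua:
  fixes \<phi> :: "real \<times> real \<Rightarrow> 'a::metric_space"
  assumes hom: "homeomorphism ({0..1} \<times> {0..1}) (quad \<phi>) \<phi> \<psi>"
  shows "compact (zeta1 \<phi>)" "connected (zeta1 \<phi>)" "zeta1 \<phi> \<subseteq> quad \<phi>"
    "compact (zeta3 \<phi>)" "connected (zeta3 \<phi>)" "zeta3 \<phi> \<subseteq> quad \<phi>"
  unfolding zeta1_def zeta3_def by (intro quad_image_continuum[OF hom] compact_Times connected_Times; auto)+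

lemma compact_disjoint_separated:
  fixes A B :: "'a::metric_space set"
  assumes "compact A" "compact B" "A \<inter> B = {}"
  obtains d where "d > 0" "\<And>x y. x \<in> A \<Longrightarrow> y \<in> B \<Longrightarrow> d \<le> dist x y"
proof (cases "A = {} \<or> B = {}")
  case True
  then show ?thesis by (intro that[of 1]) auto
next
  case False
  have "continuous_on A (\<lambda>x. infdist x B)" by (intro continuous_intros)
  then obtain a where a: "a \<in> A" "\<And>x. x \<in> A \<Longrightarrow> infdist a B \<le> infdist x B"
    using continuous_attains_inf[OF assms(1)] False by blast
  show ?thesis
  proof (rule that[of "infdist a B"])
    have "a \<notin> B" using a(1) assms(3) by blast
    then show "infdist a B > 0"
      using infdist_pos_not_in_closed[OF compact_imp_closed[OF assms(2)]] False by blast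
    show "infdist a B \<le> dist x y" if "x \<in> A" "y \<in> B" for x y
      using a(2)[OF that(1)] infdist_le[OF that(2), of x] by linarith
  qed
qed

lemma dist_le_line_integral_1:
  assumes "rect_path Q \<gamma>"
  shows "ennreal (dist (\<gamma> 0) (\<gamma> 1)) \<le> line_integral (\<lambda>_. 1) \<gamma> 0 1"
  using dist_le_curve_length[of 0 0 1 1 \<gamma>] line_integral_const[OF rect_pathD(1)[OF assms], of 1] by simp

text \<open>Vertical segments do unless one point lies above the other. In that case the upper one first moves
  horizontally to a vertical side that does not contain the lower point, and descends there.\<close>

lemma disjoint_continua_to_bottom:
  fixes c1 c2 :: "real \<times> real"
  assumes c: "c1 \<in> {0..1} \<times> {0..1}" "c2 \<in> {0..1} \<times> {0..1}" "c1 \<noteq> c2"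
  obtains A B where "compact A" "connected A" "A \<subseteq> {0..1} \<times> {0..1}" "compact B" "connected B" "B \<subseteq> {0..1} \<times> {0..1}"
    "A \<inter> B = {}" "c1 \<in> A" "c2 \<in> B" "A \<inter> ({0..1} \<times> {0}) \<noteq> {}" "B \<inter> ({0..1} \<times> {0}) \<noteq> {}"
proof -
  define down :: "real \<times> real \<Rightarrow> (real \<times> real) set" where "down c = {fst c} \<times> {0..snd c}" for c
  have down: "compact (down c)" "connected (down c)" "down c \<subseteq> {0..1} \<times> {0..1}" "c \<in> down c"
      "down c \<inter> ({0..1} \<times> {0}) \<noteq> {}" if "c \<in> {0..1} \<times> {0..1}" for c
  proof -
    show "compact (down c)" "connected (down c)"
      unfolding down_def by (intro compact_Times connected_Times compact_Icc connected_Icc; simp)+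
    show "down c \<subseteq> {0..1} \<times> {0..1}" "c \<in> down c" using that by (auto simp: down_def mem_Times_iff)
    have "(fst c, 0) \<in> down c \<inter> ({0..1} \<times> {0})" using that by (simp add: down_def mem_Times_iff)
    then show "down c \<inter> ({0..1} \<times> {0}) \<noteq> {}" by blast
  qed
  define side :: "real \<Rightarrow> real \<times> real \<Rightarrow> (real \<times> real) set" where
    "side e c = closed_segment e (fst c) \<times> {snd c} \<union> {e} \<times> {0..snd c}" for e c
  have side: "compact (side e c)" "connected (side e c)" "side e c \<subseteq> {0..1} \<times> {0..1}" "c \<in> side e c"
      "side e c \<inter> ({0..1} \<times> {0}) \<noteq> {}" if "c \<in> {0..1} \<times> {0..1}" "e \<in> {0,1}" for e c
  proof -
    show "compact (side e c)" unfolding side_def by (intro compact_Un compact_Times compact_segment compact_Icc) auto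
    have "(e, snd c) \<in> closed_segment e (fst c) \<times> {snd c} \<inter> {e} \<times> {0..snd c}" using that by (auto simp: mem_Times_iff)
    then show "connected (side e c)" unfolding side_def
      by (intro connected_Un connected_Times connected_segment connected_Icc connected_sing) blast
    show "side e c \<subseteq> {0..1} \<times> {0..1}"
      using that by (auto simp: side_def mem_Times_iff closed_segment_eq_real_ivl split: if_splits)
    show "c \<in> side e c" by (auto simp: side_def mem_Times_iff)
    have "(e, 0) \<in> side e c \<inter> ({0..1} \<times> {0})" using that by (auto simp: side_def mem_Times_iff)
    then show "side e c \<inter> ({0..1} \<times> {0}) \<noteq> {}" by blast
  qed
  have vertical: "\<exists>e\<in>{0,1}. down c \<inter> side e c' = {}" if "c \<in> {0..1} \<times> {0..1}" "fst c = fst c'" "snd c < snd c'" for c c'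
  proof (cases "fst c = 0")
    case True
    then show ?thesis using that by (intro bexI[of _ 1]) (auto simp: down_def side_def)
  next
    case False
    then show ?thesis using that by (intro bexI[of _ 0]) (auto simp: down_def side_def)
  qed
  consider "fst c1 \<noteq> fst c2" | "fst c1 = fst c2" "snd c1 < snd c2" | "fst c1 = fst c2" "snd c2 < snd c1"
    using c(3) by (metis linorder_neqE_linordered_idom prod_eq_iff)
  then show ?thesis
  proof cases
    case 1
    then have "down c1 \<inter> down c2 = {}" by (auto simp: down_def)
    then show ?thesis using down[OF c(1)] down[OF c(2)] by (intro that[of "down c1" "down c2"])
  next
    case 2
    then obtain e where e: "e \<in> {0,1}" "down c1 \<inter> side e c2 = {}" using vertical[of c1 c2] c by blast
    then show ?thesis using down[OF c(1)] side[OF c(2) e(1)] by (intro that[of "down c1" "side e c2"])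
  next
    case 3
    then obtain e where e: "e \<in> {0,1}" "down c2 \<inter> side e c1 = {}" using vertical[of c2 c1] c by fastforce
    then have "side e c1 \<inter> down c2 = {}" by blast
    then show ?thesis using down[OF c(2)] side[OF c(1) e(1)] by (intro that[of "side e c1" "down c2"])
  qed
qed

text \<open>From two points of \<open>\<alpha>\<close> disjoint continua run down to the bottom side. Both \<open>\<alpha>\<close> and the bottom side join
  these continua, so a crossing path leads from one to the other.\<close>

lemma join_to_zeta1:
  fixes \<phi> :: "real \<times> real \<Rightarrow> 'a::metric_space"
  assumes hom: "homeomorphism ({0..1} \<times> {0..1}) (quad \<phi>) \<phi> \<psi>" and fin: "hausdorff2 (quad \<phi>) < \<infinity>"
    and K: "lsc K" "\<And>x. 1 \<le> K x" and KI: "(\<integral>\<^sup>+x\<in>quad \<phi>. K x \<partial>hausdorff2_measure) < \<infinity>"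
    and \<alpha>: "compact \<alpha>" "connected \<alpha>" "\<alpha> \<subseteq> quad \<phi>" "x1 \<in> \<alpha>" "x2 \<in> \<alpha>" "x1 \<noteq> x2"
  obtains \<beta> where "rect_path (quad \<phi>) \<beta>" "\<beta> 0 \<in> \<alpha>" "\<beta> 1 \<in> zeta1 \<phi>" "line_integral K \<beta> 0 1 < \<infinity>"
proof -
  note H = quad_homeomorphismD[OF hom]
  have x: "x1 \<in> quad \<phi>" "x2 \<in> quad \<phi>" using \<alpha> by auto
  have "\<psi> x1 \<noteq> \<psi> x2" using H(3)[OF x(1)] H(3)[OF x(2)] \<alpha>(6) by auto
  then obtain A B where A: "compact A" "connected A" "A \<subseteq> {0..1} \<times> {0..1}" and B: "compact B" "connected B" "B \<subseteq> {0..1} \<times> {0..1}"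
    and AB: "A \<inter> B = {}" "\<psi> x1 \<in> A" "\<psi> x2 \<in> B" "A \<inter> ({0..1} \<times> {0}) \<noteq> {}" "B \<inter> ({0..1} \<times> {0}) \<noteq> {}"
    by (rule disjoint_continua_to_bottom[OF H(4)[OF x(1)] H(4)[OF x(2)]]) (rule that)
  note Y = quad_image_continuum[OF hom A] and Z = quad_image_continuum[OF hom B]
  have dis: "\<phi> ` A \<inter> \<phi> ` B = {}" using AB(1) inj_on_image_Int[OF H(8) A(3) B(3)] by simp
  have xA: "x1 \<in> \<phi> ` A" "x2 \<in> \<phi> ` B" using H(3)[OF x(1)] H(3)[OF x(2)] AB(2,3) by force+
  note z = zeta_continua(1-3)[OF hom]
  have zA: "zeta1 \<phi> \<inter> \<phi> ` A \<noteq> {}" "zeta1 \<phi> \<inter> \<phi> ` B \<noteq> {}" using AB(4,5) unfolding zeta1_def by blast+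
  obtain d where d: "d > 0" "\<And>x y. x \<in> \<phi> ` A \<Longrightarrow> y \<in> \<phi> ` B \<Longrightarrow> d \<le> dist x y"
    by (rule compact_disjoint_separated[OF Y(1) Z(1) dis]) (rule that)
  obtain i where i: "(\<integral>\<^sup>+x\<in>quad \<phi>. 1 * K x \<partial>hausdorff2_measure) = ennreal i" "i \<ge> 0" using KI by (auto simp: less_top_ennreal)
  obtain \<beta> where \<beta>: "rect_path (quad \<phi>) \<beta>" "\<beta> 0 \<in> \<alpha>" "\<beta> 1 \<in> zeta1 \<phi>" "line_integral K \<beta> 0 1 \<le> ennreal ((64 * i + 1) / d)"
  proof (rule crossing_finite[where k = "\<lambda>_. 1" and w = K and Y = "\<phi> ` A" and Z = "\<phi> ` B" and \<tau> = d,
        OF hom fin lsc_const order_refl K i Y _ Z _ \<alpha>(1-3) _ _ z zA d(1)])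
    show "\<phi> ` A \<noteq> {}" "\<phi> ` B \<noteq> {}" using xA by auto
    show "\<alpha> \<inter> \<phi> ` A \<noteq> {}" "\<alpha> \<inter> \<phi> ` B \<noteq> {}" using xA \<alpha>(4,5) by auto
    show "ennreal d \<le> line_integral (\<lambda>_. 1) \<gamma> 0 1" if "rect_path (quad \<phi>) \<gamma>" "\<gamma> 0 \<in> \<phi> ` A" "\<gamma> 1 \<in> \<phi> ` B" for \<gamma>
      using ennreal_leI[OF d(2)[OF that(2,3)]] dist_le_line_integral_1[OF that(1)] by (rule order_trans)
  qed (rule that)
  show ?thesis using that \<beta> by (metis ennreal_less_top infinity_ennreal_def le_less_trans)
qed

text \<open>By this reflection of the square, results about the bottom side carry over to the top side.\<close>

lemma quad_flip:
  fixes \<phi> :: "real \<times> real \<Rightarrow> 'a::metric_space"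
  assumes hom: "homeomorphism ({0..1} \<times> {0..1}) (quad \<phi>) \<phi> \<psi>"
  defines "\<phi>' \<equiv> \<lambda>z. \<phi> (fst z, 1 - snd z)" and "\<psi>' \<equiv> \<lambda>x. (fst (\<psi> x), 1 - snd (\<psi> x))"
  shows "quad \<phi>' = quad \<phi>" "zeta1 \<phi>' = zeta3 \<phi>" "zeta3 \<phi>' = zeta1 \<phi>"
    "homeomorphism ({0..1} \<times> {0..1}) (quad \<phi>') \<phi>' \<psi>'"
proof -
  let ?f = "\<lambda>z :: real \<times> real. (fst z, 1 - snd z)"
  have img: "\<phi>' ` S = \<phi> ` (?f ` S)" for S by (simp add: \<phi>'_def image_image)
  have f: "?f ` ({0..1} \<times> T) = {0..1} \<times> ((\<lambda>t. 1 - t) ` T)" for T by force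
  have fI: "(\<lambda>t::real. 1 - t) ` {0..1} = {0..1}" by (auto simp: image_iff intro!: bexI[of _ "1 - _"])
  show q: "quad \<phi>' = quad \<phi>" unfolding quad_def img f fI ..
  show "zeta1 \<phi>' = zeta3 \<phi>" "zeta3 \<phi>' = zeta1 \<phi>" unfolding zeta1_def zeta3_def img f by simp_all
  have "homeomorphism ({0..1} \<times> {0..1}) ({0..1} \<times> {0..1}) ?f ?f"
    unfolding homeomorphism_def f fI by (auto intro!: continuous_intros)
  from homeomorphism_compose[OF this hom]
  show "homeomorphism ({0..1} \<times> {0..1}) (quad \<phi>') \<phi>' \<psi>'"
    unfolding q by (simp add: \<phi>'_def \<psi>'_def o_def)
qed

lemma join_to_zeta3:
  fixes \<phi> :: "real \<times> real \<Rightarrow> 'a::metric_space"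
  assumes hom: "homeomorphism ({0..1} \<times> {0..1}) (quad \<phi>) \<phi> \<psi>" and fin: "hausdorff2 (quad \<phi>) < \<infinity>"
    and K: "lsc K" "\<And>x. 1 \<le> K x" and KI: "(\<integral>\<^sup>+x\<in>quad \<phi>. K x \<partial>hausdorff2_measure) < \<infinity>"
    and \<alpha>: "compact \<alpha>" "connected \<alpha>" "\<alpha> \<subseteq> quad \<phi>" "x1 \<in> \<alpha>" "x2 \<in> \<alpha>" "x1 \<noteq> x2"
  obtains \<beta> where "rect_path (quad \<phi>) \<beta>" "\<beta> 0 \<in> \<alpha>" "\<beta> 1 \<in> zeta3 \<phi>" "line_integral K \<beta> 0 1 < \<infinity>"
proof -
  note F = quad_flip[OF hom]
  show ?thesis
    by (rule join_to_zeta1[OF F(4) _ K _ \<alpha>(1,2) _ \<alpha>(4-6)]) (use fin KI \<alpha>(3) that in \<open>auto simp: F(1,2)\<close>)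
qed

lemma connected_quad_neighbourhood:
  fixes \<phi> :: "real \<times> real \<Rightarrow> 'a::metric_space"
  assumes hom: "homeomorphism ({0..1} \<times> {0..1}) (quad \<phi>) \<phi> \<psi>" and p: "p \<in> quad \<phi>" and R: "R > 0"
  obtains N r where "compact N" "connected N" "N \<subseteq> quad \<phi>" "N \<subseteq> ball p R" "r > 0" "ball p r \<inter> quad \<phi> \<subseteq> N"
proof -
  note H = quad_homeomorphismD[OF hom]
  have p': "\<psi> p \<in> {0..1} \<times> {0..1}" "\<phi> (\<psi> p) = p" using H(3,4) p by auto
  obtain e where e: "e > 0" "\<And>z. z \<in> {0..1} \<times> {0..1} \<Longrightarrow> dist z (\<psi> p) < e \<Longrightarrow> dist (\<phi> z) (\<phi> (\<psi> p)) < R"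
    using H(1) p'(1) R unfolding continuous_on_iff by meson
  obtain r where r: "r > 0" "\<And>x. x \<in> quad \<phi> \<Longrightarrow> dist x p < r \<Longrightarrow> dist (\<psi> x) (\<psi> p) < e/2"
    using H(2) p e(1) unfolding continuous_on_iff by (meson half_gt_zero)
  define A where "A = cball (\<psi> p) (e/2) \<inter> ({0..1} \<times> {0..1})"
  have A: "compact A" "connected A" "A \<subseteq> {0..1} \<times> {0..1}"
    unfolding A_def by (auto intro!: compact_Int closed_Times convex_connected convex_Int convex_Times compact_Int_closed)
  show ?thesis
  proof (rule that[of "\<phi> ` A" r])
    show "compact (\<phi> ` A)" "connected (\<phi> ` A)" "\<phi> ` A \<subseteq> quad \<phi>" using quad_image_continuum[OF hom A] by auto
    show "\<phi> ` A \<subseteq> ball p R"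
    proof clarify
      fix a b assume ab: "(a, b) \<in> A"
      then have "dist (a, b) (\<psi> p) < e" using e(1) by (simp add: A_def dist_commute)
      then show "\<phi> (a, b) \<in> ball p R" using e(2)[of "(a, b)"] ab A(3) p'(2) by (auto simp: dist_commute mem_ball)
    qed
    show "r > 0" by (rule r)
    show "ball p r \<inter> quad \<phi> \<subseteq> \<phi> ` A"
    proof
      fix x assume x: "x \<in> ball p r \<inter> quad \<phi>"
      then have "dist (\<psi> x) (\<psi> p) < e/2" using r(2)[of x] by (auto simp: dist_commute mem_ball)
      then have "\<psi> x \<in> A" using H(4)[of x] x by (auto simp: A_def dist_commute)
      then show "x \<in> \<phi> ` A" using H(3)[of x] x by force
    qed
  qed
qed

text \<open>In a small rectangle around \<open>x\<close> the lower side is joined to the upper one by a crossing path. Its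
  points have distance at most \<open>\<tau>\<close> from the left side, so the path stays close to \<open>x\<close>.\<close>

lemma small_path_near:
  fixes \<phi> :: "real \<times> real \<Rightarrow> 'a::metric_space"
  assumes hom: "homeomorphism ({0..1} \<times> {0..1}) (quad \<phi>) \<phi> \<psi>" and fin: "hausdorff2 (quad \<phi>) < \<infinity>"
    and K: "lsc K" "\<And>x. 1 \<le> K x" and KI: "(\<integral>\<^sup>+x\<in>quad \<phi>. K x \<partial>hausdorff2_measure) < \<infinity>"
    and x: "x \<in> quad \<phi>" and R: "R > 0"
  obtains \<beta> where "rect_path (quad \<phi>) \<beta>" "\<beta> 0 \<noteq> \<beta> 1" "\<beta> ` {0..1} \<subseteq> ball x R" "line_integral K \<beta> 0 1 < \<infinity>"
proof -
  note H = quad_homeomorphismD[OF hom]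
  obtain p q where pq: "\<psi> x = (p, q)" by (cases "\<psi> x")
  have p: "p \<in> {0..1}" "q \<in> {0..1}" "\<phi> (p, q) = x" using H(3,4)[OF x] pq by auto
  obtain e where e: "e > 0" "\<And>z. z \<in> {0..1} \<times> {0..1} \<Longrightarrow> dist z (p, q) < e \<Longrightarrow> dist (\<phi> z) (\<phi> (p, q)) < R/2"
  proof -
    have "(p, q) \<in> {0..1} \<times> {0..1}" "R/2 > 0" using p R by auto
    then have "\<exists>e>0. \<forall>z\<in>{0..1} \<times> {0..1}. dist z (p, q) < e \<longrightarrow> dist (\<phi> z) (\<phi> (p, q)) < R/2"
      using H(1) unfolding continuous_on_iff by blast
    then show ?thesis using that by blast
  qed
  define a where "a = max 0 (p - e/4)"
  define b where "b = min 1 (p + e/4)"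
  define c where "c = max 0 (q - e/4)"
  define d where "d = min 1 (q + e/4)"
  have ab: "0 \<le> a" "a < b" "b \<le> 1" "0 \<le> c" "c < d" "d \<le> 1" using p e by (auto simp: a_def b_def c_def d_def)
  have near: "\<phi> (s, t) \<in> ball x (R/2)" if "s \<in> {a..b}" "t \<in> {c..d}" for s t
  proof -
    have "dist s p \<le> e/4" "dist t q \<le> e/4" using that by (auto simp: a_def b_def c_def d_def dist_real_def abs_if)
    moreover have "dist (s, t) (p, q) \<le> dist s p + dist t q"
      unfolding dist_prod_def fst_conv snd_conv by (rule real_le_lsqrt) (simp_all add: power2_sum)
    ultimately have "dist (s, t) (p, q) < e" using e(1) by linarith
    then have "dist (\<phi> (s, t)) (\<phi> (p, q)) < R/2" using that ab by (intro e(2)) auto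
    then show ?thesis using p(3) by (simp add: dist_commute mem_ball)
  qed
  have sub: "{a..b} \<subseteq> {0..1}" "{c..d} \<subseteq> {0..1}" using ab by auto
  define Y where "Y = \<phi> ` ({a} \<times> {c..d})"
  define Z where "Z = \<phi> ` ({b} \<times> {c..d})"
  define S1 where "S1 = \<phi> ` ({a..b} \<times> {c})"
  define S2 where "S2 = \<phi> ` ({a..b} \<times> {d})"
  have Y: "compact Y" "connected Y" "Y \<subseteq> quad \<phi>" and Z: "compact Z" "connected Z" "Z \<subseteq> quad \<phi>"
    and S1: "compact S1" "connected S1" "S1 \<subseteq> quad \<phi>" and S2: "compact S2" "connected S2" "S2 \<subseteq> quad \<phi>"
    unfolding Y_def Z_def S1_def S2_def using ab
    by (intro quad_image_continuum[OF hom] compact_Times connected_Times; auto)+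
  have ne: "Y \<noteq> {}" "Z \<noteq> {}" "S1 \<inter> Y \<noteq> {}" "S1 \<inter> Z \<noteq> {}" "S2 \<inter> Y \<noteq> {}" "S2 \<inter> Z \<noteq> {}"
  proof -
    have "\<phi> (a, c) \<in> S1 \<inter> Y" "\<phi> (b, c) \<in> S1 \<inter> Z" "\<phi> (a, d) \<in> S2 \<inter> Y" "\<phi> (b, d) \<in> S2 \<inter> Z"
      using ab unfolding Y_def Z_def S1_def S2_def by (auto intro!: imageI)
    then show "Y \<noteq> {}" "Z \<noteq> {}" "S1 \<inter> Y \<noteq> {}" "S1 \<inter> Z \<noteq> {}" "S2 \<inter> Y \<noteq> {}" "S2 \<inter> Z \<noteq> {}" by blast+
  qed
  have "Y \<inter> Z = \<phi> ` (({a} \<times> {c..d}) \<inter> ({b} \<times> {c..d}))"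
    unfolding Y_def Z_def using ab by (intro inj_on_image_Int[OF quad_homeomorphismD(8)[OF hom], symmetric]) auto
  then have YZ: "Y \<inter> Z = {}" using ab by auto
  have "S1 \<inter> S2 = \<phi> ` (({a..b} \<times> {c}) \<inter> ({a..b} \<times> {d}))"
    unfolding S1_def S2_def using ab by (intro inj_on_image_Int[OF quad_homeomorphismD(8)[OF hom], symmetric]) auto
  then have S12: "S1 \<inter> S2 = {}" using ab by auto
  obtain \<delta> where \<delta>: "\<delta> > 0" "\<And>x y. x \<in> Y \<Longrightarrow> y \<in> Z \<Longrightarrow> \<delta> \<le> dist x y"
    by (rule compact_disjoint_separated[OF Y(1) Z(1) YZ]) (rule that)
  define \<tau> where "\<tau> = min \<delta> (R/4)"
  have \<tau>: "\<tau> > 0" "\<tau> \<le> \<delta>" "\<tau> < R/2" using \<delta> R by (auto simp: \<tau>_def)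
  obtain i where i: "(\<integral>\<^sup>+x\<in>quad \<phi>. 1 * K x \<partial>hausdorff2_measure) = ennreal i" "i \<ge> 0" using KI by (auto simp: less_top_ennreal)
  obtain \<beta> where \<beta>: "rect_path (quad \<phi>) \<beta>" "\<beta> 0 \<in> S1" "\<beta> 1 \<in> S2" "line_integral K \<beta> 0 1 \<le> ennreal ((64 * i + 1) / \<tau>)"
    "\<And>s. s \<in> {0..1} \<Longrightarrow> \<exists>\<alpha>. rect_path (quad \<phi>) \<alpha> \<and> \<alpha> 0 \<in> Y \<and> \<alpha> 1 = \<beta> s \<and> line_integral (\<lambda>_. 1) \<alpha> 0 1 \<le> ennreal \<tau>"
  proof (rule crossing_finite[where k = "\<lambda>_. 1" and w = K and Y = Y and Z = Z and \<tau> = \<tau>,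
        OF hom fin lsc_const order_refl K i Y ne(1) Z ne(2) S1 ne(3,4) S2 ne(5,6) \<tau>(1)])
    show "ennreal \<tau> \<le> line_integral (\<lambda>_. 1) \<gamma> 0 1" if "rect_path (quad \<phi>) \<gamma>" "\<gamma> 0 \<in> Y" "\<gamma> 1 \<in> Z" for \<gamma>
    proof -
      have "\<tau> \<le> dist (\<gamma> 0) (\<gamma> 1)" using \<delta>(2)[OF that(2,3)] \<tau> by linarith
      then show ?thesis using dist_le_line_integral_1[OF that(1)] ennreal_leI order_trans by blast
    qed
  qed (rule that)
  show ?thesis
  proof (rule that[OF \<beta>(1)])
    show "\<beta> 0 \<noteq> \<beta> 1" using \<beta>(2,3) S12 by auto
    show "\<beta> ` {0..1} \<subseteq> ball x R"
    proof
      fix y assume "y \<in> \<beta> ` {0..1}"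
      then obtain s where s: "s \<in> {0..1}" "y = \<beta> s" by blast
      obtain \<alpha> where \<alpha>: "rect_path (quad \<phi>) \<alpha>" "\<alpha> 0 \<in> Y" "\<alpha> 1 = y" "line_integral (\<lambda>_. 1) \<alpha> 0 1 \<le> ennreal \<tau>"
        using \<beta>(5)[OF s(1)] s(2) by blast
      have "ennreal (dist (\<alpha> 0) y) \<le> ennreal \<tau>" using dist_le_line_integral_1[OF \<alpha>(1)] \<alpha>(3,4) by (metis order_trans)
      then have "dist (\<alpha> 0) y \<le> \<tau>" using \<tau> by simp
      moreover have "\<alpha> 0 \<in> ball x (R/2)" using \<alpha>(2) near[of a] ab by (auto simp: Y_def)
      ultimately show "y \<in> ball x R" using \<tau>(3) dist_triangle[of x y "\<alpha> 0"] by (simp add: mem_ball)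
    qed
    show "line_integral K \<beta> 0 1 < \<infinity>" using \<beta>(4) by (auto intro: le_less_trans)
  qed
qed

text \<open>Start at the last time \<open>a\<close> at which \<open>\<gamma>\<close> visits its initial point.\<close>

lemma nonconstant_small_start:
  fixes \<gamma> :: "real \<Rightarrow> 'a::metric_space"
  assumes r: "rect_path Q \<gamma>" and ne: "\<gamma> 0 \<noteq> \<gamma> 1" and f: "f \<in> borel_measurable borel"
    and fin: "line_integral f \<gamma> 0 1 < \<infinity>" and \<kappa>: "\<kappa> > 0" and R: "R > 0"
  obtains a b where "0 \<le> a" "a < b" "b \<le> 1" "\<gamma> a = \<gamma> 0" "\<gamma> b \<noteq> \<gamma> 0" "line_integral f \<gamma> a b < \<kappa>" "\<gamma> ` {a..b} \<subseteq> ball (\<gamma> 0) R"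
proof -
  have cont: "continuous_on {0..1} \<gamma>" using rect_pathD(1)[OF r] by (simp add: rect_on_def)
  define T where "T = {t\<in>{0..1}. \<gamma> t = \<gamma> 0}"
  have "closed T" unfolding T_def by (intro continuous_closed_preimage_constant cont) auto
  then have "compact ({0..1} \<inter> T)" by (intro compact_Int_closed) auto
  moreover have "{0..1} \<inter> T = T" by (auto simp: T_def)
  ultimately have T: "compact T" by simp
  have "T \<noteq> {}" by (auto simp: T_def intro!: exI[of _ 0])
  then obtain a where a: "a \<in> T" "\<And>t. t \<in> T \<Longrightarrow> t \<le> a" using compact_attains_sup[OF T] by blast
  have a01: "0 \<le> a" "a < 1" "\<gamma> a = \<gamma> 0"
  proof -
    show "0 \<le> a" "\<gamma> a = \<gamma> 0" using a(1) by (auto simp: T_def)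
    then show "a < 1" using a(1) ne by (cases "a = 1") (auto simp: T_def)
  qed
  have ra: "rect_on \<gamma> a 1" using a01 by (intro rect_on_subinterval[OF rect_pathD(1)[OF r]]) auto
  have fina: "line_integral f \<gamma> a 1 < \<infinity>"
    using line_integral_mono_interval[OF rect_pathD(1)[OF r], of a 1 f] a01 f fin by (auto intro: le_less_trans)
  obtain \<delta> where \<delta>: "\<delta> > 0" "\<And>s. a \<le> s \<Longrightarrow> s \<le> 1 \<Longrightarrow> s \<le> a + \<delta> \<Longrightarrow> line_integral f \<gamma> a s < \<kappa>"
    by (rule line_integral_small_start[OF ra f fina \<kappa>]) (rule that)
  obtain \<delta>' where \<delta>': "\<delta>' > 0" "\<And>s. s \<in> {0..1} \<Longrightarrow> dist s a < \<delta>' \<Longrightarrow> dist (\<gamma> s) (\<gamma> a) < R"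
    using cont a01 R unfolding continuous_on_iff by (metis atLeastAtMost_iff less_imp_le)
  define b where "b = min 1 (a + min \<delta> (\<delta>'/2))"
  have b: "a < b" "b \<le> 1" "b \<le> a + \<delta>" "b < a + \<delta>'" using a01 \<delta> \<delta>' by (auto simp: b_def min_def)
  show ?thesis
  proof (rule that[of a b])
    show "\<gamma> b \<noteq> \<gamma> 0" using a(2)[of b] b a01 by (auto simp: T_def)
    show "line_integral f \<gamma> a b < \<kappa>" using b by (intro \<delta>(2)) auto
    show "\<gamma> ` {a..b} \<subseteq> ball (\<gamma> 0) R"
    proof
      fix y assume "y \<in> \<gamma> ` {a..b}"
      then obtain s where s: "s \<in> {a..b}" "y = \<gamma> s" by blast
      then have "dist (\<gamma> s) (\<gamma> a) < R" using b a01 by (intro \<delta>'(2)) (auto simp: dist_real_def)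
      then show "y \<in> ball (\<gamma> 0) R" using s a01 by (simp add: dist_commute mem_ball)
    qed
  qed (use a01 b in auto)
qed

section \<open>Short connections at an arbitrary point\<close>

lemma integral_neighbourhoods_tendsto_0:
  fixes H :: "'a::metric_space \<Rightarrow> ennreal"
  assumes \<Gamma>: "closed \<Gamma>" "\<Gamma> \<noteq> {}" "hausdorff2 \<Gamma> = 0" and Q: "Q \<in> sets borel" and H: "H \<in> borel_measurable borel"
    and HI: "(\<integral>\<^sup>+x\<in>Q. H x \<partial>hausdorff2_measure) < \<infinity>"
  shows "(\<lambda>n. \<integral>\<^sup>+x\<in>{x\<in>Q. infdist x \<Gamma> < 1 / real (Suc n)}. H x \<partial>hausdorff2_measure) \<longlonglongrightarrow> 0"
proof -
  define M where "M = density hausdorff2_measure (\<lambda>x. H x * indicator Q x)"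
  define U where "U n = {x. infdist x \<Gamma> < 1 / real (Suc n)}" for n
  note U = infdist_neighbourhoods[OF \<Gamma>(1,2), folded U_def]
  note [measurable] = H Q
  have Um: "U n \<in> sets borel" for n by (rule borel_open[OF U(1)])
  have ME: "emeasure M A = (\<integral>\<^sup>+x\<in>Q \<inter> A. H x \<partial>hausdorff2_measure)" if "A \<in> sets borel" for A
    unfolding M_def using that by (subst emeasure_density) (auto simp: indicator_inter_arith mult.assoc)
  have "(\<lambda>n. emeasure M (U n)) \<longlonglongrightarrow> emeasure M (\<Inter>n. U n)"
  proof (rule Lim_emeasure_decseq)
    show "range U \<subseteq> sets M" using Um by (auto simp: M_def)
    show "decseq U" by (rule U(2))
    fix n
    have "emeasure M (U n) \<le> (\<integral>\<^sup>+x\<in>Q. H x \<partial>hausdorff2_measure)"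
      unfolding ME[OF Um] by (intro nn_integral_mono) (auto simp: indicator_def)
    then show "emeasure M (U n) \<noteq> \<infinity>" using HI by (auto simp: top_unique)
  qed
  also have "(\<Inter>n. U n) = \<Gamma>" by (rule U(3))
  also have "emeasure M \<Gamma> = 0"
  proof -
    have gm: "\<Gamma> \<in> sets borel" using \<Gamma> by simp
    have "\<Gamma> \<in> null_sets hausdorff2_measure"
      using \<Gamma>(3) gm by (simp add: null_sets_def emeasure_hausdorff2_measure)
    then have ae: "AE x in hausdorff2_measure. x \<notin> \<Gamma>" by (rule AE_not_in)
    have "(\<integral>\<^sup>+x\<in>Q \<inter> \<Gamma>. H x \<partial>hausdorff2_measure) = (\<integral>\<^sup>+(x::'a). 0 \<partial>hausdorff2_measure)"
    proof (rule nn_integral_cong_AE)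
      show "AE x in hausdorff2_measure. H x * indicator (Q \<inter> \<Gamma>) x = 0"
        using ae by eventually_elim auto
    qed
    then show ?thesis unfolding ME[OF gm] by simp
  qed
  finally have "(\<lambda>n. emeasure M (U n)) \<longlonglongrightarrow> 0" .
  moreover have "Q \<inter> U n = {x\<in>Q. infdist x \<Gamma> < 1 / real (Suc n)}" for n by (auto simp: U_def)
  ultimately show ?thesis unfolding ME[OF Um] by simp
qed

text \<open>If all balls centred on the continuum had mass at least \<open>c s\<close>, then at every small scale \<open>s\<close>
  about \<open>1/s\<close> disjoint balls would carry a fixed mass arbitrarily close to a null set.\<close>

lemma continuum_has_light_ball:
  fixes H :: "'a::metric_space \<Rightarrow> ennreal"
  assumes \<Gamma>: "compact \<Gamma>" "connected \<Gamma>" "hausdorff2 \<Gamma> = 0" "p \<in> \<Gamma>" "q0 \<in> \<Gamma>" "p \<noteq> q0"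
    and Q: "Q \<in> sets borel" and H: "H \<in> borel_measurable borel"
    and HI: "(\<integral>\<^sup>+x\<in>Q. H x \<partial>hausdorff2_measure) < \<infinity>" and c: "c > 0" and s0: "s0 > 0"
  obtains q s where "q \<in> \<Gamma>" "dist p q0 / 2 \<le> dist p q" "0 < s" "s < s0"
    "(\<integral>\<^sup>+x\<in>Q \<inter> ball q s. H x \<partial>hausdorff2_measure) < ennreal (c * s)"
proof (rule ccontr)
  assume "\<not> thesis"
  then have heavy: "ennreal (c * s) \<le> (\<integral>\<^sup>+x\<in>Q \<inter> ball q s. H x \<partial>hausdorff2_measure)"
    if "q \<in> \<Gamma>" "dist p q0 / 2 \<le> dist p q" "0 < s" "s < s0" for q s
    using that \<open>\<And>q s. \<lbrakk>q \<in> \<Gamma>; dist p q0 / 2 \<le> dist p q; 0 < s; s < s0; (\<integral>\<^sup>+x\<in>Q \<inter> ball q s. H x \<partial>hausdorff2_measure) < ennreal (c * s)\<rbrakk> \<Longrightarrow> thesis\<close>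
    by (meson not_le)
  define D where "D = dist p q0"
  have D: "D > 0" using \<Gamma>(6) by (simp add: D_def)
  note [measurable] = H Q
  have pts: "\<exists>q\<in>\<Gamma>. dist p q = d" if d: "0 \<le> d" "d \<le> D" for d
  proof -
    have "connected ((\<lambda>q. dist p q) ` \<Gamma>)" by (intro connected_continuous_image continuous_intros \<Gamma>)
    moreover have "0 \<in> (\<lambda>q. dist p q) ` \<Gamma>" "D \<in> (\<lambda>q. dist p q) ` \<Gamma>" using \<Gamma>(4,5) by (force simp: D_def)+
    ultimately have "d \<in> (\<lambda>q. dist p q) ` \<Gamma>" using d unfolding connected_iff_interval by blast
    then show ?thesis by blast
  qed
  have mass: "ennreal (c * D / 8) \<le> (\<integral>\<^sup>+x\<in>{x\<in>Q. infdist x \<Gamma> < s}. H x \<partial>hausdorff2_measure)"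
    if s: "0 < s" "s < s0" "s < D / 8" for s
  proof -
    define N where "N = nat \<lfloor>D / (4 * s)\<rfloor>"
    have "real N = of_int \<lfloor>D / (4 * s)\<rfloor>" using D s by (simp add: N_def)
    then have N: "real N \<le> D / (4 * s)" "D / (4 * s) < real N + 1" by linarith+
    have N1: "real N * (4 * s) \<le> D" using N(1) s by (simp add: pos_le_divide_eq)
    have N2: "D < real N * (4 * s) + 4 * s" using N(2) s by (simp add: pos_divide_less_eq distrib_right)
    have "\<exists>q\<in>\<Gamma>. dist p q = D / 2 + 2 * s * real i" if i: "i < N" for i
    proof (rule pts)
      have "real i * (2 * s) \<le> real N * (2 * s)" using i s by (intro mult_right_mono) auto
      then show "D / 2 + 2 * s * real i \<le> D" using N1 by (simp add: mult.commute mult.left_commute)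
      show "0 \<le> D / 2 + 2 * s * real i" using D s by simp
    qed
    then have "\<forall>i. \<exists>q. i < N \<longrightarrow> q \<in> \<Gamma> \<and> dist p q = D / 2 + 2 * s * real i" by blast
    from choice[OF this] obtain q where q: "\<And>i. i < N \<Longrightarrow> q i \<in> \<Gamma>" "\<And>i. i < N \<Longrightarrow> dist p (q i) = D / 2 + 2 * s * real i" by blast
    have dis: "disjoint_family_on (\<lambda>i. Q \<inter> ball (q i) s) {..<N}"
    proof -
      have "False" if ij: "i < j" "j < N" and x: "dist (q i) x < s" "dist (q j) x < s" for i j x
      proof -
        have "2 * s * real i + 2 * s * 1 \<le> 2 * s * real j"
          unfolding distrib_left[symmetric] using ij s by (intro mult_left_mono) auto
        then have "dist p (q i) + 2 * s \<le> dist p (q j)" using q(2)[of i] q(2)[of j] ij by simp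
        then show False
          using dist_triangle[of p "q j" "q i"] dist_triangle[of "q i" "q j" x] x by (simp add: dist_commute)
      qed
      then show ?thesis
        unfolding disjoint_family_on_def
      proof (intro ballI impI equals0I)
        fix i j x assume "i \<in> {..<N}" "j \<in> {..<N}" "i \<noteq> j" "x \<in> Q \<inter> ball (q i) s \<inter> (Q \<inter> ball (q j) s)"
        then show False
          using \<open>\<And>j i x. \<lbrakk>i < j; j < N; dist (q i) x < s; dist (q j) x < s\<rbrakk> \<Longrightarrow> False\<close>[of i j x]
            \<open>\<And>j i x. \<lbrakk>i < j; j < N; dist (q i) x < s; dist (q j) x < s\<rbrakk> \<Longrightarrow> False\<close>[of j i x]
          by (cases i j rule: linorder_cases) auto
      qed
    qed
    have "ennreal (c * D / 8) \<le> ennreal (real N * (c * s))"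
    proof (rule ennreal_leI)
      have "D / 8 \<le> real N * s" using N2 s by linarith
      then have "c * (D / 8) \<le> c * (real N * s)" using c by (intro mult_left_mono) auto
      then show "c * D / 8 \<le> real N * (c * s)" by (simp add: mult_ac)
    qed
    also have "\<dots> = (\<Sum>i<N. ennreal (c * s))" by (simp add: ennreal_of_nat_eq_real_of_nat flip: ennreal_mult')
    also have "\<dots> \<le> (\<Sum>i<N. \<integral>\<^sup>+x\<in>Q \<inter> ball (q i) s. H x \<partial>hausdorff2_measure)"
    proof (rule sum_mono)
      fix i assume "i \<in> {..<N}"
      then have i: "q i \<in> \<Gamma>" "dist p (q i) = D / 2 + 2 * s * real i" using q by auto
      have "0 \<le> 2 * s * real i" using s by simp
      then have "dist p q0 / 2 \<le> dist p (q i)" using i(2) by (simp add: D_def)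
      then show "ennreal (c * s) \<le> (\<integral>\<^sup>+x\<in>Q \<inter> ball (q i) s. H x \<partial>hausdorff2_measure)"
        using s(1,2) by (rule heavy[OF i(1)])
    qed
    also have "\<dots> = (\<integral>\<^sup>+x. (\<Sum>i<N. H x * indicator (Q \<inter> ball (q i) s) x) \<partial>hausdorff2_measure)"
    proof (rule nn_integral_sum[symmetric])
      fix i
      have [measurable]: "Q \<inter> ball (q i) s \<in> sets borel" using Q borel_open[OF open_ball] by (rule sets.Int)
      show "(\<lambda>x. H x * indicator (Q \<inter> ball (q i) s) x) \<in> borel_measurable hausdorff2_measure" by measurable
    qed
    also have "\<dots> \<le> (\<integral>\<^sup>+x\<in>{x\<in>Q. infdist x \<Gamma> < s}. H x \<partial>hausdorff2_measure)"
    proof (rule nn_integral_mono)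
      fix x
      have "(\<Sum>i<N. H x * indicator (Q \<inter> ball (q i) s) x) = H x * (\<Sum>i<N. indicator (Q \<inter> ball (q i) s) x)"
        by (rule sum_distrib_left[symmetric])
      also have "(\<Sum>i<N. indicator (Q \<inter> ball (q i) s) x) = (indicator (\<Union>i<N. Q \<inter> ball (q i) s) x :: ennreal)"
        by (rule indicator_UN_disjoint[symmetric]) (use dis in auto)
      also have "\<dots> \<le> indicator {x\<in>Q. infdist x \<Gamma> < s} x"
      proof (cases "x \<in> (\<Union>i<N. Q \<inter> ball (q i) s)")
        case True
        then obtain i where i: "i < N" "x \<in> Q" "dist (q i) x < s" by (auto simp: mem_ball)
        have "infdist x \<Gamma> \<le> dist x (q i)" using q(1)[OF i(1)] by (rule infdist_le)
        then show ?thesis using i by (simp add: dist_commute indicator_def)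
      qed simp
      finally show "(\<Sum>i<N. H x * indicator (Q \<inter> ball (q i) s) x) \<le> H x * indicator {x\<in>Q. infdist x \<Gamma> < s} x"
        by this (erule mult_left_mono, simp)
    qed
    finally show ?thesis .
  qed
  have "(\<lambda>n. \<integral>\<^sup>+x\<in>{x\<in>Q. infdist x \<Gamma> < 1 / real (Suc n)}. H x \<partial>hausdorff2_measure) \<longlonglongrightarrow> 0"
    using \<Gamma>(4) by (intro integral_neighbourhoods_tendsto_0 compact_imp_closed \<Gamma> Q H HI) auto
  then have 1: "eventually (\<lambda>n. (\<integral>\<^sup>+x\<in>{x\<in>Q. infdist x \<Gamma> < 1 / real (Suc n)}. H x \<partial>hausdorff2_measure) < ennreal (c * D / 8)) sequentially"
    using c D by (intro order_tendstoD) auto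
  have "(\<lambda>n. 1 / real (Suc n)) \<longlonglongrightarrow> 0" by (rule LIMSEQ_Suc[OF lim_1_over_n])
  then have 2: "eventually (\<lambda>n. 1 / real (Suc n) < min s0 (D / 8)) sequentially"
    using s0 D by (intro order_tendstoD) auto
  obtain n where "(\<integral>\<^sup>+x\<in>{x\<in>Q. infdist x \<Gamma> < 1 / real (Suc n)}. H x \<partial>hausdorff2_measure) < ennreal (c * D / 8)"
    "1 / real (Suc n) < min s0 (D / 8)"
    using eventually_happens[OF eventually_conj[OF 1 2]] by auto
  then show False using mass[of "1 / real (Suc n)"] by simp
qed

text \<open>Crossing between \<open>Y n\<close> and \<open>Z n\<close> from a short connection of \<open>y n\<close> and \<open>z n\<close> to \<open>S\<close> gives paths \<open>g n\<close> of
  bounded \<open>H\<close>-length all of whose points are \<open>H\<close>-close to \<open>Y n\<close>. They subconverge to a path \<open>\<gamma>\<close> starting at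
  \<open>p\<close>, but semicontinuity alone would bring \<open>p\<close> close to a limit of the \<open>Y n\<close> only. However, \<open>\<gamma>\<close> and a late
  \<open>g n\<close> both run from the vicinity of \<open>p\<close> to the vicinity of a point \<open>q\<close> of \<open>\<gamma>\<close>, and if \<open>q\<close> is the centre of
  a light ball, a crossing around \<open>q\<close> connects them by a path of small \<open>H\<close>-length. From
  there an initial piece of \<open>\<gamma>\<close> of small \<open>H\<close>-length leads back to \<open>p\<close>.\<close>

lemma limit_point_near_continua:
  fixes \<phi> :: "real \<times> real \<Rightarrow> 'a::metric_space" and Y Z :: "nat \<Rightarrow> 'a set"
  assumes hom: "homeomorphism ({0..1} \<times> {0..1}) (quad \<phi>) \<phi> \<psi>" and fin: "hausdorff2 (quad \<phi>) < \<infinity>"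
    and H: "lsc H" "\<And>x. 1 \<le> H x" and HI: "(\<integral>\<^sup>+x\<in>quad \<phi>. (H x)\<^sup>2 \<partial>hausdorff2_measure) < \<infinity>"
    and Y: "\<And>n. compact (Y n)" "\<And>n. connected (Y n)" "\<And>n. Y n \<subseteq> quad \<phi>"
    and Z: "\<And>n. compact (Z n)" "\<And>n. connected (Z n)" "\<And>n. Z n \<subseteq> quad \<phi>"
    and yz: "\<And>n. y n \<in> Y n" "\<And>n. z n \<in> Z n" "y \<longlonglongrightarrow> p" "z \<longlonglongrightarrow> p" and p: "p \<in> quad \<phi>"
    and S: "compact S" "connected S" "S \<subseteq> quad \<phi>" "\<And>n. S \<inter> Y n \<noteq> {}" "\<And>n. S \<inter> Z n \<noteq> {}" "p \<notin> S"
    and \<delta>: "\<delta> > 0" and far: "\<And>n \<gamma>. rect_path (quad \<phi>) \<gamma> \<Longrightarrow> \<gamma> 0 \<in> Y n \<Longrightarrow> \<gamma> 1 \<in> Z n \<Longrightarrow> ennreal \<delta> \<le> line_integral H \<gamma> 0 1"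
    and \<epsilon>: "\<epsilon> > 0"
  obtains n x where "x \<in> Y n" "w_joined (quad \<phi>) H x p (ennreal \<epsilon>)"
proof -
  define Q where "Q = quad \<phi>"
  note hD = quad_homeomorphismD[OF hom]
  have Qb: "Q \<in> sets borel" using compact_imp_closed[OF hD(7)] by (simp add: Q_def)
  have Hm: "H \<in> borel_measurable borel" by (rule lsc_measurable[OF H(1)])
  define \<tau> where "\<tau> = min \<delta> (\<epsilon>/3)"
  have \<tau>: "\<tau> > 0" "\<tau> \<le> \<delta>" "\<tau> \<le> \<epsilon>/3" using \<delta> \<epsilon> by (auto simp: \<tau>_def)
  obtain i where i: "(\<integral>\<^sup>+x\<in>quad \<phi>. H x * H x \<partial>hausdorff2_measure) = ennreal i" "i \<ge> 0"
    using HI by (auto simp: less_top_ennreal power2_eq_square)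
  have H1I: "(\<integral>\<^sup>+x\<in>Q. H x \<partial>hausdorff2_measure) < \<infinity>" unfolding Q_def by (rule integrable_if_square[OF H(2) HI])
  define C where "C = (64 * i + 1) / \<tau>"
  \<comment> \<open>A connection of \<open>y n\<close> and \<open>z n\<close> close to \<open>p\<close>, without any control of length.\<close>
  define T where "T n = \<phi> ` closed_segment (\<psi> (y n)) (\<psi> (z n))" for n
  have yQ: "y n \<in> quad \<phi>" "z n \<in> quad \<phi>" for n using yz Y Z by blast+
  have cl: "closed_segment (\<psi> (y n)) (\<psi> (z n)) \<subseteq> {0..1} \<times> {0..1}" for n
    using hD(4)[OF yQ(1)[of n]] hD(4)[OF yQ(2)[of n]] by (intro closed_segment_subset convex_Times) auto
  have T: "compact (T n)" "connected (T n)" "T n \<subseteq> quad \<phi>" for n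
    unfolding T_def by (intro quad_image_continuum[OF hom _ _ cl] compact_segment connected_segment)+
  have yT: "y n \<in> T n" "z n \<in> T n" for n
    unfolding T_def using hD(3)[OF yQ(1)[of n]] hD(3)[OF yQ(2)[of n]] by (metis ends_in_segment imageI)+
  have "\<exists>\<gamma>. rect_path (quad \<phi>) \<gamma> \<and> \<gamma> 0 \<in> T n \<and> \<gamma> 1 \<in> S \<and> line_integral H \<gamma> 0 1 \<le> ennreal C \<and>
     (\<forall>s\<in>{0..1}. \<exists>x\<in>Y n. w_joined (quad \<phi>) H x (\<gamma> s) (ennreal (\<epsilon>/3)))" for n
  proof -
    obtain \<gamma> where \<gamma>: "rect_path (quad \<phi>) \<gamma>" "\<gamma> 0 \<in> T n" "\<gamma> 1 \<in> S" "line_integral H \<gamma> 0 1 \<le> ennreal C"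
      "\<And>s. s \<in> {0..1} \<Longrightarrow> \<exists>\<alpha>. rect_path (quad \<phi>) \<alpha> \<and> \<alpha> 0 \<in> Y n \<and> \<alpha> 1 = \<gamma> s \<and> line_integral H \<alpha> 0 1 \<le> ennreal \<tau>"
    proof (rule crossing_finite[where k = H and w = H and Y = "Y n" and Z = "Z n" and ?S1.0 = "T n" and \<tau> = \<tau>,
        OF hom fin H H i Y _ Z _ T _ _ S(1-5) \<tau>(1), folded C_def])
      show "Y n \<noteq> {}" "Z n \<noteq> {}" "T n \<inter> Y n \<noteq> {}" "T n \<inter> Z n \<noteq> {}" using yz yT by blast+
      show "ennreal \<tau> \<le> line_integral H \<gamma> 0 1" if "rect_path (quad \<phi>) \<gamma>" "\<gamma> 0 \<in> Y n" "\<gamma> 1 \<in> Z n" for \<gamma>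
        using ennreal_leI[OF \<tau>(2)] far[OF that] by (rule order_trans)
    qed (rule that)
    have "\<exists>x\<in>Y n. w_joined (quad \<phi>) H x (\<gamma> s) (ennreal (\<epsilon>/3))" if s: "s \<in> {0..1}" for s
    proof -
      obtain \<alpha> where \<alpha>: "rect_path (quad \<phi>) \<alpha>" "\<alpha> 0 \<in> Y n" "\<alpha> 1 = \<gamma> s" "line_integral H \<alpha> 0 1 \<le> ennreal \<tau>"
        using \<gamma>(5)[OF s] by blast
      have "line_integral H \<alpha> 0 1 \<le> ennreal (\<epsilon>/3)" using \<alpha>(4) ennreal_leI[OF \<tau>(3)] by (rule order_trans)
      then show ?thesis using \<alpha> unfolding w_joined_def by blast
    qed
    then show ?thesis using \<gamma> by blast
  qed
  then have "\<forall>n. \<exists>\<gamma>. rect_path (quad \<phi>) \<gamma> \<and> \<gamma> 0 \<in> T n \<and> \<gamma> 1 \<in> S \<and> line_integral H \<gamma> 0 1 \<le> ennreal C \<and>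
     (\<forall>s\<in>{0..1}. \<exists>x\<in>Y n. w_joined (quad \<phi>) H x (\<gamma> s) (ennreal (\<epsilon>/3)))" by blast
  from choice[OF this] obtain g where g: "\<And>n. rect_path (quad \<phi>) (g n)" "\<And>n. g n 0 \<in> T n" "\<And>n. g n 1 \<in> S"
    "\<And>n. line_integral H (g n) 0 1 \<le> ennreal C"
    "\<And>n s. s \<in> {0..1} \<Longrightarrow> \<exists>x\<in>Y n. w_joined (quad \<phi>) H x (g n s) (ennreal (\<epsilon>/3))" by blast
  have g0: "(\<lambda>n. g n 0) \<longlonglongrightarrow> p"
  proof -
    have \<psi>y: "(\<lambda>n. \<psi> (y n)) \<longlonglongrightarrow> \<psi> p" "(\<lambda>n. \<psi> (z n)) \<longlonglongrightarrow> \<psi> p"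
      using yz yQ by (auto intro!: continuous_on_tendsto_compose[OF hD(2) _ p])
    have "\<exists>a\<in>closed_segment (\<psi> (y n)) (\<psi> (z n)). g n 0 = \<phi> a" for n using g(2)[of n] unfolding T_def by blast
    then have "\<forall>n. \<exists>a. a \<in> closed_segment (\<psi> (y n)) (\<psi> (z n)) \<and> g n 0 = \<phi> a" by blast
    from choice[OF this] obtain a where a: "\<And>n. a n \<in> closed_segment (\<psi> (y n)) (\<psi> (z n))" "\<And>n. g n 0 = \<phi> (a n)" by blast
    have "a \<longlonglongrightarrow> \<psi> p"
      unfolding tendsto_dist_iff[of a]
    proof (rule tendsto_sandwich)
      show "eventually (\<lambda>n. 0 \<le> dist (a n) (\<psi> p)) sequentially" by simp
      show "eventually (\<lambda>n. dist (a n) (\<psi> p) \<le> dist (\<psi> (y n)) (\<psi> p) + dist (\<psi> (z n)) (\<psi> p)) sequentially"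
      proof (rule always_eventually, rule allI)
        fix n
        have "a n \<in> cball (\<psi> p) (dist (\<psi> (y n)) (\<psi> p) + dist (\<psi> (z n)) (\<psi> p))"
          using a(1)[of n] by (rule set_mp[OF closed_segment_subset[OF _ _ convex_cball], rotated 2]) (auto simp: dist_commute)
        then show "dist (a n) (\<psi> p) \<le> dist (\<psi> (y n)) (\<psi> p) + dist (\<psi> (z n)) (\<psi> p)" by (simp add: dist_commute)
      qed
      show "(\<lambda>n. dist (\<psi> (y n)) (\<psi> p) + dist (\<psi> (z n)) (\<psi> p)) \<longlonglongrightarrow> 0"
        using tendsto_add[OF \<psi>y(1)[unfolded tendsto_dist_iff[of _ "\<psi> p"]] \<psi>y(2)[unfolded tendsto_dist_iff[of _ "\<psi> p"]]] by simp
    qed simp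
    moreover have "a n \<in> {0..1} \<times> {0..1}" for n using a(1) cl by blast
    ultimately have "(\<lambda>n. \<phi> (a n)) \<longlonglongrightarrow> \<phi> (\<psi> p)"
      by (intro continuous_on_tendsto_compose[OF hD(1)] hD(4) p) auto
    then show ?thesis unfolding a(2) hD(3)[OF p] .
  qed
  have C0: "0 \<le> C" using i(2) \<tau> by (simp add: C_def)
  obtain r \<gamma> where r: "strict_mono (r :: nat \<Rightarrow> nat)" and \<gamma>: "rect_path (quad \<phi>) \<gamma>"
    and pts: "\<And>s. s \<in> {0..1} \<Longrightarrow> \<exists>t. (\<forall>k. t k \<in> {0..1}) \<and> (\<lambda>k. g (r k) (t k)) \<longlonglongrightarrow> \<gamma> s"
    and \<gamma>0: "(\<lambda>k. g (r k) 0) \<longlonglongrightarrow> \<gamma> 0" and \<gamma>1: "(\<lambda>k. g (r k) 1) \<longlonglongrightarrow> \<gamma> 1"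
    and \<gamma>I: "line_integral H \<gamma> 0 1 \<le> ennreal C"
    by (rule curve_limit[OF hD(7) H g(1) C0 g(4)]) (rule that)
  have gr0: "(\<lambda>k. g (r k) 0) \<longlonglongrightarrow> p" using LIMSEQ_subseq_LIMSEQ[OF g0 r] by (simp add: o_def)
  then have \<gamma>p: "\<gamma> 0 = p" using \<gamma>0 by (rule LIMSEQ_unique[rotated])
  have "\<gamma> 1 \<in> S" by (rule closed_sequentially[OF compact_imp_closed[OF S(1)] _ \<gamma>1]) (rule g(3))
  then have ne: "\<gamma> 0 \<noteq> \<gamma> 1" using S(6) \<gamma>p by auto
  have fin\<gamma>: "line_integral H \<gamma> 0 1 < \<infinity>" using \<gamma>I by (auto intro: le_less_trans)
  have \<epsilon>3: "ennreal (\<epsilon>/3) > 0" using \<epsilon> by simp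
  obtain a b where ab: "0 \<le> a" "a < b" "b \<le> 1" "\<gamma> a = p" "\<gamma> b \<noteq> p" "line_integral H \<gamma> a b < ennreal (\<epsilon>/3)"
    using nonconstant_small_start[OF \<gamma> ne Hm fin\<gamma> \<epsilon>3 zero_less_one] unfolding \<gamma>p by metis
  define \<Gamma> where "\<Gamma> = \<gamma> ` {a..b}"
  have rab: "rect_on \<gamma> a b" using ab by (intro rect_on_subinterval[OF rect_pathD(1)[OF \<gamma>]]) auto
  have \<Gamma>: "compact \<Gamma>" "connected \<Gamma>" "hausdorff2 \<Gamma> = 0" "p \<in> \<Gamma>" "\<gamma> b \<in> \<Gamma>" "p \<noteq> \<gamma> b"
  proof -
    show "compact \<Gamma>" "connected \<Gamma>" unfolding \<Gamma>_def by (rule rect_on_continuum[OF rab])+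
    show "hausdorff2 \<Gamma> = 0" unfolding \<Gamma>_def by (rule hausdorff2_rectifiable_image[OF rab])
    show "p \<in> \<Gamma>" "\<gamma> b \<in> \<Gamma>" unfolding \<Gamma>_def using ab by (auto intro!: image_eqI[of p \<gamma> a])
  qed (use ab in auto)
  have \<Gamma>Q: "\<Gamma> \<subseteq> quad \<phi>" unfolding \<Gamma>_def using rect_pathD(2)[OF \<gamma>] ab by auto
  define D where "D = dist p (\<gamma> b)"
  have D: "D > 0" using \<Gamma>(6) by (simp add: D_def)
  \<comment> \<open>The crossing below takes place at distance \<open>\<tau> = s/2\<close> with bound \<open>c = \<epsilon>/3\<close>, and
    \<open>64 \<cdot> (\<epsilon> / 384 \<cdot> s) = c \<tau>\<close>.\<close>
  have "\<epsilon> / 384 > 0" "D / 8 > 0" using \<epsilon> D by auto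
  then obtain q s where q: "q \<in> \<Gamma>" "D / 2 \<le> dist p q" and s: "0 < s" "s < D / 8"
    and light: "(\<integral>\<^sup>+x\<in>Q \<inter> ball q s. H x \<partial>hausdorff2_measure) < ennreal (\<epsilon> / 384 * s)"
    by (rule continuum_has_light_ball[OF \<Gamma> Qb Hm H1I, folded D_def]) (rule that)
  have qQ: "q \<in> quad \<phi>" using q \<Gamma>Q by blast
  have "D / 4 > 0" "s / 2 > 0" using D s by auto
  obtain Np rp where Np: "compact Np" "connected Np" "Np \<subseteq> quad \<phi>" "Np \<subseteq> ball p (D / 4)" "rp > 0" "ball p rp \<inter> quad \<phi> \<subseteq> Np"
    by (rule connected_quad_neighbourhood[OF hom p \<open>D / 4 > 0\<close>]) (rule that)
  obtain Nq rq where Nq: "compact Nq" "connected Nq" "Nq \<subseteq> quad \<phi>" "Nq \<subseteq> ball q (s / 2)" "rq > 0" "ball q rq \<inter> quad \<phi> \<subseteq> Nq"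
    by (rule connected_quad_neighbourhood[OF hom qQ \<open>s / 2 > 0\<close>]) (rule that)
  have pN: "p \<in> Np" "q \<in> Nq" using Np(5,6) Nq(5,6) p qQ by (auto simp: mem_ball)
  obtain sq where sq: "sq \<in> {0..1}" "\<gamma> sq = q"
  proof -
    obtain t where "t \<in> {a..b}" "q = \<gamma> t" using q(1) unfolding \<Gamma>_def by blast
    then show ?thesis using that[of t] ab by auto
  qed
  obtain t where t: "\<And>k. t k \<in> {0..1}" "(\<lambda>k. g (r k) (t k)) \<longlonglongrightarrow> q" using pts[OF sq(1)] sq(2) by blast
  have gQ: "g n u \<in> quad \<phi>" if "u \<in> {0..1}" for n u using rect_pathD(2)[OF g(1) that] .
  have "eventually (\<lambda>k. dist (g (r k) 0) p < rp) sequentially" using gr0 Np(5) by (rule tendstoD)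
  moreover have "eventually (\<lambda>k. dist (g (r k) (t k)) q < rq) sequentially" using t(2) Nq(5) by (rule tendstoD)
  ultimately have "eventually (\<lambda>k. dist (g (r k) 0) p < rp \<and> dist (g (r k) (t k)) q < rq) sequentially" by eventually_elim simp
  then obtain k where k: "dist (g (r k) 0) p < rp" "dist (g (r k) (t k)) q < rq" using eventually_happens by force
  define n where "n = r k"
  have in_N: "g n 0 \<in> Np" "g n (t k) \<in> Nq"
    using k Np(6) Nq(6) gQ[of 0 n] gQ[OF t(1)[of k], of n] by (auto simp: n_def mem_ball dist_commute)
  define G where "G = g n ` {0..1}"
  have G: "compact G" "connected G" "G \<subseteq> quad \<phi>"
    unfolding G_def using rect_on_continuum[OF rect_pathD(1)[OF g(1)[of n]]] rect_pathD(2)[OF g(1)[of n]] by auto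
  have "g n 0 \<in> G" "g n (t k) \<in> G" unfolding G_def using t(1)[of k] by (auto intro!: imageI)
  then have G_meets: "G \<inter> Nq \<noteq> {}" "G \<inter> Np \<noteq> {}" using in_N by blast+
  have s2: "s / 2 > 0" using s by simp
  have \<epsilon>30: "\<epsilon> / 3 > 0" using \<epsilon> by simp
  obtain \<beta> where \<beta>: "rect_path (quad \<phi>) \<beta>" "\<beta> 0 \<in> G" "\<beta> 1 \<in> \<Gamma>" "line_integral H \<beta> 0 1 \<le> ennreal (\<epsilon>/3)"
  proof (rule crossing[where k = "\<lambda>_. 1" and w = H and Y = Nq and Z = Np and ?S1.0 = G and ?S2.0 = \<Gamma> and \<tau> = "s/2" and c = "\<epsilon>/3",
      OF hom fin lsc_const order_refl H Nq(1-3) _ Np(1-3) _ G G_meets \<Gamma>(1,2) \<Gamma>Q _ _ s2 _ _ \<epsilon>30])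
    show "Nq \<noteq> {}" "Np \<noteq> {}" "\<Gamma> \<inter> Nq \<noteq> {}" "\<Gamma> \<inter> Np \<noteq> {}" using pN q(1) \<Gamma>(4) by blast+
    show "ennreal (s/2) \<le> line_integral (\<lambda>_. 1) \<gamma> 0 1" if "rect_path (quad \<phi>) \<gamma>" "\<gamma> 0 \<in> Nq" "\<gamma> 1 \<in> Np" for \<gamma>
    proof -
      have "dist q (\<gamma> 0) < s/2" "dist p (\<gamma> 1) < D/4" using that(2,3) Nq(4) Np(4) by (auto simp: mem_ball)
      then have "s/2 \<le> dist (\<gamma> 0) (\<gamma> 1)"
        using q(2) s dist_triangle[of p q "\<gamma> 1"] dist_triangle[of "\<gamma> 1" q "\<gamma> 0"] by (simp add: dist_commute)
      then show ?thesis using dist_le_line_integral_1[OF that(1)] ennreal_leI order_trans by blast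
    qed
    have "(\<integral>\<^sup>+x\<in>{x\<in>quad \<phi>. infdist x Nq < s/2}. 1 * H x \<partial>hausdorff2_measure) \<le> (\<integral>\<^sup>+x\<in>Q \<inter> ball q s. H x \<partial>hausdorff2_measure)"
    proof (intro nn_integral_mono)
      fix x
      have "x \<in> ball q s" if x: "infdist x Nq < s/2"
      proof -
        have Nne: "Nq \<noteq> {}" using pN(2) by blast
        have "\<exists>y\<in>Nq. dist x y < s/2"
        proof (rule ccontr)
          assume "\<not> ?thesis"
          then have "s/2 \<le> infdist x Nq"
            unfolding infdist_notempty[OF Nne] using Nne by (intro cINF_greatest) (auto simp: not_less)
          then show False using x by simp
        qed
        then obtain y where y: "y \<in> Nq" "dist x y < s/2" by blast
        have "dist q y < s/2" using y(1) Nq(4) by (auto simp: mem_ball)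
        then show ?thesis using y(2) dist_triangle[of q x y] by (simp add: mem_ball dist_commute)
      qed
      then show "1 * H x * indicator {x\<in>quad \<phi>. infdist x Nq < s/2} x \<le> H x * indicator (Q \<inter> ball q s) x"
        by (auto simp: indicator_def Q_def)
    qed
    also note light
    finally have "(\<integral>\<^sup>+x\<in>{x\<in>quad \<phi>. infdist x Nq < s/2}. 1 * H x \<partial>hausdorff2_measure) < ennreal (\<epsilon> / 384 * s)" .
    then have "64 * (\<integral>\<^sup>+x\<in>{x\<in>quad \<phi>. infdist x Nq < s/2}. 1 * H x \<partial>hausdorff2_measure) < 64 * ennreal (\<epsilon> / 384 * s)"
      by (intro ennreal_mult_strict_left_mono) auto
    also have "\<dots> = ennreal (\<epsilon>/3 * (s/2))" using \<epsilon> s by (subst ennreal_numeral[symmetric], subst ennreal_mult'[symmetric]) auto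
    finally show "64 * (\<integral>\<^sup>+x\<in>{x\<in>quad \<phi>. infdist x Nq < s/2}. 1 * H x \<partial>hausdorff2_measure) < ennreal (\<epsilon>/3 * (s/2))" .
  qed (rule that)
  obtain u where u: "u \<in> {0..1}" "\<beta> 0 = g n u" using \<beta>(2) by (auto simp: G_def)
  obtain x where x: "x \<in> Y n" "w_joined (quad \<phi>) H x (\<beta> 0) (ennreal (\<epsilon>/3))" using g(5)[OF u(1), of n] u(2) by auto
  have b01: "w_joined (quad \<phi>) H (\<beta> 0) (\<beta> 1) (ennreal (\<epsilon>/3))" unfolding w_joined_def using \<beta> by blast
  obtain v where v: "v \<in> {a..b}" "\<beta> 1 = \<gamma> v" using \<beta>(3) by (auto simp: \<Gamma>_def)
  have "line_integral H \<gamma> a v \<le> line_integral H \<gamma> a b" using v by (intro line_integral_mono_interval rab Hm) auto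
  then have "line_integral H \<gamma> a v \<le> ennreal (\<epsilon>/3)" using ab(6) by simp
  then have "w_joined (quad \<phi>) H (\<gamma> a) (\<gamma> v) (ennreal (\<epsilon>/3))" using v ab by (intro w_joined_sub[OF \<gamma>]) auto
  then have "w_joined (quad \<phi>) H (\<beta> 1) p (ennreal (\<epsilon>/3))" unfolding v(2) ab(4) by (rule w_joined_sym[OF _ Hm])
  from w_joined_trans[OF w_joined_trans[OF x(2) b01 Hm] this Hm]
  have "w_joined (quad \<phi>) H x p (ennreal (\<epsilon>/3) + ennreal (\<epsilon>/3) + ennreal (\<epsilon>/3))" .
  moreover have "ennreal (\<epsilon>/3) + ennreal (\<epsilon>/3) + ennreal (\<epsilon>/3) = ennreal \<epsilon>" using \<epsilon> by (simp flip: ennreal_plus)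
  ultimately show ?thesis using that x(1) by simp
qed

section \<open>Points on short curves\<close>

text \<open>Lower semicontinuity of the \<open>w\<close>-length distance from \<open>A\<close>.\<close>

lemma w_joined_limit:
  fixes w :: "'a::metric_space \<Rightarrow> ennreal"
  assumes Q: "compact Q" and w: "lsc w" and w1: "\<And>x. ennreal e \<le> w x" and e: "e > 0" and A: "compact A"
    and a: "\<And>n. a n \<in> A" and c: "\<And>n. w_joined Q w (a n) (x n) (ennreal c)" and c0: "c \<ge> 0" and x: "x \<longlonglongrightarrow> l"
  obtains a' where "a' \<in> A" "w_joined Q w a' l (ennreal c)"
proof -
  have "\<forall>n. \<exists>\<gamma>. rect_path Q \<gamma> \<and> \<gamma> 0 = a n \<and> \<gamma> 1 = x n \<and> line_integral w \<gamma> 0 1 \<le> ennreal c"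
    using c unfolding w_joined_def by blast
  from choice[OF this] obtain g where g: "\<And>n. rect_path Q (g n)" "\<And>n. g n 0 = a n" "\<And>n. g n 1 = x n"
    "\<And>n. line_integral w (g n) 0 1 \<le> ennreal c" by blast
  define w' where "w' x = ennreal (1 / e) * w x" for x
  have w': "lsc w'" unfolding w'_def using w e by (intro lsc_cmult) auto
  have w'1: "1 \<le> w' x" for x
  proof -
    have "ennreal (1 / e) * ennreal e \<le> w' x" unfolding w'_def by (intro mult_left_mono w1) simp
    then show ?thesis using e by (simp flip: ennreal_mult')
  qed
  have wm: "w \<in> borel_measurable borel" by (rule lsc_measurable[OF w])
  have I': "line_integral w' \<gamma> 0 1 = ennreal (1 / e) * line_integral w \<gamma> 0 1" if "rect_path Q \<gamma>" for \<gamma>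
    unfolding w'_def by (rule line_integral_cmult[OF rect_pathD(1)[OF that] wm])
  have wt: "line_integral w' (g n) 0 1 \<le> ennreal (c / e)" for n
  proof -
    have "line_integral w' (g n) 0 1 \<le> ennreal (1 / e) * ennreal c" unfolding I'[OF g(1)] by (rule mult_left_mono[OF g(4)]) simp
    then show ?thesis using e by (simp flip: ennreal_mult')
  qed
  have ce: "0 \<le> c / e" using c0 e by simp
  obtain r \<beta> where r: "strict_mono (r :: nat \<Rightarrow> nat)" and \<beta>: "rect_path Q \<beta>"
    and st: "(\<lambda>k. g (r k) 0) \<longlonglongrightarrow> \<beta> 0" and fi: "(\<lambda>k. g (r k) 1) \<longlonglongrightarrow> \<beta> 1"
    and I: "line_integral w' \<beta> 0 1 \<le> ennreal (c / e)"
    by (rule curve_limit[OF Q w' w'1 g(1) ce wt]) (rule that)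
  have "(\<lambda>k. x (r k)) \<longlonglongrightarrow> l" using LIMSEQ_subseq_LIMSEQ[OF x r] by (simp add: o_def)
  then have \<beta>1: "\<beta> 1 = l" using fi unfolding g(3) by (rule LIMSEQ_unique[rotated])
  have \<beta>0: "\<beta> 0 \<in> A" by (rule closed_sequentially[OF compact_imp_closed[OF A] _ st]) (simp add: g a)
  have "line_integral w \<beta> 0 1 \<le> ennreal c"
  proof -
    have "ennreal e * (ennreal (1 / e) * line_integral w \<beta> 0 1) \<le> ennreal e * ennreal (c / e)"
      using I unfolding I'[OF \<beta>] by (rule mult_left_mono) simp
    then show ?thesis using e by (simp add: mult.assoc[symmetric] flip: ennreal_mult')
  qed
  then show ?thesis using that \<beta> \<beta>0 \<beta>1 unfolding w_joined_def by blast
qed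

text \<open>The points whose \<open>w\<close>-length distances from \<open>A\<close> and \<open>B\<close> add up to at most \<open>M\<close>. The \<open>\<epsilon>\<close> stands for the
  infimum in these distances and makes the set closed without a discussion of minimizers.\<close>

definition short_through :: "'a::metric_space set \<Rightarrow> ('a \<Rightarrow> ennreal) \<Rightarrow> 'a set \<Rightarrow> 'a set \<Rightarrow> real \<Rightarrow> 'a set" where
  "short_through Q w A B M = {x\<in>Q. \<forall>\<epsilon>>0. \<exists>a\<in>A. \<exists>b\<in>B. \<exists>c\<ge>0. \<exists>d\<ge>0.
     w_joined Q w a x (ennreal c) \<and> w_joined Q w b x (ennreal d) \<and> c + d \<le> M + \<epsilon>}"

lemma closed_short_through:
  fixes w :: "'a::metric_space \<Rightarrow> ennreal"
  assumes Q: "compact Q" and w: "lsc w" and w1: "\<And>x. ennreal e \<le> w x" and e: "e > 0" and A: "compact A" and B: "compact B"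
  shows "closed (short_through Q w A B M)"
  unfolding closed_sequential_limits
proof (intro allI impI, elim conjE)
  fix x l assume x: "\<forall>n. x n \<in> short_through Q w A B M" and l: "x \<longlonglongrightarrow> l"
  have "l \<in> Q" by (rule closed_sequentially[OF compact_imp_closed[OF Q] _ l]) (use x in \<open>auto simp: short_through_def\<close>)
  moreover have "\<exists>a\<in>A. \<exists>b\<in>B. \<exists>c\<ge>0. \<exists>d\<ge>0. w_joined Q w a l (ennreal c) \<and> w_joined Q w b l (ennreal d) \<and> c + d \<le> M + \<epsilon>"
    if \<epsilon>: "\<epsilon> > 0" for \<epsilon>
  proof -
    have "\<epsilon> / 2 > 0" using \<epsilon> by simp
    then have "\<forall>n. \<exists>a b c d. a \<in> A \<and> b \<in> B \<and> 0 \<le> c \<and> 0 \<le> d \<and> w_joined Q w a (x n) (ennreal c) \<and> w_joined Q w b (x n) (ennreal d) \<and> c + d \<le> M + \<epsilon> / 2"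
      using x unfolding short_through_def by blast
    then obtain a b c d where abcd: "\<And>n. a n \<in> A" "\<And>n. b n \<in> B" "\<And>n::nat. 0 \<le> c n" "\<And>n. 0 \<le> d n"
      "\<And>n. w_joined Q w (a n) (x n) (ennreal (c n))" "\<And>n. w_joined Q w (b n) (x n) (ennreal (d n))" "\<And>n. c n + d n \<le> M + \<epsilon> / 2"
      unfolding choice_iff by blast
    \<comment> \<open>Fixing the limit \<open>c'\<close> of the first distances makes both bounds uniform along the sequence.\<close>
    have "c n \<in> {0..M + \<epsilon> / 2}" for n using abcd(3,4,7)[of n] by auto
    then obtain c' r where c': "strict_mono (r :: nat \<Rightarrow> nat)" "(c \<circ> r) \<longlonglongrightarrow> c'"
      using compact_Icc[of 0 "M + \<epsilon> / 2"] unfolding compact_eq_seq_compact_metric seq_compact_def by metis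
    have c'0: "0 \<le> c'" using abcd(3) by (intro LIMSEQ_le_const[OF c'(2)]) auto
    have "\<epsilon> / 4 > 0" using \<epsilon> by simp
    from tendstoD[OF c'(2) this] have "eventually (\<lambda>n. dist ((c \<circ> r) n) c' < \<epsilon> / 4) sequentially" .
    then obtain N where N: "\<And>n. n \<ge> N \<Longrightarrow> \<bar>c (r n) - c'\<bar> < \<epsilon> / 4" by (auto simp: eventually_sequentially dist_real_def)
    define s where "s n = r (n + N)" for n
    have sN: "\<bar>c (s n) - c'\<bar> < \<epsilon> / 4" for n using N[of "n + N"] by (simp add: s_def)
    have xs: "(\<lambda>n. x (s n)) \<longlonglongrightarrow> l"
      using LIMSEQ_ignore_initial_segment[OF LIMSEQ_subseq_LIMSEQ[OF l c'(1)], of N] by (simp add: s_def o_def)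
    have d0: "0 \<le> M + 3 * \<epsilon> / 4 - c'" using abcd(4,7)[of "s 0"] sN[of 0] by linarith
    have ca: "w_joined Q w (a (s n)) (x (s n)) (ennreal (c' + \<epsilon> / 4))" for n
      by (rule w_joined_mono[OF abcd(5)]) (use sN[of n] in \<open>intro ennreal_leI, linarith\<close>)
    have db: "w_joined Q w (b (s n)) (x (s n)) (ennreal (M + 3 * \<epsilon> / 4 - c'))" for n
      by (rule w_joined_mono[OF abcd(6)]) (use sN[of n] abcd(7)[of "s n"] in \<open>intro ennreal_leI, linarith\<close>)
    obtain a' where a': "a' \<in> A" "w_joined Q w a' l (ennreal (c' + \<epsilon> / 4))"
      by (rule w_joined_limit[OF Q w w1 e A abcd(1) ca _ xs]) (use c'0 \<epsilon> that in auto)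
    obtain b' where b': "b' \<in> B" "w_joined Q w b' l (ennreal (M + 3 * \<epsilon> / 4 - c'))"
      by (rule w_joined_limit[OF Q w w1 e B abcd(2) db d0 xs]) (use that in auto)
    show ?thesis using a' b' c'0 \<epsilon> d0
      by (intro bexI[of _ a'] bexI[of _ b'] exI[of _ "c' + \<epsilon> / 4"] exI[of _ "M + 3 * \<epsilon> / 4 - c'"] conjI) auto
  qed
  ultimately show "l \<in> short_through Q w A B M" by (simp add: short_through_def)
qed

section \<open>The length distance of the minimizer\<close>

text \<open>The weight \<open>H\<close> controls both \<open>\<rho>\<close> and the convergence of integrals.\<close>

locale minimizer =
  fixes \<phi> :: "real \<times> real \<Rightarrow> 'a::metric_space" and \<psi> :: "'a \<Rightarrow> real \<times> real"
    and \<rho>k :: "nat \<Rightarrow> 'a \<Rightarrow> ennreal" and \<rho> H :: "'a \<Rightarrow> ennreal"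
  assumes hom: "homeomorphism ({0..1} \<times> {0..1}) (quad \<phi>) \<phi> \<psi>" and fin: "hausdorff2 (quad \<phi>) < \<infinity>"
    and adm: "\<And>k. admissible (Gamma1 \<phi>) (\<rho>k k)"
    and \<rho>m: "\<rho> \<in> borel_measurable borel"
    and \<rho>2: "(\<integral>\<^sup>+x\<in>quad \<phi>. \<rho> x ^ 2 \<partial>hausdorff2_measure) < \<infinity>"
    and \<rho>min: "(\<integral>\<^sup>+x\<in>quad \<phi>. \<rho> x ^ 2 \<partial>hausdorff2_measure) = modulus (Gamma1 \<phi>)"
    and H: "lsc H" "\<And>x. 1 \<le> H x" "\<And>x. \<rho> x \<le> H x" and H2: "(\<integral>\<^sup>+x\<in>quad \<phi>. (H x)\<^sup>2 \<partial>hausdorff2_measure) < \<infinity>"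
    and H_good: "\<And>\<gamma>. rect_path (quad \<phi>) \<gamma> \<Longrightarrow> line_integral H \<gamma> 0 1 < \<infinity> \<Longrightarrow> good (quad \<phi>) \<rho>k \<rho> \<gamma>"
begin

abbreviation "Q \<equiv> quad \<phi>"
abbreviation "joined \<equiv> rho_joined Q \<rho>k \<rho>"

lemma \<rho>km: "\<rho>k k \<in> borel_measurable borel"
  using adm[of k] by (simp add: admissible_def)

lemmas joined_refl = rho_joined_refl[where \<rho>k = \<rho>k and \<rho> = \<rho> and Q = Q, OF \<rho>km \<rho>m]
lemmas joined_trans = rho_joined_trans[where \<rho>k = \<rho>k and \<rho> = \<rho> and Q = Q, OF \<rho>km \<rho>m]
lemmas joined_sym = rho_joined_sym[where \<rho>k = \<rho>k and \<rho> = \<rho> and Q = Q, OF \<rho>km \<rho>m]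
lemmas joined_sub = rho_joined_sub[where \<rho>k = \<rho>k and \<rho> = \<rho> and Q = Q, OF \<rho>km \<rho>m]

lemma Q_compact: "compact Q" by (rule quad_homeomorphismD(7)[OF hom])
lemma Q_borel: "Q \<in> sets borel" using compact_imp_closed[OF Q_compact] by simp
lemma Hm: "H \<in> borel_measurable borel" by (rule lsc_measurable[OF H(1)])

lemmas zeta = zeta_continua[OF hom]

lemma zeta_disjoint: "zeta1 \<phi> \<inter> zeta3 \<phi> = {}"
proof -
  have "zeta1 \<phi> \<inter> zeta3 \<phi> = \<phi> ` (({0..1} \<times> {0}) \<inter> ({0..1} \<times> {1}))"
    unfolding zeta1_def zeta3_def by (intro inj_on_image_Int[OF quad_homeomorphismD(8)[OF hom], symmetric]) auto
  then show ?thesis by auto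
qed

lemma good_finite: "good Q \<rho>k \<rho> \<gamma> \<Longrightarrow> line_integral \<rho> \<gamma> 0 1 < \<infinity>"
  by (auto simp: good_def integrals_converge_def)

lemma goodD_rect_path: "good Q \<rho>k \<rho> \<gamma> \<Longrightarrow> rect_path Q \<gamma>"
  by (simp add: good_def)

text \<open>Good paths from \<open>\<zeta>\<^sub>1\<close> to \<open>\<zeta>\<^sub>3\<close> take part in the definition of \<open>u\<close>, and admissibility of the \<open>\<rho>k\<close> passes to the
  limit along them.\<close>

lemma Gamma1I:
  assumes g: "good Q \<rho>k \<rho> \<gamma>" and e: "\<gamma> 0 \<in> zeta1 \<phi>" "\<gamma> 1 \<in> zeta3 \<phi>"
  shows "\<gamma> \<in> Gamma1 \<phi> - Gamma0 \<phi> \<rho>k \<rho>" "1 \<le> line_integral \<rho> \<gamma> 0 1"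
proof -
  have r: "rect_path Q \<gamma>" by (rule goodD_rect_path[OF g])
  have rect: "rectifiable \<gamma>" using rect_pathD(1)[OF r] by (simp add: rectifiable_def rect_on_def)
  have nc: "\<not> \<gamma> constant_on {0..1}"
  proof
    assume "\<gamma> constant_on {0..1}"
    then have "\<gamma> 0 = \<gamma> 1" unfolding constant_on_def by auto
    then show False using e zeta_disjoint by auto
  qed
  have ci: "curve_in Q \<gamma>"
    using nc rect_pathD[OF r] by (auto simp: curve_in_def path_def path_image_def rect_on_def)
  then have G1: "\<gamma> \<in> Gamma1 \<phi>" using e by (simp add: Gamma1_def pathstart_def pathfinish_def)
  moreover have "\<gamma> \<notin> Gamma0 \<phi> \<rho>k \<rho>" using g rect by (auto simp: Gamma0_def good_def)
  ultimately show "\<gamma> \<in> Gamma1 \<phi> - Gamma0 \<phi> \<rho>k \<rho>" by simp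
  have "(\<lambda>k. line_integral (\<rho>k k) \<gamma> 0 1) \<longlonglongrightarrow> line_integral \<rho> \<gamma> 0 1"
    using g by (simp add: good_def integrals_converge_def)
  moreover have "1 \<le> line_integral (\<rho>k k) \<gamma> 0 1" for k
    using adm[of k] G1 rect by (auto simp: admissible_def)
  ultimately show "1 \<le> line_integral \<rho> \<gamma> 0 1" by (intro LIMSEQ_le_const) auto
qed

lemma joined_zeta:
  assumes "joined e e' c" "e \<in> zeta1 \<phi>" "e' \<in> zeta3 \<phi>"
  shows "1 < c"
  using assms Gamma1I(2) unfolding rho_joined_def by (auto intro: le_less_trans)

lemma Gamma1_goodD:
  assumes "\<gamma> \<in> Gamma1 \<phi> - Gamma0 \<phi> \<rho>k \<rho>"
  shows "good Q \<rho>k \<rho> \<gamma>"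
proof -
  have ci: "curve_in Q \<gamma>" using assms by (simp add: Gamma1_def)
  then have n: "rectifiable \<gamma>" "\<And>a b. 0 \<le> a \<Longrightarrow> a < b \<Longrightarrow> b \<le> 1 \<Longrightarrow> integrals_converge \<rho>k \<rho> \<gamma> a b"
    using assms by (auto simp: Gamma0_def)
  have r: "rect_path Q \<gamma>"
    using ci n(1) by (auto simp: rect_path_def rect_on_def curve_in_def path_def path_image_def rectifiable_def)
  show ?thesis
    unfolding good_def
  proof (intro conjI allI impI r)
    fix a b :: real assume ab: "0 \<le> a" "a \<le> b" "b \<le> 1"
    show "integrals_converge \<rho>k \<rho> \<gamma> a b"
    proof (cases "a = b")
      case True
      have "rect_on \<gamma> a b" by (rule rect_on_subinterval[OF rect_pathD(1)[OF r] ab])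
      then show ?thesis using True by (intro integrals_converge_length_zero) (auto simp: curve_length_refl)
    next
      case False
      then show ?thesis using n(2) ab by simp
    qed
  qed
qed

lemma E_uD:
  assumes "x \<in> E_u \<phi> \<rho>k \<rho>"
  obtains e e' where "e \<in> zeta1 \<phi>" "e' \<in> zeta3 \<phi>" "joined e x \<infinity>" "joined x e' \<infinity>"
proof -
  obtain \<gamma> where \<gamma>: "\<gamma> \<in> Gamma1 \<phi> - Gamma0 \<phi> \<rho>k \<rho>" "x \<in> path_image \<gamma>" using assms by (auto simp: E_u_def)
  then obtain t where t: "t \<in> {0..1}" "x = \<gamma> t" by (auto simp: path_image_def)
  have g: "good Q \<rho>k \<rho> \<gamma>" by (rule Gamma1_goodD[OF \<gamma>(1)])
  have f: "line_integral \<rho> \<gamma> a b < \<infinity>" if "0 \<le> a" "a \<le> b" "b \<le> 1" for a b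
    using g that by (simp add: good_def integrals_converge_def)
  have 1: "joined (\<gamma> 0) x \<infinity>" unfolding t(2) using t by (intro joined_sub[OF g] f) auto
  have 2: "joined x (\<gamma> 1) \<infinity>" unfolding t(2) using t by (intro joined_sub[OF g] f) auto
  have "\<gamma> 0 \<in> zeta1 \<phi> \<and> \<gamma> 1 \<in> zeta3 \<phi> \<or> \<gamma> 0 \<in> zeta3 \<phi> \<and> \<gamma> 1 \<in> zeta1 \<phi>"
    using \<gamma>(1) by (auto simp: Gamma1_def pathstart_def pathfinish_def)
  then show ?thesis
  proof
    assume "\<gamma> 0 \<in> zeta1 \<phi> \<and> \<gamma> 1 \<in> zeta3 \<phi>"
    with that[of "\<gamma> 0" "\<gamma> 1"] 1 2 show ?thesis by simp
  next
    assume "\<gamma> 0 \<in> zeta3 \<phi> \<and> \<gamma> 1 \<in> zeta1 \<phi>"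
    with that[of "\<gamma> 1" "\<gamma> 0"] joined_sym[OF 1] joined_sym[OF 2] show ?thesis by simp
  qed
qed

lemma u_inf_lessD:
  assumes "u_inf \<phi> \<rho>k \<rho> x < a"
  obtains e where "e \<in> zeta1 \<phi>" "joined e x a"
proof -
  obtain \<gamma> s t where \<gamma>: "\<gamma> \<in> Gamma1 \<phi> - Gamma0 \<phi> \<rho>k \<rho>" "s \<in> {0..1}" "t \<in> {0..1}" "\<gamma> s \<in> zeta1 \<phi>" "\<gamma> t = x"
    "line_integral \<rho> \<gamma> (min s t) (max s t) < a"
    using assms unfolding u_inf_def Inf_less_iff by blast
  have g: "good Q \<rho>k \<rho> \<gamma>" by (rule Gamma1_goodD[OF \<gamma>(1)])
  have "joined (\<gamma> (min s t)) (\<gamma> (max s t)) a" using \<gamma> by (intro joined_sub[OF g]) auto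
  then have "joined (\<gamma> s) (\<gamma> t) a" by (cases "s \<le> t") (auto intro: joined_sym)
  then show ?thesis using that \<gamma> by simp
qed

text \<open>A good path from \<open>\<zeta>\<^sub>1\<close> to \<open>x\<close> counts for \<open>u\<close> only as part of a curve that continues to \<open>\<zeta>\<^sub>3\<close>, which is why some
  good path from \<open>x\<close> to \<open>\<zeta>\<^sub>3\<close>, of any length, is required.\<close>

lemma u_inf_lessI:
  assumes "joined e x a" "e \<in> zeta1 \<phi>" "joined x e' \<infinity>" "e' \<in> zeta3 \<phi>"
  shows "x \<in> E_u \<phi> \<rho>k \<rho>" "u_inf \<phi> \<rho>k \<rho> x < a"
proof -
  obtain \<gamma> where \<gamma>: "good Q \<rho>k \<rho> \<gamma>" "\<gamma> 0 = e" "\<gamma> 1 = x" "line_integral \<rho> \<gamma> 0 1 < a" using assms(1) unfolding rho_joined_def by blast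
  obtain \<gamma>' where \<gamma>': "good Q \<rho>k \<rho> \<gamma>'" "\<gamma>' 0 = x" "\<gamma>' 1 = e'" using assms(3) unfolding rho_joined_def by blast
  have j: "\<gamma> 1 = \<gamma>' 0" using \<gamma> \<gamma>' by simp
  let ?\<beta> = "\<gamma> +++ \<gamma>'"
  have g: "good Q \<rho>k \<rho> ?\<beta>" by (rule good_join[OF \<gamma>(1) \<gamma>'(1) j \<rho>km \<rho>m])
  have \<beta>: "?\<beta> \<in> Gamma1 \<phi> - Gamma0 \<phi> \<rho>k \<rho>"
    using Gamma1I(1)[OF g] assms(2,4) \<gamma> \<gamma>' by (simp add: joinpaths_0_1)
  have half: "?\<beta> (1/2) = x" using \<gamma>(3) by (simp add: joinpaths_def)
  then have "x \<in> path_image ?\<beta>" unfolding path_image_def by (intro image_eqI[of _ _ "1/2"]) auto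
  moreover have "x \<in> Q" using rect_pathD(2)[OF goodD_rect_path[OF \<gamma>(1)], of 1] \<gamma>(3) by simp
  ultimately show "x \<in> E_u \<phi> \<rho>k \<rho>" using \<beta> by (auto simp: E_u_def)
  have "line_integral \<rho> ?\<beta> (min 0 (1/2)) (max 0 (1/2)) = line_integral \<rho> \<gamma> 0 1"
    using rect_path_join_left(2)[where a = 0 and b = "1/2" and \<gamma>' = \<gamma>' and f = \<rho>, OF goodD_rect_path[OF \<gamma>(1)]] by simp
  then have "u_inf \<phi> \<rho>k \<rho> x \<le> line_integral \<rho> \<gamma> 0 1"
    unfolding u_inf_def using \<beta> half assms(2) \<gamma>(2)
    by (intro Inf_lower CollectI exI[of _ ?\<beta>] exI[of _ 0] exI[of _ "1/2"] conjI) (simp_all add: joinpaths_0_1)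
  then show "u_inf \<phi> \<rho>k \<rho> x < a" using \<gamma>(4) by (rule le_less_trans)
qed

text \<open>Arbitrarily small multiples of \<open>H\<close> suffice to make paths of finite length good. This allows weights
  with energy close to that of \<open>\<rho>\<close>.\<close>

lemma good_if_dominates_H:
  assumes "e > 0" "\<And>x. ennreal e * H x \<le> w x" and r: "rect_path Q \<gamma>" and fin: "line_integral w \<gamma> 0 1 < \<infinity>"
  shows "good Q \<rho>k \<rho> \<gamma>"
proof (rule H_good[OF r])
  have "ennreal e * line_integral H \<gamma> 0 1 = line_integral (\<lambda>x. ennreal e * H x) \<gamma> 0 1"
    by (rule line_integral_cmult[OF rect_pathD(1)[OF r] Hm, symmetric])
  also have "\<dots> \<le> line_integral w \<gamma> 0 1" by (intro line_integral_mono rect_pathD(1)[OF r] assms(2))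
  also note fin
  finally show "line_integral H \<gamma> 0 1 < \<infinity>" using assms(1) by (auto simp: less_top[symmetric] ennreal_mult_eq_top_iff)
qed

lemma joined_if_w_joined:
  assumes "e > 0" "\<And>x. ennreal e * H x \<le> w x" "\<And>x. \<rho> x \<le> w x" "w_joined Q w x y (ennreal c)" "ennreal c < d"
  shows "joined x y d"
proof -
  obtain \<gamma> where \<gamma>: "rect_path Q \<gamma>" "\<gamma> 0 = x" "\<gamma> 1 = y" "line_integral w \<gamma> 0 1 \<le> ennreal c" using assms(4) unfolding w_joined_def by blast
  have "line_integral w \<gamma> 0 1 < \<infinity>" using \<gamma>(4) by (auto intro: le_less_trans)
  then have g: "good Q \<rho>k \<rho> \<gamma>" by (rule good_if_dominates_H[OF assms(1,2) \<gamma>(1)])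
  have "line_integral \<rho> \<gamma> 0 1 \<le> line_integral w \<gamma> 0 1" by (intro line_integral_mono rect_pathD(1)[OF \<gamma>(1)] assms(3))
  also have "\<dots> < d" using \<gamma>(4) assms(5) by (rule le_less_trans)
  finally show ?thesis using g \<gamma> unfolding rho_joined_def by blast
qed

lemma joined_if_w_joined_H: "w_joined Q H x y (ennreal c) \<Longrightarrow> ennreal c < d \<Longrightarrow> joined x y d"
  by (rule joined_if_w_joined[of 1 H]) (use H in auto)

text \<open>A small path of finite \<open>H\<close>-length near \<open>p\<close> is a nondegenerate continuum, so paths of finite \<open>H\<close>-length
  join it to \<open>\<zeta>\<^sub>1\<close> and to \<open>\<zeta>\<^sub>3\<close>. All of these are good.\<close>

lemma E_u_dense:
  assumes p: "p \<in> Q" and R: "R > 0"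
  obtains x where "x \<in> E_u \<phi> \<rho>k \<rho>" "dist x p < R"
proof -
  note HI = integrable_if_square[OF H(2) H2]
  obtain \<beta> where \<beta>: "rect_path Q \<beta>" "\<beta> 0 \<noteq> \<beta> 1" "\<beta> ` {0..1} \<subseteq> ball p R" "line_integral H \<beta> 0 1 < \<infinity>"
    by (rule small_path_near[OF hom fin H(1,2) HI p R]) (rule that)
  define \<alpha> where "\<alpha> = \<beta> ` {0..1}"
  have \<alpha>: "compact \<alpha>" "connected \<alpha>" "\<alpha> \<subseteq> Q" "\<beta> 0 \<in> \<alpha>" "\<beta> 1 \<in> \<alpha>"
    unfolding \<alpha>_def using rect_on_continuum[OF rect_pathD(1)[OF \<beta>(1)]] rect_pathD(2)[OF \<beta>(1)] by auto
  have g: "good Q \<rho>k \<rho> \<beta>" by (rule H_good[OF \<beta>(1,4)])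
  have inner: "joined x y \<infinity>" if xy: "x \<in> \<alpha>" "y \<in> \<alpha>" for x y
  proof -
    obtain s t where st: "s \<in> {0..1}" "t \<in> {0..1}" "x = \<beta> s" "y = \<beta> t" using xy unfolding \<alpha>_def by blast
    have "line_integral \<rho> \<beta> (min s t) (max s t) < \<infinity>" using g st by (simp add: good_def integrals_converge_def)
    then have "joined (\<beta> (min s t)) (\<beta> (max s t)) \<infinity>" using st by (intro joined_sub[OF g]) auto
    then show ?thesis unfolding st(3,4) by (cases "s \<le> t") (auto intro: joined_sym)
  qed
  have H_fin: "joined (\<nu> 0) (\<nu> 1) \<infinity>" if "rect_path Q \<nu>" "line_integral H \<nu> 0 1 < \<infinity>" for \<nu>
    unfolding rho_joined_def using H_good[OF that] good_finite by blast
  obtain \<nu> where \<nu>: "rect_path Q \<nu>" "\<nu> 0 \<in> \<alpha>" "\<nu> 1 \<in> zeta1 \<phi>" "line_integral H \<nu> 0 1 < \<infinity>"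
    by (rule join_to_zeta1[OF hom fin H(1,2) HI \<alpha> \<beta>(2)]) (rule that)
  obtain \<mu> where \<mu>: "rect_path Q \<mu>" "\<mu> 0 \<in> \<alpha>" "\<mu> 1 \<in> zeta3 \<phi>" "line_integral H \<mu> 0 1 < \<infinity>"
    by (rule join_to_zeta3[OF hom fin H(1,2) HI \<alpha> \<beta>(2)]) (rule that)
  have 1: "joined (\<nu> 1) (\<nu> 0) \<infinity>" by (rule joined_sym[OF H_fin[OF \<nu>(1,4)]])
  have 2: "joined (\<nu> 0) (\<mu> 1) (\<infinity> + \<infinity>)" by (rule joined_trans[OF inner[OF \<nu>(2) \<mu>(2)] H_fin[OF \<mu>(1,4)]])
  have "\<nu> 0 \<in> E_u \<phi> \<rho>k \<rho>" using u_inf_lessI(1)[OF 1 \<nu>(3) _ \<mu>(3)] 2 by simp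
  moreover have "dist (\<nu> 0) p < R" using \<nu>(2) \<beta>(3) by (auto simp: \<alpha>_def mem_ball dist_commute)
  ultimately show ?thesis using that by blast
qed

end

section \<open>The maximum principle\<close>

lemma path_first_hit:
  fixes \<gamma> :: "real \<Rightarrow> 'a::metric_space"
  assumes c: "continuous_on {0..1} \<gamma>" and S: "closed S"
  obtains t where "t \<in> {0..1}" "t = 1 \<or> \<gamma> t \<in> S" "\<And>s. s \<in> {0..<t} \<Longrightarrow> \<gamma> s \<notin> S"
proof -
  define T where "T = {t\<in>{0..1}. \<gamma> t \<in> S}"
  show ?thesis
  proof (cases "T = {}")
    case True
    show ?thesis by (rule that[of 1]) (use True in \<open>auto simp: T_def\<close>)
  next
    case False
    have "closed T" unfolding T_def using continuous_closed_preimage[OF c _ S] by (simp add: vimage_def Int_def)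
    moreover have "bounded T" by (rule bounded_subset[of "{0..1}"]) (auto simp: T_def)
    ultimately have "compact T" by (simp add: compact_eq_bounded_closed)
    from compact_attains_inf[OF this False] obtain t where t: "t \<in> T" "\<And>s. s \<in> T \<Longrightarrow> t \<le> s" by blast
    show ?thesis
    proof (rule that[of t])
      fix s assume "s \<in> {0..<t}"
      then show "\<gamma> s \<notin> S" using t(2)[of s] t(1) by (auto simp: T_def)
    qed (use t(1) in \<open>auto simp: T_def\<close>)
  qed
qed

context minimizer
begin

lemma short_throughI:
  assumes r: "rect_path Q \<gamma>" and g: "g \<in> borel_measurable borel" and e: "\<gamma> 0 \<in> A" "\<gamma> 1 \<in> B"
    and I: "line_integral g \<gamma> 0 1 < ennreal M" and t: "t \<in> {0..1}"
  shows "\<gamma> t \<in> short_through Q g A B M"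
proof -
  have add: "line_integral g \<gamma> 0 1 = line_integral g \<gamma> 0 t + line_integral g \<gamma> t 1"
    using t by (intro line_integral_add[OF rect_pathD(1)[OF r] _ _ g]) auto
  have "line_integral g \<gamma> 0 t < \<infinity>" "line_integral g \<gamma> t 1 < \<infinity>"
    using I unfolding add by (auto simp: less_top[symmetric] top_unique)
  then obtain c d where cd: "0 \<le> c" "0 \<le> d" "line_integral g \<gamma> 0 t = ennreal c" "line_integral g \<gamma> t 1 = ennreal d"
    by (auto simp: less_top_ennreal)
  have "ennreal (c + d) < ennreal M" using I unfolding add cd using cd by simp
  then have sum: "c + d < M" using cd by (simp add: ennreal_less_iff del: ennreal_plus)
  have 1: "w_joined Q g (\<gamma> 0) (\<gamma> t) (ennreal c)" using t cd by (intro w_joined_sub[OF r]) auto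
  have "w_joined Q g (\<gamma> t) (\<gamma> 1) (ennreal d)" using t cd by (intro w_joined_sub[OF r]) auto
  then have 2: "w_joined Q g (\<gamma> 1) (\<gamma> t) (ennreal d)" using g by (rule w_joined_sym)
  have "\<gamma> t \<in> Q" using rect_pathD(2)[OF r t] .
  moreover have "c + d \<le> M + \<epsilon>" if "\<epsilon> > 0" for \<epsilon> using sum that by simp
  ultimately show ?thesis unfolding short_through_def using 1 2 cd(1,2) e by blast
qed

text \<open>Where \<open>g\<close> is not needed it is small. Off the curves of \<open>g\<close>-length at most \<open>M > 1\<close> the function \<open>g\<close> may be
  divided by \<open>M\<close> and stays admissible, so the minimality of \<open>\<rho>\<close> bounds the energy saved by the excess of the energy
  of \<open>g\<close> over that of \<open>\<rho>\<close>.\<close>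

lemma integral_off_short_curves:
  assumes g: "lsc g" "\<And>x. \<rho> x \<le> g x" and e: "e > 0" "\<And>x. ennreal e * H x \<le> g x" and M: "M > 1" and d: "d \<ge> 0"
    and I: "(\<integral>\<^sup>+x\<in>Q. (g x)\<^sup>2 \<partial>hausdorff2_measure) \<le> (\<integral>\<^sup>+x\<in>Q. (\<rho> x)\<^sup>2 \<partial>hausdorff2_measure) + ennreal ((1 - 1 / M\<^sup>2) * d)"
  defines "G \<equiv> - short_through Q g (zeta1 \<phi>) (zeta3 \<phi>) M"
  shows "open G" "(\<integral>\<^sup>+x\<in>Q \<inter> G. (g x)\<^sup>2 \<partial>hausdorff2_measure) \<le> ennreal d"
proof -
  have gm: "g \<in> borel_measurable borel" by (rule lsc_measurable[OF g(1)])
  have ge: "ennreal e \<le> g x" for x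
    using mult_left_mono[OF H(2)[of x], of "ennreal e"] e(2)[of x] by (auto intro: order_trans)
  show G: "open G" unfolding G_def open_closed[symmetric]
    using closed_short_through[OF Q_compact g(1) ge e(1) zeta(1,4)] by (simp add: open_Compl)
  have Gb: "G \<in> sets borel" using G by simp
  define \<sigma> where "\<sigma> x = (if x \<in> G then ennreal (1 / M) * g x else g x) * indicator Q x" for x
  note [measurable] = gm Gb Q_borel
  have \<sigma>m: "\<sigma> \<in> borel_measurable borel" unfolding \<sigma>_def by measurable
  have c: "0 < 1 / M" "1 / M < 1" using M by auto
  have cg: "ennreal (1 / M) * g x \<le> g x" for x
  proof -
    have "ennreal (1 / M) * g x \<le> 1 * g x" using c by (intro mult_right_mono) (auto simp: ennreal_le_1)
    then show ?thesis by simp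
  qed
  have adm\<sigma>: "1 \<le> line_integral \<sigma> \<gamma> 0 1" if r: "rect_path Q \<gamma>" and ee: "\<gamma> 0 \<in> zeta1 \<phi>" "\<gamma> 1 \<in> zeta3 \<phi>" for \<gamma>
  proof (cases "\<exists>t\<in>{0..1}. \<gamma> t \<in> G")
    case True
    then obtain t where t: "t \<in> {0..1}" "\<gamma> t \<in> G" by blast
    have "\<not> line_integral g \<gamma> 0 1 < ennreal M"
      using short_throughI[OF r gm ee _ t(1)] t(2) by (auto simp: G_def)
    then have "ennreal (1 / M) * ennreal M \<le> ennreal (1 / M) * line_integral g \<gamma> 0 1" by (intro mult_left_mono) auto
    also have "\<dots> = line_integral (\<lambda>x. ennreal (1 / M) * g x) \<gamma> 0 1"
      by (rule line_integral_cmult[OF rect_pathD(1)[OF r] gm, symmetric])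
    also have "\<dots> \<le> line_integral \<sigma> \<gamma> 0 1"
      by (intro line_integral_mono rect_pathD(1)[OF r]) (use rect_pathD(2)[OF r] cg in \<open>auto simp: \<sigma>_def\<close>)
    finally show ?thesis using M by (simp flip: ennreal_mult')
  next
    case False
    have "line_integral g \<gamma> 0 1 \<le> line_integral \<sigma> \<gamma> 0 1"
      by (intro line_integral_mono rect_pathD(1)[OF r]) (use rect_pathD(2)[OF r] False in \<open>auto simp: \<sigma>_def\<close>)
    moreover have "1 \<le> line_integral g \<gamma> 0 1"
    proof (cases "line_integral g \<gamma> 0 1 = \<infinity>")
      case False
      then have "line_integral g \<gamma> 0 1 < \<infinity>" by (simp add: less_top)
      then have "good Q \<rho>k \<rho> \<gamma>" by (rule good_if_dominates_H[OF e r])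
      then have "1 \<le> line_integral \<rho> \<gamma> 0 1" using ee by (rule Gamma1I(2))
      also have "\<dots> \<le> line_integral g \<gamma> 0 1" by (intro line_integral_mono rect_pathD(1)[OF r] g(2))
      finally show ?thesis .
    qed simp
    ultimately show ?thesis by (rule order_trans[rotated])
  qed
  have "admissible (Gamma1 \<phi>) \<sigma>"
    unfolding admissible_def
  proof (intro conjI ballI impI \<sigma>m)
    fix \<gamma> assume \<gamma>: "\<gamma> \<in> Gamma1 \<phi>" "rectifiable \<gamma>"
    have r: "rect_path Q \<gamma>"
      using \<gamma> by (auto simp: Gamma1_def rect_path_def rect_on_def curve_in_def path_def path_image_def rectifiable_def)
    have "\<gamma> 0 \<in> zeta1 \<phi> \<and> \<gamma> 1 \<in> zeta3 \<phi> \<or> \<gamma> 0 \<in> zeta3 \<phi> \<and> \<gamma> 1 \<in> zeta1 \<phi>"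
      using \<gamma>(1) by (auto simp: Gamma1_def pathstart_def pathfinish_def)
    then show "1 \<le> line_integral \<sigma> \<gamma> 0 1"
    proof
      assume "\<gamma> 0 \<in> zeta1 \<phi> \<and> \<gamma> 1 \<in> zeta3 \<phi>"
      then show ?thesis using adm\<sigma>[OF r] by blast
    next
      assume ee: "\<gamma> 0 \<in> zeta3 \<phi> \<and> \<gamma> 1 \<in> zeta1 \<phi>"
      have "line_integral \<sigma> (\<lambda>t. \<gamma> (1 - t)) 0 1 = line_integral \<sigma> \<gamma> 0 1"
        using line_integral_reverse[OF _ \<sigma>m, of \<gamma> 1 1 0] rect_pathD(1)[OF r] by simp
      then show ?thesis using adm\<sigma>[OF rect_path_reverse[OF r]] ee by simp
    qed
  qed
  then have "modulus (Gamma1 \<phi>) \<le> (\<integral>\<^sup>+x. (\<sigma> x)\<^sup>2 \<partial>hausdorff2_measure)"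
    unfolding modulus_def by (intro INF_lower) simp
  then have le: "(\<integral>\<^sup>+x\<in>Q. (\<rho> x)\<^sup>2 \<partial>hausdorff2_measure) \<le> (\<integral>\<^sup>+x. (\<sigma> x)\<^sup>2 \<partial>hausdorff2_measure)"
    by (simp add: \<rho>min)
  have c2: "ennreal (1 - 1 / M\<^sup>2) + ennreal (1 / M) ^ 2 = 1"
  proof -
    have "1 \<le> M\<^sup>2" using M by (intro one_le_power) simp
    then have "1 / M\<^sup>2 \<le> 1" using M by (subst divide_le_eq_1_pos) auto
    then show ?thesis using c by (simp add: ennreal_power power_divide flip: ennreal_plus)
  qed
  let ?J = "\<integral>\<^sup>+x\<in>Q \<inter> G. (g x)\<^sup>2 \<partial>hausdorff2_measure"
  have "ennreal (1 - 1 / M\<^sup>2) * ?J + (\<integral>\<^sup>+x. (\<sigma> x)\<^sup>2 \<partial>hausdorff2_measure)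
      = (\<integral>\<^sup>+x. ennreal (1 - 1 / M\<^sup>2) * ((g x)\<^sup>2 * indicator (Q \<inter> G) x) + (\<sigma> x)\<^sup>2 \<partial>hausdorff2_measure)"
    using \<sigma>m by (subst nn_integral_add) (auto simp: nn_integral_cmult)
  also have "\<dots> = (\<integral>\<^sup>+x\<in>Q. (g x)\<^sup>2 \<partial>hausdorff2_measure)"
  proof (rule nn_integral_cong)
    fix x
    have "ennreal (1 - 1 / M\<^sup>2) * (g x)\<^sup>2 + (ennreal (1 / M) * g x)\<^sup>2 = (g x)\<^sup>2"
      unfolding power_mult_distrib distrib_right[symmetric] c2 by simp
    then show "ennreal (1 - 1 / M\<^sup>2) * ((g x)\<^sup>2 * indicator (Q \<inter> G) x) + (\<sigma> x)\<^sup>2 = (g x)\<^sup>2 * indicator Q x"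
      by (auto simp: \<sigma>_def split: split_indicator)
  qed
  also note I
  finally have "ennreal (1 - 1 / M\<^sup>2) * ?J + (\<integral>\<^sup>+x. (\<sigma> x)\<^sup>2 \<partial>hausdorff2_measure)
      \<le> ennreal ((1 - 1 / M\<^sup>2) * d) + (\<integral>\<^sup>+x\<in>Q. (\<rho> x)\<^sup>2 \<partial>hausdorff2_measure)"
    by (simp add: add.commute)
  with add_left_mono[OF le] have "ennreal (1 - 1 / M\<^sup>2) * ?J + (\<integral>\<^sup>+x\<in>Q. (\<rho> x)\<^sup>2 \<partial>hausdorff2_measure)
      \<le> ennreal ((1 - 1 / M\<^sup>2) * d) + (\<integral>\<^sup>+x\<in>Q. (\<rho> x)\<^sup>2 \<partial>hausdorff2_measure)"
    by (rule order_trans)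
  then have "ennreal (1 - 1 / M\<^sup>2) * ?J \<le> ennreal ((1 - 1 / M\<^sup>2) * d)"
    using \<rho>2 unfolding add.commute[of "ennreal _ * _"] add.commute[of "ennreal (_ * _)"] ennreal_add_left_cancel_le by auto
  moreover have pos: "1 - 1 / M\<^sup>2 > 0" using M by (simp add: power2_eq_square less_1_mult)
  ultimately have "ennreal (1 / (1 - 1 / M\<^sup>2)) * (ennreal (1 - 1 / M\<^sup>2) * ?J) \<le> ennreal (1 / (1 - 1 / M\<^sup>2)) * ennreal ((1 - 1 / M\<^sup>2) * d)"
    by (intro mult_left_mono) auto
  moreover have "ennreal (1 / (1 - 1 / M\<^sup>2)) * ennreal (1 - 1 / M\<^sup>2) = 1"
    using pos by (subst ennreal_mult'[symmetric]) auto
  moreover have "ennreal (1 / (1 - 1 / M\<^sup>2)) * ennreal ((1 - 1 / M\<^sup>2) * d) = ennreal d"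
    using pos d by (subst ennreal_mult'[symmetric]) auto
  ultimately show "?J \<le> ennreal d" by (simp add: mult.assoc[symmetric])
qed

text \<open>A lower semicontinuous majorant of \<open>max \<rho> (e H)\<close> for a small \<open>e\<close>.\<close>

lemma near_optimal_weight:
  assumes \<eta>: "\<eta> > 0"
  obtains g e where "lsc g" "\<And>x. \<rho> x \<le> g x" "e > 0" "\<And>x. ennreal e * H x \<le> g x"
    "(\<integral>\<^sup>+x\<in>Q. (g x)\<^sup>2 \<partial>hausdorff2_measure) \<le> (\<integral>\<^sup>+x\<in>Q. (\<rho> x)\<^sup>2 \<partial>hausdorff2_measure) + ennreal \<eta>"
proof -
  obtain J where J: "0 \<le> J" "(\<integral>\<^sup>+x\<in>Q. (H x)\<^sup>2 \<partial>hausdorff2_measure) = ennreal J"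
    using H2 by (auto simp: less_top_ennreal)
  define e where "e = sqrt (\<eta> / (2 * (J + 1)))"
  have e: "e > 0" using \<eta> J by (simp add: e_def)
  have "e\<^sup>2 * J \<le> e\<^sup>2 * (J + 1)" by (intro mult_left_mono) auto
  also have "\<dots> = \<eta> / (2 * (J + 1)) * (J + 1)" using \<eta> J(1) by (simp add: e_def)
  also have "\<dots> = \<eta> / 2" using J(1) by (simp add: field_simps)
  finally have eJ: "e\<^sup>2 * J \<le> \<eta> / 2" .
  note [measurable] = \<rho>m Hm Q_borel
  define f where "f x = max (\<rho> x) (ennreal e * H x)" for x
  have fm: "f \<in> borel_measurable borel" unfolding f_def by measurable
  have "(\<integral>\<^sup>+x\<in>Q. (f x)\<^sup>2 \<partial>hausdorff2_measure)
      \<le> (\<integral>\<^sup>+x. (\<rho> x)\<^sup>2 * indicator Q x + ennreal (e\<^sup>2) * ((H x)\<^sup>2 * indicator Q x) \<partial>hausdorff2_measure)"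
  proof (rule nn_integral_mono)
    fix x
    have "(f x)\<^sup>2 \<le> (\<rho> x)\<^sup>2 + (ennreal e * H x)\<^sup>2" by (auto simp: f_def max_def)
    also have "(ennreal e * H x)\<^sup>2 = ennreal (e\<^sup>2) * (H x)\<^sup>2" using e by (simp add: power_mult_distrib ennreal_power)
    finally show "(f x)\<^sup>2 * indicator Q x \<le> (\<rho> x)\<^sup>2 * indicator Q x + ennreal (e\<^sup>2) * ((H x)\<^sup>2 * indicator Q x)"
      by (auto split: split_indicator)
  qed
  also have "\<dots> = (\<integral>\<^sup>+x\<in>Q. (\<rho> x)\<^sup>2 \<partial>hausdorff2_measure) + ennreal (e\<^sup>2) * ennreal J"
    unfolding J(2)[symmetric] by (subst nn_integral_add) (auto simp: nn_integral_cmult)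
  also have "ennreal (e\<^sup>2) * ennreal J = ennreal (e\<^sup>2 * J)" using J(1) by (simp add: ennreal_mult'')
  also have "\<dots> \<le> ennreal (\<eta> / 2)" by (rule ennreal_leI[OF eJ])
  finally have f2: "(\<integral>\<^sup>+x\<in>Q. (f x)\<^sup>2 \<partial>hausdorff2_measure) \<le> (\<integral>\<^sup>+x\<in>Q. (\<rho> x)\<^sup>2 \<partial>hausdorff2_measure) + ennreal (\<eta> / 2)"
    by this (erule add_left_mono)
  then have "(\<integral>\<^sup>+x\<in>Q. (f x)\<^sup>2 \<partial>hausdorff2_measure) < \<infinity>" using \<rho>2 by (auto elim!: le_less_trans simp: less_top)
  then obtain g where g: "lsc g" "\<And>x. f x \<le> g x"
    "(\<integral>\<^sup>+x\<in>Q. (g x)\<^sup>2 \<partial>hausdorff2_measure) \<le> (\<integral>\<^sup>+x\<in>Q. (f x)\<^sup>2 \<partial>hausdorff2_measure) + ennreal (\<eta> / 2)"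
    using lsc_majorant[OF Q_borel fin fm, of "\<eta> / 2"] \<eta> by auto
  have "(\<integral>\<^sup>+x\<in>Q. (g x)\<^sup>2 \<partial>hausdorff2_measure) \<le> (\<integral>\<^sup>+x\<in>Q. (\<rho> x)\<^sup>2 \<partial>hausdorff2_measure) + ennreal (\<eta> / 2) + ennreal (\<eta> / 2)"
    using g(3) add_right_mono[OF f2, of "ennreal (\<eta> / 2)"] by (rule order_trans)
  also have "\<dots> = (\<integral>\<^sup>+x\<in>Q. (\<rho> x)\<^sup>2 \<partial>hausdorff2_measure) + ennreal \<eta>"
    using \<eta> by (simp add: add.assoc flip: ennreal_plus)
  finally show ?thesis using g(2) by (intro that[OF g(1) _ e]) (auto simp: f_def)
qed

text \<open>A maximum principle. If it fails, a small good arc \<open>\<alpha>\<close> at \<open>z\<close> is avoided by all good paths from \<open>\<zeta>\<^sub>1\<close> to \<open>\<zeta>\<^sub>3\<close> of \<open>\<rho>\<close>-length below \<open>1 + 2\<kappa>\<close>. Let the weights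
  \<open>g n\<close> above \<open>\<rho>\<close> have energies that exceed the one of \<open>\<rho>\<close> by \<open>8\<^sup>-\<^sup>n\<close>, up to a constant. Off the
  set \<open>S n\<close> of points on curves of \<open>g n\<close>-length at most \<open>1 + \<kappa>/2\<close> their energies are at most \<open>8\<^sup>-\<^sup>n\<close>, hence the
  supremum of the \<open>2\<^sup>n g n\<close> off \<open>S n\<close> is square integrable, and \<open>\<alpha>\<close> is joined to \<open>\<zeta>\<^sub>1\<close> and \<open>\<zeta>\<^sub>3\<close> by paths along
  which it has a finite integral. For large \<open>n\<close> these paths have tiny \<open>g n\<close>-length as long as they
  stay off \<open>S n\<close>. They cannot enter \<open>S n\<close>, as this would bring a short curve close to \<open>\<alpha>\<close>. So they are short
  altogether and connect \<open>\<zeta>\<^sub>1\<close> to \<open>\<zeta>\<^sub>3\<close> through \<open>\<alpha>\<close> within \<open>4\<kappa> \<le> 1\<close>, which is impossible.\<close>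

lemma joined_to_zeta3_near:
  assumes z: "z \<in> E_u \<phi> \<rho>k \<rho>" and b: "0 \<le> b" and u: "ennreal b < u_inf \<phi> \<rho>k \<rho> z" and R: "R > 0"
  obtains z' e' where "dist z z' < R" "e' \<in> zeta3 \<phi>" "joined z' e' (ennreal (1 - b))"
proof (rule ccontr)
  assume no: "\<not> thesis"
  note near = that
  have none: "\<not> joined z' e' (ennreal (1 - b))" if "dist z z' < R" "e' \<in> zeta3 \<phi>" for z' e'
    using near[OF that] no by blast
  obtain w where "ennreal b < w" "w < u_inf \<phi> \<rho>k \<rho> z" using dense[OF u] by blast
  moreover from this obtain r where r: "0 \<le> r" "w = ennreal r" by (cases w) auto
  ultimately have r: "0 \<le> r" "b < r" "ennreal r < u_inf \<phi> \<rho>k \<rho> z" using b by (auto simp: ennreal_less_iff)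
  define \<kappa> where "\<kappa> = min (1/4) ((r - b) / 3)"
  have \<kappa>: "\<kappa> > 0" "\<kappa> \<le> 1/4" "b + 3 * \<kappa> \<le> r"
  proof -
    have "\<kappa> \<le> (r - b) / 3" unfolding \<kappa>_def by (rule min.cobounded2)
    then show "b + 3 * \<kappa> \<le> r" by simp
  qed (use r in \<open>auto simp: \<kappa>_def\<close>)
  obtain e1 e3 where e13: "e1 \<in> zeta1 \<phi>" "e3 \<in> zeta3 \<phi>" "joined e1 z \<infinity>" "joined z e3 \<infinity>"
    by (rule E_uD[OF z]) (rule that)
  obtain w where w: "joined z w \<infinity>" "w \<noteq> z"
  proof (cases "e3 = z")
    case True
    then have "e1 \<noteq> z" using zeta_disjoint e13 by auto
    then show ?thesis using that[of e1] joined_sym[OF e13(3)] by blast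
  next
    case False
    then show ?thesis using that[of e3] e13(4) by blast
  qed
  obtain \<gamma> where \<gamma>: "good Q \<rho>k \<rho> \<gamma>" "\<gamma> 0 = z" "\<gamma> 1 = w" "line_integral \<rho> \<gamma> 0 1 < \<infinity>" using w(1) unfolding rho_joined_def by blast
  have r\<gamma>: "rect_path Q \<gamma>" by (rule goodD_rect_path[OF \<gamma>(1)])
  have ne: "\<gamma> 0 \<noteq> \<gamma> 1" using \<gamma> w by simp
  have "ennreal \<kappa> > 0" using \<kappa> by simp
  then obtain a a' where aa: "0 \<le> a" "a < a'" "a' \<le> 1" "\<gamma> a = \<gamma> 0" "\<gamma> a' \<noteq> \<gamma> 0" "line_integral \<rho> \<gamma> a a' < ennreal \<kappa>"
      "\<gamma> ` {a..a'} \<subseteq> ball (\<gamma> 0) R"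
    by (rule nonconstant_small_start[OF r\<gamma> ne \<rho>m \<gamma>(4) _ R]) (rule that)
  define \<alpha> where "\<alpha> = \<gamma> ` {a..a'}"
  have raa: "rect_on \<gamma> a a'" by (rule rect_on_subinterval[OF rect_pathD(1)[OF r\<gamma>]]) (use aa in auto)
  have \<alpha>: "compact \<alpha>" "connected \<alpha>" "\<alpha> \<subseteq> Q" "\<gamma> a \<in> \<alpha>" "\<gamma> a' \<in> \<alpha>"
    unfolding \<alpha>_def using rect_pathD(2)[OF r\<gamma>] rect_on_continuum[OF raa] aa(1-3) by auto
  have \<alpha>ne: "\<gamma> a \<noteq> \<gamma> a'" using aa(4,5) by simp
  have z\<alpha>: "joined z x (ennreal \<kappa>)" and \<alpha>R: "dist z x < R" if x: "x \<in> \<alpha>" for x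
  proof -
    obtain t where t: "t \<in> {a..a'}" "x = \<gamma> t" using x unfolding \<alpha>_def by blast
    have "line_integral \<rho> \<gamma> a t \<le> line_integral \<rho> \<gamma> a a'"
      using t aa by (intro line_integral_mono_interval[OF raa _ _ _ \<rho>m]) auto
    also note aa(6)
    finally have "joined (\<gamma> a) (\<gamma> t) (ennreal \<kappa>)" using t aa by (intro joined_sub[OF \<gamma>(1)]) auto
    then show "joined z x (ennreal \<kappa>)" using t aa(4) \<gamma>(2) by simp
    have "x \<in> ball (\<gamma> 0) R" using aa(7) x unfolding \<alpha>_def by (rule subsetD)
    then show "dist z x < R" using \<gamma>(2) by simp
  qed
  \<comment> \<open>Both bounds hold because any point of \<open>\<alpha>\<close> is within \<open>\<kappa>\<close> of \<open>z\<close>, respectively in the ball of radius \<open>R\<close>.\<close>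
  have low1: "b + 2 * \<kappa> < c" if "joined e x (ennreal c)" "e \<in> zeta1 \<phi>" "x \<in> \<alpha>" "c \<ge> 0" for e x c
  proof -
    have "joined e z (ennreal c + ennreal \<kappa>)" by (rule joined_trans[OF that(1) joined_sym[OF z\<alpha>[OF that(3)]]])
    then have "u_inf \<phi> \<rho>k \<rho> z < ennreal c + ennreal \<kappa>" by (rule u_inf_lessI(2)[OF _ that(2) e13(4,2)])
    with r(3) have "ennreal r < ennreal c + ennreal \<kappa>" by (rule less_trans)
    then have "r < c + \<kappa>" using that(4) \<kappa>(1) r(1) by (simp add: ennreal_less_iff flip: ennreal_plus)
    then show ?thesis using \<kappa>(3) by simp
  qed
  have low3: "1 - b < d" if "joined x e (ennreal d)" "e \<in> zeta3 \<phi>" "x \<in> \<alpha>" for e x d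
  proof (rule ccontr)
    assume "\<not> 1 - b < d"
    then have "ennreal d \<le> ennreal (1 - b)" by (intro ennreal_leI) simp
    with that(1) have "joined x e (ennreal (1 - b))" by (rule rho_joined_mono[where \<rho>k = \<rho>k and \<rho> = \<rho>, OF \<rho>km \<rho>m])
    then show False using none[OF \<alpha>R[OF that(3)] that(2)] by blast
  qed
  define M where "M = 1 + \<kappa> / 2"
  define D where "D = 1 - 1 / M\<^sup>2"
  have M: "M > 1" using \<kappa>(1) by (simp add: M_def)
  have D: "D > 0" using M by (simp add: D_def power2_eq_square less_1_mult)
  have "\<forall>n. \<exists>g e. lsc g \<and> (\<forall>x. \<rho> x \<le> g x) \<and> e > 0 \<and> (\<forall>x. ennreal e * H x \<le> g x) \<and>
    (\<integral>\<^sup>+x\<in>Q. (g x)\<^sup>2 \<partial>hausdorff2_measure) \<le> (\<integral>\<^sup>+x\<in>Q. (\<rho> x)\<^sup>2 \<partial>hausdorff2_measure) + ennreal (D * (1/8) ^ n)"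
  proof
    fix n :: nat
    have "D * (1/8) ^ n > 0" using D by simp
    then show "\<exists>g e. lsc g \<and> (\<forall>x. \<rho> x \<le> g x) \<and> e > 0 \<and> (\<forall>x. ennreal e * H x \<le> g x) \<and>
      (\<integral>\<^sup>+x\<in>Q. (g x)\<^sup>2 \<partial>hausdorff2_measure) \<le> (\<integral>\<^sup>+x\<in>Q. (\<rho> x)\<^sup>2 \<partial>hausdorff2_measure) + ennreal (D * (1/8) ^ n)"
      by (rule near_optimal_weight) blast
  qed
  then obtain g e where g: "\<And>n. lsc (g n)" "\<And>n x. \<rho> x \<le> g n x" and e: "\<And>n::nat. e n > 0" "\<And>n x. ennreal (e n) * H x \<le> g n x"
    and g2: "\<And>n. (\<integral>\<^sup>+x\<in>Q. (g n x)\<^sup>2 \<partial>hausdorff2_measure) \<le> (\<integral>\<^sup>+x\<in>Q. (\<rho> x)\<^sup>2 \<partial>hausdorff2_measure) + ennreal (D * (1/8) ^ n)"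
    unfolding choice_iff by blast
  define S where "S n = short_through Q (g n) (zeta1 \<phi>) (zeta3 \<phi>) M" for n
  have d0: "(1/8 :: real) ^ n \<ge> 0" for n by simp
  note off = integral_off_short_curves[OF g(1) g(2) e(1) e(2) M d0 g2[unfolded D_def], folded S_def]
  have gm: "g n \<in> borel_measurable borel" for n by (rule lsc_measurable[OF g(1)])
  define A where "A x = (SUP n. ennreal (2 ^ n) * (g n x * indicator (- S n) x))" for x
  define K where "K x = max (H x) (A x)" for x
  have lA: "lsc A" unfolding A_def by (intro lsc_SUP lsc_cmult lsc_mult_indicator g(1) off(1)) simp
  have lK: "lsc K" unfolding K_def by (rule lsc_max[OF H(1) lA])
  have AK: "ennreal (2 ^ n) * g n x \<le> K x" if "x \<notin> S n" for n x
  proof -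
    have "ennreal (2 ^ n) * g n x = ennreal (2 ^ n) * (g n x * indicator (- S n) x)" using that by simp
    also have "\<dots> \<le> A x" unfolding A_def by (rule SUP_upper) simp
    finally show ?thesis by (simp add: K_def max.coboundedI2)
  qed
  have K1: "1 \<le> K x" for x using H(2)[of x] by (simp add: K_def max.coboundedI1)
  note [measurable] = gm Q_borel Hm lsc_measurable[OF lA] borel_open[OF off(1)]
  have A2: "(\<integral>\<^sup>+x\<in>Q. (A x)\<^sup>2 \<partial>hausdorff2_measure) < \<infinity>"
  proof -
    have "(\<integral>\<^sup>+x. (SUP n. ennreal (2 ^ n) * (g n x * indicator (Q \<inter> - S n) x))\<^sup>2 \<partial>hausdorff2_measure) < \<infinity>"
    proof (rule nn_integral_SUP_square_finite)
      fix n
      show "(\<lambda>x. g n x * indicator (Q \<inter> - S n) x) \<in> borel_measurable hausdorff2_measure" by measurable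
      have "(\<integral>\<^sup>+x. (g n x * indicator (Q \<inter> - S n) x)\<^sup>2 \<partial>hausdorff2_measure) = (\<integral>\<^sup>+x\<in>Q \<inter> - S n. (g n x)\<^sup>2 \<partial>hausdorff2_measure)"
        by (rule nn_integral_cong) (simp split: split_indicator)
      then show "(\<integral>\<^sup>+x. (g n x * indicator (Q \<inter> - S n) x)\<^sup>2 \<partial>hausdorff2_measure) \<le> ennreal ((1/8) ^ n)"
        using off(2)[of n] by simp
    qed
    moreover have le: "(A x)\<^sup>2 * indicator Q x \<le> (SUP n. ennreal (2 ^ n) * (g n x * indicator (Q \<inter> - S n) x))\<^sup>2" for x
      by (simp add: A_def indicator_inter_arith split: split_indicator)
    ultimately show ?thesis by (intro le_less_trans[OF nn_integral_mono[OF le]])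
  qed
  have "(\<integral>\<^sup>+x\<in>Q. (K x)\<^sup>2 \<partial>hausdorff2_measure) \<le> (\<integral>\<^sup>+x. (H x)\<^sup>2 * indicator Q x + (A x)\<^sup>2 * indicator Q x \<partial>hausdorff2_measure)"
    by (intro nn_integral_mono) (auto simp: K_def max_def split: split_indicator)
  also have "\<dots> = (\<integral>\<^sup>+x\<in>Q. (H x)\<^sup>2 \<partial>hausdorff2_measure) + (\<integral>\<^sup>+x\<in>Q. (A x)\<^sup>2 \<partial>hausdorff2_measure)"
    by (rule nn_integral_add) measurable
  also have "\<dots> < \<infinity>" using H2 A2 by (simp add: less_top)
  finally have KI: "(\<integral>\<^sup>+x\<in>Q. K x \<partial>hausdorff2_measure) < \<infinity>" by (rule integrable_if_square[OF K1])
  \<comment> \<open>Follow \<open>\<nu>\<close> until it first enters \<open>S n\<close>. Up to this time its \<open>g n\<close>-length is at most \<open>\<kappa>/8\<close>.\<close>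
  have exit: "joined (\<nu> 0) (\<nu> 1) (ennreal \<kappa>)"
    if \<nu>: "rect_path Q \<nu>" "\<nu> 0 \<in> \<alpha>" "line_integral K \<nu> 0 1 < \<infinity>" for \<nu>
  proof -
    obtain C where C: "0 \<le> C" "line_integral K \<nu> 0 1 = ennreal C" using \<nu>(3) by (auto simp: less_top_ennreal)
    have "\<kappa> / 8 / (C + 1) > 0" using C \<kappa> by simp
    then obtain n where n: "(1/2) ^ n < \<kappa> / 8 / (C + 1)" using real_arch_pow_inv[of "\<kappa> / 8 / (C + 1)" "1/2"] by auto
    then have n: "C / 2 ^ n < \<kappa> / 8"
    proof -
      have "C + 1 > 0" using C(1) by simp
      then have "(1/2) ^ n * (C + 1) < \<kappa> / 8" using n by (simp only: pos_less_divide_eq)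
      moreover have "(1/2) ^ n * C \<le> (1/2) ^ n * (C + 1)" by (intro mult_left_mono) auto
      ultimately have "(1/2) ^ n * C < \<kappa> / 8" by linarith
      then show ?thesis by (simp add: power_divide)
    qed
    have c\<nu>: "continuous_on {0..1} \<nu>" using rect_pathD(1)[OF \<nu>(1)] by (simp add: rect_on_def)
    have "closed (S n)" using off(1)[of n] by (simp add: open_closed)
    then obtain t where t: "t \<in> {0..1}" "t = 1 \<or> \<nu> t \<in> S n" "\<And>s. s \<in> {0..<t} \<Longrightarrow> \<nu> s \<notin> S n"
      by (rule path_first_hit[OF c\<nu>]) (rule that)
    have rt: "rect_on \<nu> 0 t" by (rule rect_on_subinterval[OF rect_pathD(1)[OF \<nu>(1)]]) (use t in auto)
    have "ennreal (2 ^ n) * line_integral (g n) \<nu> 0 t = line_integral (\<lambda>x. ennreal (2 ^ n) * g n x) \<nu> 0 t"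
      by (rule line_integral_cmult[OF rt gm, symmetric])
    also have "\<dots> = line_integral (\<lambda>x. ennreal (2 ^ n) * (g n x * indicator (- S n) x)) \<nu> 0 t"
      using t(3) by (intro line_integral_cong_except_end[OF rt]) simp
    also have "\<dots> \<le> line_integral K \<nu> 0 t"
      using AK by (intro line_integral_mono[OF rt]) (simp split: split_indicator)
    also have "\<dots> \<le> line_integral K \<nu> 0 1"
      using t by (intro line_integral_mono_interval[OF rect_pathD(1)[OF \<nu>(1)] _ _ _ lsc_measurable[OF lK]]) auto
    finally have "ennreal (1 / 2 ^ n) * (ennreal (2 ^ n) * line_integral (g n) \<nu> 0 t) \<le> ennreal (1 / 2 ^ n) * ennreal C"
      unfolding C(2) by (rule mult_left_mono) simp
    moreover have "ennreal (1 / 2 ^ n) * ennreal (2 ^ n) = 1" by (subst ennreal_mult'[symmetric]) auto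
    moreover have "ennreal (1 / 2 ^ n) * ennreal C = ennreal (C / 2 ^ n)" by (subst ennreal_mult'[symmetric]) auto
    ultimately have "line_integral (g n) \<nu> 0 t \<le> ennreal (C / 2 ^ n)" by (simp add: mult.assoc[symmetric])
    also have "\<dots> \<le> ennreal (\<kappa> / 8)" using n by (intro ennreal_leI) simp
    finally have \<nu>t: "w_joined Q (g n) (\<nu> 0) (\<nu> t) (ennreal (\<kappa> / 8))" using t(1) by (intro w_joined_sub[OF \<nu>(1)]) auto
    note J = joined_if_w_joined[OF e(1)[of n] e(2)[of n] g(2)[of _ n]]
    show ?thesis
    proof (cases "t = 1")
      case True
      have "ennreal (\<kappa> / 8) < ennreal \<kappa>" using \<kappa> by (intro ennreal_lessI) auto
      then show ?thesis using J[OF \<nu>t] True by simp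
    next
      case False
      then have "\<nu> t \<in> S n" using t(2) by simp
      moreover have "\<kappa> / 8 > 0" using \<kappa> by simp
      ultimately obtain a1 a3 c d where acd: "a1 \<in> zeta1 \<phi>" "a3 \<in> zeta3 \<phi>" "0 \<le> c" "0 \<le> d"
        "w_joined Q (g n) a1 (\<nu> t) (ennreal c)" "w_joined Q (g n) a3 (\<nu> t) (ennreal d)" "c + d \<le> M + \<kappa> / 8"
        unfolding S_def short_through_def by blast
      have "w_joined Q (g n) a1 (\<nu> 0) (ennreal (c + \<kappa> / 8))"
        using w_joined_trans[OF acd(5) w_joined_sym[OF \<nu>t gm] gm] acd(3) \<kappa> by simp
      then have "joined a1 (\<nu> 0) (ennreal (c + \<kappa> / 4))"
        by (rule J) (use acd(3) \<kappa> in \<open>intro ennreal_lessI; simp\<close>)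
      then have 1: "b + 2 * \<kappa> < c + \<kappa> / 4" by (rule low1[OF _ acd(1) \<nu>(2)]) (use acd(3) \<kappa> in simp)
      have "w_joined Q (g n) (\<nu> 0) a3 (ennreal (\<kappa> / 8 + d))"
        using w_joined_trans[OF \<nu>t w_joined_sym[OF acd(6) gm] gm] acd(4) \<kappa> by simp
      then have "joined (\<nu> 0) a3 (ennreal (\<kappa> / 4 + d))"
        by (rule J) (use acd(4) \<kappa> in \<open>intro ennreal_lessI; simp\<close>)
      then have 2: "1 - b < \<kappa> / 4 + d" by (rule low3[OF _ acd(2) \<nu>(2)])
      show ?thesis using 1 2 acd(7) \<kappa>(1) unfolding M_def by argo
    qed
  qed
  obtain \<nu> where \<nu>: "rect_path Q \<nu>" "\<nu> 0 \<in> \<alpha>" "\<nu> 1 \<in> zeta1 \<phi>" "line_integral K \<nu> 0 1 < \<infinity>"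
    by (rule join_to_zeta1[OF hom fin lK K1 KI \<alpha> \<alpha>ne]) (rule that)
  obtain \<mu> where \<mu>: "rect_path Q \<mu>" "\<mu> 0 \<in> \<alpha>" "\<mu> 1 \<in> zeta3 \<phi>" "line_integral K \<mu> 0 1 < \<infinity>"
    by (rule join_to_zeta3[OF hom fin lK K1 KI \<alpha> \<alpha>ne]) (rule that)
  have 1: "joined (\<nu> 1) z (ennreal \<kappa> + ennreal \<kappa>)"
    by (rule joined_trans[OF joined_sym[OF exit[OF \<nu>(1,2,4)]] joined_sym[OF z\<alpha>[OF \<nu>(2)]]])
  have 2: "joined z (\<mu> 1) (ennreal \<kappa> + ennreal \<kappa>)"
    by (rule joined_trans[OF z\<alpha>[OF \<mu>(2)] exit[OF \<mu>(1,2,4)]])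
  have "1 < (ennreal \<kappa> + ennreal \<kappa>) + (ennreal \<kappa> + ennreal \<kappa>)"
    by (rule joined_zeta[OF joined_trans[OF 1 2] \<nu>(3) \<mu>(3)])
  then have "1 < 4 * \<kappa>" using \<kappa>(1) by (simp flip: ennreal_plus)
  then show False using \<kappa>(2) by simp
qed

end

section \<open>Continuity\<close>

lemma LIMSEQ_if_dist_less:
  assumes y: "y \<longlonglongrightarrow> p" and z: "\<And>n. dist (y n) (z n) < 1 / real (Suc n)"
  shows "z \<longlonglongrightarrow> (p :: 'a::metric_space)"
proof (rule metric_tendsto_imp_tendsto)
  have "(\<lambda>n. 1 / real (Suc n)) \<longlonglongrightarrow> 0" by (rule LIMSEQ_Suc[OF lim_1_over_n])
  with y[unfolded tendsto_dist_iff[of y p]] show "(\<lambda>n. dist (y n) p + 1 / real (Suc n)) \<longlonglongrightarrow> 0" by (rule tendsto_add_zero)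
  show "eventually (\<lambda>n. dist (z n) p \<le> dist (dist (y n) p + 1 / real (Suc n)) 0) sequentially"
  proof (rule always_eventually, rule allI)
    fix n
    have "dist (z n) p \<le> dist (y n) p + 1 / real (Suc n)"
      using dist_triangle3[of "z n" p "y n"] z[of n] by linarith
    then show "dist (z n) p \<le> dist (dist (y n) p + 1 / real (Suc n)) 0" by (simp add: dist_real_def)
  qed
qed

context minimizer
begin

lemma joined_point_of_path:
  assumes g: "good Q \<rho>k \<rho> \<gamma>" and I: "line_integral \<rho> \<gamma> 0 1 < c" and t: "t \<in> {0..1}"
  shows "joined (\<gamma> 0) (\<gamma> t) c" "joined (\<gamma> t) (\<gamma> 1) c"
proof -
  note m = line_integral_mono_interval[OF rect_pathD(1)[OF goodD_rect_path[OF g]] _ _ _ \<rho>m]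
  show "joined (\<gamma> 0) (\<gamma> t) c" using t by (intro joined_sub[OF g] le_less_trans[OF m I]) auto
  show "joined (\<gamma> t) (\<gamma> 1) c" using t by (intro joined_sub[OF g] le_less_trans[OF m I]) auto
qed

lemma joined_if_line_integral_H:
  assumes r: "rect_path Q \<gamma>" and I: "line_integral H \<gamma> 0 1 < ennreal c"
  shows "joined (\<gamma> 0) (\<gamma> 1) (ennreal c)"
proof -
  have "line_integral H \<gamma> 0 1 < \<infinity>" using I by (rule less_trans) simp
  then have "good Q \<rho>k \<rho> \<gamma>" by (rule H_good[OF r])
  moreover have "line_integral \<rho> \<gamma> 0 1 < ennreal c"
    using line_integral_mono[OF rect_pathD(1)[OF r] H(3)] I by (rule le_less_trans)
  ultimately show ?thesis unfolding rho_joined_def by blast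
qed

text \<open>The two families of continua and the passage through \<open>p\<close> are described at the beginning of the theory.
  For \<open>b \<ge> 1\<close> the maximum principle would give a path of length below \<open>0\<close>; this case shows that \<open>u \<le> 1\<close> on \<open>E\<^sub>u\<close>.\<close>

lemma no_oscillation:
  assumes p: "p \<in> Q" and y: "\<And>n. y n \<in> E_u \<phi> \<rho>k \<rho>" "y \<longlonglongrightarrow> p" "\<And>n. u_inf \<phi> \<rho>k \<rho> (y n) < ennreal a"
    and z: "\<And>n. z n \<in> E_u \<phi> \<rho>k \<rho>" "z \<longlonglongrightarrow> p" "\<And>n. ennreal b < u_inf \<phi> \<rho>k \<rho> (z n)" and ab: "0 \<le> a" "a < b"
  shows False
proof (cases "1 \<le> b")
  case True
  then have "ennreal 1 \<le> ennreal b" by (rule ennreal_leI)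
  then have u: "ennreal 1 < u_inf \<phi> \<rho>k \<rho> (z 0)" using z(3) by (rule le_less_trans)
  have "(0::real) \<le> 1" "(0::real) < 1" by auto
  then obtain z' e' where "joined z' e' (ennreal (1 - 1))"
    by (rule joined_to_zeta3_near[OF z(1)[of 0] _ u]) (rule that)
  then show False by (simp add: rho_joined_def)
next
  case False
  have "\<forall>n. \<exists>\<nu>. good Q \<rho>k \<rho> \<nu> \<and> dist (z n) (\<nu> 0) < 1 / real (Suc n) \<and> \<nu> 1 \<in> zeta3 \<phi> \<and> line_integral \<rho> \<nu> 0 1 < ennreal (1 - b)"
  proof
    fix n
    have "0 \<le> b" "1 / real (Suc n) > 0" using ab by auto
    then obtain z' e' where "dist (z n) z' < 1 / real (Suc n)" "e' \<in> zeta3 \<phi>" "joined z' e' (ennreal (1 - b))"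
      by (rule joined_to_zeta3_near[OF z(1) _ z(3)]) (rule that)
    then show "\<exists>\<nu>. good Q \<rho>k \<rho> \<nu> \<and> dist (z n) (\<nu> 0) < 1 / real (Suc n) \<and> \<nu> 1 \<in> zeta3 \<phi> \<and> line_integral \<rho> \<nu> 0 1 < ennreal (1 - b)"
      unfolding rho_joined_def by blast
  qed
  from choice[OF this] obtain \<nu> where \<nu>: "\<And>n. good Q \<rho>k \<rho> (\<nu> n)" "\<And>n. dist (z n) (\<nu> n 0) < 1 / real (Suc n)"
    "\<And>n. \<nu> n 1 \<in> zeta3 \<phi>" "\<And>n. line_integral \<rho> (\<nu> n) 0 1 < ennreal (1 - b)" by blast
  have "\<forall>n. \<exists>\<mu>. good Q \<rho>k \<rho> \<mu> \<and> \<mu> 0 \<in> zeta1 \<phi> \<and> \<mu> 1 = y n \<and> line_integral \<rho> \<mu> 0 1 < ennreal a"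
  proof
    fix n
    obtain e where "e \<in> zeta1 \<phi>" "joined e (y n) (ennreal a)" by (rule u_inf_lessD[OF y(3)[of n]]) (rule that)
    then show "\<exists>\<mu>. good Q \<rho>k \<rho> \<mu> \<and> \<mu> 0 \<in> zeta1 \<phi> \<and> \<mu> 1 = y n \<and> line_integral \<rho> \<mu> 0 1 < ennreal a"
      unfolding rho_joined_def by blast
  qed
  from choice[OF this] obtain \<mu> where \<mu>: "\<And>n. good Q \<rho>k \<rho> (\<mu> n)" "\<And>n. \<mu> n 0 \<in> zeta1 \<phi>"
    "\<And>n. \<mu> n 1 = y n" "\<And>n. line_integral \<rho> (\<mu> n) 0 1 < ennreal a" by blast
  have cont: "compact (\<gamma> ` {0..1})" "connected (\<gamma> ` {0..1})" "\<gamma> ` {0..1} \<subseteq> Q" if "good Q \<rho>k \<rho> \<gamma>" for \<gamma>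
    using rect_on_continuum[OF rect_pathD(1)[OF goodD_rect_path[OF that]]] rect_pathD(2)[OF goodD_rect_path[OF that]] by auto
  have "0 < ennreal a" using y(3)[of 0] by (rule le_less_trans[rotated]) simp
  then have a0: "a > 0" by simp
  define Y where "Y n = \<mu> n ` {0..1} \<union> zeta1 \<phi>" for n
  define Z where "Z n = \<nu> n ` {0..1} \<union> zeta3 \<phi>" for n
  have cY: "compact (Y n)" "Y n \<subseteq> Q" for n
    unfolding Y_def using cont[OF \<mu>(1)] zeta(1,3) by (auto intro: compact_Un)
  have cZ: "compact (Z n)" "Z n \<subseteq> Q" for n
    unfolding Z_def using cont[OF \<nu>(1)] zeta(4,6) by (auto intro: compact_Un)
  have coY: "connected (Y n)" for n
    unfolding Y_def
  proof (rule connected_Un[OF cont(2)[OF \<mu>(1)] zeta(2)])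
    have "\<mu> n 0 \<in> \<mu> n ` {0..1}" by (rule imageI) simp
    then show "\<mu> n ` {0..1} \<inter> zeta1 \<phi> \<noteq> {}" using \<mu>(2)[of n] by blast
  qed
  have coZ: "connected (Z n)" for n
    unfolding Z_def
  proof (rule connected_Un[OF cont(2)[OF \<nu>(1)] zeta(5)])
    have "\<nu> n 1 \<in> \<nu> n ` {0..1}" by (rule imageI) simp
    then show "\<nu> n ` {0..1} \<inter> zeta3 \<phi> \<noteq> {}" using \<nu>(3)[of n] by blast
  qed
  have jY: "\<exists>e\<in>zeta1 \<phi>. joined e x (ennreal a)" if "x \<in> Y n" for x n
  proof (cases "x \<in> zeta1 \<phi>")
    case True
    then show ?thesis using joined_refl[of x "ennreal a"] zeta(3) a0 by (intro bexI[of _ x]) auto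
  next
    case False
    then obtain t where "t \<in> {0..1}" "x = \<mu> n t" using \<open>x \<in> Y n\<close> unfolding Y_def by blast
    then show ?thesis using joined_point_of_path(1)[OF \<mu>(1,4)] \<mu>(2) by blast
  qed
  have jZ: "\<exists>e\<in>zeta3 \<phi>. joined x e (ennreal (1 - b))" if "x \<in> Z n" for x n
  proof (cases "x \<in> zeta3 \<phi>")
    case True
    then show ?thesis using joined_refl[of x "ennreal (1 - b)"] zeta(6) False by (intro bexI[of _ x]) auto
  next
    case False
    then obtain t where "t \<in> {0..1}" "x = \<nu> n t" using \<open>x \<in> Z n\<close> unfolding Z_def by blast
    then show ?thesis using joined_point_of_path(2)[OF \<nu>(1,4)] \<nu>(3) by blast
  qed
  have apart: False if xy: "x \<in> Y n" "x' \<in> Z m" "joined x x' (ennreal (b - a))" for x x' n m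
  proof -
    obtain e e' where e: "e \<in> zeta1 \<phi>" "joined e x (ennreal a)" "e' \<in> zeta3 \<phi>" "joined x' e' (ennreal (1 - b))"
      using jY[OF xy(1)] jZ[OF xy(2)] by blast
    have "1 < (ennreal a + ennreal (b - a)) + ennreal (1 - b)"
      by (rule joined_zeta[OF joined_trans[OF joined_trans[OF e(2) xy(3)] e(4)] e(1,3)])
    also have "\<dots> = 1" using False ab by (simp flip: ennreal_plus)
    finally show False by simp
  qed
  have far: "ennreal (b - a) \<le> line_integral H \<gamma> 0 1" if "rect_path Q \<gamma>" "\<gamma> 0 \<in> Y n" "\<gamma> 1 \<in> Z n" for n \<gamma>
  proof (rule ccontr)
    assume "\<not> ennreal (b - a) \<le> line_integral H \<gamma> 0 1"
    then have "joined (\<gamma> 0) (\<gamma> 1) (ennreal (b - a))" by (intro joined_if_line_integral_H[OF that(1)]) simp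
    then show False by (rule apart[OF that(2,3)])
  qed
  have far': "ennreal (b - a) \<le> line_integral H \<gamma> 0 1" if "rect_path Q \<gamma>" "\<gamma> 0 \<in> Z n" "\<gamma> 1 \<in> Y n" for n \<gamma>
  proof (rule ccontr)
    assume "\<not> ennreal (b - a) \<le> line_integral H \<gamma> 0 1"
    then have "joined (\<gamma> 0) (\<gamma> 1) (ennreal (b - a))" by (intro joined_if_line_integral_H[OF that(1)]) simp
    then show False by (rule apart[OF that(3,2) joined_sym])
  qed
  note hD = quad_homeomorphismD[OF hom]
  \<comment> \<open>The abscissa of a vertical side that does not contain \<open>p\<close>.\<close>
  define c :: real where "c = (if fst (\<psi> p) = 0 then 1 else 0)"
  have c01: "c \<in> {0..1}" by (simp add: c_def)
  define S where "S = \<phi> ` ({c} \<times> {0..1})"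
  have cS: "compact S" "connected S" "S \<subseteq> Q"
    unfolding S_def by (intro quad_image_continuum[OF hom] compact_Times connected_Times; use c01 in auto)+
  have pS: "p \<notin> S"
  proof
    assume "p \<in> S"
    then obtain s where s: "s \<in> {0..1}" "p = \<phi> (c, s)" unfolding S_def by auto
    then have "\<psi> p = (c, s)" using hD(5)[of "(c, s)"] c01 by simp
    then show False by (auto simp: c_def split: if_splits)
  qed
  have SY: "S \<inter> Y n \<noteq> {}" for n
  proof -
    have "\<phi> (c, 0) \<in> S" "\<phi> (c, 0) \<in> zeta1 \<phi>" unfolding S_def zeta1_def using c01 by auto
    then show ?thesis unfolding Y_def by blast
  qed
  have SZ: "S \<inter> Z n \<noteq> {}" for n
  proof -
    have "\<phi> (c, 1) \<in> S" "\<phi> (c, 1) \<in> zeta3 \<phi>" unfolding S_def zeta3_def using c01 by auto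
    then show ?thesis unfolding Z_def by blast
  qed
  have yY: "y n \<in> Y n" for n
  proof -
    have "\<mu> n 1 \<in> \<mu> n ` {0..1}" by (rule imageI) simp
    then show ?thesis unfolding Y_def \<mu>(3) by blast
  qed
  have zZ: "\<nu> n 0 \<in> Z n" for n
  proof -
    have "\<nu> n 0 \<in> \<nu> n ` {0..1}" by (rule imageI) simp
    then show ?thesis unfolding Z_def by blast
  qed
  have \<nu>p: "(\<lambda>n. \<nu> n 0) \<longlonglongrightarrow> p" by (rule LIMSEQ_if_dist_less[OF z(2) \<nu>(2)])
  have \<delta>: "b - a > 0" "(b - a) / 4 > 0" using ab by auto
  obtain n x where x: "x \<in> Y n" "w_joined Q H x p (ennreal ((b - a) / 4))"
    by (rule limit_point_near_continua[OF hom fin H(1,2) H2 cY(1) coY cY(2) cZ(1) coZ cZ(2) yY zZ y(2) \<nu>p p cS SY SZ pS \<delta>(1) _ \<delta>(2)]) (erule (2) far, rule that)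
  obtain m x' where x': "x' \<in> Z m" "w_joined Q H x' p (ennreal ((b - a) / 4))"
    by (rule limit_point_near_continua[OF hom fin H(1,2) H2 cZ(1) coZ cZ(2) cY(1) coY cY(2) zZ yY \<nu>p y(2) p cS SZ SY pS \<delta>(1) _ \<delta>(2)]) (erule (2) far', rule that)
  have lt: "ennreal ((b - a) / 4) < ennreal ((b - a) / 2)" using ab by (intro ennreal_lessI) auto
  have "joined x x' (ennreal ((b - a) / 2) + ennreal ((b - a) / 2))"
    by (rule joined_trans[OF joined_if_w_joined_H[OF x(2) lt] joined_sym[OF joined_if_w_joined_H[OF x'(2) lt]]])
  moreover have "ennreal ((b - a) / 2) + ennreal ((b - a) / 2) = ennreal (b - a)" using ab by (simp flip: ennreal_plus)
  ultimately show False using apart[OF x(1) x'(1)] by simp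
qed

end

text \<open>Absence of oscillation on \<open>E\<close> means that near \<open>p\<close> either all values on \<open>E\<close> are at least \<open>a\<close> or all are at
  most \<open>b\<close>. Such bounds pass to lower limits in both directions because \<open>E\<close> is dense.\<close>

lemma continuous_on_Liminf_extension:
  fixes g :: "'a::metric_space \<Rightarrow> ennreal"
  assumes dense: "\<And>p r. p \<in> Q \<Longrightarrow> r > 0 \<Longrightarrow> \<exists>x\<in>E. dist x p < r"
    and osc: "\<And>p a b y z. p \<in> Q \<Longrightarrow> 0 \<le> a \<Longrightarrow> a < b \<Longrightarrow> \<forall>n. y n \<in> E \<Longrightarrow> y \<longlonglongrightarrow> p \<Longrightarrow> \<forall>n. g (y n) < ennreal a
      \<Longrightarrow> \<forall>n. z n \<in> E \<Longrightarrow> z \<longlonglongrightarrow> p \<Longrightarrow> \<forall>n. ennreal b < g (z n) \<Longrightarrow> False"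
  shows "continuous_on Q (\<lambda>x. if x \<in> E then g x else Liminf (at x within E) g)"
proof -
  define f where "f x = (if x \<in> E then g x else Liminf (at x within E) g)" for x
  have ev: "eventually (\<lambda>y. y \<in> E \<and> dist y x < r) (at x within E)" if "r > 0" for x and r :: real
    using that unfolding eventually_at by blast
  have nb: "at x within E \<noteq> bot" if x: "x \<in> Q" "x \<notin> E" for x
  proof -
    have "x islimpt E" unfolding islimpt_approachable
    proof (intro allI impI)
      fix e :: real assume "e > 0"
      with dense[OF x(1)] obtain y where "y \<in> E" "dist y x < e" by blast
      then show "\<exists>x'\<in>E. x' \<noteq> x \<and> dist x' x < e" using x(2) by (intro bexI[of _ y]) auto
    qed
    then show ?thesis by (simp add: trivial_limit_within)
  qed
  have le: "f x \<le> c" if x: "x \<in> Q" "r > 0" "\<And>y. y \<in> E \<Longrightarrow> dist y x < r \<Longrightarrow> g y \<le> c" for x r c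
  proof (cases "x \<in> E")
    case True
    then show ?thesis using x(2,3) by (simp add: f_def)
  next
    case False
    have "eventually (\<lambda>y. g y \<le> c) (at x within E)" using ev[OF x(2)] by eventually_elim (use x(3) in blast)
    then have "Limsup (at x within E) g \<le> c" by (rule Limsup_bounded)
    then show ?thesis using Liminf_le_Limsup[OF nb[OF x(1) False], of g] False by (simp add: f_def)
  qed
  have ge: "c \<le> f x" if x: "x \<in> Q" "r > 0" "\<And>y. y \<in> E \<Longrightarrow> dist y x < r \<Longrightarrow> c \<le> g y" for x r c
  proof (cases "x \<in> E")
    case True
    then show ?thesis using x(2,3) by (simp add: f_def)
  next
    case False
    have "eventually (\<lambda>y. c \<le> g y) (at x within E)" using ev[OF x(2)] by eventually_elim (use x(3) in blast)
    then show ?thesis using False by (simp add: f_def Liminf_bounded)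
  qed
  have seq: "\<exists>y. (\<forall>n. y n \<in> E \<and> P (y n)) \<and> y \<longlonglongrightarrow> p" if "\<And>r. r > 0 \<Longrightarrow> \<exists>y\<in>E. dist y p < r \<and> P y" for p P
  proof -
    have "\<forall>n. \<exists>y. y \<in> E \<and> dist y p < 1 / real (Suc n) \<and> P y"
    proof
      fix n :: nat
      have "1 / real (Suc n) > 0" by simp
      from that[OF this] show "\<exists>y. y \<in> E \<and> dist y p < 1 / real (Suc n) \<and> P y" by blast
    qed
    from choice[OF this] obtain y where y: "\<And>n. y n \<in> E" "\<And>n. dist (y n) p < 1 / real (Suc n)" "\<And>n. P (y n)" by blast
    have "y \<longlonglongrightarrow> p" by (rule LIMSEQ_if_dist_less[OF tendsto_const]) (use y(2) in \<open>simp add: dist_commute\<close>)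
    then show ?thesis using y by blast
  qed
  have alt: "(\<exists>r>0. \<forall>y\<in>E. dist y p < r \<longrightarrow> ennreal a \<le> g y) \<or> (\<exists>r>0. \<forall>y\<in>E. dist y p < r \<longrightarrow> g y \<le> ennreal b)"
    if p: "p \<in> Q" and ab: "0 \<le> a" "a < b" for p a b
  proof (rule ccontr)
    assume *: "\<not> ?thesis"
    then have 1: "\<exists>y\<in>E. dist y p < r \<and> g y < ennreal a" if "r > 0" for r :: real using that by (auto simp: not_le)
    from * have 2: "\<exists>y\<in>E. dist y p < r \<and> ennreal b < g y" if "r > 0" for r :: real using that by (auto simp: not_le)
    obtain y where y: "\<forall>n. y n \<in> E \<and> g (y n) < ennreal a" "y \<longlonglongrightarrow> p" using seq[OF 1] by blast
    obtain z where z: "\<forall>n. z n \<in> E \<and> ennreal b < g (z n)" "z \<longlonglongrightarrow> p" using seq[OF 2] by blast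
    show False by (rule osc[OF p ab, of y z]) (use y z in auto)
  qed
  have dn: "\<exists>a b. 0 \<le> a \<and> a < b \<and> u < ennreal a \<and> ennreal b < v" if uv: "u < v" for u v :: ennreal
  proof -
    obtain w where w: "u < w" "w < v" using Orderings.dense[OF uv] by blast
    obtain w' where w': "w < w'" "w' < v" using Orderings.dense[OF w(2)] by blast
    obtain a where a: "0 \<le> a" "w = ennreal a" using w by (cases w) auto
    obtain b where b: "0 \<le> b" "w' = ennreal b" using w' by (cases w') auto
    have "a < b" using w' a b by (simp add: ennreal_less_iff)
    then show ?thesis using a b w w' by blast
  qed
  have "continuous_on Q f"
    unfolding continuous_on_def
  proof (intro ballI order_tendstoI)
    fix p c assume p: "p \<in> Q" and c: "c < f p"
    obtain a b where ab: "0 \<le> a" "a < b" "c < ennreal a" "ennreal b < f p" using dn[OF c] by blast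
    have "\<not> (\<exists>r>0. \<forall>y\<in>E. dist y p < r \<longrightarrow> g y \<le> ennreal b)"
    proof
      assume "\<exists>r>0. \<forall>y\<in>E. dist y p < r \<longrightarrow> g y \<le> ennreal b"
      then have "f p \<le> ennreal b" using le[OF p] by blast
      then show False using ab(4) by simp
    qed
    then obtain r where r: "r > 0" "\<And>y. y \<in> E \<Longrightarrow> dist y p < r \<Longrightarrow> ennreal a \<le> g y" using alt[OF p ab(1,2)] by blast
    have "c < f x" if x: "x \<in> Q" "dist x p < r" for x
    proof -
      have "ennreal a \<le> g y" if "y \<in> E" "dist y x < r - dist x p" for y
        using r(2)[OF that(1)] that(2) dist_triangle[of y p x] by linarith
      then have "ennreal a \<le> f x" by (rule ge[OF x(1), of "r - dist x p", rotated]) (use x in auto)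
      with ab(3) show ?thesis by (rule less_le_trans)
    qed
    then show "eventually (\<lambda>x. c < f x) (at p within Q)" unfolding eventually_at using r(1) by blast
  next
    fix p c assume p: "p \<in> Q" and c: "f p < c"
    obtain a b where ab: "0 \<le> a" "a < b" "f p < ennreal a" "ennreal b < c" using dn[OF c] by blast
    have "\<not> (\<exists>r>0. \<forall>y\<in>E. dist y p < r \<longrightarrow> ennreal a \<le> g y)"
    proof
      assume "\<exists>r>0. \<forall>y\<in>E. dist y p < r \<longrightarrow> ennreal a \<le> g y"
      then have "ennreal a \<le> f p" using ge[OF p] by blast
      then show False using ab(3) by simp
    qed
    then obtain r where r: "r > 0" "\<And>y. y \<in> E \<Longrightarrow> dist y p < r \<Longrightarrow> g y \<le> ennreal b" using alt[OF p ab(1,2)] by blast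
    have "f x < c" if x: "x \<in> Q" "dist x p < r" for x
    proof -
      have "g y \<le> ennreal b" if "y \<in> E" "dist y x < r - dist x p" for y
        using r(2)[OF that(1)] that(2) dist_triangle[of y p x] by linarith
      then have "f x \<le> ennreal b" by (rule le[OF x(1), of "r - dist x p", rotated]) (use x in auto)
      then show ?thesis using ab(4) by (rule le_less_trans)
    qed
    then show "eventually (\<lambda>x. f x < c) (at p within Q)" unfolding eventually_at using r(1) by blast
  qed
  then show ?thesis by (simp add: f_def[abs_def])
qed

theorem theorem5p2:
  fixes \<phi> :: "real \<times> real \<Rightarrow> 'a::metric_space" and \<psi> :: "'a \<Rightarrow> real \<times> real"
    and \<rho>k :: "nat \<Rightarrow> 'a \<Rightarrow> ennreal" and \<rho> :: "'a \<Rightarrow> ennreal"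
  assumes "(UNIV :: 'a set) homeomorphic (UNIV :: (real ^ 2) set)"
    and "locally_finite_hausdorff2 TYPE('a)"
    and "homeomorphism ({0..1} \<times> {0..1}) (quad \<phi>) \<phi> \<psi>"
    and "\<And>k. admissible (Gamma1 \<phi>) (\<rho>k k)"
    and "\<And>k. (\<integral>\<^sup>+x\<in>quad \<phi>. \<rho>k k x ^ 2 \<partial>hausdorff2_measure) < \<infinity>"
    and "\<rho> \<in> borel_measurable borel"
    and "\<And>x. x \<notin> quad \<phi> \<Longrightarrow> \<rho> x = 0"
    and "(\<integral>\<^sup>+x\<in>quad \<phi>. \<rho> x ^ 2 \<partial>hausdorff2_measure) < \<infinity>"
    and "L2_converges_on (quad \<phi>) \<rho>k \<rho>"
    and "(\<integral>\<^sup>+x\<in>quad \<phi>. \<rho> x ^ 2 \<partial>hausdorff2_measure) = modulus (Gamma1 \<phi>)"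
    and "modulus {\<gamma>. curve_in (quad \<phi>) \<gamma> \<and> \<not> integrals_converge \<rho>k \<rho> \<gamma> 0 1} = 0"
  shows "continuous_on (quad \<phi>) (harmonic_u \<phi> \<rho>k \<rho>)"
proof -
  have Qc: "compact (quad \<phi>)" by (rule quad_homeomorphismD(7)[OF assms(3)])
  have Qb: "quad \<phi> \<in> sets borel" using compact_imp_closed[OF Qc] by simp
  have fin: "hausdorff2 (quad \<phi>) < \<infinity>" by (rule hausdorff2_compact_finite[OF assms(2) Qc])
  obtain h where h: "h \<in> borel_measurable borel" "(\<integral>\<^sup>+x. (h x)\<^sup>2 \<partial>hausdorff2_measure) < \<infinity>"
    "\<And>\<gamma>. \<gamma> \<in> {\<gamma>. curve_in (quad \<phi>) \<gamma> \<and> \<not> integrals_converge \<rho>k \<rho> \<gamma> 0 1} \<Longrightarrow> rect_on \<gamma> 0 1 \<Longrightarrow> line_integral h \<gamma> 0 1 = \<infinity>"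
    by (rule modulus_zero_weight[OF assms(11)]) (rule that)
  define f where "f x = max 1 (max (\<rho> x) (h x))" for x
  note [measurable] = assms(6) h(1) Qb
  have fm: "f \<in> borel_measurable borel" unfolding f_def by measurable
  have "(\<integral>\<^sup>+x\<in>quad \<phi>. (f x)\<^sup>2 \<partial>hausdorff2_measure)
      \<le> (\<integral>\<^sup>+x. indicator (quad \<phi>) x + ((\<rho> x)\<^sup>2 * indicator (quad \<phi>) x + (h x)\<^sup>2) \<partial>hausdorff2_measure)"
  proof (rule nn_integral_mono)
    fix x
    have "(f x)\<^sup>2 \<le> 1 + ((\<rho> x)\<^sup>2 + (h x)\<^sup>2)" by (auto simp: f_def max_def intro: add_increasing add_increasing2)
    then show "(f x)\<^sup>2 * indicator (quad \<phi>) x \<le> indicator (quad \<phi>) x + ((\<rho> x)\<^sup>2 * indicator (quad \<phi>) x + (h x)\<^sup>2)"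
      by (auto split: split_indicator)
  qed
  also have "\<dots> = hausdorff2 (quad \<phi>) + ((\<integral>\<^sup>+x\<in>quad \<phi>. (\<rho> x)\<^sup>2 \<partial>hausdorff2_measure) + (\<integral>\<^sup>+x. (h x)\<^sup>2 \<partial>hausdorff2_measure))"
    by (simp add: nn_integral_add emeasure_hausdorff2_measure[OF Qb])
  also have "\<dots> < \<infinity>" using fin assms(8) h(2) by (simp add: less_top)
  finally have f2: "(\<integral>\<^sup>+x\<in>quad \<phi>. (f x)\<^sup>2 \<partial>hausdorff2_measure) < \<infinity>" .
  obtain H where H: "lsc H" "\<And>x. f x \<le> H x"
    "(\<integral>\<^sup>+x\<in>quad \<phi>. (H x)\<^sup>2 \<partial>hausdorff2_measure) \<le> (\<integral>\<^sup>+x\<in>quad \<phi>. (f x)\<^sup>2 \<partial>hausdorff2_measure) + ennreal 1"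
    by (rule lsc_majorant[OF Qb fin fm f2, of 1]) (simp, rule that)
  have Hf: "1 \<le> H x" "\<rho> x \<le> H x" "h x \<le> H x" for x using H(2)[of x] by (auto simp: f_def)
  have H2: "(\<integral>\<^sup>+x\<in>quad \<phi>. (H x)\<^sup>2 \<partial>hausdorff2_measure) < \<infinity>"
    by (rule le_less_trans[OF H(3)]) (use f2 in \<open>simp add: less_top\<close>)
  interpret minimizer \<phi> \<psi> \<rho>k \<rho> H
  proof unfold_locales
    fix \<gamma> assume \<gamma>: "rect_path (quad \<phi>) \<gamma>" "line_integral H \<gamma> 0 1 < \<infinity>"
    have mk: "\<And>k. \<rho>k k \<in> borel_measurable borel" using assms(4) by (simp add: admissible_def)
    show "good (quad \<phi>) \<rho>k \<rho> \<gamma>"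
      by (rule good_if_weight_finite[where h = h and w = H, OF mk assms(6) h(1) _ \<gamma>(1) Hf(3) \<gamma>(2)]) (use h(3) in blast)
  qed (fact assms fin H(1) Hf(1,2) H2)+
  have "continuous_on (quad \<phi>) (\<lambda>x. if x \<in> E_u \<phi> \<rho>k \<rho> then u_inf \<phi> \<rho>k \<rho> x else Liminf (at x within E_u \<phi> \<rho>k \<rho>) (u_inf \<phi> \<rho>k \<rho>))"
  proof (rule continuous_on_Liminf_extension)
    fix p and r :: real assume "p \<in> quad \<phi>" "r > 0"
    then show "\<exists>x\<in>E_u \<phi> \<rho>k \<rho>. dist x p < r" by (rule E_u_dense) blast
  next
    fix p a b y z
    assume "p \<in> quad \<phi>" "0 \<le> a" "a < b" "\<forall>n. y n \<in> E_u \<phi> \<rho>k \<rho>" "y \<longlonglongrightarrow> p" "\<forall>n. u_inf \<phi> \<rho>k \<rho> (y n) < ennreal a"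
      "\<forall>n. z n \<in> E_u \<phi> \<rho>k \<rho>" "z \<longlonglongrightarrow> p" "\<forall>n. ennreal b < u_inf \<phi> \<rho>k \<rho> (z n)"
    then show False by (intro no_oscillation[of p y a z b]) auto
  qed
  then show ?thesis by (simp add: harmonic_u_def[abs_def])
qed

end
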